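(* Consider a continuous action of a locally compact totally disconnected group $G$ on a simplicial set $\mathcal{X}_\bullet$ (extending to $|\mathcal{X}|$), where a closed central subgroup $A\le G$ acts trivially. Let $\mathbb{F}$ be any field. Then: (1) The class $\Sigma$ of morphisms $f$ in $\mathrm{Csh}_G(\mathcal{X}_\bullet)$ such that $\mathcal{H}(f)$ is an isomorphism admits a calculus of left fractions. (2) $\mathcal{H}[\Sigma^{-1}]:\mathrm{Csh}_G(\mathcal{X}_\bullet)[\Sigma^{-1}]\to\mathcal{M}(G)$ is conservative, i.e. a morphism $f$ is an isomorphism if and only if $\mathcal{H}[\Sigma^{-1}](f)$ is an isomorphism. (3) $\mathcal{H}[\Sigma^{-1}]$ commutes with colimits. (4) $\mathcal{H}[\Sigma^{-1}]$ is faithful, i.e. injective on morphisms. If $|\mathcal{X}|$ is connected, then moreover: (5) $\mathcal{H}[\Sigma^{-1}]:\mathrm{Csh}_G(\mathcal{X}_\bullet)[\Sigma^{-1}]\to\mathcal{M}(G)$ is an equivalence of categories. (6) $\mathcal{Q}_\Sigma\circ\mathcal{L}$ is a quasi-inverse of $\mathcal{H}[\Sigma^{-1}]$. (7) These equivalences restrict to equivalences $\mathrm{Csh}_{G,A}(\mathcal{X}_\bullet)[\Sigma_A^{-1}]\xrightarrow{\cong}\mathcal{M}_A(G)$ and $\mathrm{Csh}_{G,A,\chi}(\mathcal{X}_\bullet)[\Sigma_{A,\chi}^{-1}]\xrightarrow{\cong}\mathcal{M}_{A,\chi}(G)$ (for each $\chi\in\mathrm{Irr}(\mathbb{F}A)$),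 where $\Sigma_A$ and $\Sigma_{A,\chi}$ are the intersections of $\Sigma$ with the corresponding subcategories.
   Context: Representations. A representation of $G$ over the (discrete) field $\mathbb{F}$ is smooth if every vector is fixed by some compact open subgroup; $\mathcal{M}(G)$ is the abelian category of smooth representations. A simple $\mathbb{F}A$-module is given by a field extension $\widetilde{\mathbb{F}}\supseteq\mathbb{F}$ and a character $\chi:A\to\widetilde{\mathbb{F}}^\times$ such that $\chi(A)$ generates $\widetilde{\mathbb{F}}$ as an $\mathbb{F}$-algebra; it is denoted $\widetilde{\mathbb{F}}_\chi$, and $\mathrm{Irr}(\mathbb{F}A)$ is the set of such $\chi$. A representation is $A$-semisimple if it is semisimple over $\mathbb{F}A$, and $A$-semisimple with character $\chi$ if over $A$ it is a direct sum of copies of $\widetilde{\mathbb{F}}_\chi$. $\mathcal{M}_A(G)$, $\mathcal{M}_{A,\chi}(G)$ are the corresponding full subcategories of $\mathcal{M}(G)$. Actions on simplicial sets. $[n]=\{0,\dots,n\}$; $\partial^i:[n-1]\to[n]$ is the increasing map missing $i$; $\sigma^i:[n+1]\to[n]$ is the nondecreasing surjection taking the value $i$ twice; $\mathcal{X}(f):\mathcal{X}_n\to\mathcal{X}_m$ is the structure map of nondecreasing $f:[m]\to[n]$; $\mathcal{X}_{(n)}$ is the set of non-degenerate $n$-simplices. An action of $G$ on $\mathcal{X}_\bullet$ extending to $|\mathcal{X}|$ consists of actions of $G$ on all $\mathcal{X}_n$ and functions $R:G\times\mathcal{X}_n\to\mathrm{Sym}([n])$ such that for all $\mathbf{g},\mathbf{h}\in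 G$, $x\in\mathcal{X}_n$, $i\in[n]$: (a) $R(1,x)=1$, $R(\mathbf{g}\mathbf{h},x)=R(\mathbf{g},\mathbf{h}x)R(\mathbf{h},x)$; (b) with $\phi=R(\mathbf{g},x)$, $R(\mathbf{g},\mathcal{X}(\partial^i)x)$ is the unique permutation $\psi$ with $\phi\partial^i=\partial^{\phi(i)}\psi$, and $R(\mathbf{g},\mathcal{X}(\sigma^i)x)$ is the unique permutation $\psi$ with $\phi\sigma^i=\sigma^{\phi(i)}\psi$, $\psi(i)=\phi(i)$, $\psi(i+1)=\phi(i)+1$; (c) $\mathbf{g}\mathcal{X}(\partial^i)x=\mathcal{X}(\partial^{\phi(i)})\mathbf{g}x$ and $\mathbf{g}\mathcal{X}(\sigma^i)x=\mathcal{X}(\sigma^{\phi(i)})\mathbf{g}x$. For $f:[m]\to[n]$ and $x\in\mathcal{X}_n$ set $\mathbf{g}f:=R(\mathbf{g},x)\circ f\circ R(\mathbf{g},\mathcal{X}(f)x)^{-1}$; it is nondecreasing and $\mathbf{g}\mathcal{X}(f)x=\mathcal{X}(\mathbf{g}f)\mathbf{g}x$. The action is continuous if all stabilisers $G_x$ are open in $G$. Cosheaves. A cosheaf $\mathcal{C}$ on $\mathcal{X}_\bullet$ (homological coefficient system) assigns an $\mathbb{F}$-vector space $\mathcal{C}_x$ to each simplex $x$ and a linear map $\mathcal{C}(f,x):\mathcal{C}_x\to\mathcal{C}_{\mathcal{X}(f)x}$ to each $x\in\mathcal{X}_n$ and nondecreasing $f:[m]\to[n]$, with $\mathcal{C}(\mathrm{id},x)=\mathrm{id}$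 and $\mathcal{C}(h,\mathcal{X}(f)x)\circ\mathcal{C}(f,x)=\mathcal{C}(f\circ h,x)$. An equivariant cosheaf is a cosheaf with linear maps $\mathbf{g}_x:\mathcal{C}_x\to\mathcal{C}_{\mathbf{g}x}$ ($\mathbf{g}\in G$) such that (i) $\mathbf{g}_{\mathbf{h}x}\circ\mathbf{h}_x=(\mathbf{g}\mathbf{h})_x$; (ii) $\mathcal{C}_x$ is a smooth representation of $G_x$; (iii) $\mathbf{g}_{\mathcal{X}(f)x}\circ\mathcal{C}(f,x)=\mathcal{C}(\mathbf{g}f,\mathbf{g}x)\circ\mathbf{g}_x$. Morphisms are families of linear maps $\psi_x:\mathcal{C}_x\to\mathcal{D}_x$ commuting with the maps $\mathcal{C}(f,x)$ and $\mathbf{g}_x$. This gives the abelian category $\mathrm{Csh}_G(\mathcal{X}_\bullet)$; $\mathrm{Csh}_{G,A}(\mathcal{X}_\bullet)$ and $\mathrm{Csh}_{G,A,\chi}(\mathcal{X}_\bullet)$ are the full subcategories where every $\mathcal{C}_x$ is $A$-semisimple, respectively $A$-semisimple with character $\chi$. Homology and localisation. $C^\sharp_n(\mathcal{X}_\bullet,\mathcal{C})$ is the space of finitely supported formal sums $\sum_{x\in\mathcal{X}_n}\alpha_x x$, $\alpha_x\in\mathcal{C}_x$, with $d_n(\alpha x)=\sum_{i=0}^n(-1)^i\,\mathcal{C}(\partial^i,x)(\alpha)\,\mathcal{X}(\partial^i)(x)$ for $n>0$ and $d_0=0$; $C^\flat_\bullet$ is the subcomplex spanned by the degenerate simplices,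 and $C_\bullet(\mathcal{X}_\bullet,\mathcal{C})=C^\sharp_\bullet/C^\flat_\bullet$, with homology $H_n(\mathcal{X}_\bullet,\mathcal{C})$. $G$ acts by $\mathbf{g}\cdot(\alpha x)=\mathrm{sgn}(R(\mathbf{g},x))\,\mathbf{g}_x(\alpha)\,(\mathbf{g}\cdot x)$. The functor $\mathcal{H}:\mathrm{Csh}_G(\mathcal{X}_\bullet)\to\mathcal{M}(G)$ is $\mathcal{H}(\mathcal{C})=H_0(\mathcal{X}_\bullet,\mathcal{C})$. The functor $\mathcal{L}:\mathcal{M}(G)\to\mathrm{Csh}_G(\mathcal{X}_\bullet)$ sends $(\rho,V)$ to the trivial cosheaf with all $\mathcal{C}_x=V$, all $\mathcal{C}(f,x)=\mathrm{Id}_V$ and $\mathbf{g}_x=\rho(\mathbf{g})$. $\mathcal{Q}_\Sigma:\mathrm{Csh}_G(\mathcal{X}_\bullet)\to\mathrm{Csh}_G(\mathcal{X}_\bullet)[\Sigma^{-1}]$ is the canonical functor to the category of fractions and $\mathcal{H}[\Sigma^{-1}]$ is the functor induced by $\mathcal{H}$ on it. *)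

theory Defs
  imports "HOL-Combinatorics.Permutations" "HOL-Analysis.Analysis" "HOL-Homology.Simplices"
    "HOL-Algebra.Algebra"
begin

section \<open>Categories, functors, categories of fractions\<close>

record ('o, 'a) cat =
  obj :: "'o set"
  arr :: "'a set"
  src :: "'a \<Rightarrow> 'o"
  tgt :: "'a \<Rightarrow> 'o"
  ident :: "'o \<Rightarrow> 'a"
  cmp :: "'a \<Rightarrow> 'a \<Rightarrow> 'a"  \<comment> \<open>\<open>cmp C g f\<close> is \<open>g\<close> after \<open>f\<close>\<close>

definition category :: "('o, 'a) cat \<Rightarrow> bool" where
  "category C \<longleftrightarrow>
     (\<forall>f\<in>arr C. src C f \<in> obj C \<and> tgt C f \<in> obj C) \<and>
     (\<forall>x\<in>obj C. ident C x \<in> arr C \<and> src C (ident C x) = x \<and> tgt C (ident C x) = x) \<and>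
     (\<forall>f\<in>arr C. \<forall>g\<in>arr C. tgt C f = src C g \<longrightarrow>
        cmp C g f \<in> arr C \<and> src C (cmp C g f) = src C f \<and> tgt C (cmp C g f) = tgt C g) \<and>
     (\<forall>f\<in>arr C. cmp C f (ident C (src C f)) = f \<and> cmp C (ident C (tgt C f)) f = f) \<and>
     (\<forall>f\<in>arr C. \<forall>g\<in>arr C. \<forall>h\<in>arr C. tgt C f = src C g \<longrightarrow> tgt C g = src C h \<longrightarrow>
        cmp C h (cmp C g f) = cmp C (cmp C h g) f)"

definition full_subcat :: "('o, 'a) cat \<Rightarrow> ('o \<Rightarrow> bool) \<Rightarrow> ('o, 'a) cat" where
  "full_subcat C P = C\<lparr>obj := {x \<in> obj C. P x}, arr := {f \<in> arr C. P (src C f) \<and> P (tgt C f)}\<rparr>"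

definition inverse_arrows :: "('o, 'a) cat \<Rightarrow> 'a \<Rightarrow> 'a \<Rightarrow> bool" where
  "inverse_arrows C f g \<longleftrightarrow> f \<in> arr C \<and> g \<in> arr C \<and> src C g = tgt C f \<and> tgt C g = src C f \<and>
     cmp C g f = ident C (src C f) \<and> cmp C f g = ident C (tgt C f)"

definition iso_arr :: "('o, 'a) cat \<Rightarrow> 'a \<Rightarrow> bool" where
  "iso_arr C f \<longleftrightarrow> (\<exists>g. inverse_arrows C f g)"

definition inv_arr :: "('o, 'a) cat \<Rightarrow> 'a \<Rightarrow> 'a" where
  "inv_arr C f = (SOME g. inverse_arrows C f g)"

record ('o, 'a, 'p, 'b) functr =
  omap :: "'o \<Rightarrow> 'p"
  amap :: "'a \<Rightarrow> 'b"

definition is_functor :: "('o, 'a) cat \<Rightarrow> ('p, 'b) cat \<Rightarrow> ('o, 'a, 'p, 'b) functr \<Rightarrow> bool" where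
  "is_functor C D \<Phi> \<longleftrightarrow> category C \<and> category D \<and>
     (\<forall>x\<in>obj C. omap \<Phi> x \<in> obj D) \<and>
     (\<forall>f\<in>arr C. amap \<Phi> f \<in> arr D \<and>
        src D (amap \<Phi> f) = omap \<Phi> (src C f) \<and> tgt D (amap \<Phi> f) = omap \<Phi> (tgt C f)) \<and>
     (\<forall>x\<in>obj C. amap \<Phi> (ident C x) = ident D (omap \<Phi> x)) \<and>
     (\<forall>f\<in>arr C. \<forall>g\<in>arr C. tgt C f = src C g \<longrightarrow>
        amap \<Phi> (cmp C g f) = cmp D (amap \<Phi> g) (amap \<Phi> f))"

definition id_functor :: "('o, 'a, 'o, 'a) functr" where
  "id_functor = \<lparr>omap = (\<lambda>x. x), amap = (\<lambda>f. f)\<rparr>"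

definition comp_functor ::
    "('p, 'b, 'q, 'c) functr \<Rightarrow> ('o, 'a, 'p, 'b) functr \<Rightarrow> ('o, 'a, 'q, 'c) functr"
    (infixr "\<circ>\<^sub>F" 55) where
  "\<Psi> \<circ>\<^sub>F \<Phi> = \<lparr>omap = omap \<Psi> \<circ> omap \<Phi>, amap = amap \<Psi> \<circ> amap \<Phi>\<rparr>"

definition naturally_isomorphic ::
    "('o, 'a) cat \<Rightarrow> ('p, 'b) cat \<Rightarrow> ('o, 'a, 'p, 'b) functr \<Rightarrow> ('o, 'a, 'p, 'b) functr \<Rightarrow> bool" where
  "naturally_isomorphic C D \<Phi> \<Psi> \<longleftrightarrow> (\<exists>\<tau>.
     (\<forall>x\<in>obj C. iso_arr D (\<tau> x) \<and> src D (\<tau> x) = omap \<Phi> x \<and> tgt D (\<tau> x) = omap \<Psi> x) \<and>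
     (\<forall>f\<in>arr C. cmp D (\<tau> (tgt C f)) (amap \<Phi> f) = cmp D (amap \<Psi> f) (\<tau> (src C f))))"

definition quasi_inverse ::
    "('o, 'a) cat \<Rightarrow> ('p, 'b) cat \<Rightarrow> ('o, 'a, 'p, 'b) functr \<Rightarrow> ('p, 'b, 'o, 'a) functr \<Rightarrow> bool" where
  "quasi_inverse C D \<Phi> \<Psi> \<longleftrightarrow> is_functor C D \<Phi> \<and> is_functor D C \<Psi> \<and>
     naturally_isomorphic C C (\<Psi> \<circ>\<^sub>F \<Phi>) id_functor \<and>
     naturally_isomorphic D D (\<Phi> \<circ>\<^sub>F \<Psi>) id_functor"

definition equivalence_of_categories ::
    "('o, 'a) cat \<Rightarrow> ('p, 'b) cat \<Rightarrow> ('o, 'a, 'p, 'b) functr \<Rightarrow> bool" where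
  "equivalence_of_categories C D \<Phi> \<longleftrightarrow> (\<exists>\<Psi>. quasi_inverse C D \<Phi> \<Psi>)"

definition conservative :: "('o, 'a) cat \<Rightarrow> ('p, 'b) cat \<Rightarrow> ('o, 'a, 'p, 'b) functr \<Rightarrow> bool" where
  "conservative C D \<Phi> \<longleftrightarrow> is_functor C D \<Phi> \<and> (\<forall>f\<in>arr C. iso_arr C f \<longleftrightarrow> iso_arr D (amap \<Phi> f))"

definition faithful :: "('o, 'a) cat \<Rightarrow> ('p, 'b) cat \<Rightarrow> ('o, 'a, 'p, 'b) functr \<Rightarrow> bool" where
  "faithful C D \<Phi> \<longleftrightarrow> is_functor C D \<Phi> \<and>
     (\<forall>f\<in>arr C. \<forall>g\<in>arr C. src C f = src C g \<longrightarrow> tgt C f = tgt C g \<longrightarrow>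
        amap \<Phi> f = amap \<Phi> g \<longrightarrow> f = g)"

definition cocone ::
    "('o, 'a) cat \<Rightarrow> ('j, 'k) cat \<Rightarrow> ('j, 'k, 'o, 'a) functr \<Rightarrow> 'o \<Rightarrow> ('j \<Rightarrow> 'a) \<Rightarrow> bool" where
  "cocone C J D c t \<longleftrightarrow> is_functor J C D \<and> c \<in> obj C \<and>
     (\<forall>j\<in>obj J. t j \<in> arr C \<and> src C (t j) = omap D j \<and> tgt C (t j) = c) \<and>
     (\<forall>k\<in>arr J. cmp C (t (tgt J k)) (amap D k) = t (src J k))"

definition colimit ::
    "('o, 'a) cat \<Rightarrow> ('j, 'k) cat \<Rightarrow> ('j, 'k, 'o, 'a) functr \<Rightarrow> 'o \<Rightarrow> ('j \<Rightarrow> 'a) \<Rightarrow> bool" where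
  "colimit C J D c t \<longleftrightarrow> cocone C J D c t \<and>
     (\<forall>c' t'. cocone C J D c' t' \<longrightarrow>
        (\<exists>!u. u \<in> arr C \<and> src C u = c \<and> tgt C u = c' \<and> (\<forall>j\<in>obj J. cmp C u (t j) = t' j)))"

text \<open>Calculus of left fractions in the sense of Gabriel and Zisman.\<close>

definition left_calculus_of_fractions :: "('o, 'a) cat \<Rightarrow> 'a set \<Rightarrow> bool" where
  "left_calculus_of_fractions C S \<longleftrightarrow> category C \<and> S \<subseteq> arr C \<and>
     (\<forall>x\<in>obj C. ident C x \<in> S) \<and>
     (\<forall>s\<in>S. \<forall>s'\<in>S. tgt C s = src C s' \<longrightarrow> cmp C s' s \<in> S) \<and>
     (\<forall>s\<in>S. \<forall>u\<in>arr C. src C u = src C s \<longrightarrow>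
        (\<exists>s'\<in>S. \<exists>u'\<in>arr C. src C u' = tgt C s \<and> src C s' = tgt C u \<and> tgt C u' = tgt C s' \<and>
           cmp C u' s = cmp C s' u)) \<and>
     (\<forall>f\<in>arr C. \<forall>g\<in>arr C. \<forall>s\<in>S. src C f = src C g \<longrightarrow> tgt C f = tgt C g \<longrightarrow> tgt C s = src C f \<longrightarrow>
        cmp C f s = cmp C g s \<longrightarrow> (\<exists>t\<in>S. src C t = tgt C f \<and> cmp C t f = cmp C t g))"

text \<open>
  The category of fractions for an arbitrary set \<open>S\<close> of arrows, with the same objects:
  arrows are zigzags of arrows of \<open>C\<close> and formal inverses of arrows in \<open>S\<close>
  (listed in the order in which they are traversed), modulo the congruence generated by the
  relations of \<open>C\<close> and the cancellation of \<open>s\<close> against its formal inverse.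
\<close>

datatype 'a step = Fwd 'a | Bwd 'a

fun zigzag :: "('o, 'a) cat \<Rightarrow> 'a set \<Rightarrow> 'o \<Rightarrow> 'a step list \<Rightarrow> 'o \<Rightarrow> bool" where
  "zigzag C S x [] y \<longleftrightarrow> x \<in> obj C \<and> x = y"
| "zigzag C S x (Fwd f # p) y \<longleftrightarrow> f \<in> arr C \<and> src C f = x \<and> zigzag C S (tgt C f) p y"
| "zigzag C S x (Bwd s # p) y \<longleftrightarrow> s \<in> S \<and> tgt C s = x \<and> zigzag C S (src C s) p y"

inductive zz_reduce :: "('o, 'a) cat \<Rightarrow> 'a set \<Rightarrow> 'o \<Rightarrow> 'o \<Rightarrow> 'a step list \<Rightarrow> 'a step list \<Rightarrow> bool"
  for C S x y where
  ident: "z \<in> obj C \<Longrightarrow> zigzag C S x (p @ Fwd (ident C z) # q) y \<Longrightarrow>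
     zz_reduce C S x y (p @ Fwd (ident C z) # q) (p @ q)"
| cmp: "zigzag C S x (p @ Fwd f # Fwd g # q) y \<Longrightarrow>
     zz_reduce C S x y (p @ Fwd f # Fwd g # q) (p @ Fwd (cmp C g f) # q)"
| fwd_bwd: "s \<in> S \<Longrightarrow> zigzag C S x (p @ Fwd s # Bwd s # q) y \<Longrightarrow>
     zz_reduce C S x y (p @ Fwd s # Bwd s # q) (p @ q)"
| bwd_fwd: "s \<in> S \<Longrightarrow> zigzag C S x (p @ Bwd s # Fwd s # q) y \<Longrightarrow>
     zz_reduce C S x y (p @ Bwd s # Fwd s # q) (p @ q)"

definition zz_class :: "('o, 'a) cat \<Rightarrow> 'a set \<Rightarrow> 'o \<Rightarrow> 'a step list \<Rightarrow> 'o \<Rightarrow> 'a step list set" where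
  "zz_class C S x p y = {q. zigzag C S x q y \<and> equivclp (zz_reduce C S x y) p q}"

type_synonym ('o, 'a) frac = "'o \<times> 'a step list set \<times> 'o"

definition fractions :: "('o, 'a) cat \<Rightarrow> 'a set \<Rightarrow> ('o, ('o, 'a) frac) cat" where
  "fractions C S =
     \<lparr>obj = obj C,
      arr = {(x, zz_class C S x p y, y) | x p y. zigzag C S x p y},
      src = (\<lambda>(x, c, y). x),
      tgt = (\<lambda>(x, c, y). y),
      ident = (\<lambda>x. (x, zz_class C S x [] x, x)),
      cmp = (\<lambda>(y', d, z) (x, c, y). (x, zz_class C S x ((SOME p. p \<in> c) @ (SOME q. q \<in> d)) z, z))\<rparr>"

text \<open>The canonical functor from \<open>C\<close> to its category of fractions.\<close>

definition frac_functor :: "('o, 'a) cat \<Rightarrow> 'a set \<Rightarrow> ('o, 'a, 'o, ('o, 'a) frac) functr" where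
  "frac_functor C S =
     \<lparr>omap = (\<lambda>x. x), amap = (\<lambda>f. (src C f, zz_class C S (src C f) [Fwd f] (tgt C f), tgt C f))\<rparr>"

primrec zz_val :: "('p, 'b) cat \<Rightarrow> ('a \<Rightarrow> 'b) \<Rightarrow> 'b \<Rightarrow> 'a step list \<Rightarrow> 'b" where
  "zz_val D \<phi> e [] = e"
| "zz_val D \<phi> e (s # p) =
     zz_val D \<phi> (cmp D (case s of Fwd f \<Rightarrow> \<phi> f | Bwd f \<Rightarrow> inv_arr D (\<phi> f)) e) p"

text \<open>
  The functor from a category of fractions to \<open>D\<close> that is induced by a functor \<open>\<Phi>\<close> to \<open>D\<close>
  inverting the arrows in question.
\<close>

definition frac_induced ::
    "('p, 'b) cat \<Rightarrow> ('o, 'a, 'p, 'b) functr \<Rightarrow> ('o, ('o, 'a) frac, 'p, 'b) functr" where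
  "frac_induced D \<Phi> =
     \<lparr>omap = omap \<Phi>,
      amap = (\<lambda>(x, c, y). zz_val D (amap \<Phi>) (ident D (omap \<Phi> x)) (SOME p. p \<in> c))\<rparr>"

definition inverted_arrows :: "('o, 'a) cat \<Rightarrow> ('p, 'b) cat \<Rightarrow> ('o, 'a, 'p, 'b) functr \<Rightarrow> 'a set" where
  "inverted_arrows C D \<Phi> = {f \<in> arr C. iso_arr D (amap \<Phi> f)}"

text \<open>
  The equivalence between \<open>fractions C S\<close> and \<open>D\<close> given by \<open>frac_induced D \<Phi>\<close> and
  \<open>frac_functor C S \<circ>\<^sub>F \<Psi>\<close> restricts to an equivalence between the categories obtained from the
  full subcategories \<open>{x. P x}\<close> of \<open>C\<close> and \<open>{y. R y}\<close> of \<open>D\<close>. Here \<open>I\<close> is the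
  functor between the categories of fractions that is induced by the inclusion of the subcategory.
\<close>

definition equivalence_restricts ::
    "('o, 'a) cat \<Rightarrow> 'a set \<Rightarrow> ('p, 'b) cat \<Rightarrow> ('o, 'a, 'p, 'b) functr \<Rightarrow> ('p, 'b, 'o, 'a) functr \<Rightarrow>
     ('o \<Rightarrow> bool) \<Rightarrow> ('p \<Rightarrow> bool) \<Rightarrow> bool" where
  "equivalence_restricts C S D \<Phi> \<Psi> P R \<longleftrightarrow>
     (let C' = full_subcat C P; D' = full_subcat D R; S' = S \<inter> arr C';
          I = frac_induced (fractions C S) (frac_functor C S);
          \<Phi>' = frac_induced D' \<Phi>; \<Psi>' = frac_functor C' S' \<circ>\<^sub>F \<Psi>
      in equivalence_of_categories (fractions C' S') D' \<Phi>' \<and>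
         quasi_inverse (fractions C' S') D' \<Phi>' \<Psi>' \<and>
         is_functor (fractions C' S') (fractions C S) I \<and>
         (\<forall>f\<in>arr (fractions C' S'). amap \<Phi>' f = amap (frac_induced D \<Phi>) (amap I f)) \<and>
         (\<forall>f\<in>arr D'. amap I (amap \<Psi>' f) = amap (frac_functor C S \<circ>\<^sub>F \<Psi>) f))"


section \<open>Linear algebra\<close>

text \<open>
  Vector spaces over \<open>F\<close> are HOL-Algebra modules; the components \<open>mult\<close> and \<open>one\<close>
  that the record type \<open>module\<close> inherits from \<open>ring\<close> play no role.
\<close>

definition lin_maps :: "'f ring \<Rightarrow> ('f, 'u) module \<Rightarrow> ('f, 'v) module \<Rightarrow> ('u \<Rightarrow> 'v) set" where
  "lin_maps F V W = {f \<in> carrier V \<rightarrow> carrier W.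
     (\<forall>u\<in>carrier V. \<forall>v\<in>carrier V. f (u \<oplus>\<^bsub>V\<^esub> v) = f u \<oplus>\<^bsub>W\<^esub> f v) \<and>
     (\<forall>k\<in>carrier F. \<forall>v\<in>carrier V. f (k \<odot>\<^bsub>V\<^esub> v) = k \<odot>\<^bsub>W\<^esub> f v)}"

definition quot_mod :: "('f, 'u) module \<Rightarrow> 'u set \<Rightarrow> ('f, 'u set) module" where
  "quot_mod V N =
     \<lparr>carrier = a_rcosets\<^bsub>V\<^esub> N, monoid.mult = undefined, one = undefined, zero = N, add = set_add V,
      smult = (\<lambda>k Y. N <+>\<^bsub>V\<^esub> (\<lambda>v. k \<odot>\<^bsub>V\<^esub> v) ` Y)\<rparr>"

text \<open>The map into the quotient of \<open>W\<close> by \<open>N\<close>, on cosets, that is induced by \<open>f\<close>.\<close>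

definition quot_map :: "('f, 'v) module \<Rightarrow> 'v set \<Rightarrow> ('u \<Rightarrow> 'v) \<Rightarrow> 'u set \<Rightarrow> 'v set" where
  "quot_map W N f Y = N <+>\<^bsub>W\<^esub> f ` Y"

text \<open>Direct sum of the family \<open>V x\<close>, \<open>x \<in> I\<close>, as finitely supported families.\<close>

definition direct_sum :: "'x set \<Rightarrow> ('x \<Rightarrow> ('f, 'u) module) \<Rightarrow> ('f, 'x \<Rightarrow> 'u) module" where
  "direct_sum I V =
     \<lparr>carrier = {c \<in> (\<Pi>\<^sub>E x\<in>I. carrier (V x)). finite {x\<in>I. c x \<noteq> \<zero>\<^bsub>V x\<^esub>}},
      monoid.mult = undefined, one = undefined,
      zero = (\<lambda>x\<in>I. \<zero>\<^bsub>V x\<^esub>),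
      add = (\<lambda>c d. \<lambda>x\<in>I. c x \<oplus>\<^bsub>V x\<^esub> d x),
      smult = (\<lambda>k c. \<lambda>x\<in>I. k \<odot>\<^bsub>V x\<^esub> c x)\<rparr>"

definition internal_direct_sum :: "('f, 'u) module \<Rightarrow> 'u set set \<Rightarrow> bool" where
  "internal_direct_sum V \<W> \<longleftrightarrow> (\<forall>v\<in>carrier V. \<exists>!c. c \<in> (\<Pi>\<^sub>E W\<in>\<W>. W) \<and>
     finite {W\<in>\<W>. c W \<noteq> \<zero>\<^bsub>V\<^esub>} \<and> v = finsum V c {W\<in>\<W>. c W \<noteq> \<zero>\<^bsub>V\<^esub>})"


section \<open>Representations\<close>

definition tdlc_group :: "'g monoid \<Rightarrow> 'g topology \<Rightarrow> bool" where
  "tdlc_group G T \<longleftrightarrow> group G \<and> topspace T = carrier G \<and>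
     continuous_map (prod_topology T T) T (\<lambda>(g, h). g \<otimes>\<^bsub>G\<^esub> h) \<and>
     continuous_map T T (\<lambda>g. inv\<^bsub>G\<^esub> g) \<and>
     locally_compact_space T \<and>
     (\<forall>Y. connectedin T Y \<longrightarrow> (\<exists>y. Y \<subseteq> {y}))"

record ('f, 'u, 'g) rep =
  rspace :: "('f, 'u) module"
  ract :: "'g \<Rightarrow> 'u \<Rightarrow> 'u"

definition smooth_rep :: "'f ring \<Rightarrow> 'g monoid \<Rightarrow> 'g topology \<Rightarrow> ('f, 'u, 'g) rep \<Rightarrow> bool" where
  "smooth_rep F G T V \<longleftrightarrow> Module.module F (rspace V) \<and>
     (\<forall>g\<in>carrier G. ract V g \<in> lin_maps F (rspace V) (rspace V)) \<and>
     (\<forall>v\<in>carrier (rspace V). ract V \<one>\<^bsub>G\<^esub> v = v) \<and>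
     (\<forall>g\<in>carrier G. \<forall>h\<in>carrier G. \<forall>v\<in>carrier (rspace V).
        ract V (g \<otimes>\<^bsub>G\<^esub> h) v = ract V g (ract V h v)) \<and>
     (\<forall>v\<in>carrier (rspace V). \<exists>K. subgroup K G \<and> openin T K \<and> compactin T K \<and>
        (\<forall>g\<in>K. ract V g v = v))"

text \<open>
  Morphisms are stored together with domain and codomain; the underlying functions are
  extensional so that equality of morphisms is equality on the carrier.
\<close>

type_synonym ('f, 'u, 'g) rep_arr = "('f, 'u, 'g) rep \<times> ('u \<Rightarrow> 'u) \<times> ('f, 'u, 'g) rep"
type_synonym ('f, 'u, 'g) rep_cat = "(('f, 'u, 'g) rep, ('f, 'u, 'g) rep_arr) cat"

definition rep_maps ::
    "'f ring \<Rightarrow> 'g monoid \<Rightarrow> ('f, 'u, 'g) rep \<Rightarrow> ('f, 'u, 'g) rep \<Rightarrow> ('u \<Rightarrow> 'u) set" where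
  "rep_maps F G V W = {f \<in> lin_maps F (rspace V) (rspace W) \<inter> extensional (carrier (rspace V)).
     \<forall>g\<in>carrier G. \<forall>v\<in>carrier (rspace V). f (ract V g v) = ract W g (f v)}"

definition SmoothRep :: "'f ring \<Rightarrow> 'g monoid \<Rightarrow> 'g topology \<Rightarrow> ('f, 'u, 'g) rep_cat" where
  "SmoothRep F G T =
     \<lparr>obj = {V. smooth_rep F G T V},
      arr = {(V, f, W). smooth_rep F G T V \<and> smooth_rep F G T W \<and> f \<in> rep_maps F G V W},
      src = (\<lambda>(V, f, W). V),
      tgt = (\<lambda>(V, f, W). W),
      ident = (\<lambda>V. (V, (\<lambda>v\<in>carrier (rspace V). v), V)),
      cmp = (\<lambda>(V', g, W) (U, f, V). (U, compose (carrier (rspace U)) g f, W))\<rparr>"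

text \<open>In the following three definitions \<open>\<rho>\<close> is an action of the group \<open>A\<close> on \<open>V\<close>.\<close>

definition stable_submod ::
    "'f ring \<Rightarrow> 'g set \<Rightarrow> ('f, 'u) module \<Rightarrow> ('g \<Rightarrow> 'u \<Rightarrow> 'u) \<Rightarrow> 'u set \<Rightarrow> bool" where
  "stable_submod F A V \<rho> W \<longleftrightarrow> submodule W F V \<and> (\<forall>a\<in>A. \<forall>w\<in>W. \<rho> a w \<in> W)"

definition simple_submod ::
    "'f ring \<Rightarrow> 'g set \<Rightarrow> ('f, 'u) module \<Rightarrow> ('g \<Rightarrow> 'u \<Rightarrow> 'u) \<Rightarrow> 'u set \<Rightarrow> bool" where
  "simple_submod F A V \<rho> W \<longleftrightarrow> stable_submod F A V \<rho> W \<and> W \<noteq> {\<zero>\<^bsub>V\<^esub>} \<and>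
     (\<forall>W'. stable_submod F A V \<rho> W' \<longrightarrow> W' \<subseteq> W \<longrightarrow> W' = {\<zero>\<^bsub>V\<^esub>} \<or> W' = W)"

definition A_semisimple ::
    "'f ring \<Rightarrow> 'g set \<Rightarrow> ('f, 'u) module \<Rightarrow> ('g \<Rightarrow> 'u \<Rightarrow> 'u) \<Rightarrow> bool" where
  "A_semisimple F A V \<rho> \<longleftrightarrow>
     (\<exists>\<W>. (\<forall>W\<in>\<W>. simple_submod F A V \<rho> W) \<and> internal_direct_sum V \<W>)"

text \<open>
  A point of \<open>Irr(FA)\<close>: a field extension \<open>\<iota> : F \<rightarrow> E\<close> together with a character
  \<open>chi\<close> of \<open>A\<close> whose values generate \<open>E\<close> as an \<open>F\<close>-algebra.
\<close>

definition irr_character ::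
    "'f ring \<Rightarrow> 'g monoid \<Rightarrow> 'g set \<Rightarrow> 'e ring \<Rightarrow> ('f \<Rightarrow> 'e) \<Rightarrow> ('g \<Rightarrow> 'e) \<Rightarrow> bool" where
  "irr_character F G A E \<iota> chi \<longleftrightarrow> field E \<and> \<iota> \<in> ring_hom F E \<and>
     chi \<in> hom (G\<lparr>carrier := A\<rparr>) (units_of E) \<and>
     generate_ring E (\<iota> ` carrier F \<union> chi ` A) = carrier E"

definition A_semisimple_with_character ::
    "'f ring \<Rightarrow> 'g set \<Rightarrow> 'e ring \<Rightarrow> ('f \<Rightarrow> 'e) \<Rightarrow> ('g \<Rightarrow> 'e) \<Rightarrow>
     ('f, 'u) module \<Rightarrow> ('g \<Rightarrow> 'u \<Rightarrow> 'u) \<Rightarrow> bool" where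
  "A_semisimple_with_character F A E \<iota> chi V \<rho> \<longleftrightarrow>
     (\<exists>\<W>. internal_direct_sum V \<W> \<and>
       (\<forall>W\<in>\<W>. stable_submod F A V \<rho> W \<and>
         (\<exists>\<theta>. bij_betw \<theta> (carrier E) W \<and>
            (\<forall>x\<in>carrier E. \<forall>y\<in>carrier E. \<theta> (x \<oplus>\<^bsub>E\<^esub> y) = \<theta> x \<oplus>\<^bsub>V\<^esub> \<theta> y) \<and>
            (\<forall>k\<in>carrier F. \<forall>x\<in>carrier E. \<theta> (\<iota> k \<otimes>\<^bsub>E\<^esub> x) = k \<odot>\<^bsub>V\<^esub> \<theta> x) \<and>
            (\<forall>a\<in>A. \<forall>x\<in>carrier E. \<theta> (chi a \<otimes>\<^bsub>E\<^esub> x) = \<rho> a (\<theta> x)))))"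


section \<open>Simplicial sets\<close>

text \<open>
  \<open>[n]\<close> is \<open>{..n}\<close>, and a nondecreasing map \<open>[m] \<rightarrow> [n]\<close> is a function on the naturals that
  is extensional on \<open>{..m}\<close>. The sets \<open>splx Xs n\<close> need not be disjoint; accordingly
  everything indexed by simplices carries the dimension as an additional index.
\<close>

definition delta_maps :: "nat \<Rightarrow> nat \<Rightarrow> (nat \<Rightarrow> nat) set" where
  "delta_maps m n = {f \<in> {..m} \<rightarrow>\<^sub>E {..n}. mono_on {..m} f}"

definition coface :: "nat \<Rightarrow> nat \<Rightarrow> nat \<Rightarrow> nat" where  \<comment> \<open>\<open>[n] \<rightarrow> [n+1]\<close> missing \<open>i\<close>\<close>
  "coface n i = (\<lambda>j\<in>{..n}. if j < i then j else Suc j)"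

definition codegen :: "nat \<Rightarrow> nat \<Rightarrow> nat \<Rightarrow> nat" where  \<comment> \<open>\<open>[n+1] \<rightarrow> [n]\<close> taking the value \<open>i\<close> twice\<close>
  "codegen n i = (\<lambda>j\<in>{..Suc n}. if j \<le> i then j else j - 1)"

record 'x sset =
  splx :: "nat \<Rightarrow> 'x set"
  struct_map :: "nat \<Rightarrow> nat \<Rightarrow> (nat \<Rightarrow> nat) \<Rightarrow> 'x \<Rightarrow> 'x"
    \<comment> \<open>\<open>struct_map Xs m n f\<close> is the structure map \<open>splx Xs n \<rightarrow> splx Xs m\<close> of \<open>f : [m] \<rightarrow> [n]\<close>\<close>

definition simplicial_set :: "('x, 'z) sset_scheme \<Rightarrow> bool" where
  "simplicial_set Xs \<longleftrightarrow>
     (\<forall>m n. \<forall>f\<in>delta_maps m n. struct_map Xs m n f \<in> splx Xs n \<rightarrow> splx Xs m) \<and>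
     (\<forall>n. \<forall>x\<in>splx Xs n. struct_map Xs n n (\<lambda>i\<in>{..n}. i) x = x) \<and>
     (\<forall>k m n. \<forall>h\<in>delta_maps k m. \<forall>f\<in>delta_maps m n. \<forall>x\<in>splx Xs n.
        struct_map Xs k n (compose {..k} f h) x = struct_map Xs k m h (struct_map Xs m n f x))"

definition degenerate :: "('x, 'z) sset_scheme \<Rightarrow> nat \<Rightarrow> 'x \<Rightarrow> bool" where
  "degenerate Xs n x \<longleftrightarrow> (\<exists>m i y. n = Suc m \<and> i \<le> m \<and> y \<in> splx Xs m \<and> x = struct_map Xs (Suc m) m (codegen m i) y)"

text \<open>Geometric realisation: the quotient of the disjoint union of the simplices
  \<open>{x} \<times> \<Delta>\<^sup>n\<close> by the relation generated by \<open>(f\<^sup>* x, t) \<sim> (x, f\<^sub>* t)\<close>, where \<open>f\<^sup>*\<close> is the structure map of \<open>f\<close>.\<close>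

definition simplex_push :: "nat \<Rightarrow> (nat \<Rightarrow> nat) \<Rightarrow> (nat \<Rightarrow> real) \<Rightarrow> nat \<Rightarrow> real" where
  "simplex_push m f t = (\<lambda>i. \<Sum>j | j \<le> m \<and> f j = i. t j)"

inductive glue :: "('x, 'z) sset_scheme \<Rightarrow>
    (nat \<times> 'x) \<times> (nat \<Rightarrow> real) \<Rightarrow> (nat \<times> 'x) \<times> (nat \<Rightarrow> real) \<Rightarrow> bool" for Xs where
  "x \<in> splx Xs n \<Longrightarrow> f \<in> delta_maps m n \<Longrightarrow> t \<in> standard_simplex m \<Longrightarrow>
     glue Xs ((m, struct_map Xs m n f x), t) ((n, x), simplex_push m f t)"

definition quotient_space :: "'a topology \<Rightarrow> ('a \<Rightarrow> 'b) \<Rightarrow> 'b topology" where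
  "quotient_space T q = topology (\<lambda>U. U \<subseteq> q ` topspace T \<and> openin T {p \<in> topspace T. q p \<in> U})"

definition realization :: "('x, 'z) sset_scheme \<Rightarrow> ((nat \<times> 'x) \<times> (nat \<Rightarrow> real)) set topology" where
  "realization Xs = quotient_space
     (sum_topology (\<lambda>(n, x). subtopology (powertop_real UNIV) (standard_simplex n))
        (SIGMA n:UNIV. splx Xs n))
     (\<lambda>p. {q. equivclp (glue Xs) p q})"

text \<open>The empty space does not count as connected.\<close>

definition connected_realization :: "('x, 'z) sset_scheme \<Rightarrow> bool" where
  "connected_realization Xs \<longleftrightarrow> topspace (realization Xs) \<noteq> {} \<and> connected_space (realization Xs)"

text \<open>
  Actions extending to the realisation. A permutation of \<open>[n]\<close> is a permutation of the naturals
  fixing everything outside \<open>{..n}\<close>.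
\<close>

record ('g, 'x) gsset = "'x sset" +
  sact :: "nat \<Rightarrow> 'g \<Rightarrow> 'x \<Rightarrow> 'x"
  sperm :: "nat \<Rightarrow> 'g \<Rightarrow> 'x \<Rightarrow> nat \<Rightarrow> nat"

definition sset_action :: "'g monoid \<Rightarrow> ('g, 'x) gsset \<Rightarrow> bool" where
  "sset_action G Xs \<longleftrightarrow>
     (\<forall>n. group_action G (splx Xs n) (sact Xs n)) \<and>
     (\<forall>n. \<forall>g\<in>carrier G. \<forall>x\<in>splx Xs n. sperm Xs n g x permutes {..n}) \<and>
     (\<forall>n. \<forall>x\<in>splx Xs n. sperm Xs n \<one>\<^bsub>G\<^esub> x = id) \<and>
     (\<forall>n. \<forall>g\<in>carrier G. \<forall>h\<in>carrier G. \<forall>x\<in>splx Xs n.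
        sperm Xs n (g \<otimes>\<^bsub>G\<^esub> h) x = sperm Xs n g (sact Xs n h x) \<circ> sperm Xs n h x) \<and>
     (\<forall>n. \<forall>g\<in>carrier G. \<forall>x\<in>splx Xs (Suc n). \<forall>i\<le>Suc n.
        let \<phi> = sperm Xs (Suc n) g x; y = struct_map Xs n (Suc n) (coface n i) x; \<psi> = sperm Xs n g y in
          (\<forall>j\<le>n. \<phi> (coface n i j) = coface n (\<phi> i) (\<psi> j)) \<and>
          sact Xs n g y = struct_map Xs n (Suc n) (coface n (\<phi> i)) (sact Xs (Suc n) g x)) \<and>
     (\<forall>n. \<forall>g\<in>carrier G. \<forall>x\<in>splx Xs n. \<forall>i\<le>n.
        let \<phi> = sperm Xs n g x; y = struct_map Xs (Suc n) n (codegen n i) x; \<psi> = sperm Xs (Suc n) g y in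
          (\<forall>j\<le>Suc n. \<phi> (codegen n i j) = codegen n (\<phi> i) (\<psi> j)) \<and>
          \<psi> i = \<phi> i \<and> \<psi> (Suc i) = Suc (\<phi> i) \<and>
          sact Xs (Suc n) g y = struct_map Xs (Suc n) n (codegen n (\<phi> i)) (sact Xs n g x))"

definition continuous_action :: "'g monoid \<Rightarrow> 'g topology \<Rightarrow> ('g, 'x) gsset \<Rightarrow> bool" where
  "continuous_action G T Xs \<longleftrightarrow> (\<forall>n. \<forall>x\<in>splx Xs n. openin T (stabilizer G (sact Xs n) x))"

definition acts_trivially :: "'g set \<Rightarrow> ('g, 'x) gsset \<Rightarrow> bool" where
  "acts_trivially A Xs \<longleftrightarrow> (\<forall>n. \<forall>a\<in>A. \<forall>x\<in>splx Xs n. sact Xs n a x = x \<and> sperm Xs n a x = id)"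

text \<open>The map \<open>gf\<close> for \<open>f : [m] \<rightarrow> [n]\<close> and an \<open>n\<close>-simplex \<open>x\<close>.\<close>

definition delta_act ::
    "('g, 'x) gsset \<Rightarrow> nat \<Rightarrow> nat \<Rightarrow> 'g \<Rightarrow> (nat \<Rightarrow> nat) \<Rightarrow> 'x \<Rightarrow> nat \<Rightarrow> nat" where
  "delta_act Xs m n g f x =
     restrict (sperm Xs n g x \<circ> f \<circ> inv_into UNIV (sperm Xs m g (struct_map Xs m n f x))) {..m}"


section \<open>Equivariant cosheaves\<close>

record ('f, 'u, 'x, 'g) cosheaf =
  cval :: "nat \<Rightarrow> 'x \<Rightarrow> ('f, 'u) module"
  cmap :: "nat \<Rightarrow> nat \<Rightarrow> (nat \<Rightarrow> nat) \<Rightarrow> 'x \<Rightarrow> 'u \<Rightarrow> 'u"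
    \<comment> \<open>\<open>cmap C m n f x\<close> goes from the value at \<open>x\<close> to the value at \<open>struct_map Xs m n f x\<close>\<close>
  cact :: "nat \<Rightarrow> 'g \<Rightarrow> 'x \<Rightarrow> 'u \<Rightarrow> 'u"

definition equivariant_cosheaf ::
    "'f ring \<Rightarrow> 'g monoid \<Rightarrow> 'g topology \<Rightarrow> ('g, 'x) gsset \<Rightarrow> ('f, 'u, 'x, 'g) cosheaf \<Rightarrow> bool" where
  "equivariant_cosheaf F G T Xs C \<longleftrightarrow>
     (\<forall>n. \<forall>x\<in>splx Xs n. Module.module F (cval C n x)) \<and>
     (\<forall>m n. \<forall>f\<in>delta_maps m n. \<forall>x\<in>splx Xs n.
        cmap C m n f x \<in> lin_maps F (cval C n x) (cval C m (struct_map Xs m n f x))) \<and>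
     (\<forall>n. \<forall>x\<in>splx Xs n. \<forall>v\<in>carrier (cval C n x). cmap C n n (\<lambda>i\<in>{..n}. i) x v = v) \<and>
     (\<forall>k m n. \<forall>h\<in>delta_maps k m. \<forall>f\<in>delta_maps m n. \<forall>x\<in>splx Xs n. \<forall>v\<in>carrier (cval C n x).
        cmap C k m h (struct_map Xs m n f x) (cmap C m n f x v) = cmap C k n (compose {..k} f h) x v) \<and>
     (\<forall>n. \<forall>g\<in>carrier G. \<forall>x\<in>splx Xs n.
        cact C n g x \<in> lin_maps F (cval C n x) (cval C n (sact Xs n g x))) \<and>
     (\<forall>n. \<forall>g\<in>carrier G. \<forall>h\<in>carrier G. \<forall>x\<in>splx Xs n. \<forall>v\<in>carrier (cval C n x).
        cact C n g (sact Xs n h x) (cact C n h x v) = cact C n (g \<otimes>\<^bsub>G\<^esub> h) x v) \<and>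
     (\<forall>n. \<forall>x\<in>splx Xs n. let Gx = stabilizer G (sact Xs n) x in
        smooth_rep F (G\<lparr>carrier := Gx\<rparr>) (subtopology T Gx)
          \<lparr>rspace = cval C n x, ract = (\<lambda>g. cact C n g x)\<rparr>) \<and>
     (\<forall>m n. \<forall>g\<in>carrier G. \<forall>f\<in>delta_maps m n. \<forall>x\<in>splx Xs n. \<forall>v\<in>carrier (cval C n x).
        cact C m g (struct_map Xs m n f x) (cmap C m n f x v) =
        cmap C m n (delta_act Xs m n g f x) (sact Xs n g x) (cact C n g x v))"

type_synonym ('f, 'u, 'x, 'g) csh_arr =
  "('f, 'u, 'x, 'g) cosheaf \<times> (nat \<Rightarrow> 'x \<Rightarrow> 'u \<Rightarrow> 'u) \<times> ('f, 'u, 'x, 'g) cosheaf"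
type_synonym ('f, 'u, 'x, 'g) csh_cat = "(('f, 'u, 'x, 'g) cosheaf, ('f, 'u, 'x, 'g) csh_arr) cat"

definition cosheaf_maps ::
    "'f ring \<Rightarrow> 'g monoid \<Rightarrow> ('g, 'x) gsset \<Rightarrow>
     ('f, 'u, 'x, 'g) cosheaf \<Rightarrow> ('f, 'u, 'x, 'g) cosheaf \<Rightarrow> (nat \<Rightarrow> 'x \<Rightarrow> 'u \<Rightarrow> 'u) set" where
  "cosheaf_maps F G Xs C D = {\<psi>.
     (\<forall>n. \<psi> n \<in> extensional (splx Xs n)) \<and>
     (\<forall>n. \<forall>x\<in>splx Xs n. \<psi> n x \<in> lin_maps F (cval C n x) (cval D n x) \<inter> extensional (carrier (cval C n x))) \<and>
     (\<forall>m n. \<forall>f\<in>delta_maps m n. \<forall>x\<in>splx Xs n. \<forall>v\<in>carrier (cval C n x).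
        \<psi> m (struct_map Xs m n f x) (cmap C m n f x v) = cmap D m n f x (\<psi> n x v)) \<and>
     (\<forall>n. \<forall>g\<in>carrier G. \<forall>x\<in>splx Xs n. \<forall>v\<in>carrier (cval C n x).
        \<psi> n (sact Xs n g x) (cact C n g x v) = cact D n g x (\<psi> n x v))}"

definition Csh :: "'f ring \<Rightarrow> 'g monoid \<Rightarrow> 'g topology \<Rightarrow> ('g, 'x) gsset \<Rightarrow> ('f, 'u, 'x, 'g) csh_cat" where
  "Csh F G T Xs =
     \<lparr>obj = {C. equivariant_cosheaf F G T Xs C},
      arr = {(C, \<psi>, D). equivariant_cosheaf F G T Xs C \<and> equivariant_cosheaf F G T Xs D \<and>
               \<psi> \<in> cosheaf_maps F G Xs C D},
      src = (\<lambda>(C, \<psi>, D). C),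
      tgt = (\<lambda>(C, \<psi>, D). D),
      ident = (\<lambda>C. (C, (\<lambda>n. \<lambda>x\<in>splx Xs n. \<lambda>v\<in>carrier (cval C n x). v), C)),
      cmp = (\<lambda>(D', \<phi>, E) (C, \<psi>, D).
               (C, (\<lambda>n. \<lambda>x\<in>splx Xs n. compose (carrier (cval C n x)) (\<phi> n x) (\<psi> n x)), E))\<rparr>"

text \<open>
  Meant for conditions \<open>P\<close> that only involve the action of a subgroup \<open>A\<close> acting trivially on
  the simplicial set: \<open>A\<close> then lies in every stabiliser and acts on every value.
\<close>

definition valuewise ::
    "('g, 'x) gsset \<Rightarrow> (('f, 'u) module \<Rightarrow> ('g \<Rightarrow> 'u \<Rightarrow> 'u) \<Rightarrow> bool) \<Rightarrow>
     ('f, 'u, 'x, 'g) cosheaf \<Rightarrow> bool" where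
  "valuewise Xs P C \<longleftrightarrow> (\<forall>n. \<forall>x\<in>splx Xs n. P (cval C n x) (\<lambda>a. cact C n a x))"


section \<open>Homology\<close>

definition all_chains :: "('g, 'x) gsset \<Rightarrow> ('f, 'u, 'x, 'g) cosheaf \<Rightarrow> nat \<Rightarrow> ('f, 'x \<Rightarrow> 'u) module" where
  "all_chains Xs C n = direct_sum (splx Xs n) (cval C n)"

definition degen_chains :: "('g, 'x) gsset \<Rightarrow> ('f, 'u, 'x, 'g) cosheaf \<Rightarrow> nat \<Rightarrow> ('x \<Rightarrow> 'u) set" where
  "degen_chains Xs C n = {c \<in> carrier (all_chains Xs C n).
     \<forall>x\<in>splx Xs n. c x \<noteq> \<zero>\<^bsub>cval C n x\<^esub> \<longrightarrow> degenerate Xs n x}"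

text \<open>The differential from degree \<open>n + 1\<close> to degree \<open>n\<close>.\<close>

definition differential ::
    "('g, 'x) gsset \<Rightarrow> ('f, 'u, 'x, 'g) cosheaf \<Rightarrow> nat \<Rightarrow> ('x \<Rightarrow> 'u) \<Rightarrow> 'x \<Rightarrow> 'u" where
  "differential Xs C n c = (\<lambda>y\<in>splx Xs n.
     finsum (cval C n y)
       (\<lambda>(x, i). add_pow (cval C n y) ((-1 :: int) ^ i) (cmap C n (Suc n) (coface n i) x (c x)))
       {(x, i). x \<in> splx Xs (Suc n) \<and> c x \<noteq> \<zero>\<^bsub>cval C (Suc n) x\<^esub> \<and> i \<le> Suc n \<and>
                struct_map Xs n (Suc n) (coface n i) x = y})"

definition chain_act ::
    "'g monoid \<Rightarrow> ('g, 'x) gsset \<Rightarrow> ('f, 'u, 'x, 'g) cosheaf \<Rightarrow> nat \<Rightarrow> 'g \<Rightarrow> ('x \<Rightarrow> 'u) \<Rightarrow> 'x \<Rightarrow> 'u" where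
  "chain_act G Xs C n g c = (\<lambda>y\<in>splx Xs n. let x = sact Xs n (inv\<^bsub>G\<^esub> g) y in
     add_pow (cval C n y) (sign (sperm Xs n g x)) (cact C n g x (c x)))"

definition chains :: "('g, 'x) gsset \<Rightarrow> ('f, 'u, 'x, 'g) cosheaf \<Rightarrow> nat \<Rightarrow> ('f, ('x \<Rightarrow> 'u) set) module" where
  "chains Xs C n = quot_mod (all_chains Xs C n) (degen_chains Xs C n)"

definition quot_differential ::
    "('g, 'x) gsset \<Rightarrow> ('f, 'u, 'x, 'g) cosheaf \<Rightarrow> nat \<Rightarrow> ('x \<Rightarrow> 'u) set \<Rightarrow> ('x \<Rightarrow> 'u) set" where
  "quot_differential Xs C n = quot_map (all_chains Xs C n) (degen_chains Xs C n) (differential Xs C n)"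

definition cycles :: "('g, 'x) gsset \<Rightarrow> ('f, 'u, 'x, 'g) cosheaf \<Rightarrow> nat \<Rightarrow> ('f, ('x \<Rightarrow> 'u) set) module" where
  "cycles Xs C n = (chains Xs C n)\<lparr>carrier := {c \<in> carrier (chains Xs C n).
     case n of 0 \<Rightarrow> True | Suc m \<Rightarrow> quot_differential Xs C m c = \<zero>\<^bsub>chains Xs C m\<^esub>}\<rparr>"

definition boundaries :: "('g, 'x) gsset \<Rightarrow> ('f, 'u, 'x, 'g) cosheaf \<Rightarrow> nat \<Rightarrow> ('x \<Rightarrow> 'u) set set" where
  "boundaries Xs C n = quot_differential Xs C n ` carrier (chains Xs C (Suc n))"

definition homology ::
    "'g monoid \<Rightarrow> ('g, 'x) gsset \<Rightarrow> ('f, 'u, 'x, 'g) cosheaf \<Rightarrow> nat \<Rightarrow> ('f, ('x \<Rightarrow> 'u) set set, 'g) rep" where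
  "homology G Xs C n =
     \<lparr>rspace = quot_mod (cycles Xs C n) (boundaries Xs C n),
      ract = (\<lambda>g. quot_map (cycles Xs C n) (boundaries Xs C n)
               (quot_map (all_chains Xs C n) (degen_chains Xs C n) (chain_act G Xs C n g)))\<rparr>"

text \<open>The map on homology induced by a family of maps \<open>\<psi>\<close> into the cosheaf \<open>D\<close>.\<close>

definition homology_map ::
    "('g, 'x) gsset \<Rightarrow> ('f, 'u, 'x, 'g) cosheaf \<Rightarrow> nat \<Rightarrow> (nat \<Rightarrow> 'x \<Rightarrow> 'u \<Rightarrow> 'u) \<Rightarrow>
     ('x \<Rightarrow> 'u) set set \<Rightarrow> ('x \<Rightarrow> 'u) set set" where
  "homology_map Xs D n \<psi> = quot_map (cycles Xs D n) (boundaries Xs D n)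
     (quot_map (all_chains Xs D n) (degen_chains Xs D n) (\<lambda>c. \<lambda>x\<in>splx Xs n. \<psi> n x (c x)))"

text \<open>
  All vector spaces in \<open>Csh\<close> and \<open>SmoothRep\<close> have carriers in one type \<open>'u\<close>, which plays the
  role of a universe. Homology is built on a larger type, so it is transported back along
  an injection of its carrier into \<open>'u\<close>, which exists if \<open>'u\<close> is infinite and at least as large
  as the set of vertices. The choice affects the result only up to canonical isomorphism.
\<close>

definition code :: "'s set \<Rightarrow> 's \<Rightarrow> 'u" where
  "code Y = (SOME e. inj_on e Y)"

definition decode :: "'s set \<Rightarrow> 'u \<Rightarrow> 's" where
  "decode Y = inv_into Y (code Y)"

definition transport_rep :: "('f, 's, 'g) rep \<Rightarrow> ('f, 'u, 'g) rep" where
  "transport_rep V = (let M = rspace V; e = code (carrier M); d = decode (carrier M) in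
     \<lparr>rspace = \<lparr>carrier = e ` carrier M, monoid.mult = undefined, one = undefined,
                 zero = e \<zero>\<^bsub>M\<^esub>, add = (\<lambda>u v. e (d u \<oplus>\<^bsub>M\<^esub> d v)), smult = (\<lambda>k v. e (k \<odot>\<^bsub>M\<^esub> d v))\<rparr>,
      ract = (\<lambda>g v. e (ract V g (d v)))\<rparr>)"

definition transport_map :: "'s set \<Rightarrow> 't set \<Rightarrow> ('s \<Rightarrow> 't) \<Rightarrow> 'u \<Rightarrow> 'u" where
  "transport_map Y Z f = (\<lambda>v\<in>code Y ` Y. code Z (f (decode Y v)))"

definition homology_functor ::
    "'g monoid \<Rightarrow> ('g, 'x) gsset \<Rightarrow>
     (('f, 'u, 'x, 'g) cosheaf, ('f, 'u, 'x, 'g) csh_arr, ('f, 'u, 'g) rep, ('f, 'u, 'g) rep_arr) functr" where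
  "homology_functor G Xs =
     \<lparr>omap = (\<lambda>C. transport_rep (homology G Xs C 0)),
      amap = (\<lambda>(C, \<psi>, D).
        (transport_rep (homology G Xs C 0),
         transport_map (carrier (rspace (homology G Xs C 0))) (carrier (rspace (homology G Xs D 0)))
           (homology_map Xs D 0 \<psi>),
         transport_rep (homology G Xs D 0)))\<rparr>"

definition trivial_cosheaf :: "('f, 'u, 'g) rep \<Rightarrow> ('f, 'u, 'x, 'g) cosheaf" where
  "trivial_cosheaf V =
     \<lparr>cval = (\<lambda>n x. rspace V), cmap = (\<lambda>m n f x v. v), cact = (\<lambda>n g x. ract V g)\<rparr>"

definition trivial_functor ::
    "('g, 'x) gsset \<Rightarrow>
     (('f, 'u, 'g) rep, ('f, 'u, 'g) rep_arr, ('f, 'u, 'x, 'g) cosheaf, ('f, 'u, 'x, 'g) csh_arr) functr" where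
  "trivial_functor Xs =
     \<lparr>omap = trivial_cosheaf,
      amap = (\<lambda>(V, f, W). (trivial_cosheaf V, (\<lambda>n. \<lambda>x\<in>splx Xs n. f), trivial_cosheaf W))\<rparr>"

end

theory Submission
  imports Defs
begin

text \<open>
  Degree 0 homology \<open>H\<close> is left adjoint to the trivial cosheaf functor \<open>L\<close>, and the functor induced by \<open>H\<close>
  on the category of fractions is left adjoint to \<open>Q \<circ>\<^sub>F L\<close>; hence it preserves colimits. The class
  inverted by \<open>H\<close> admits left fractions, and the induced functor is conservative and faithful, as soon as
  a span with one leg in the class can be completed to a square, and two maps with equal image under
  \<open>H\<close> are equalized by a map of the class. Such an equalizing map is the unit of the adjunction,
  corestricted to its image, because \<open>H\<close> inverts it. Spans are completed in the same way, by images of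
  pushouts inside the trivial cosheaf on the homology.

  If the realisation is connected, any two vertices are joined by edges, so the homology of a trivial
  cosheaf is its value and the counit is invertible, which makes \<open>Q \<circ>\<^sub>F L\<close> a quasi-inverse. Homology
  is a sum of images of the values at vertices, and a sum of simple modules is a direct sum of some of
  them, so homology inherits semisimplicity over \<open>A\<close> from the values of the cosheaf.
\<close>

section \<open>Categories and functors\<close>

text \<open>Degree 0 homology is handled through a universal property: linear maps out of it are
  families of linear maps on the values at vertices that agree along edges. Once this is extracted
  from the quotients of chain spaces, maps out of homology are compared on vectors that come from a
  single vertex. Two obstacles shape the construction. First, all vector spaces must have their
  carriers in \<open>'u\<close>. Homology is coded into \<open>'u\<close>, which rests on a
  cardinality bound for finitely supported chains; pushouts are replaced by images in the trivial
  cosheaf on homology, because a subspace of a space in \<open>'u\<close> requires no coding.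
  Second, smoothness also concerns the zero vector, so a compact open subgroup must exist even if
  there are no simplices; this is van Dantzig's theorem. The adjunction passes to the category of
  fractions because naturality of the unit extends to zigzags: for a formal inverse it follows by
  cancelling an invertible arrow.\<close>

definition arrow :: "('o, 'a) cat \<Rightarrow> 'a \<Rightarrow> 'o \<Rightarrow> 'o \<Rightarrow> bool" where
  "arrow C f x y \<longleftrightarrow> f \<in> arr C \<and> src C f = x \<and> tgt C f = y"

lemma arrow_self: "f \<in> arr C \<Longrightarrow> arrow C f (src C f) (tgt C f)"
  by (simp add: arrow_def)

lemma arrow_obj:
  assumes "category C" "arrow C f x y"
  shows "x \<in> obj C" "y \<in> obj C"
  using assms by (auto simp: category_def arrow_def)

lemma arrow_ident: "category C \<Longrightarrow> x \<in> obj C \<Longrightarrow> arrow C (ident C x) x x"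
  by (simp add: category_def arrow_def)

lemma arrow_cmp:
  "category C \<Longrightarrow> arrow C f x y \<Longrightarrow> arrow C g y z \<Longrightarrow> arrow C (cmp C g f) x z"
  unfolding category_def arrow_def by metis

lemma cmp_assoc:
  "category C \<Longrightarrow> arrow C f x y \<Longrightarrow> arrow C g y z \<Longrightarrow> arrow C h z w \<Longrightarrow>
     cmp C (cmp C h g) f = cmp C h (cmp C g f)"
  unfolding category_def arrow_def by metis

lemma cmp_ident_right: "category C \<Longrightarrow> arrow C f x y \<Longrightarrow> cmp C f (ident C x) = f"
  unfolding category_def arrow_def by metis

lemma cmp_ident_left: "category C \<Longrightarrow> arrow C f x y \<Longrightarrow> cmp C (ident C y) f = f"
  unfolding category_def arrow_def by metis

text \<open>Each rule quantifies over both ends of its arrows, so composability is settled by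
  unification and not by equations between \<open>src\<close> and \<open>tgt\<close>; this is the
  purpose of \<open>arrow\<close>.\<close>

lemma categoryI:
  assumes "\<And>f x y. arrow C f x y \<Longrightarrow> x \<in> obj C \<and> y \<in> obj C"
    and "\<And>x. x \<in> obj C \<Longrightarrow> arrow C (ident C x) x x"
    and "\<And>f g x y z. arrow C f x y \<Longrightarrow> arrow C g y z \<Longrightarrow> arrow C (cmp C g f) x z"
    and "\<And>f x y. arrow C f x y \<Longrightarrow> cmp C f (ident C x) = f \<and> cmp C (ident C y) f = f"
    and "\<And>f g h x y z w. arrow C f x y \<Longrightarrow> arrow C g y z \<Longrightarrow> arrow C h z w \<Longrightarrow>
           cmp C h (cmp C g f) = cmp C (cmp C h g) f"
  shows "category C"
  using assms unfolding category_def arrow_def by auto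

lemma functor_categories:
  assumes "is_functor C D \<Phi>" shows "category C" "category D"
  using assms by (auto simp: is_functor_def)

lemma functor_obj: "is_functor C D \<Phi> \<Longrightarrow> x \<in> obj C \<Longrightarrow> omap \<Phi> x \<in> obj D"
  by (simp add: is_functor_def)

lemma functor_arrow:
  "is_functor C D \<Phi> \<Longrightarrow> arrow C f x y \<Longrightarrow> arrow D (amap \<Phi> f) (omap \<Phi> x) (omap \<Phi> y)"
  unfolding is_functor_def arrow_def by metis

lemma functor_ident:
  "is_functor C D \<Phi> \<Longrightarrow> x \<in> obj C \<Longrightarrow> amap \<Phi> (ident C x) = ident D (omap \<Phi> x)"
  by (simp add: is_functor_def)

lemma functor_cmp:
  "is_functor C D \<Phi> \<Longrightarrow> arrow C f x y \<Longrightarrow> arrow C g y z \<Longrightarrow>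
     amap \<Phi> (cmp C g f) = cmp D (amap \<Phi> g) (amap \<Phi> f)"
  unfolding is_functor_def arrow_def by metis

lemma is_functorI:
  assumes "category C" "category D"
    and "\<And>x. x \<in> obj C \<Longrightarrow> omap \<Phi> x \<in> obj D"
    and "\<And>f x y. arrow C f x y \<Longrightarrow> arrow D (amap \<Phi> f) (omap \<Phi> x) (omap \<Phi> y)"
    and "\<And>x. x \<in> obj C \<Longrightarrow> amap \<Phi> (ident C x) = ident D (omap \<Phi> x)"
    and "\<And>f g x y z. arrow C f x y \<Longrightarrow> arrow C g y z \<Longrightarrow>
           amap \<Phi> (cmp C g f) = cmp D (amap \<Phi> g) (amap \<Phi> f)"
  shows "is_functor C D \<Phi>"
proof -
  have "amap \<Phi> f \<in> arr D \<and> src D (amap \<Phi> f) = omap \<Phi> (src C f) \<and> tgt D (amap \<Phi> f) = omap \<Phi> (tgt C f)"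
    if "f \<in> arr C" for f
    using assms(4)[OF arrow_self[OF that]] by (simp add: arrow_def)
  moreover have "amap \<Phi> (cmp C g f) = cmp D (amap \<Phi> g) (amap \<Phi> f)"
    if "f \<in> arr C" "g \<in> arr C" "tgt C f = src C g" for f g
    using assms(6)[of f "src C f" "tgt C f" g "tgt C g"] that by (simp add: arrow_def)
  ultimately show ?thesis
    using assms unfolding is_functor_def by blast
qed

lemma comp_functor_simps [simp]:
  "omap (\<Psi> \<circ>\<^sub>F \<Phi>) x = omap \<Psi> (omap \<Phi> x)" "amap (\<Psi> \<circ>\<^sub>F \<Phi>) f = amap \<Psi> (amap \<Phi> f)"
  by (simp_all add: comp_functor_def)

lemma id_functor_simps [simp]: "omap id_functor x = x" "amap id_functor f = f"
  by (simp_all add: id_functor_def)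

lemma is_functor_comp:
  assumes "is_functor C D \<Phi>" "is_functor D E \<Psi>"
  shows "is_functor C E (\<Psi> \<circ>\<^sub>F \<Phi>)"
proof (rule is_functorI)
  show "amap (\<Psi> \<circ>\<^sub>F \<Phi>) (cmp C g f) = cmp E (amap (\<Psi> \<circ>\<^sub>F \<Phi>) g) (amap (\<Psi> \<circ>\<^sub>F \<Phi>) f)"
    if "arrow C f x y" "arrow C g y z" for f g x y z
    using functor_cmp[OF assms(1) that]
      functor_cmp[OF assms(2) functor_arrow[OF assms(1) that(1)] functor_arrow[OF assms(1) that(2)]]
    by simp
  show "arrow E (amap (\<Psi> \<circ>\<^sub>F \<Phi>) f) (omap (\<Psi> \<circ>\<^sub>F \<Phi>) x) (omap (\<Psi> \<circ>\<^sub>F \<Phi>) y)"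
    if "arrow C f x y" for f x y
    using functor_arrow[OF assms(2) functor_arrow[OF assms(1) that]] by simp
qed (use assms in \<open>simp_all add: functor_categories functor_obj functor_ident\<close>)

lemma inverse_arrows_arrow:
  "arrow C f x y \<Longrightarrow> inverse_arrows C f g \<longleftrightarrow>
     arrow C g y x \<and> cmp C g f = ident C x \<and> cmp C f g = ident C y"
  by (auto simp: inverse_arrows_def arrow_def)

lemma inverse_arrows_unique:
  assumes "category C" "inverse_arrows C f g" "inverse_arrows C f h"
  shows "g = h"
proof -
  have f: "arrow C f (src C f) (tgt C f)"
    using assms by (auto simp: inverse_arrows_def arrow_def)
  note * = assms(2,3)[unfolded inverse_arrows_arrow[OF f]]
  have "g = cmp C g (cmp C f h)"
    using * cmp_ident_right[OF assms(1)] by metis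
  also have "\<dots> = cmp C (cmp C g f) h"
    using * cmp_assoc[OF assms(1) _ f] by metis
  also have "\<dots> = h"
    using * cmp_ident_left[OF assms(1)] by metis
  finally show ?thesis .
qed

lemma inv_arrI: "category C \<Longrightarrow> inverse_arrows C f g \<Longrightarrow> inv_arr C f = g"
  unfolding inv_arr_def by (rule some_equality) (auto dest: inverse_arrows_unique)

lemma inv_arr:
  assumes "iso_arr C f" "arrow C f x y"
  shows "arrow C (inv_arr C f) y x" "cmp C (inv_arr C f) f = ident C x"
    "cmp C f (inv_arr C f) = ident C y"
proof -
  have "inverse_arrows C f (inv_arr C f)"
    using assms(1) unfolding iso_arr_def inv_arr_def by (rule someI_ex)
  then show "arrow C (inv_arr C f) y x" "cmp C (inv_arr C f) f = ident C x"
    "cmp C f (inv_arr C f) = ident C y"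
    by (simp_all add: inverse_arrows_arrow[OF assms(2)])
qed

lemma iso_arrI:
  assumes "arrow C f x y" "arrow C g y x" "cmp C g f = ident C x" "cmp C f g = ident C y"
  shows "iso_arr C f"
  using assms inverse_arrows_arrow[OF assms(1)] unfolding iso_arr_def by blast

lemma iso_inv:
  assumes "iso_arr C f" "arrow C f x y"
  shows "iso_arr C (inv_arr C f)"
  using inv_arr[OF assms] assms(2) by (intro iso_arrI[of _ _ y x f]) auto

lemma iso_ident: "category C \<Longrightarrow> x \<in> obj C \<Longrightarrow> iso_arr C (ident C x)"
  by (rule iso_arrI[of C _ x x "ident C x"]) (auto simp: arrow_ident cmp_ident_left[OF _ arrow_ident])

lemma iso_cmp:
  assumes C: "category C" and f: "iso_arr C f" "arrow C f x y" and g: "iso_arr C g" "arrow C g y z"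
  shows "iso_arr C (cmp C g f)"
proof -
  let ?f = "inv_arr C f" and ?g = "inv_arr C g"
  note f' = inv_arr[OF f] and g' = inv_arr[OF g]
  have gf: "arrow C (cmp C g f) x z" and fg: "arrow C (cmp C ?f ?g) z x"
    using arrow_cmp[OF C f(2) g(2)] arrow_cmp[OF C g'(1) f'(1)] by auto
  have "cmp C (cmp C ?f ?g) (cmp C g f) = cmp C ?f (cmp C (cmp C ?g g) f)"
    using cmp_assoc[OF C gf g'(1) f'(1)] cmp_assoc[OF C f(2) g(2) g'(1)] by simp
  also have "\<dots> = ident C x"
    using f'(2) g'(2) cmp_ident_left[OF C f(2)] by simp
  finally have 1: "cmp C (cmp C ?f ?g) (cmp C g f) = ident C x" .
  have "cmp C (cmp C g f) (cmp C ?f ?g) = cmp C g (cmp C (cmp C f ?f) ?g)"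
    using cmp_assoc[OF C fg f(2) g(2)] cmp_assoc[OF C g'(1) f'(1) f(2)] by simp
  also have "\<dots> = ident C z"
    using f'(3) g'(3) cmp_ident_left[OF C g'(1)] by simp
  finally show ?thesis
    using iso_arrI[OF gf fg 1] by simp
qed

lemma iso_cancel_left:
  assumes C: "category C" and t: "iso_arr C t" "arrow C t y z"
    and "arrow C f x y" "arrow C g x y" "cmp C t f = cmp C t g"
  shows "f = g"
proof -
  have "cmp C (cmp C (inv_arr C t) t) f = cmp C (cmp C (inv_arr C t) t) g"
    using cmp_assoc[OF C assms(4) t(2) inv_arr(1)[OF t]] cmp_assoc[OF C assms(5) t(2) inv_arr(1)[OF t]] assms(6)
    by simp
  then show ?thesis
    using cmp_ident_left[OF C assms(4)] cmp_ident_left[OF C assms(5)] inv_arr(2)[OF t] by simp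
qed

lemma iso_cancel_right:
  assumes C: "category C" and t: "iso_arr C t" "arrow C t x y"
    and "arrow C f y z" "arrow C g y z" "cmp C f t = cmp C g t"
  shows "f = g"
proof -
  have "cmp C f (cmp C t (inv_arr C t)) = cmp C g (cmp C t (inv_arr C t))"
    using cmp_assoc[OF C inv_arr(1)[OF t] t(2) assms(4)] cmp_assoc[OF C inv_arr(1)[OF t] t(2) assms(5)] assms(6)
    by simp
  then show ?thesis
    using cmp_ident_right[OF C assms(4)] cmp_ident_right[OF C assms(5)] inv_arr(3)[OF t] by simp
qed

lemma iso_two_of_three_left:
  assumes C: "category C" and g: "iso_arr C g" "arrow C g y z" and f: "arrow C f x y"
    and gf: "iso_arr C (cmp C g f)"
  shows "iso_arr C f"
proof -
  have "f = cmp C (inv_arr C g) (cmp C g f)"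
    using cmp_assoc[OF C f g(2) inv_arr(1)[OF g]] inv_arr(2)[OF g] cmp_ident_left[OF C f] by simp
  moreover have "iso_arr C (cmp C (inv_arr C g) (cmp C g f))"
    by (rule iso_cmp[OF C gf arrow_cmp[OF C f g(2)] iso_inv[OF g] inv_arr(1)[OF g]])
  ultimately show ?thesis by simp
qed

lemma functor_inverse_arrows:
  assumes F: "is_functor C D \<Phi>" and "inverse_arrows C f g"
  shows "inverse_arrows D (amap \<Phi> f) (amap \<Phi> g)"
proof -
  define x y where "x = src C f" and "y = tgt C f"
  have f: "arrow C f x y"
    using assms by (auto simp: inverse_arrows_def arrow_def x_def y_def)
  have g: "arrow C g y x" "cmp C g f = ident C x" "cmp C f g = ident C y"
    using assms(2)[unfolded inverse_arrows_arrow[OF f]] by auto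
  have xy: "x \<in> obj C" "y \<in> obj C"
    using arrow_obj[OF functor_categories(1)[OF F] f] by auto
  show ?thesis
    unfolding inverse_arrows_arrow[OF functor_arrow[OF F f]]
    using functor_arrow[OF F g(1)] functor_cmp[OF F f g(1)] functor_cmp[OF F g(1) f] g xy
    by (simp add: functor_ident[OF F])
qed

lemma functor_iso: "is_functor C D \<Phi> \<Longrightarrow> iso_arr C f \<Longrightarrow> iso_arr D (amap \<Phi> f)"
  unfolding iso_arr_def by (blast dest: functor_inverse_arrows)

lemma functor_inv_arr:
  assumes "is_functor C D \<Phi>" "iso_arr C f"
  shows "amap \<Phi> (inv_arr C f) = inv_arr D (amap \<Phi> f)"
proof -
  obtain g where g: "inverse_arrows C f g" using assms(2) by (auto simp: iso_arr_def)
  have "inv_arr C f = g" by (rule inv_arrI[OF functor_categories(1)[OF assms(1)] g])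
  then show ?thesis
    using inv_arrI[OF functor_categories(2)[OF assms(1)] functor_inverse_arrows[OF assms(1) g]] by simp
qed

section \<open>Full subcategories\<close>

lemma obj_full_subcat [simp]: "obj (full_subcat C P) = {x \<in> obj C. P x}"
  and src_full_subcat [simp]: "src (full_subcat C P) = src C"
  and tgt_full_subcat [simp]: "tgt (full_subcat C P) = tgt C"
  and ident_full_subcat [simp]: "ident (full_subcat C P) = ident C"
  and cmp_full_subcat [simp]: "cmp (full_subcat C P) = cmp C"
  by (simp_all add: full_subcat_def)

lemma arrow_full_subcat: "arrow (full_subcat C P) f x y \<longleftrightarrow> arrow C f x y \<and> P x \<and> P y"
  by (auto simp: full_subcat_def arrow_def)

lemma category_full_subcat: "category C \<Longrightarrow> category (full_subcat C P)"
  unfolding category_def full_subcat_def by simp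

lemma functor_full_subcat:
  assumes "is_functor C D \<Phi>" "\<And>x. x \<in> obj C \<Longrightarrow> P x \<Longrightarrow> R (omap \<Phi> x)"
  shows "is_functor (full_subcat C P) (full_subcat D R) \<Phi>"
proof (rule is_functorI)
  show "arrow (full_subcat D R) (amap \<Phi> f) (omap \<Phi> x) (omap \<Phi> y)"
    if "arrow (full_subcat C P) f x y" for f x y
    using that assms arrow_obj[OF functor_categories(1)[OF assms(1)], of f x y]
    by (auto simp: arrow_full_subcat functor_arrow)
  show "amap \<Phi> (cmp (full_subcat C P) g f) = cmp (full_subcat D R) (amap \<Phi> g) (amap \<Phi> f)"
    if "arrow (full_subcat C P) f x y" "arrow (full_subcat C P) g y z" for f g x y z
    using that functor_cmp[OF assms(1)] by (auto simp: arrow_full_subcat)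
qed (use assms in \<open>simp_all add: category_full_subcat functor_categories functor_obj functor_ident\<close>)

text \<open>Fullness: an inverse in \<open>C\<close> has its ends in the subcategory and hence
  belongs to it.\<close>

lemma iso_full_subcat:
  assumes "arrow (full_subcat C P) f x y"
  shows "iso_arr (full_subcat C P) f \<longleftrightarrow> iso_arr C f"
  using assms
  by (auto simp: iso_arr_def inverse_arrows_arrow[OF assms] inverse_arrows_arrow arrow_full_subcat)

text \<open>The two choices by \<open>SOME\<close> are made from equivalent predicates, hence agree
  literally. The restricted equivalence has to satisfy equations between arrows, so agreement up to
  isomorphism would not do.\<close>

lemma inv_arr_full_subcat:
  assumes "arrow (full_subcat C P) f x y"
  shows "inv_arr (full_subcat C P) f = inv_arr C f"
proof -
  have "inverse_arrows (full_subcat C P) f g \<longleftrightarrow> inverse_arrows C f g" for g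
    using assms inverse_arrows_arrow[OF assms] inverse_arrows_arrow[of C f x y]
    by (auto simp: arrow_full_subcat)
  then show ?thesis by (simp add: inv_arr_def)
qed


section \<open>Categories of fractions\<close>

text \<open>\<open>S\<close> is an arbitrary class of arrows: the zigzag construction and the
  functors out of it are set up before any calculus of fractions is available.\<close>

locale fractions_of =
  fixes C :: "('o, 'a) cat" and S :: "'a set"
  assumes cat: "category C" and S_sub: "S \<subseteq> arr C"
begin

abbreviation "B \<equiv> fractions C S"
abbreviation "Q \<equiv> frac_functor C S"

definition zz_arr :: "'o \<Rightarrow> 'a step list \<Rightarrow> 'o \<Rightarrow> ('o, 'a) frac" where
  "zz_arr x p y = (x, zz_class C S x p y, y)"

lemma S_arrow: "s \<in> S \<Longrightarrow> arrow C s (src C s) (tgt C s)"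
  using S_sub by (auto simp: arrow_def)

lemma zigzag_objs: "zigzag C S x p y \<Longrightarrow> x \<in> obj C \<and> y \<in> obj C"
proof (induction p arbitrary: x)
  case (Cons a p)
  then show ?case using cat S_sub by (cases a) (auto simp: category_def)
qed auto

lemma zigzag_append: "zigzag C S x (p @ q) y \<longleftrightarrow> (\<exists>z. zigzag C S x p z \<and> zigzag C S z q y)"
proof (induction p arbitrary: x)
  case Nil
  then show ?case using zigzag_objs by auto
next
  case (Cons a p)
  then show ?case by (cases a) auto
qed

lemma zz_reduce_zigzag: "zz_reduce C S x y p q \<Longrightarrow> zigzag C S x p y \<and> zigzag C S x q y"
proof (induction rule: zz_reduce.induct)
  case (ident z p q)
  then show ?case
    using arrow_ident[OF cat ident(1)] by (auto simp: zigzag_append arrow_def)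
next
  case (cmp p f g q)
  then obtain z where z: "zigzag C S x p z" "arrow C f z (tgt C f)" "arrow C g (tgt C f) (tgt C g)"
    "zigzag C S (tgt C g) q y"
    by (auto simp: zigzag_append arrow_def)
  with arrow_cmp[OF cat z(2,3)] show ?case
    using cmp by (auto simp: zigzag_append arrow_def)
qed (auto simp: zigzag_append)

lemma zz_reduce_context:
  assumes "zz_reduce C S x y p q" "zigzag C S x' r x" "zigzag C S y t y'"
  shows "zz_reduce C S x' y' (r @ p @ t) (r @ q @ t)"
proof -
  have *: "zigzag C S x' (r @ p @ t) y'"
    using assms zz_reduce_zigzag[OF assms(1)] by (auto simp: zigzag_append)
  show ?thesis
    using assms(1)
  proof cases
    case (ident z a b)
    then show ?thesis
      using * zz_reduce.ident[of z C S x' "r @ a" "b @ t" y'] by simp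
  next
    case (cmp a f g b)
    then show ?thesis
      using * zz_reduce.cmp[of C S x' "r @ a" f g "b @ t" y'] by simp
  next
    case (fwd_bwd s a b)
    then show ?thesis
      using * zz_reduce.fwd_bwd[of s S C x' "r @ a" "b @ t" y'] by simp
  next
    case (bwd_fwd s a b)
    then show ?thesis
      using * zz_reduce.bwd_fwd[of s S C x' "r @ a" "b @ t" y'] by simp
  qed
qed

text \<open>The relation is a congruence for concatenation, so composition in \<open>B\<close> does
  not depend on the representatives that \<open>SOME\<close> picks.\<close>

lemma equiv_context:
  assumes "equivclp (zz_reduce C S x y) p q" "zigzag C S x' r x" "zigzag C S y t y'"
  shows "equivclp (zz_reduce C S x' y') (r @ p @ t) (r @ q @ t)"
  using assms(1)
proof (induction rule: equivclp_induct)
  case (step q q')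
  then have "zz_reduce C S x' y' (r @ q @ t) (r @ q' @ t) \<or> zz_reduce C S x' y' (r @ q' @ t) (r @ q @ t)"
    using zz_reduce_context assms(2,3) by blast
  then show ?case using step(3) by (rule equivclp_into_equivclp[rotated])
qed simp

lemma zz_arr_eqI: "equivclp (zz_reduce C S x y) p q \<Longrightarrow> zz_arr x p y = zz_arr x q y"
  unfolding zz_arr_def zz_class_def by (auto intro: equivclp_trans equivclp_sym)

lemma zz_arr_reduce: "zz_reduce C S x y p q \<Longrightarrow> zz_arr x p y = zz_arr x q y"
  by (rule zz_arr_eqI) (simp add: r_into_equivclp)

lemma some_zz_class:
  assumes "zigzag C S x p y"
  shows "zigzag C S x (SOME q. q \<in> zz_class C S x p y) y"
    "equivclp (zz_reduce C S x y) p (SOME q. q \<in> zz_class C S x p y)"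
proof -
  have "p \<in> zz_class C S x p y" using assms by (simp add: zz_class_def)
  then have "(SOME q. q \<in> zz_class C S x p y) \<in> zz_class C S x p y" by (rule someI)
  then show "zigzag C S x (SOME q. q \<in> zz_class C S x p y) y"
    "equivclp (zz_reduce C S x y) p (SOME q. q \<in> zz_class C S x p y)"
    by (auto simp: zz_class_def)
qed

lemma obj_B [simp]: "obj B = obj C"
  by (simp add: fractions_def)

lemma ident_B: "ident B x = zz_arr x [] x"
  by (simp add: fractions_def zz_arr_def)

lemma arrow_B: "arrow B b x y \<longleftrightarrow> (\<exists>p. zigzag C S x p y \<and> b = zz_arr x p y)"
  unfolding arrow_def fractions_def zz_arr_def by auto

lemma arrow_zz_arr: "zigzag C S x p y \<Longrightarrow> arrow B (zz_arr x p y) x y"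
  unfolding arrow_B by blast

lemma cmp_zz_arr:
  assumes p: "zigzag C S x p y" and q: "zigzag C S y q z"
  shows "cmp B (zz_arr y q z) (zz_arr x p y) = zz_arr x (p @ q) z"
proof -
  define p' q' where "p' = (SOME r. r \<in> zz_class C S x p y)" and "q' = (SOME r. r \<in> zz_class C S y q z)"
  have p': "zigzag C S x p' y" "equivclp (zz_reduce C S x y) p p'"
    and q': "zigzag C S y q' z" "equivclp (zz_reduce C S y z) q q'"
    using some_zz_class[OF p] some_zz_class[OF q] by (auto simp: p'_def q'_def)
  have "equivclp (zz_reduce C S x z) (p @ q) (p' @ q)"
    using equiv_context[OF p'(2) _ q, of x "[]"] zigzag_objs[OF p] by simp
  moreover have "equivclp (zz_reduce C S x z) (p' @ q) (p' @ q')"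
    using equiv_context[OF q'(2) p'(1), of "[]" z] zigzag_objs[OF q] by simp
  ultimately have "zz_arr x (p @ q) z = zz_arr x (p' @ q') z"
    by (metis equivclp_trans zz_arr_eqI)
  then show ?thesis
    by (simp add: fractions_def zz_arr_def p'_def q'_def)
qed

text \<open>On representatives composition is concatenation of lists, so the category laws are those
  of concatenation.\<close>

lemma category_B: "category B"
proof (rule categoryI)
  fix f x y assume "arrow B f x y"
  then obtain p where p: "zigzag C S x p y" "f = zz_arr x p y" by (auto simp: arrow_B)
  show "x \<in> obj B \<and> y \<in> obj B" using zigzag_objs[OF p(1)] by simp
  then have "zigzag C S x [] x" "zigzag C S y [] y" by simp_all
  then show "cmp B f (ident B x) = f \<and> cmp B (ident B y) f = f"
    using p by (simp add: ident_B cmp_zz_arr)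
next
  fix x assume "x \<in> obj B"
  then have "zigzag C S x [] x" by simp
  then show "arrow B (ident B x) x x" by (simp add: arrow_zz_arr ident_B)
next
  fix f g x y z assume "arrow B f x y" "arrow B g y z"
  then obtain p q where "zigzag C S x p y" "f = zz_arr x p y" "zigzag C S y q z" "g = zz_arr y q z"
    by (auto simp: arrow_B)
  moreover from this have "zigzag C S x (p @ q) z" by (auto simp: zigzag_append)
  ultimately show "arrow B (cmp B g f) x z" by (simp add: cmp_zz_arr arrow_zz_arr)
next
  fix f g h x y z w assume "arrow B f x y" "arrow B g y z" "arrow B h z w"
  then obtain p q r where "zigzag C S x p y" "f = zz_arr x p y" "zigzag C S y q z" "g = zz_arr y q z"
      "zigzag C S z r w" "h = zz_arr z r w"
    by (auto simp: arrow_B)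
  moreover from this have "zigzag C S x (p @ q) z" "zigzag C S y (q @ r) w" by (auto simp: zigzag_append)
  ultimately show "cmp B h (cmp B g f) = cmp B (cmp B h g) f" by (simp add: cmp_zz_arr)
qed

lemma omap_Q [simp]: "omap Q x = x"
  by (simp add: frac_functor_def)

lemma amap_Q: "arrow C f x y \<Longrightarrow> amap Q f = zz_arr x [Fwd f] y"
  by (auto simp: frac_functor_def zz_arr_def arrow_def)

lemma zigzag_Fwd: "arrow C f x y \<Longrightarrow> zigzag C S x [Fwd f] y"
  using arrow_obj[OF cat] by (auto simp: arrow_def)

lemma zigzag_Bwd: "s \<in> S \<Longrightarrow> arrow C s x y \<Longrightarrow> zigzag C S y [Bwd s] x"
  using arrow_obj[OF cat] by (auto simp: arrow_def)

lemma functor_Q: "is_functor C B Q"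
proof (rule is_functorI)
  show "category C" "category B" by (fact cat, fact category_B)
next
  fix x assume x: "x \<in> obj C"
  have "zz_reduce C S x x ([] @ Fwd (ident C x) # []) ([] @ [])"
    using x zigzag_Fwd[OF arrow_ident[OF cat x]] by (intro zz_reduce.ident) auto
  then show "amap Q (ident C x) = ident B (omap Q x)"
    using zz_arr_reduce amap_Q[OF arrow_ident[OF cat x]] by (simp add: ident_B)
next
  fix f x y assume f: "arrow C f x y"
  then show "arrow B (amap Q f) (omap Q x) (omap Q y)"
    using arrow_zz_arr[OF zigzag_Fwd[OF f]] by (simp add: amap_Q[OF f])
next
  fix f g x y z assume f: "arrow C f x y" and g: "arrow C g y z"
  have "zz_reduce C S x z ([] @ Fwd f # Fwd g # []) ([] @ Fwd (cmp C g f) # [])"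
    using f zigzag_Fwd[OF g] by (intro zz_reduce.cmp) (auto simp: arrow_def)
  then show "amap Q (cmp C g f) = cmp B (amap Q g) (amap Q f)"
    using zz_arr_reduce cmp_zz_arr[OF zigzag_Fwd[OF f] zigzag_Fwd[OF g]]
    by (simp add: amap_Q[OF f] amap_Q[OF g] amap_Q[OF arrow_cmp[OF cat f g]])
qed simp

lemma inverse_Q:
  assumes s: "s \<in> S" "arrow C s x y"
  shows "inverse_arrows B (amap Q s) (zz_arr y [Bwd s] x)"
proof -
  note z = zigzag_Fwd[OF s(2)] zigzag_Bwd[OF s]
  have a: "arrow B (amap Q s) x y"
    using functor_arrow[OF functor_Q s(2)] by simp
  have "zz_reduce C S x x ([] @ Fwd s # Bwd s # []) ([] @ [])"
    using s z by (intro zz_reduce.fwd_bwd) (auto simp: arrow_def)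
  moreover have "zz_reduce C S y y ([] @ Bwd s # Fwd s # []) ([] @ [])"
    using s z S_sub by (intro zz_reduce.bwd_fwd) (auto simp: arrow_def)
  ultimately show ?thesis
    unfolding inverse_arrows_arrow[OF a]
    using zz_arr_reduce z cmp_zz_arr[OF z] cmp_zz_arr[OF z(2,1)]
    by (simp add: arrow_zz_arr amap_Q[OF s(2)] ident_B)
qed

lemma iso_Q: "s \<in> S \<Longrightarrow> iso_arr B (amap Q s)"
  using inverse_Q[OF _ S_arrow] unfolding iso_arr_def by blast

lemma inv_Q: "s \<in> S \<Longrightarrow> arrow C s x y \<Longrightarrow> inv_arr B (amap Q s) = zz_arr y [Bwd s] x"
  by (rule inv_arrI[OF category_B inverse_Q])

lemma arrow_inv_Q: "s \<in> S \<Longrightarrow> arrow C s x y \<Longrightarrow> arrow B (inv_arr B (amap Q s)) y x"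
  using arrow_zz_arr[OF zigzag_Bwd] by (simp add: inv_Q)

text \<open>Removing the first step of a zigzag writes a fraction as a shorter one after the image
  of an arrow, or after the inverse of the image of an arrow of \<open>S\<close>. Naturality of the
  unit, the normal form of fractions and the comparison with subcategories all start from this
  rule.\<close>

lemma fraction_induct [consumes 1, case_names ident fwd bwd]:
  assumes "arrow B b x y"
    and ident: "y \<in> obj C \<Longrightarrow> P y (ident B y)"
    and fwd: "\<And>b f x z. arrow B b z y \<Longrightarrow> P z b \<Longrightarrow> arrow C f x z \<Longrightarrow> P x (cmp B b (amap Q f))"
    and bwd: "\<And>b s x z. arrow B b z y \<Longrightarrow> P z b \<Longrightarrow> s \<in> S \<Longrightarrow> arrow C s z x \<Longrightarrow>
                P x (cmp B b (inv_arr B (amap Q s)))"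
  shows "P x b"
proof -
  obtain p where p: "zigzag C S x p y" and b: "b = zz_arr x p y"
    using assms(1) by (auto simp: arrow_B)
  from p show ?thesis unfolding b
  proof (induction p arbitrary: x)
    case Nil
    then show ?case using ident by (auto simp: ident_B)
  next
    case (Cons a p)
    show ?case
    proof (cases a)
      case (Fwd f)
      then have f: "arrow C f x (tgt C f)" and p: "zigzag C S (tgt C f) p y"
        using Cons.prems by (auto simp: arrow_def)
      then have "arrow B (zz_arr (tgt C f) p y) (tgt C f) y" by (simp add: arrow_zz_arr)
      then have "P x (cmp B (zz_arr (tgt C f) p y) (amap Q f))"
        using Cons.IH[OF p] f by (rule fwd)
      then show ?thesis
        using cmp_zz_arr[OF zigzag_Fwd[OF f] p] by (simp add: Fwd amap_Q[OF f])
    next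
      case (Bwd s)
      then have s: "s \<in> S" "arrow C s (src C s) x" and p: "zigzag C S (src C s) p y"
        using Cons.prems S_sub by (auto simp: arrow_def)
      then have "arrow B (zz_arr (src C s) p y) (src C s) y" by (simp add: arrow_zz_arr)
      then have "P x (cmp B (zz_arr (src C s) p y) (inv_arr B (amap Q s)))"
        using Cons.IH[OF p] s by (rule bwd)
      then show ?thesis
        using cmp_zz_arr[OF zigzag_Bwd[OF s] p] by (simp add: Bwd inv_Q[OF s])
    qed
  qed
qed

end

section \<open>The functor induced on the category of fractions\<close>

locale inverting_functor = fractions_of C S for C :: "('o, 'a) cat" and S +
  fixes D :: "('p, 'b) cat" and \<Phi> :: "('o, 'a, 'p, 'b) functr"
  assumes func: "is_functor C D \<Phi>" and inverts: "s \<in> S \<Longrightarrow> iso_arr D (amap \<Phi> s)"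
begin

abbreviation "\<Phi>B \<equiv> frac_induced D \<Phi>"

lemma catD: "category D"
  by (rule functor_categories(2)[OF func])

abbreviation val :: "'b \<Rightarrow> 'a step list \<Rightarrow> 'b" where
  "val \<equiv> zz_val D (amap \<Phi>)"

abbreviation step_val :: "'a step \<Rightarrow> 'b" where
  "step_val a \<equiv> (case a of Fwd f \<Rightarrow> amap \<Phi> f | Bwd f \<Rightarrow> inv_arr D (amap \<Phi> f))"

lemma val_append: "val e (p @ q) = val (val e p) q"
  by (induction p arbitrary: e) auto

lemma step_val_arrow:
  assumes "zigzag C S x (a # p) y"
  obtains z where "arrow D (step_val a) (omap \<Phi> x) (omap \<Phi> z)" "zigzag C S z p y"
proof (cases a)
  case (Fwd f)
  then have "arrow C f x (tgt C f)" "zigzag C S (tgt C f) p y" using assms by (auto simp: arrow_def)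
  then show ?thesis using that functor_arrow[OF func] Fwd by fastforce
next
  case (Bwd s)
  then have "s \<in> S" "arrow C s (src C s) x" "zigzag C S (src C s) p y"
    using assms S_sub by (auto simp: arrow_def)
  then show ?thesis using that inv_arr(1)[OF inverts functor_arrow[OF func]] Bwd by fastforce
qed

lemma val_arrow:
  "zigzag C S x p y \<Longrightarrow> arrow D e w (omap \<Phi> x) \<Longrightarrow> arrow D (val e p) w (omap \<Phi> y)"
proof (induction p arbitrary: x e)
  case (Cons a p)
  obtain z where "arrow D (step_val a) (omap \<Phi> x) (omap \<Phi> z)" "zigzag C S z p y"
    using step_val_arrow[OF Cons.prems(1)] .
  then show ?case using Cons arrow_cmp[OF catD] by simp
qed auto

text \<open>The accumulator of \<open>zz_val\<close> is a composite on the right and can be split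
  off; this turns the value of a concatenated zigzag into a composite.\<close>

lemma val_cmp:
  "zigzag C S x p y \<Longrightarrow> arrow D e v w \<Longrightarrow> arrow D e' w (omap \<Phi> x) \<Longrightarrow>
     val (cmp D e' e) p = cmp D (val e' p) e"
proof (induction p arbitrary: x e')
  case (Cons a p)
  obtain z where z: "arrow D (step_val a) (omap \<Phi> x) (omap \<Phi> z)" "zigzag C S z p y"
    using step_val_arrow[OF Cons.prems(1)] .
  show ?case
    using Cons.IH[OF z(2) Cons.prems(2) arrow_cmp[OF catD Cons.prems(3) z(1)]]
      cmp_assoc[OF catD Cons.prems(2,3) z(1)] by simp
qed auto

text \<open>Each of the four generating relations becomes an identity in \<open>D\<close>. The part
  of the zigzag before the rewritten steps is absorbed into the accumulator, and the part after them
  is evaluated from equal accumulators.\<close>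

lemma val_reduce:
  assumes "zz_reduce C S x y p q" "arrow D e w (omap \<Phi> x)"
  shows "val e p = val e q"
  using assms(1)
proof cases
  case (ident z a b)
  then have a: "zigzag C S x a z" using arrow_ident[OF cat ident(3)]
    by (auto simp: zigzag_append arrow_def)
  show ?thesis
    using cmp_ident_left[OF catD val_arrow[OF a assms(2)]] ident
    by (simp add: val_append functor_ident[OF func])
next
  case (cmp a f g b)
  then obtain z where z: "zigzag C S x a z" "arrow C f z (tgt C f)" "arrow C g (tgt C f) (tgt C g)"
    by (auto simp: zigzag_append arrow_def)
  have "cmp D (amap \<Phi> g) (cmp D (amap \<Phi> f) (val e a)) = cmp D (amap \<Phi> (cmp C g f)) (val e a)"
    using cmp_assoc[OF catD val_arrow[OF z(1) assms(2)] functor_arrow[OF func z(2)] functor_arrow[OF func z(3)]]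
      functor_cmp[OF func z(2,3)] by simp
  then show ?thesis using cmp by (simp add: val_append)
next
  case (fwd_bwd s a b)
  then obtain z where z: "zigzag C S x a z" "arrow C s z (tgt C s)"
    by (auto simp: zigzag_append arrow_def)
  note s = functor_arrow[OF func z(2)] and i = inv_arr[OF inverts[OF fwd_bwd(3)] functor_arrow[OF func z(2)]]
  have "cmp D (inv_arr D (amap \<Phi> s)) (cmp D (amap \<Phi> s) (val e a)) = val e a"
    using cmp_assoc[OF catD val_arrow[OF z(1) assms(2)] s i(1)] i(2)
      cmp_ident_left[OF catD val_arrow[OF z(1) assms(2)]] by simp
  then show ?thesis using fwd_bwd by (simp add: val_append)
next
  case (bwd_fwd s a b)
  then obtain z where z: "zigzag C S x a z" "arrow C s (src C s) z"
    by (auto simp: zigzag_append arrow_def)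
  note s = functor_arrow[OF func z(2)] and i = inv_arr[OF inverts[OF bwd_fwd(3)] functor_arrow[OF func z(2)]]
  have "cmp D (amap \<Phi> s) (cmp D (inv_arr D (amap \<Phi> s)) (val e a)) = val e a"
    using cmp_assoc[OF catD val_arrow[OF z(1) assms(2)] i(1) s] i(3)
      cmp_ident_left[OF catD val_arrow[OF z(1) assms(2)]] by simp
  then show ?thesis using bwd_fwd by (simp add: val_append)
qed

lemma val_equiv:
  assumes "equivclp (zz_reduce C S x y) p q" "arrow D e w (omap \<Phi> x)"
  shows "val e p = val e q"
  using assms(1) by (induction rule: equivclp_induct) (use val_reduce[OF _ assms(2)] in auto)

lemma omap_induced [simp]: "omap \<Phi>B x = omap \<Phi> x"
  by (simp add: frac_induced_def)

lemma amap_zz_arr: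
  assumes "zigzag C S x p y"
  shows "amap \<Phi>B (zz_arr x p y) = val (ident D (omap \<Phi> x)) p"
  using val_equiv[OF some_zz_class(2)[OF assms] arrow_ident[OF catD functor_obj[OF func]]]
    zigzag_objs[OF assms]
  by (simp add: frac_induced_def zz_arr_def)

lemma induced_Q:
  assumes "arrow C f x y" shows "amap \<Phi>B (amap Q f) = amap \<Phi> f"
  using amap_zz_arr[OF zigzag_Fwd[OF assms]] cmp_ident_right[OF catD functor_arrow[OF func assms]]
  by (simp add: amap_Q[OF assms])

lemma functor_induced: "is_functor B D \<Phi>B"
proof (rule is_functorI)
  fix x assume "x \<in> obj B"
  then have "zigzag C S x [] x" by simp
  then show "amap \<Phi>B (ident B x) = ident D (omap \<Phi>B x)"
    by (simp add: ident_B amap_zz_arr)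
next
  have ar: "arrow D (val (ident D (omap \<Phi> x)) p) (omap \<Phi> x) (omap \<Phi> y)"
    and ob: "arrow D (ident D (omap \<Phi> y)) (omap \<Phi> y) (omap \<Phi> y)" if "zigzag C S x p y" for x y p
    using that val_arrow arrow_ident[OF catD functor_obj[OF func]] zigzag_objs[OF that] by blast+
  {
    fix f x y assume "arrow B f x y"
    then show "arrow D (amap \<Phi>B f) (omap \<Phi>B x) (omap \<Phi>B y)"
      by (auto simp: arrow_B amap_zz_arr intro: ar)
  next
    fix f g x y z assume "arrow B f x y" "arrow B g y z"
    then obtain p q where p: "zigzag C S x p y" "f = zz_arr x p y" and q: "zigzag C S y q z" "g = zz_arr y q z"
      by (auto simp: arrow_B)
    have pq: "zigzag C S x (p @ q) z" using p q by (auto simp: zigzag_append)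
    show "amap \<Phi>B (cmp B g f) = cmp D (amap \<Phi>B g) (amap \<Phi>B f)"
      using val_cmp[OF q(1) ar[OF p(1)] ob[OF p(1)]] cmp_ident_left[OF catD ar[OF p(1)]]
      by (simp add: p q cmp_zz_arr pq amap_zz_arr val_append)
  }
qed (auto simp: category_B catD functor_obj[OF func])

end

lemma cocone_arrow:
  "cocone C J D c t \<longleftrightarrow> is_functor J C D \<and> c \<in> obj C \<and>
     (\<forall>j\<in>obj J. arrow C (t j) (omap D j) c) \<and>
     (\<forall>k j j'. arrow J k j j' \<longrightarrow> cmp C (t j') (amap D k) = t j)"
  unfolding cocone_def arrow_def by auto

section \<open>Left fractions for the class inverted by a functor\<close>

locale functor_fractions =
  fixes C :: "('o, 'a) cat" and D :: "('p, 'b) cat" and H :: "('o, 'a, 'p, 'b) functr"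
  assumes functor_H: "is_functor C D H"

sublocale functor_fractions \<subseteq> inverting_functor C "inverted_arrows C D H" D H
  by unfold_locales (auto simp: inverted_arrows_def functor_H functor_categories[OF functor_H])

context functor_fractions
begin

abbreviation "S \<equiv> inverted_arrows C D H"
abbreviation "HB \<equiv> frac_induced D H"

lemma S_iff: "arrow C s x y \<Longrightarrow> s \<in> S \<longleftrightarrow> iso_arr D (amap H s)"
  by (auto simp: inverted_arrows_def arrow_def)

lemma S_cmp: "s \<in> S \<Longrightarrow> t \<in> S \<Longrightarrow> arrow C s x y \<Longrightarrow> arrow C t y z \<Longrightarrow> cmp C t s \<in> S"
  using iso_cmp[OF catD _ functor_arrow[OF func] _ functor_arrow[OF func], of s x y t z]
  by (simp add: S_iff[OF arrow_cmp[OF cat]] functor_cmp[OF func] inverts)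

end

text \<open>The condition \<open>equalized\<close> asks more than the cancellation axiom of a
  calculus of left fractions: the two arrows need only have the same image under \<open>H\<close>.
  Cancellation gives the calculus; the stronger form gives faithfulness.\<close>

locale left_fractions = functor_fractions C D H
  for C :: "('o, 'a) cat" and D :: "('p, 'b) cat" and H +
  assumes ore: "s \<in> S \<Longrightarrow> arrow C s x y \<Longrightarrow> arrow C u x z \<Longrightarrow>
      \<exists>w s' u'. s' \<in> S \<and> arrow C s' z w \<and> arrow C u' y w \<and> cmp C u' s = cmp C s' u"
    and equalized: "arrow C f x y \<Longrightarrow> arrow C g x y \<Longrightarrow> amap H f = amap H g \<Longrightarrow>
      \<exists>w t. t \<in> S \<and> arrow C t y w \<and> cmp C t f = cmp C t g"
begin

theorem left_calculus: "left_calculus_of_fractions C S"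
  unfolding left_calculus_of_fractions_def
proof (intro conjI ballI impI)
  fix x assume "x \<in> obj C"
  then show "ident C x \<in> S"
    using iso_ident[OF catD functor_obj[OF func]]
    by (simp add: S_iff[OF arrow_ident[OF cat]] functor_ident[OF func])
next
  fix s t assume "s \<in> S" "t \<in> S" "tgt C s = src C t"
  then show "cmp C t s \<in> S"
    using S_cmp[OF _ _ S_arrow, of s t "tgt C t"] S_arrow[of t] by simp
next
  fix s u assume "s \<in> S" "u \<in> arr C" "src C u = src C s"
  then obtain w s' u' where "s' \<in> S" "arrow C s' (tgt C u) w" "arrow C u' (tgt C s) w" "cmp C u' s = cmp C s' u"
    using ore[OF _ S_arrow, of s u "tgt C u"] by (auto simp: arrow_def)
  then show "\<exists>s'\<in>S. \<exists>u'\<in>arr C. src C u' = tgt C s \<and> src C s' = tgt C u \<and> tgt C u' = tgt C s' \<and>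
           cmp C u' s = cmp C s' u"
    unfolding arrow_def by metis
next
  fix f g s
  assume fg: "f \<in> arr C" "g \<in> arr C" "src C f = src C g" "tgt C f = tgt C g" "cmp C f s = cmp C g s"
    and s: "s \<in> S" "tgt C s = src C f"
  then have a: "arrow C s (src C s) (src C f)" "arrow C f (src C f) (tgt C f)" "arrow C g (src C f) (tgt C f)"
    using S_arrow[OF s(1)] by (auto simp: arrow_def)
  have "cmp D (amap H f) (amap H s) = cmp D (amap H g) (amap H s)"
    using fg(5) functor_cmp[OF func a(1,2)] functor_cmp[OF func a(1,3)] by simp
  then have "amap H f = amap H g"
    using iso_cancel_right[OF catD inverts[OF s(1)] functor_arrow[OF func a(1)]
        functor_arrow[OF func a(2)] functor_arrow[OF func a(3)]] by simp
  then obtain w t where "t \<in> S" "arrow C t (tgt C f) w" "cmp C t f = cmp C t g"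
    using equalized[OF a(2,3)] by blast
  then show "\<exists>t\<in>S. src C t = tgt C f \<and> cmp C t f = cmp C t g"
    by (auto simp: arrow_def)
qed (auto simp: cat S_sub)

text \<open>A fraction becomes an arrow of \<open>C\<close> after composition with some
  \<open>s\<close> in \<open>S\<close>. In the induction a formal inverse at the source end is moved
  to the target end by an Ore square.\<close>

lemma left_fraction:
  assumes "arrow B b x y"
  obtains w s u where "s \<in> S" "arrow C s y w" "arrow C u x w" "cmp B (amap Q s) b = amap Q u"
proof -
  note functor_Q[THEN functor_arrow, simplified]
  from assms have "\<exists>w s u. s \<in> S \<and> arrow C s y w \<and> arrow C u x w \<and> cmp B (amap Q s) b = amap Q u"
  proof (induct rule: fraction_induct)
    case ident
    note i = arrow_ident[OF cat ident]
    have "ident C y \<in> S" using left_calculus ident by (auto simp: left_calculus_of_fractions_def)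
    moreover have "cmp B (amap Q (ident C y)) (ident B y) = amap Q (ident C y)"
      using cmp_ident_right[OF category_B functor_arrow[OF functor_Q i]] by simp
    ultimately show ?case using i by blast
  next
    case (fwd b f x z)
    then obtain w s u where s: "s \<in> S" "arrow C s y w" "arrow C u z w" "cmp B (amap Q s) b = amap Q u"
      by blast
    note a = functor_arrow[OF functor_Q fwd(3)] functor_arrow[OF functor_Q s(2)]
    have "cmp B (amap Q s) (cmp B b (amap Q f)) = amap Q (cmp C u f)"
      using cmp_assoc[OF category_B a(1) _ a(2), of b] fwd(1) s(4) functor_cmp[OF functor_Q fwd(3) s(3)] by simp
    then show ?case using s arrow_cmp[OF cat fwd(3) s(3)] by blast
  next
    case (bwd b t x z)
    then obtain w s u where s: "s \<in> S" "arrow C s y w" "arrow C u z w" "cmp B (amap Q s) b = amap Q u"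
      by blast
    \<comment> \<open>In \<open>B\<close> the square turns \<open>u\<close> after the inverse of
      \<open>t\<close> into the inverse of \<open>s'\<close> after \<open>u'\<close>.\<close>
    obtain w' s' u' where s': "s' \<in> S" "arrow C s' w w'" "arrow C u' x w'" "cmp C u' t = cmp C s' u"
      using ore[OF bwd(3,4) s(3)] by blast
    let ?t = "inv_arr B (amap Q t)"
    note a = functor_arrow[OF functor_Q s(2)] functor_arrow[OF functor_Q s'(2)] functor_arrow[OF functor_Q s(3)]
      functor_arrow[OF functor_Q s'(3)] functor_arrow[OF functor_Q bwd(4)]
    note a = a[unfolded omap_Q]
    note t = inv_arr[OF iso_Q[OF bwd(3)] a(5)]
    have "cmp B (amap Q (cmp C s' s)) (cmp B b ?t) = cmp B (cmp B (amap Q s') (cmp B (amap Q s) b)) ?t"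
      using functor_cmp[OF functor_Q s(2) s'(2)] cmp_assoc[OF category_B t(1) bwd(1) arrow_cmp[OF category_B a(1,2)]]
        cmp_assoc[OF category_B bwd(1) a(1,2)] by simp
    also have "\<dots> = cmp B (cmp B (amap Q u') (amap Q t)) ?t"
      using s(4) s'(4) functor_cmp[OF functor_Q s(3) s'(2)] functor_cmp[OF functor_Q bwd(4) s'(3)] by simp
    also have "\<dots> = amap Q u'"
      using cmp_assoc[OF category_B t(1) a(5,4)] t(3) cmp_ident_right[OF category_B a(4)] by simp
    finally show ?case using S_cmp[OF s(1) s'(1) s(2) s'(2)] arrow_cmp[OF cat s(2) s'(2)] s'(3) by blast
  qed
  then show ?thesis using that by blast
qed

text \<open>\<open>S\<close> contains every arrow that \<open>H\<close> inverts. When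
  \<open>b\<close> followed by \<open>s\<close> equals \<open>u\<close>, the arrow
  \<open>H u\<close> is invertible together with \<open>HB b\<close>, so \<open>u\<close> belongs to
  \<open>S\<close> and \<open>b\<close> is a quotient of two invertible arrows.\<close>

theorem conservative_induced: "conservative B D HB"
  unfolding conservative_def
proof (intro conjI functor_induced ballI iffI)
  fix b assume "b \<in> arr B" and iso: "iso_arr D (amap HB b)"
  then have b: "arrow B b (src B b) (tgt B b)" by (simp add: arrow_def)
  obtain w s u where s: "s \<in> S" "arrow C s (tgt B b) w" "arrow C u (src B b) w" "cmp B (amap Q s) b = amap Q u"
    using left_fraction[OF b] .
  have "cmp D (amap H s) (amap HB b) = amap H u"
    using functor_cmp[OF functor_induced b functor_arrow[OF functor_Q s(2), simplified]]
    by (simp add: s(4) induced_Q[OF s(2)] induced_Q[OF s(3)])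
  then have "u \<in> S"
    using iso_cmp[OF catD iso functor_arrow[OF functor_induced b] inverts[OF s(1)]] functor_arrow[OF func s(2)]
    by (simp add: S_iff[OF s(3)])
  then show "iso_arr B b"
    using iso_two_of_three_left[OF category_B iso_Q[OF s(1)] functor_arrow[OF functor_Q s(2), simplified] b] s(4)
      iso_Q by simp
qed (rule functor_iso[OF functor_induced])

text \<open>Two parallel fractions are brought to a common denominator. Their numerators have the
  same image under \<open>H\<close>, hence are equalized by an arrow of \<open>S\<close>, which can
  be cancelled in \<open>B\<close>.\<close>

theorem faithful_induced: "faithful B D HB"
  unfolding faithful_def
proof (intro conjI functor_induced ballI impI)
  fix b c assume "b \<in> arr B" "c \<in> arr B" "src B b = src B c" "tgt B b = tgt B c" and eq: "amap HB b = amap HB c"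
  then obtain x y where b: "arrow B b x y" and c: "arrow B c x y" by (auto simp: arrow_def)
  note Q_arrow = functor_arrow[OF functor_Q, simplified] and Q_cmp = functor_cmp[OF functor_Q]
  obtain w s u where s: "s \<in> S" "arrow C s y w" "arrow C u x w" "cmp B (amap Q s) b = amap Q u"
    using left_fraction[OF b] .
  obtain w' t v where t: "t \<in> S" "arrow C t y w'" "arrow C v x w'" "cmp B (amap Q t) c = amap Q v"
    using left_fraction[OF c] .
  obtain z t' s' where r: "t' \<in> S" "arrow C t' w' z" "arrow C s' w z" "cmp C s' s = cmp C t' t"
    using ore[OF s(1,2) t(2)] by blast
  \<comment> \<open>A common denominator: the Ore square makes it equal to \<open>cmp C s' s\<close>
    as well.\<close>
  define r where "r = cmp C t' t"
  have r_S: "r \<in> S" and r_arrow: "arrow C r y z"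
    using S_cmp[OF t(1) r(1) t(2) r(2)] arrow_cmp[OF cat t(2) r(2)] by (auto simp: r_def)
  have rb: "cmp B (amap Q r) b = amap Q (cmp C s' u)"
    using cmp_assoc[OF category_B b Q_arrow[OF s(2)] Q_arrow[OF r(3)]] s(4) Q_cmp[OF s(2) r(3)] Q_cmp[OF s(3) r(3)]
    by (simp add: r_def flip: r(4))
  have rc: "cmp B (amap Q r) c = amap Q (cmp C t' v)"
    using cmp_assoc[OF category_B c Q_arrow[OF t(2)] Q_arrow[OF r(2)]] t(4) Q_cmp[OF t(2) r(2)] Q_cmp[OF t(3) r(2)]
    by (simp add: r_def)
  note su = arrow_cmp[OF cat s(3) r(3)] and tv = arrow_cmp[OF cat t(3) r(2)]
  have "amap H (cmp C s' u) = amap H (cmp C t' v)"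
    using functor_cmp[OF functor_induced b Q_arrow[OF r_arrow]] functor_cmp[OF functor_induced c Q_arrow[OF r_arrow]]
    by (simp add: rb rc induced_Q[OF su] induced_Q[OF tv] eq)
  then obtain w'' q where q: "q \<in> S" "arrow C q z w''" "cmp C q (cmp C s' u) = cmp C q (cmp C t' v)"
    using equalized[OF su tv] by blast
  have "amap Q (cmp C s' u) = amap Q (cmp C t' v)"
    using iso_cancel_left[OF category_B iso_Q[OF q(1)] Q_arrow[OF q(2)] Q_arrow[OF su] Q_arrow[OF tv]]
      Q_cmp[OF su q(2)] Q_cmp[OF tv q(2)] q(3) by simp
  then show "b = c"
    using iso_cancel_left[OF category_B iso_Q[OF r_S] Q_arrow[OF r_arrow] b c] rb rc by simp
qed

end

section \<open>The adjunction on the category of fractions\<close>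

locale adjunction = functor_fractions C D H
  for C :: "('o, 'a) cat" and D :: "('p, 'b) cat" and H +
  fixes L :: "('p, 'b, 'o, 'a) functr" and \<eta> :: "'o \<Rightarrow> 'a" and \<epsilon> :: "'p \<Rightarrow> 'b"
  assumes functor_L: "is_functor D C L"
    and unit: "x \<in> obj C \<Longrightarrow> arrow C (\<eta> x) x (omap L (omap H x))"
    and unit_natural: "arrow C f x y \<Longrightarrow> cmp C (\<eta> y) f = cmp C (amap L (amap H f)) (\<eta> x)"
    and counit: "v \<in> obj D \<Longrightarrow> arrow D (\<epsilon> v) (omap H (omap L v)) v"
    and counit_natural: "arrow D g v w \<Longrightarrow> cmp D (\<epsilon> w) (amap H (amap L g)) = cmp D g (\<epsilon> v)"
    and triangle_H: "x \<in> obj C \<Longrightarrow> cmp D (\<epsilon> (omap H x)) (amap H (\<eta> x)) = ident D (omap H x)"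
    and triangle_L: "v \<in> obj D \<Longrightarrow> cmp C (amap L (\<epsilon> v)) (\<eta> (omap L v)) = ident C (omap L v)"
begin

lemma functor_QL: "is_functor D B (Q \<circ>\<^sub>F L)"
  by (rule is_functor_comp[OF functor_L functor_Q])

lemma functor_QLH: "is_functor B B ((Q \<circ>\<^sub>F L) \<circ>\<^sub>F HB)"
  by (rule is_functor_comp[OF functor_induced functor_QL])

lemmas Q_arrow = functor_arrow[OF functor_Q, simplified]
lemmas Q_cmp = functor_cmp[OF functor_Q]
lemmas QLH_arrow = functor_arrow[OF functor_QLH, simplified]

lemma Q_unit: "x \<in> obj C \<Longrightarrow> arrow B (amap Q (\<eta> x)) x (omap L (omap H x))"
  by (rule Q_arrow[OF unit])

lemma unit_natural_Q:
  assumes "arrow C f x y"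
  shows "cmp B (amap Q (\<eta> y)) (amap Q f) = cmp B (amap Q (amap L (amap HB (amap Q f)))) (amap Q (\<eta> x))"
proof -
  note xy = arrow_obj[OF cat assms]
  show ?thesis
    using unit_natural[OF assms] Q_cmp[OF assms unit[OF xy(2)]]
      Q_cmp[OF unit[OF xy(1)] functor_arrow[OF functor_L functor_arrow[OF func assms]]]
    by (simp add: induced_Q[OF assms])
qed

text \<open>Naturality has to be checked on generators of the category of fractions: for arrows of
  \<open>C\<close> it is naturality of the unit, and for formal inverses it follows by
  cancellation.\<close>

lemma unit_natural_fractions:
  assumes "arrow B b x y"
  shows "cmp B (amap Q (\<eta> y)) b = cmp B (amap Q (amap L (amap HB b))) (amap Q (\<eta> x))"
  using assms
proof (induct rule: fraction_induct)
  case ident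
  then show ?case
    using functor_ident[OF functor_QLH, of y] cmp_ident_right[OF category_B Q_unit[OF ident]]
      cmp_ident_left[OF category_B Q_unit[OF ident]] by simp
next
  case (fwd b f x z)
  note f = Q_arrow[OF fwd(3)] and xy = arrow_obj[OF cat fwd(3)] and y = arrow_obj[OF category_B fwd(1)]
  have "cmp B (amap Q (\<eta> y)) (cmp B b (amap Q f)) = cmp B (cmp B (amap Q (amap L (amap HB b))) (amap Q (\<eta> z))) (amap Q f)"
    using fwd(2) y(2) cmp_assoc[OF category_B f fwd(1) Q_unit] by simp
  also have "\<dots> = cmp B (amap Q (amap L (amap HB b))) (cmp B (amap Q (amap L (amap HB (amap Q f)))) (amap Q (\<eta> x)))"
    using cmp_assoc[OF category_B f Q_unit[OF xy(2)] QLH_arrow[OF fwd(1)]] unit_natural_Q[OF fwd(3)] by simp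
  also have "\<dots> = cmp B (amap Q (amap L (amap HB (cmp B b (amap Q f))))) (amap Q (\<eta> x))"
    using cmp_assoc[OF category_B Q_unit[OF xy(1)] QLH_arrow[OF f] QLH_arrow[OF fwd(1)]]
      functor_cmp[OF functor_QLH f fwd(1)] by simp
  finally show ?case .
next
  case (bwd b s x z)
  let ?s = "inv_arr B (amap Q s)"
  note s = Q_arrow[OF bwd(4)] and xy = arrow_obj[OF cat bwd(4)] and y = arrow_obj[OF category_B bwd(1)]
  note i = inv_arr[OF iso_Q[OF bwd(3)] s]
  note bs = arrow_cmp[OF category_B i(1) bwd(1)]
  have bss: "cmp B (cmp B b ?s) (amap Q s) = b"
    using cmp_assoc[OF category_B s i(1) bwd(1)] i(2) cmp_ident_right[OF category_B bwd(1)] by simp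
  \<comment> \<open>Composition with the invertible \<open>Q s\<close> on the right reduces the
    claim for \<open>b\<close> after the inverse of \<open>s\<close> to the claims for
    \<open>b\<close> and for \<open>s\<close>.\<close>
  have "cmp B (cmp B (amap Q (\<eta> y)) (cmp B b ?s)) (amap Q s) = cmp B (amap Q (\<eta> y)) b"
    using cmp_assoc[OF category_B s bs Q_unit] y(2) bss by simp
  also have "\<dots> = cmp B (amap Q (amap L (amap HB (cmp B (cmp B b ?s) (amap Q s))))) (amap Q (\<eta> z))"
    using bwd(2) bss by simp
  also have "\<dots> = cmp B (amap Q (amap L (amap HB (cmp B b ?s)))) (cmp B (amap Q (amap L (amap HB (amap Q s)))) (amap Q (\<eta> z)))"
    using cmp_assoc[OF category_B Q_unit[OF xy(1)] QLH_arrow[OF s] QLH_arrow[OF bs]]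
      functor_cmp[OF functor_QLH s bs] by simp
  also have "\<dots> = cmp B (cmp B (amap Q (amap L (amap HB (cmp B b ?s)))) (amap Q (\<eta> x))) (amap Q s)"
    using cmp_assoc[OF category_B s Q_unit[OF xy(2)] QLH_arrow[OF bs]] unit_natural_Q[OF bwd(4)] by simp
  finally show ?case
    using y(2) iso_cancel_right[OF category_B iso_Q[OF bwd(3)] s arrow_cmp[OF category_B bs Q_unit]
        arrow_cmp[OF category_B Q_unit[OF xy(2)] QLH_arrow[OF bs]]] by simp
qed

text \<open>The adjunct of \<open>\<phi>\<close> for the adjunction between \<open>HB\<close> and
  \<open>Q\<close> after \<open>L\<close>.\<close>

definition transpose :: "'o \<Rightarrow> 'b \<Rightarrow> ('o, 'a) frac" where
  "transpose x \<phi> = cmp B (amap Q (amap L \<phi>)) (amap Q (\<eta> x))"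

lemma transpose_arrow:
  "x \<in> obj C \<Longrightarrow> arrow D \<phi> (omap H x) v \<Longrightarrow> arrow B (transpose x \<phi>) x (omap L v)"
  unfolding transpose_def
  by (rule arrow_cmp[OF category_B Q_unit Q_arrow[OF functor_arrow[OF functor_L]]])

lemma transpose_natural:
  assumes b: "arrow B b x y" and \<phi>: "arrow D \<phi> (omap H y) v"
  shows "cmp B (transpose y \<phi>) b = transpose x (cmp D \<phi> (amap HB b))"
proof -
  note xy = arrow_obj[OF category_B b, simplified]
  note Hb = functor_arrow[OF functor_induced b, simplified]
  note L\<phi> = functor_arrow[OF functor_QL \<phi>, simplified]
  have "cmp B (transpose y \<phi>) b = cmp B (amap Q (amap L \<phi>)) (cmp B (amap Q (amap L (amap HB b))) (amap Q (\<eta> x)))"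
    using cmp_assoc[OF category_B b Q_unit[OF xy(2)] L\<phi>] unit_natural_fractions[OF b]
    by (simp add: transpose_def)
  also have "\<dots> = transpose x (cmp D \<phi> (amap HB b))"
    using cmp_assoc[OF category_B Q_unit[OF xy(1)] QLH_arrow[OF b] L\<phi>] functor_cmp[OF functor_QL Hb \<phi>]
    by (simp add: transpose_def)
  finally show ?thesis .
qed

text \<open>By the triangle identity for \<open>H\<close> a map is recovered from its transpose. In
  the colimit proof this gives both the factorisation and its uniqueness.\<close>

lemma counit_transpose:
  assumes x: "x \<in> obj C" and \<phi>: "arrow D \<phi> (omap H x) v"
  shows "cmp D (\<epsilon> v) (amap HB (transpose x \<phi>)) = \<phi>"
proof -
  note v = arrow_obj[OF catD \<phi>]
  note L\<phi> = functor_arrow[OF functor_L \<phi>]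
  note H\<eta> = functor_arrow[OF func unit[OF x]]
  have t: "transpose x \<phi> = amap Q (cmp C (amap L \<phi>) (\<eta> x))"
    using Q_cmp[OF unit[OF x] L\<phi>] by (simp add: transpose_def)
  have "cmp D (\<epsilon> v) (amap HB (transpose x \<phi>)) = cmp D (cmp D (\<epsilon> v) (amap H (amap L \<phi>))) (amap H (\<eta> x))"
    unfolding t induced_Q[OF arrow_cmp[OF cat unit[OF x] L\<phi>]]
    using functor_cmp[OF func unit[OF x] L\<phi>] cmp_assoc[OF catD H\<eta> functor_arrow[OF func L\<phi>] counit[OF v(2)]]
    by simp
  also have "\<dots> = cmp D \<phi> (cmp D (\<epsilon> (omap H x)) (amap H (\<eta> x)))"
    using counit_natural[OF \<phi>] cmp_assoc[OF catD H\<eta> counit[OF v(1)] \<phi>] by simp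
  also have "\<dots> = \<phi>"
    using triangle_H[OF x] cmp_ident_right[OF catD \<phi>] by simp
  finally show ?thesis .
qed

text \<open>Left adjoints preserve colimits: a cocone under \<open>HB\<close> after \<open>K\<close>
  with vertex \<open>v\<close> is transposed to a cocone under \<open>K\<close> with vertex
  \<open>omap L v\<close>, factored there and transposed back.\<close>

theorem induced_preserves_colimits:
  fixes J :: "('j, 'k) cat"
  assumes "colimit B J K c t"
  shows "colimit D J (HB \<circ>\<^sub>F K) (omap HB c) (\<lambda>j. amap HB (t j))"
proof -
  have K: "is_functor J B K" and c: "c \<in> obj C" and t: "\<And>j. j \<in> obj J \<Longrightarrow> arrow B (t j) (omap K j) c"
    and tk: "\<And>k j j'. arrow J k j j' \<Longrightarrow> cmp B (t j') (amap K k) = t j"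
    and univ: "\<And>c' t'. cocone B J K c' t' \<Longrightarrow>
      \<exists>!u. arrow B u c c' \<and> (\<forall>j\<in>obj J. cmp B u (t j) = t' j)"
    using assms unfolding colimit_def cocone_arrow by (auto simp: arrow_def)
  note catJ = functor_categories(1)[OF K]
  note Kobj = functor_obj[OF K, simplified]
  have "cocone D J (HB \<circ>\<^sub>F K) (omap HB c) (\<lambda>j. amap HB (t j))"
    unfolding cocone_arrow
  proof (intro conjI allI ballI impI)
    fix k j j' assume k: "arrow J k j j'"
    show "cmp D (amap HB (t j')) (amap (HB \<circ>\<^sub>F K) k) = amap HB (t j)"
      using functor_cmp[OF functor_induced functor_arrow[OF K k] t] tk[OF k] arrow_obj[OF catJ k] by simp
  next
    show "is_functor J D (HB \<circ>\<^sub>F K)" by (rule is_functor_comp[OF K functor_induced])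
    show "omap HB c \<in> obj D" using functor_obj[OF func c] by simp
    show "arrow D (amap HB (t j)) (omap (HB \<circ>\<^sub>F K) j) (omap HB c)" if "j \<in> obj J" for j
      using functor_arrow[OF functor_induced t[OF that]] by simp
  qed
  moreover have "\<exists>!u. arrow D u (omap HB c) v \<and> (\<forall>j\<in>obj J. cmp D u (amap HB (t j)) = t' j)"
    if "cocone D J (HB \<circ>\<^sub>F K) v t'" for v t'
  proof -
    have v: "v \<in> obj D" and t': "\<And>j. j \<in> obj J \<Longrightarrow> arrow D (t' j) (omap H (omap K j)) v"
      and t'k: "\<And>k j j'. arrow J k j j' \<Longrightarrow> cmp D (t' j') (amap HB (amap K k)) = t' j"
      using that unfolding cocone_arrow by auto
    have "cocone B J K (omap L v) (\<lambda>j. transpose (omap K j) (t' j))"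
      unfolding cocone_arrow
    proof (intro conjI allI ballI impI)
      fix k j j' assume k: "arrow J k j j'"
      show "cmp B (transpose (omap K j') (t' j')) (amap K k) = transpose (omap K j) (t' j)"
        using transpose_natural[OF functor_arrow[OF K k] t'] t'k[OF k] arrow_obj[OF catJ k] by simp
    next
      show "is_functor J B K" by (fact K)
      show "omap L v \<in> obj B" using functor_obj[OF functor_L v] by simp
      show "arrow B (transpose (omap K j) (t' j)) (omap K j) (omap L v)" if "j \<in> obj J" for j
        by (rule transpose_arrow[OF Kobj[OF that] t'[OF that]])
    qed
    from univ[OF this] obtain u
      where u': "arrow B u c (omap L v) \<and> (\<forall>j\<in>obj J. cmp B u (t j) = transpose (omap K j) (t' j))"
        and uniq: "\<And>w. arrow B w c (omap L v) \<and> (\<forall>j\<in>obj J. cmp B w (t j) = transpose (omap K j) (t' j)) \<Longrightarrow> w = u"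
      by (rule ex1E) blast
    from u' have u: "arrow B u c (omap L v)"
        "\<And>j. j \<in> obj J \<Longrightarrow> cmp B u (t j) = transpose (omap K j) (t' j)"
      by auto
    let ?u = "cmp D (\<epsilon> v) (amap HB u)"
    note Hu = functor_arrow[OF functor_induced u(1), simplified]
    show ?thesis
    proof (rule ex1I[of _ ?u], intro conjI ballI)
      show "arrow D ?u (omap HB c) v"
        using arrow_cmp[OF catD Hu counit[OF v]] by simp
      fix j assume j: "j \<in> obj J"
      have "cmp D ?u (amap HB (t j)) = cmp D (\<epsilon> v) (amap HB (cmp B u (t j)))"
        using cmp_assoc[OF catD functor_arrow[OF functor_induced t[OF j], simplified] Hu counit[OF v]]
          functor_cmp[OF functor_induced t[OF j] u(1)] by simp
      then show "cmp D ?u (amap HB (t j)) = t' j"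
        using u(2)[OF j] counit_transpose[OF Kobj[OF j] t'[OF j]] by simp
    next
      fix w assume w: "arrow D w (omap HB c) v \<and> (\<forall>j\<in>obj J. cmp D w (amap HB (t j)) = t' j)"
      then have "arrow D w (omap H c) v" by simp
      moreover have "transpose c w = u"
      proof (intro uniq conjI ballI)
        show "arrow B (transpose c w) c (omap L v)" using transpose_arrow[OF c] w by simp
        show "cmp B (transpose c w) (t j) = transpose (omap K j) (t' j)" if "j \<in> obj J" for j
          using transpose_natural[OF t[OF that], of w v] w that by simp
      qed
      ultimately show "w = ?u" using counit_transpose[OF c] by metis
    qed
  qed
  ultimately show ?thesis
    unfolding colimit_def by (auto simp: arrow_def)
qed

end

section \<open>Equivalences from an invertible counit\<close>

context adjunction
begin

text \<open>By the triangle identity \<open>H\<close> of the unit is a one-sided inverse of the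
  invertible counit, hence itself invertible.\<close>

lemma triangle_iso:
  assumes "\<And>v. v \<in> obj D \<Longrightarrow> iso_arr D (\<epsilon> v)" "x \<in> obj C"
  shows "\<eta> x \<in> S"
proof -
  note a = functor_arrow[OF func unit[OF assms(2)]] and Hx = functor_obj[OF func assms(2)]
  have "iso_arr D (amap H (\<eta> x))"
    using iso_two_of_three_left[OF catD assms(1)[OF Hx] counit[OF Hx] a] triangle_H[OF assms(2)]
      iso_ident[OF catD Hx] by simp
  then show ?thesis by (simp add: S_iff[OF unit[OF assms(2)]])
qed

text \<open>The unit becomes invertible in \<open>B\<close>, and its inverse gives one natural
  isomorphism; the counit gives the other.\<close>

theorem quasi_inverse_induced:
  assumes iso: "\<And>v. v \<in> obj D \<Longrightarrow> iso_arr D (\<epsilon> v)"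
  shows "quasi_inverse B D HB (Q \<circ>\<^sub>F L)"
  unfolding quasi_inverse_def
proof (intro conjI functor_induced functor_QL)
  let ?i = "\<lambda>x. inv_arr B (amap Q (\<eta> x))"
  have \<eta>: "iso_arr B (amap Q (\<eta> x))" if "x \<in> obj C" for x
    using iso_Q[OF triangle_iso[OF iso that]] .
  have i: "arrow B (?i x) (omap L (omap H x)) x" "cmp B (?i x) (amap Q (\<eta> x)) = ident B x"
    "cmp B (amap Q (\<eta> x)) (?i x) = ident B (omap L (omap H x))" if "x \<in> obj C" for x
    using inv_arr[OF \<eta>[OF that] Q_unit[OF that]] .
  have "cmp B (?i y) (amap Q (amap L (amap HB b))) = cmp B b (?i x)" if b: "arrow B b x y" for b x y
  proof -
    note xy = arrow_obj[OF category_B b, simplified]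
    \<comment> \<open>After composition with the invertible \<open>Q (\<eta> x)\<close> both sides
      equal \<open>b\<close>, by naturality of the unit on fractions.\<close>
    have "cmp B (cmp B (?i y) (amap Q (amap L (amap HB b)))) (amap Q (\<eta> x)) = cmp B (?i y) (cmp B (amap Q (\<eta> y)) b)"
      using cmp_assoc[OF category_B Q_unit[OF xy(1)] QLH_arrow[OF b] i(1)[OF xy(2)]]
        unit_natural_fractions[OF b] by simp
    also have "\<dots> = b"
      using cmp_assoc[OF category_B b Q_unit[OF xy(2)] i(1)[OF xy(2)]] i(2)[OF xy(2)] cmp_ident_left[OF category_B b]
      by simp
    also have "\<dots> = cmp B (cmp B b (?i x)) (amap Q (\<eta> x))"
      using cmp_assoc[OF category_B Q_unit[OF xy(1)] i(1)[OF xy(1)] b] i(2)[OF xy(1)] cmp_ident_right[OF category_B b]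
      by simp
    finally show ?thesis
      using iso_cancel_right[OF category_B \<eta>[OF xy(1)] Q_unit[OF xy(1)]
          arrow_cmp[OF category_B QLH_arrow[OF b] i(1)[OF xy(2)]] arrow_cmp[OF category_B i(1)[OF xy(1)] b]]
      by simp
  qed
  then have "cmp B (?i (tgt B b)) (amap Q (amap L (amap HB b))) = cmp B b (?i (src B b))" if "b \<in> arr B" for b
    using that by (simp add: arrow_def)
  then show "naturally_isomorphic B B ((Q \<circ>\<^sub>F L) \<circ>\<^sub>F HB) id_functor"
    unfolding naturally_isomorphic_def using i(1) iso_inv[OF \<eta> Q_unit]
    by (intro exI[of _ ?i]) (auto simp: arrow_def)
next
  have "cmp D (\<epsilon> w) (amap HB (amap Q (amap L g))) = cmp D g (\<epsilon> v)" if g: "arrow D g v w" for g v w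
    using counit_natural[OF g] induced_Q[OF functor_arrow[OF functor_L g]] by simp
  then have "cmp D (\<epsilon> (tgt D g)) (amap HB (amap Q (amap L g))) = cmp D g (\<epsilon> (src D g))" if "g \<in> arr D" for g
    using that by (simp add: arrow_def)
  then show "naturally_isomorphic D D (HB \<circ>\<^sub>F (Q \<circ>\<^sub>F L)) id_functor"
    unfolding naturally_isomorphic_def using iso counit
    by (intro exI[of _ \<epsilon>]) (auto simp: arrow_def)
qed

text \<open>Both functors respect the full subcategories, so the whole adjunction restricts and the
  previous theorem applies to the restriction. What remains is the comparison with the functor
  \<open>I\<close>, by induction on fractions.\<close>

theorem equivalence_restricts_full:
  assumes iso: "\<And>v. v \<in> obj D \<Longrightarrow> iso_arr D (\<epsilon> v)"
    and PR: "\<And>x. x \<in> obj C \<Longrightarrow> P x \<Longrightarrow> R (omap H x)"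
    and RP: "\<And>v. v \<in> obj D \<Longrightarrow> R v \<Longrightarrow> P (omap L v)"
  shows "equivalence_restricts C S D H L P R"
proof -
  let ?C = "full_subcat C P" and ?D = "full_subcat D R"
  have fH: "is_functor ?C ?D H" and fL: "is_functor ?D ?C L"
    using functor_full_subcat[OF func] functor_full_subcat[OF functor_L] PR RP by auto
  interpret R: adjunction ?C ?D H L \<eta> \<epsilon>
    by unfold_locales
      (auto simp: fH fL arrow_full_subcat functor_obj[OF func] functor_obj[OF functor_L] PR RP
        unit counit unit_natural counit_natural triangle_H triangle_L)
  \<comment> \<open>By fullness an arrow of the subcategory is inverted by \<open>H\<close> in the
    small target exactly when it is in the large one, so the class in the statement is the class of
    the restricted functor.\<close>
  have S': "S \<inter> arr ?C = R.S"
    using iso_full_subcat[OF functor_arrow[OF fH arrow_self]]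
    by (auto simp: inverted_arrows_def full_subcat_def)
  have iso': "iso_arr ?D (\<epsilon> v)" if "v \<in> obj ?D" for v
    using that iso R.counit[OF that] by (simp add: iso_full_subcat)
  have q: "quasi_inverse R.B ?D R.HB (R.Q \<circ>\<^sub>F L)"
    using iso' by (rule R.quasi_inverse_induced)
  have fQ: "is_functor ?C B Q"
    using functor_Q category_full_subcat[OF cat]
    by (auto intro!: is_functorI simp: arrow_full_subcat category_B functor_ident[OF functor_Q, simplified]
        Q_arrow Q_cmp)
  \<comment> \<open>\<open>Q\<close> restricted to the subcategory inverts \<open>R.S\<close>; the
    functor \<open>I\<close> of the statement is the one induced by it.\<close>
  interpret I: inverting_functor ?C R.S B Q
    using iso_Q S' by unfold_locales (auto simp: fQ)
  have "amap R.HB b = amap HB (amap (frac_induced B Q) b)" if "arrow R.B b x y" for b x y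
    using that
  proof (induct rule: R.fraction_induct)
    case ident
    then show ?case
      using functor_ident[OF R.functor_induced] functor_ident[OF I.functor_induced] functor_ident[OF functor_induced]
      by simp
  next
    case (fwd b f x z)
    note f = R.Q_arrow[OF fwd(3)]
    have f': "arrow C f x z" using fwd(3) by (simp add: arrow_full_subcat)
    have "amap HB (amap (frac_induced B Q) (cmp R.B b (amap R.Q f)))
        = cmp D (amap HB (amap (frac_induced B Q) b)) (amap HB (amap Q f))"
      using functor_cmp[OF I.functor_induced f fwd(1)] I.induced_Q[OF fwd(3)]
        functor_cmp[OF functor_induced functor_arrow[OF I.functor_induced f] functor_arrow[OF I.functor_induced fwd(1)]]
      by simp
    then show ?case
      using functor_cmp[OF R.functor_induced f fwd(1)] fwd(2) R.induced_Q[OF fwd(3)] induced_Q[OF f'] by simp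
  next
    case (bwd b s x z)
    let ?s = "inv_arr R.B (amap R.Q s)"
    note s = R.arrow_inv_Q[OF bwd(3,4)]
    have s': "arrow C s z x" "s \<in> S" using bwd(3,4) S' by (auto simp: arrow_full_subcat)
    have "amap (frac_induced B Q) ?s = inv_arr B (amap Q s)"
      using functor_inv_arr[OF I.functor_induced R.iso_Q[OF bwd(3)]] I.induced_Q[OF bwd(4)] by simp
    moreover have "amap HB (inv_arr B (amap Q s)) = inv_arr D (amap H s)"
      using functor_inv_arr[OF functor_induced iso_Q[OF s'(2)]] induced_Q[OF s'(1)] by simp
    moreover have "amap R.HB ?s = inv_arr D (amap H s)"
      using functor_inv_arr[OF R.functor_induced R.iso_Q[OF bwd(3)]] R.induced_Q[OF bwd(4)]
        inv_arr_full_subcat[OF functor_arrow[OF fH bwd(4)]] by simp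
    ultimately show ?case
      using functor_cmp[OF R.functor_induced s bwd(1)] functor_cmp[OF I.functor_induced s bwd(1)] bwd(2)
        functor_cmp[OF functor_induced functor_arrow[OF I.functor_induced s] functor_arrow[OF I.functor_induced bwd(1)]]
      by simp
  qed
  then have 1: "amap R.HB b = amap HB (amap (frac_induced B Q) b)" if "b \<in> arr R.B" for b
    using arrow_self[OF that] by blast
  have 2: "amap (frac_induced B Q) (amap (R.Q \<circ>\<^sub>F L) g) = amap (Q \<circ>\<^sub>F L) g" if "g \<in> arr ?D" for g
    using I.induced_Q[OF functor_arrow[OF fL arrow_self[OF that]]] by simp
  show ?thesis
    unfolding equivalence_restricts_def Let_def S'
    using q 1 2 I.functor_induced by (auto simp: equivalence_of_categories_def)
qed

end


section \<open>Totally disconnected locally compact groups\<close>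

locale tdlc =
  fixes G :: "'g monoid" (structure) and T :: "'g topology"
  assumes tdlc: "tdlc_group G T"

sublocale tdlc \<subseteq> group G
  using tdlc by (simp add: tdlc_group_def)

context tdlc
begin

lemma topspace_T [simp]: "topspace T = carrier G"
  using tdlc by (simp add: tdlc_group_def)

lemma continuous_mult: "continuous_map (prod_topology T T) T (\<lambda>(g, h). g \<otimes> h)"
  and continuous_inv: "continuous_map T T (\<lambda>g. inv g)"
  using tdlc by (auto simp: tdlc_group_def)

lemma continuous_mult_left: "g \<in> carrier G \<Longrightarrow> continuous_map T T (\<lambda>h. g \<otimes> h)"
  using continuous_map_compose[OF _ continuous_mult, of T "\<lambda>h. (g, h)"]
  by (simp add: o_def continuous_map_pairwise)

lemma open_left_translate:
  assumes "openin T U" "g \<in> carrier G"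
  shows "openin T ((\<lambda>h. g \<otimes> h) ` U)"
proof -
  have U: "U \<subseteq> carrier G" using openin_subset[OF assms(1)] by simp
  have "(\<lambda>h. g \<otimes> h) ` U = {h \<in> topspace T. inv g \<otimes> h \<in> U}"
  proof (intro equalityI subsetI)
    fix h assume "h \<in> (\<lambda>h. g \<otimes> h) ` U"
    then show "h \<in> {h \<in> topspace T. inv g \<otimes> h \<in> U}"
      using U assms(2) by (auto simp: m_assoc[symmetric] subset_iff)
  next
    fix h assume "h \<in> {h \<in> topspace T. inv g \<otimes> h \<in> U}"
    then show "h \<in> (\<lambda>h. g \<otimes> h) ` U"
      using assms(2) by (intro image_eqI[of _ _ "inv g \<otimes> h"]) (auto simp: m_assoc[symmetric])
  qed
  then show ?thesis
    using openin_continuous_map_preimage[OF continuous_mult_left assms(1)] assms(2) by simp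
qed

lemma open_subgroupI:
  assumes H: "subgroup H G" and V: "openin T V" "\<one> \<in> V" "V \<subseteq> H"
  shows "openin T H"
proof (subst openin_subopen, intro ballI)
  fix h assume h: "h \<in> H"
  then have hG: "h \<in> carrier G" using subgroup.mem_carrier[OF H] by simp
  show "\<exists>W. openin T W \<and> h \<in> W \<and> W \<subseteq> H"
  proof (intro exI conjI)
    show "openin T ((\<lambda>v. h \<otimes> v) ` V)" by (rule open_left_translate[OF V(1) hG])
    show "h \<in> (\<lambda>v. h \<otimes> v) ` V" using V(2) hG by (intro image_eqI[of _ _ \<one>]) auto
    show "(\<lambda>v. h \<otimes> v) ` V \<subseteq> H" using V(3) h subgroup.m_closed[OF H] by auto
  qed
qed

text \<open>The complement is a union of translates of \<open>H\<close>.\<close>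

lemma open_subgroup_closed:
  assumes H: "subgroup H G" "openin T H"
  shows "closedin T H"
proof -
  have HG: "H \<subseteq> carrier G" by (rule subgroup.subset[OF H(1)])
  have "openin T (carrier G - H)"
  proof (subst openin_subopen, intro ballI)
    fix g assume g: "g \<in> carrier G - H"
    show "\<exists>W. openin T W \<and> g \<in> W \<and> W \<subseteq> carrier G - H"
    proof (intro exI conjI)
      show "openin T ((\<lambda>h. g \<otimes> h) ` H)" using open_left_translate[OF H(2)] g by simp
      show "g \<in> (\<lambda>h. g \<otimes> h) ` H" using subgroup.one_closed[OF H(1)] g by (intro image_eqI[of _ _ \<one>]) auto
      have False if "h \<in> H" "g \<otimes> h \<in> H" for h
      proof -
        have "(g \<otimes> h) \<otimes> inv h \<in> H"
          using that subgroup.m_closed[OF H(1)] subgroup.m_inv_closed[OF H(1)] by blast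
        then show False using g that HG by (auto simp: m_assoc subset_iff)
      qed
      then show "(\<lambda>h. g \<otimes> h) ` H \<subseteq> carrier G - H" using g HG by auto
    qed
  qed
  then show ?thesis using HG by (simp add: closedin_def)
qed

text \<open>An open subgroup is also closed, so the intersection is closed in the compact
  \<open>K\<close>.\<close>

lemma compact_open_Int:
  assumes "subgroup K G" "openin T K" "compactin T K" "subgroup H G" "openin T H"
  shows "subgroup (K \<inter> H) G" "openin T (K \<inter> H)" "compactin T (K \<inter> H)"
  using assms subgroups_Inter_pair open_subgroup_closed
  by (auto intro: compact_Int_closedin)

text \<open>Separation comes from total disconnectedness: the closure of a point is connected, hence
  the point alone. The diagonal is the preimage of the closed point \<open>\<one>\<close> under
  division.\<close>

lemma Hausdorff_T: "Hausdorff_space T"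
proof -
  have "closedin T {\<one>}"
  proof -
    have "connectedin T (T closure_of {\<one>})"
      by (intro connectedin_closure_of) simp
    then obtain y where "T closure_of {\<one>} \<subseteq> {y}"
      using tdlc by (auto simp: tdlc_group_def)
    moreover have "{\<one>} \<subseteq> T closure_of {\<one>}" by (intro closure_of_subset) simp
    ultimately have "T closure_of {\<one>} = {\<one>}" by auto
    then show ?thesis by (metis closedin_closure_of)
  qed
  moreover have "continuous_map (prod_topology T T) T (\<lambda>(g, h). inv g \<otimes> h)"
    using continuous_map_compose[OF _ continuous_mult, of "prod_topology T T" "\<lambda>(g, h). (inv g, h)"]
      continuous_map_compose[OF continuous_map_fst continuous_inv, of T]
    by (simp add: o_def case_prod_unfold continuous_map_pairwise continuous_map_snd[of T T, unfolded o_def])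
  ultimately have "closedin (prod_topology T T) {p \<in> topspace (prod_topology T T). (\<lambda>(g, h). inv g \<otimes> h) p \<in> {\<one>}}"
    by (rule closedin_continuous_map_preimage[rotated])
  also have "{p \<in> topspace (prod_topology T T). (\<lambda>(g, h). inv g \<otimes> h) p \<in> {\<one>}} = (\<lambda>x. (x, x)) ` topspace T"
    by (auto simp: image_iff) (metis inv_closed inv_inv inv_unique' inv_equality l_inv_ex)
  finally show ?thesis by (simp add: Hausdorff_space_closedin_diagonal)
qed

text \<open>This is van Dantzig's theorem. A compact open neighbourhood \<open>U\<close> of \<open>\<one>\<close> exists because
  the component of \<open>\<one>\<close> is a point; the right stabiliser of \<open>U\<close> is the required subgroup.\<close>

theorem compact_open_subgroup:
  obtains K where "subgroup K G" "openin T K" "compactin T K"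
proof -
  have lc: "locally_compact_space T" using tdlc by (simp add: tdlc_group_def)
  then obtain W L where W: "openin T W" "compactin T L" "\<one> \<in> W" "W \<subseteq> L"
    unfolding locally_compact_space_def using one_closed by (metis topspace_T)
  have "connected_component_of_set T \<one> = {\<one>}"
  proof -
    obtain y where "connected_component_of_set T \<one> \<subseteq> {y}"
      using tdlc connectedin_connected_component_of[of T \<one>] unfolding tdlc_group_def by blast
    moreover have "\<one> \<in> connected_component_of_set T \<one>"
      by (simp add: connected_component_of_refl)
    ultimately show ?thesis by blast
  qed
  then have "{\<one>} \<in> connected_components_of T"
    using connected_component_in_connected_components_of[of T \<one>] by simp
  then obtain U V where U: "openin T U" "openin T V" "disjnt U V" "U \<union> V = topspace T" "{\<one>} \<subseteq> U" "U \<subseteq> W"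
    using wilder_locally_compact_component_thm[OF lc Hausdorff_T _ _ W(1), of "{\<one>}"] W(3) by auto
  have UG: "U \<subseteq> carrier G" using openin_subset[OF U(1)] by simp
  have "U = topspace T - V" using U(3,4) by (auto simp: disjnt_iff)
  then have "closedin T U" using closedin_diff[OF closedin_topspace U(2)] by simp
  then have U_compact: "compactin T U"
    using closed_compactin[OF W(2)] U(6) W(4) by auto
  define M where "M = {p \<in> topspace (prod_topology T T). (\<lambda>(g, h). g \<otimes> h) p \<in> U}"
  have M: "openin (prod_topology T T) M" "U \<times> {\<one>} \<subseteq> M"
    unfolding M_def using openin_continuous_map_preimage[OF continuous_mult U(1)] UG by auto
  have "compactin T {\<one>}" by (simp add: finite_imp_compactin)
  \<comment> \<open>Compactness of \<open>U\<close> gives a single neighbourhood \<open>U2\<close>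
    of the identity element with \<open>u \<otimes> g\<close> in \<open>U\<close> for all
    \<open>u\<close> in \<open>U\<close> and \<open>g\<close> in \<open>U2\<close>; this makes
    \<open>K\<close> open.\<close>
  from Wallace_theorem_prod_topology[OF U_compact this M] obtain U1 U2
    where U12: "openin T U1" "openin T U2" "U \<subseteq> U1" "{\<one>} \<subseteq> U2" "U1 \<times> U2 \<subseteq> M" .
  have mult: "u \<otimes> g \<in> U" if "u \<in> U" "g \<in> U2" for u g
  proof -
    have "(u, g) \<in> M" using that U12(3,5) by blast
    then show ?thesis by (simp add: M_def)
  qed
  define K where "K = {g \<in> carrier G. \<forall>u\<in>U. u \<otimes> g \<in> U \<and> u \<otimes> inv g \<in> U}"
  have K: "subgroup K G"
  proof
    show "x \<otimes> y \<in> K" if "x \<in> K" "y \<in> K" for x y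
      using that UG by (auto simp: K_def inv_mult_group m_assoc[symmetric] subset_iff)
  qed (use UG in \<open>auto simp: K_def\<close>)
  \<comment> \<open>Membership in \<open>K\<close> involves \<open>g\<close> and its inverse, so
    \<open>U2\<close> is first made symmetric.\<close>
  define Z where "Z = U2 \<inter> {g \<in> topspace T. inv g \<in> U2}"
  have "openin T Z"
    unfolding Z_def using U12(2) openin_continuous_map_preimage[OF continuous_inv U12(2)] by blast
  moreover have "\<one> \<in> Z" using U12(4) by (auto simp: Z_def)
  moreover have "Z \<subseteq> K" by (auto simp: Z_def K_def mult)
  ultimately have K_open: "openin T K" by (rule open_subgroupI[OF K])
  \<comment> \<open>Evaluate the condition at \<open>u = \<one>\<close>, which lies in
    \<open>U\<close>.\<close>
  have "K \<subseteq> U" using U(5) by (auto simp: K_def dest!: bspec[of _ _ \<one>])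
  then have "compactin T K"
    by (rule closed_compactin[OF U_compact _ open_subgroup_closed[OF K K_open]])
  then show ?thesis using that K K_open by blast
qed

end

section \<open>Linear maps, direct sums and quotients\<close>

lemma lin_maps_closed: "f \<in> lin_maps F V W \<Longrightarrow> v \<in> carrier V \<Longrightarrow> f v \<in> carrier W"
  by (auto simp: lin_maps_def)

lemma lin_maps_add:
  "f \<in> lin_maps F V W \<Longrightarrow> u \<in> carrier V \<Longrightarrow> v \<in> carrier V \<Longrightarrow> f (u \<oplus>\<^bsub>V\<^esub> v) = f u \<oplus>\<^bsub>W\<^esub> f v"
  by (auto simp: lin_maps_def)

lemma lin_maps_smult:
  "f \<in> lin_maps F V W \<Longrightarrow> k \<in> carrier F \<Longrightarrow> v \<in> carrier V \<Longrightarrow> f (k \<odot>\<^bsub>V\<^esub> v) = k \<odot>\<^bsub>W\<^esub> f v"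
  by (auto simp: lin_maps_def)

lemma lin_mapsI:
  assumes "\<And>v. v \<in> carrier V \<Longrightarrow> f v \<in> carrier W"
    and "\<And>u v. u \<in> carrier V \<Longrightarrow> v \<in> carrier V \<Longrightarrow> f (u \<oplus>\<^bsub>V\<^esub> v) = f u \<oplus>\<^bsub>W\<^esub> f v"
    and "\<And>k v. k \<in> carrier F \<Longrightarrow> v \<in> carrier V \<Longrightarrow> f (k \<odot>\<^bsub>V\<^esub> v) = k \<odot>\<^bsub>W\<^esub> f v"
  shows "f \<in> lin_maps F V W"
  using assms by (auto simp: lin_maps_def)

lemma lin_maps_cong:
  assumes "f \<in> lin_maps F V W" "\<And>v. v \<in> carrier V \<Longrightarrow> g v = f v" "Module.module F V"
  shows "g \<in> lin_maps F V W"
proof -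
  interpret V: Module.module F V by (fact assms)
  show ?thesis using assms(1,2) by (auto simp: lin_maps_def Pi_iff)
qed

lemma lin_maps_compose:
  assumes "f \<in> lin_maps F U V" "g \<in> lin_maps F V W"
  shows "(\<lambda>u. g (f u)) \<in> lin_maps F U W"
  using assms by (auto simp: lin_maps_def Pi_iff)

lemma module_abelian: "Module.module F V \<Longrightarrow> abelian_group V"
  by (simp add: Module.module_def)

lemma lin_maps_zero:
  assumes "f \<in> lin_maps F V W" "Module.module F V" "Module.module F W"
  shows "f \<zero>\<^bsub>V\<^esub> = \<zero>\<^bsub>W\<^esub>"
proof -
  interpret V: Module.module F V by (fact assms)
  interpret W: Module.module F W by (fact assms)
  have "f \<zero>\<^bsub>V\<^esub> \<oplus>\<^bsub>W\<^esub> f \<zero>\<^bsub>V\<^esub> = f \<zero>\<^bsub>V\<^esub>"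
    using lin_maps_add[OF assms(1), of "\<zero>\<^bsub>V\<^esub>" "\<zero>\<^bsub>V\<^esub>"] by simp
  then show ?thesis using assms(1) by (metis V.zero_closed W.add.r_cancel_one' lin_maps_closed)
qed

lemma lin_maps_uminus:
  assumes "f \<in> lin_maps F V W" "Module.module F V" "Module.module F W" "v \<in> carrier V"
  shows "f (\<ominus>\<^bsub>V\<^esub> v) = \<ominus>\<^bsub>W\<^esub> f v"
proof -
  interpret V: Module.module F V by (fact assms)
  interpret W: Module.module F W by (fact assms)
  have "f (\<ominus>\<^bsub>V\<^esub> v) \<oplus>\<^bsub>W\<^esub> f v = \<zero>\<^bsub>W\<^esub>"
    using lin_maps_add[OF assms(1), of "\<ominus>\<^bsub>V\<^esub> v" v] lin_maps_zero[OF assms(1-3)] assms(4) by (simp add: V.l_neg)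
  from W.minus_equality[OF this] show ?thesis
    using lin_maps_closed[OF assms(1)] assms(4) by simp
qed

lemma lin_maps_minus:
  assumes "f \<in> lin_maps F V W" "Module.module F V" "Module.module F W" "u \<in> carrier V" "v \<in> carrier V"
  shows "f (u \<ominus>\<^bsub>V\<^esub> v) = f u \<ominus>\<^bsub>W\<^esub> f v"
proof -
  interpret V: Module.module F V by (fact assms)
  show ?thesis using assms by (simp add: a_minus_def lin_maps_add[OF assms(1)] lin_maps_uminus[OF assms(1-3)])
qed

lemma lin_maps_finsum:
  assumes f: "f \<in> lin_maps F V W" and V: "Module.module F V" and W: "Module.module F W"
    and g: "g \<in> A \<rightarrow> carrier V" and "finite A"
  shows "f (finsum V g A) = finsum W (\<lambda>x. f (g x)) A"
proof -
  interpret V: Module.module F V by (fact V)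
  interpret W: Module.module F W by (fact W)
  show ?thesis
    using \<open>finite A\<close> g
  proof induction
    case empty
    then show ?case using lin_maps_zero[OF f V W] by simp
  next
    case (insert a A)
    then have "f (g a) \<in> carrier W" "(\<lambda>x. f (g x)) \<in> A \<rightarrow> carrier W"
      using lin_maps_closed[OF f] by auto
    then show ?case using insert by (simp add: lin_maps_add[OF f])
  qed
qed

text \<open>The module laws pass along a surjection that respects the operations. With
  \<open>\<kappa>\<close> the map from chains to coded homology this replaces a verification inside
  the quotient.\<close>

lemma module_imageI:
  assumes "Module.module F V" and carrier: "carrier W = \<kappa> ` carrier V" and "\<zero>\<^bsub>W\<^esub> = \<kappa> \<zero>\<^bsub>V\<^esub>"
    and add: "\<And>u v. u \<in> carrier V \<Longrightarrow> v \<in> carrier V \<Longrightarrow> \<kappa> u \<oplus>\<^bsub>W\<^esub> \<kappa> v = \<kappa> (u \<oplus>\<^bsub>V\<^esub> v)"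
    and smult: "\<And>k v. k \<in> carrier F \<Longrightarrow> v \<in> carrier V \<Longrightarrow> k \<odot>\<^bsub>W\<^esub> \<kappa> v = \<kappa> (k \<odot>\<^bsub>V\<^esub> v)"
  shows "Module.module F W" "\<kappa> \<in> lin_maps F V W"
proof -
  interpret V: Module.module F V by (fact assms)
  have ex: "\<exists>y\<in>carrier W. y \<oplus>\<^bsub>W\<^esub> x = \<zero>\<^bsub>W\<^esub>" if x: "x \<in> carrier W" for x
  proof -
    obtain v where v: "v \<in> carrier V" "x = \<kappa> v" using x carrier by auto
    then show ?thesis
      using add[of "\<ominus>\<^bsub>V\<^esub> v" v] carrier assms(3) V.a_inv_closed by (metis V.l_neg imageI)
  qed
  have "abelian_group W"
    using ex by (intro abelian_groupI) (auto simp: carrier assms(3) add V.a_ac)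
  then show "Module.module F W"
    by (intro moduleI V.R.is_cring)
       (auto simp: carrier add smult V.smult_l_distr V.smult_r_distr V.smult_assoc1)
  show "\<kappa> \<in> lin_maps F V W"
    by (intro lin_mapsI) (auto simp: carrier add smult)
qed

section \<open>Direct sums of families of modules\<close>

definition ds_single :: "'x set \<Rightarrow> ('x \<Rightarrow> ('f, 'u) module) \<Rightarrow> 'x \<Rightarrow> 'u \<Rightarrow> 'x \<Rightarrow> 'u" where
  "ds_single I V x v = (\<lambda>y\<in>I. if y = x then v else \<zero>\<^bsub>V y\<^esub>)"

definition ds_lift :: "'x set \<Rightarrow> ('x \<Rightarrow> ('f, 'u) module) \<Rightarrow> ('f, 'w) module \<Rightarrow> ('x \<Rightarrow> 'u \<Rightarrow> 'w) \<Rightarrow> ('x \<Rightarrow> 'u) \<Rightarrow> 'w" where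
  "ds_lift I V W f c = finsum W (\<lambda>x. f x (c x)) {x \<in> I. c x \<noteq> \<zero>\<^bsub>V x\<^esub>}"

locale module_family =
  fixes F :: "'f ring" and I :: "'x set" and V :: "'x \<Rightarrow> ('f, 'u) module"
  assumes F: "cring F" and family: "x \<in> I \<Longrightarrow> Module.module F (V x)"
begin

abbreviation "DS \<equiv> direct_sum I V"

text \<open>Direct sums are computed pointwise at a variable index, whereas a locale interpretation
  fixes the index; hence the laws are restated under the condition \<open>x \<in> I\<close>.\<close>

lemma
  assumes "x \<in> I"
  shows V_zero_closed: "\<zero>\<^bsub>V x\<^esub> \<in> carrier (V x)"
    and V_l_zero: "v \<in> carrier (V x) \<Longrightarrow> \<zero>\<^bsub>V x\<^esub> \<oplus>\<^bsub>V x\<^esub> v = v"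
    and V_r_zero: "v \<in> carrier (V x) \<Longrightarrow> v \<oplus>\<^bsub>V x\<^esub> \<zero>\<^bsub>V x\<^esub> = v"
    and V_a_closed: "v \<in> carrier (V x) \<Longrightarrow> w \<in> carrier (V x) \<Longrightarrow> v \<oplus>\<^bsub>V x\<^esub> w \<in> carrier (V x)"
    and V_a_comm: "v \<in> carrier (V x) \<Longrightarrow> w \<in> carrier (V x) \<Longrightarrow> v \<oplus>\<^bsub>V x\<^esub> w = w \<oplus>\<^bsub>V x\<^esub> v"
    and V_a_assoc: "u \<in> carrier (V x) \<Longrightarrow> v \<in> carrier (V x) \<Longrightarrow> w \<in> carrier (V x) \<Longrightarrow>
      (u \<oplus>\<^bsub>V x\<^esub> v) \<oplus>\<^bsub>V x\<^esub> w = u \<oplus>\<^bsub>V x\<^esub> (v \<oplus>\<^bsub>V x\<^esub> w)"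
    and V_a_lcomm: "u \<in> carrier (V x) \<Longrightarrow> v \<in> carrier (V x) \<Longrightarrow> w \<in> carrier (V x) \<Longrightarrow>
      u \<oplus>\<^bsub>V x\<^esub> (v \<oplus>\<^bsub>V x\<^esub> w) = v \<oplus>\<^bsub>V x\<^esub> (u \<oplus>\<^bsub>V x\<^esub> w)"
    and V_a_inv_closed: "v \<in> carrier (V x) \<Longrightarrow> \<ominus>\<^bsub>V x\<^esub> v \<in> carrier (V x)"
    and V_l_neg: "v \<in> carrier (V x) \<Longrightarrow> \<ominus>\<^bsub>V x\<^esub> v \<oplus>\<^bsub>V x\<^esub> v = \<zero>\<^bsub>V x\<^esub>"
    and V_minus_zero: "\<ominus>\<^bsub>V x\<^esub> \<zero>\<^bsub>V x\<^esub> = \<zero>\<^bsub>V x\<^esub>"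
    and V_smult_closed: "k \<in> carrier F \<Longrightarrow> v \<in> carrier (V x) \<Longrightarrow> k \<odot>\<^bsub>V x\<^esub> v \<in> carrier (V x)"
    and V_smult_r_null: "k \<in> carrier F \<Longrightarrow> k \<odot>\<^bsub>V x\<^esub> \<zero>\<^bsub>V x\<^esub> = \<zero>\<^bsub>V x\<^esub>"
    and V_smult_one: "v \<in> carrier (V x) \<Longrightarrow> \<one>\<^bsub>F\<^esub> \<odot>\<^bsub>V x\<^esub> v = v"
    and V_smult_assoc1: "j \<in> carrier F \<Longrightarrow> k \<in> carrier F \<Longrightarrow> v \<in> carrier (V x) \<Longrightarrow>
      (j \<otimes>\<^bsub>F\<^esub> k) \<odot>\<^bsub>V x\<^esub> v = j \<odot>\<^bsub>V x\<^esub> (k \<odot>\<^bsub>V x\<^esub> v)"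
    and V_smult_l_distr: "j \<in> carrier F \<Longrightarrow> k \<in> carrier F \<Longrightarrow> v \<in> carrier (V x) \<Longrightarrow>
      (j \<oplus>\<^bsub>F\<^esub> k) \<odot>\<^bsub>V x\<^esub> v = j \<odot>\<^bsub>V x\<^esub> v \<oplus>\<^bsub>V x\<^esub> k \<odot>\<^bsub>V x\<^esub> v"
    and V_smult_r_distr: "k \<in> carrier F \<Longrightarrow> v \<in> carrier (V x) \<Longrightarrow> w \<in> carrier (V x) \<Longrightarrow>
      k \<odot>\<^bsub>V x\<^esub> (v \<oplus>\<^bsub>V x\<^esub> w) = k \<odot>\<^bsub>V x\<^esub> v \<oplus>\<^bsub>V x\<^esub> k \<odot>\<^bsub>V x\<^esub> w"
proof -
  interpret Module.module F "V x" by (rule family[OF assms])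
  note M.a_ac [simp]
  show "\<zero>\<^bsub>V x\<^esub> \<in> carrier (V x)" "\<ominus>\<^bsub>V x\<^esub> \<zero>\<^bsub>V x\<^esub> = \<zero>\<^bsub>V x\<^esub>" by simp_all
  {
    fix v assume v: "v \<in> carrier (V x)"
    show "\<zero>\<^bsub>V x\<^esub> \<oplus>\<^bsub>V x\<^esub> v = v" "v \<oplus>\<^bsub>V x\<^esub> \<zero>\<^bsub>V x\<^esub> = v" "\<ominus>\<^bsub>V x\<^esub> v \<in> carrier (V x)"
      "\<ominus>\<^bsub>V x\<^esub> v \<oplus>\<^bsub>V x\<^esub> v = \<zero>\<^bsub>V x\<^esub>" "\<one>\<^bsub>F\<^esub> \<odot>\<^bsub>V x\<^esub> v = v"
      using v by (simp_all add: M.l_neg M.r_neg)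
    fix w assume w: "w \<in> carrier (V x)"
    show "v \<oplus>\<^bsub>V x\<^esub> w \<in> carrier (V x)" "v \<oplus>\<^bsub>V x\<^esub> w = w \<oplus>\<^bsub>V x\<^esub> v"
      using v w by simp_all
    fix u assume "u \<in> carrier (V x)"
    then show "(u \<oplus>\<^bsub>V x\<^esub> v) \<oplus>\<^bsub>V x\<^esub> w = u \<oplus>\<^bsub>V x\<^esub> (v \<oplus>\<^bsub>V x\<^esub> w)"
      "u \<oplus>\<^bsub>V x\<^esub> (v \<oplus>\<^bsub>V x\<^esub> w) = v \<oplus>\<^bsub>V x\<^esub> (u \<oplus>\<^bsub>V x\<^esub> w)"
      using v w by simp_all
  next
    fix k assume k: "k \<in> carrier F"
    show "k \<odot>\<^bsub>V x\<^esub> \<zero>\<^bsub>V x\<^esub> = \<zero>\<^bsub>V x\<^esub>" using k by (rule smult_r_null)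
    fix v assume v: "v \<in> carrier (V x)"
    show "k \<odot>\<^bsub>V x\<^esub> v \<in> carrier (V x)" using k v by simp
    show "k \<odot>\<^bsub>V x\<^esub> (v \<oplus>\<^bsub>V x\<^esub> w) = k \<odot>\<^bsub>V x\<^esub> v \<oplus>\<^bsub>V x\<^esub> k \<odot>\<^bsub>V x\<^esub> w"
      if "w \<in> carrier (V x)" for w
      using k v that by (rule smult_r_distr)
    fix j assume "j \<in> carrier F"
    then show "(j \<otimes>\<^bsub>F\<^esub> k) \<odot>\<^bsub>V x\<^esub> v = j \<odot>\<^bsub>V x\<^esub> (k \<odot>\<^bsub>V x\<^esub> v)"
      "(j \<oplus>\<^bsub>F\<^esub> k) \<odot>\<^bsub>V x\<^esub> v = j \<odot>\<^bsub>V x\<^esub> v \<oplus>\<^bsub>V x\<^esub> k \<odot>\<^bsub>V x\<^esub> v"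
      using k v by (rule smult_assoc1 smult_l_distr)+
  }
qed

lemma carrier_DS:
  "c \<in> carrier DS \<longleftrightarrow> c \<in> extensional I \<and> (\<forall>x\<in>I. c x \<in> carrier (V x)) \<and> finite {x \<in> I. c x \<noteq> \<zero>\<^bsub>V x\<^esub>}"
  by (auto simp: direct_sum_def PiE_def Pi_iff)

lemma DS_simps:
  "\<zero>\<^bsub>DS\<^esub> = (\<lambda>x\<in>I. \<zero>\<^bsub>V x\<^esub>)" "c \<oplus>\<^bsub>DS\<^esub> d = (\<lambda>x\<in>I. c x \<oplus>\<^bsub>V x\<^esub> d x)" "k \<odot>\<^bsub>DS\<^esub> c = (\<lambda>x\<in>I. k \<odot>\<^bsub>V x\<^esub> c x)"
  by (simp_all add: direct_sum_def)

lemma DS_closed: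
  "\<zero>\<^bsub>DS\<^esub> \<in> carrier DS"
  "c \<in> carrier DS \<Longrightarrow> d \<in> carrier DS \<Longrightarrow> c \<oplus>\<^bsub>DS\<^esub> d \<in> carrier DS"
  "k \<in> carrier F \<Longrightarrow> c \<in> carrier DS \<Longrightarrow> k \<odot>\<^bsub>DS\<^esub> c \<in> carrier DS"
proof -
  show "\<zero>\<^bsub>DS\<^esub> \<in> carrier DS" by (auto simp: carrier_DS DS_simps V_zero_closed cong: conj_cong)
  {
    assume cd: "c \<in> carrier DS" "d \<in> carrier DS"
    have "finite {x \<in> I. c x \<oplus>\<^bsub>V x\<^esub> d x \<noteq> \<zero>\<^bsub>V x\<^esub>}"
      by (rule finite_subset[of _ "{x \<in> I. c x \<noteq> \<zero>\<^bsub>V x\<^esub>} \<union> {x \<in> I. d x \<noteq> \<zero>\<^bsub>V x\<^esub>}"])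
         (use cd in \<open>auto simp: carrier_DS V_l_zero V_zero_closed\<close>)
    then show "c \<oplus>\<^bsub>DS\<^esub> d \<in> carrier DS"
      using cd by (auto simp: carrier_DS DS_simps V_a_closed cong: conj_cong)
  next
    assume c: "k \<in> carrier F" "c \<in> carrier DS"
    have "finite {x \<in> I. k \<odot>\<^bsub>V x\<^esub> c x \<noteq> \<zero>\<^bsub>V x\<^esub>}"
      by (rule finite_subset[of _ "{x \<in> I. c x \<noteq> \<zero>\<^bsub>V x\<^esub>}"])
         (use c in \<open>auto simp: carrier_DS V_smult_r_null\<close>)
    then show "k \<odot>\<^bsub>DS\<^esub> c \<in> carrier DS"
      using c by (auto simp: carrier_DS DS_simps V_smult_closed cong: conj_cong)
  }
qed

lemma module_DS: "Module.module F DS"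
proof (rule moduleI)
  show "cring F" by (rule F)
  show "abelian_group DS"
  proof (rule abelian_groupI)
    fix c assume c: "c \<in> carrier DS"
    let ?d = "\<lambda>x\<in>I. \<ominus>\<^bsub>V x\<^esub> c x"
    have "finite {x \<in> I. \<ominus>\<^bsub>V x\<^esub> c x \<noteq> \<zero>\<^bsub>V x\<^esub>}"
      by (rule finite_subset[of _ "{x \<in> I. c x \<noteq> \<zero>\<^bsub>V x\<^esub>}"])
         (use c in \<open>auto simp: carrier_DS V_minus_zero\<close>)
    then have "?d \<in> carrier DS" using c by (auto simp: carrier_DS V_a_inv_closed cong: conj_cong)
    moreover have "?d \<oplus>\<^bsub>DS\<^esub> c = \<zero>\<^bsub>DS\<^esub>"
      using c by (auto simp: DS_simps carrier_DS V_l_neg intro!: restrict_ext)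
    ultimately show "\<exists>d\<in>carrier DS. d \<oplus>\<^bsub>DS\<^esub> c = \<zero>\<^bsub>DS\<^esub>" by blast
  next
    fix c assume "c \<in> carrier DS"
    then show "\<zero>\<^bsub>DS\<^esub> \<oplus>\<^bsub>DS\<^esub> c = c"
      by (intro extensionalityI[of _ I]) (auto simp: DS_simps carrier_DS V_l_zero)
  qed (use DS_closed in \<open>auto simp: DS_simps carrier_DS V_a_assoc V_a_comm V_a_lcomm V_a_closed intro!: restrict_ext\<close>)
qed (use DS_closed in \<open>auto simp: DS_simps carrier_DS V_smult_l_distr V_smult_r_distr V_smult_assoc1 V_smult_one V_smult_closed
      intro!: restrict_ext extensionalityI[of _ I]\<close>)

lemma single_closed [simp]:
  assumes "x \<in> I" "v \<in> carrier (V x)" shows "ds_single I V x v \<in> carrier DS"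
proof -
  have "finite {y \<in> I. ds_single I V x v y \<noteq> \<zero>\<^bsub>V y\<^esub>}"
    by (rule finite_subset[of _ "{x}"]) (auto simp: ds_single_def)
  then show ?thesis using assms by (auto simp: carrier_DS ds_single_def V_zero_closed)
qed

lemma single_linear:
  assumes x: "x \<in> I" shows "ds_single I V x \<in> lin_maps F (V x) DS"
proof -
  show ?thesis
  proof (rule lin_mapsI)
    show "ds_single I V x v \<in> carrier DS" if "v \<in> carrier (V x)" for v
      using x that by (rule single_closed)
  qed (use x in \<open>auto simp: ds_single_def DS_simps V_l_zero V_zero_closed V_smult_r_null intro!: restrict_ext\<close>)
qed

text \<open>The step retains that \<open>x\<close> lies in the support of \<open>c\<close>. For
  chains supported on degenerate simplices this ensures that each added summand sits on a degenerate
  simplex.\<close>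

lemma DS_induct [consumes 1, case_names zero add]:
  assumes c: "c \<in> carrier DS" and zero: "Q \<zero>\<^bsub>DS\<^esub>"
    and add: "\<And>d x v. d \<in> carrier DS \<Longrightarrow> Q d \<Longrightarrow> x \<in> I \<Longrightarrow> v \<in> carrier (V x) \<Longrightarrow> c x \<noteq> \<zero>\<^bsub>V x\<^esub> \<Longrightarrow>
                Q (d \<oplus>\<^bsub>DS\<^esub> ds_single I V x v)"
  shows "Q c"
proof -
  \<comment> \<open>Truncation of \<open>c\<close> to a set \<open>A\<close> of indices; the
    induction runs over finite subsets of the support.\<close>
  let ?r = "\<lambda>A. \<lambda>x\<in>I. if x \<in> A then c x else \<zero>\<^bsub>V x\<^esub>"
  have r: "?r A \<in> carrier DS" for A
    using c by (auto simp: carrier_DS V_zero_closed cong: conj_cong elim: rev_finite_subset)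
  have "Q (?r A)" if "finite A" "A \<subseteq> {x \<in> I. c x \<noteq> \<zero>\<^bsub>V x\<^esub>}" for A
    using that
  proof induction
    case empty
    then show ?case using zero by (simp add: DS_simps restrict_def)
  next
    case (insert a A)
    then have a: "a \<in> I" "c a \<in> carrier (V a)" "c a \<noteq> \<zero>\<^bsub>V a\<^esub>" using c by (auto simp: carrier_DS)
    have "?r (insert a A) = ?r A \<oplus>\<^bsub>DS\<^esub> ds_single I V a (c a)"
      using insert(2) c a by (auto simp: DS_simps ds_single_def carrier_DS V_l_zero V_r_zero V_zero_closed intro!: restrict_ext)
    moreover have "A \<subseteq> {x \<in> I. c x \<noteq> \<zero>\<^bsub>V x\<^esub>}" using insert(4) by simp
    ultimately show ?case using add[OF r insert(3) a] by metis
  qed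
  from this[of "{x \<in> I. c x \<noteq> \<zero>\<^bsub>V x\<^esub>}"] have "Q (?r {x \<in> I. c x \<noteq> \<zero>\<^bsub>V x\<^esub>})"
    using c by (simp add: carrier_DS)
  also have "?r {x \<in> I. c x \<noteq> \<zero>\<^bsub>V x\<^esub>} = c"
    using c by (intro extensionalityI[of _ I]) (auto simp: carrier_DS)
  finally show ?thesis .
qed

text \<open>Additivity compares sums over different supports; this puts them over a common finite
  index set.\<close>

lemma ds_lift_superset:
  assumes W: "Module.module F W" and f: "\<And>x. x \<in> I \<Longrightarrow> f x \<in> lin_maps F (V x) W" and c: "c \<in> carrier DS"
    and A: "finite A" "A \<subseteq> I" "{x \<in> I. c x \<noteq> \<zero>\<^bsub>V x\<^esub>} \<subseteq> A"
  shows "ds_lift I V W f c = finsum W (\<lambda>x. f x (c x)) A"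
proof -
  interpret W: Module.module F W by (fact W)
  have "f x (c x) = \<zero>\<^bsub>W\<^esub>" if "x \<in> A - {x \<in> I. c x \<noteq> \<zero>\<^bsub>V x\<^esub>}" for x
    using that A lin_maps_zero[OF f family W] by auto
  then show ?thesis
    unfolding ds_lift_def using A c lin_maps_closed[OF f]
    by (intro W.add.finprod_mono_neutral_cong_left) (auto simp: carrier_DS subset_iff)
qed

lemma ds_lift_linear:
  assumes W: "Module.module F W" and f: "\<And>x. x \<in> I \<Longrightarrow> f x \<in> lin_maps F (V x) W"
  shows "ds_lift I V W f \<in> lin_maps F DS W"
proof (rule lin_mapsI)
  interpret W: Module.module F W by (fact W)
  let ?s = "\<lambda>c. {x \<in> I. c x \<noteq> \<zero>\<^bsub>V x\<^esub>}"
  have fin: "finite (?s c)" if "c \<in> carrier DS" for c using that by (simp add: carrier_DS)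
  have Pi: "(\<lambda>x. f x (c x)) \<in> A \<rightarrow> carrier W" if "c \<in> carrier DS" "A \<subseteq> I" for c A
    using that lin_maps_closed[OF f] by (auto simp: carrier_DS)
  show "ds_lift I V W f c \<in> carrier W" if "c \<in> carrier DS" for c
    unfolding ds_lift_def by (rule W.finsum_closed[OF Pi[OF that]]) auto
  show "ds_lift I V W f (c \<oplus>\<^bsub>DS\<^esub> d) = ds_lift I V W f c \<oplus>\<^bsub>W\<^esub> ds_lift I V W f d"
    if cd: "c \<in> carrier DS" "d \<in> carrier DS" for c d
  proof -
    let ?A = "?s c \<union> ?s d"
    have A: "finite ?A" "?A \<subseteq> I" using fin cd by auto
    have "?s (c \<oplus>\<^bsub>DS\<^esub> d) \<subseteq> ?A" by (auto simp: DS_simps V_l_zero V_zero_closed)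
    then have "ds_lift I V W f (c \<oplus>\<^bsub>DS\<^esub> d) = finsum W (\<lambda>x. f x ((c \<oplus>\<^bsub>DS\<^esub> d) x)) ?A"
      using ds_lift_superset[OF W f DS_closed(2)[OF cd] A] by blast
    also have "\<dots> = finsum W (\<lambda>x. f x (c x) \<oplus>\<^bsub>W\<^esub> f x (d x)) ?A"
      using cd A lin_maps_closed[OF f] by (intro W.add.finprod_cong') (auto simp: DS_simps carrier_DS lin_maps_add[OF f])
    also have "\<dots> = finsum W (\<lambda>x. f x (c x)) ?A \<oplus>\<^bsub>W\<^esub> finsum W (\<lambda>x. f x (d x)) ?A"
      by (rule W.finsum_addf[OF Pi[OF cd(1) A(2)] Pi[OF cd(2) A(2)]])
    also have "\<dots> = ds_lift I V W f c \<oplus>\<^bsub>W\<^esub> ds_lift I V W f d"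
      using ds_lift_superset[OF W f cd(1) A] ds_lift_superset[OF W f cd(2) A] by auto
    finally show ?thesis .
  qed
  show "ds_lift I V W f (k \<odot>\<^bsub>DS\<^esub> c) = k \<odot>\<^bsub>W\<^esub> ds_lift I V W f c"
    if k: "k \<in> carrier F" and c: "c \<in> carrier DS" for k c
  proof -
    have "ds_lift I V W f (k \<odot>\<^bsub>DS\<^esub> c) = finsum W (\<lambda>x. f x ((k \<odot>\<^bsub>DS\<^esub> c) x)) (?s c)"
      by (rule ds_lift_superset[OF W _ DS_closed(3)[OF k c] fin[OF c]]) (auto simp: f DS_simps V_smult_r_null k)
    also have "\<dots> = finsum W (\<lambda>x. k \<odot>\<^bsub>W\<^esub> f x (c x)) (?s c)"
      using c lin_maps_closed[OF f] k by (intro W.add.finprod_cong') (auto simp: DS_simps carrier_DS lin_maps_smult[OF f])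
    also have "\<dots> = k \<odot>\<^bsub>W\<^esub> ds_lift I V W f c"
      unfolding ds_lift_def using W.finsum_smult_ldistr[OF fin[OF c] k Pi[OF c]] by auto
    finally show ?thesis .
  qed
qed

lemma ds_lift_single:
  assumes W: "Module.module F W" and f: "\<And>x. x \<in> I \<Longrightarrow> f x \<in> lin_maps F (V x) W"
    and x: "x \<in> I" "v \<in> carrier (V x)"
  shows "ds_lift I V W f (ds_single I V x v) = f x v"
proof -
  interpret W: Module.module F W by (fact W)
  have "ds_lift I V W f (ds_single I V x v) = finsum W (\<lambda>y. f y (ds_single I V x v y)) {x}"
    by (rule ds_lift_superset[OF W _ single_closed]) (use x f in \<open>auto simp: ds_single_def\<close>)
  then show ?thesis using x lin_maps_closed[OF f[OF x(1)] x(2)] by (simp add: ds_single_def)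
qed

end

text \<open>Lists of one length form a finite power of \<open>A\<close>, of size at most that of the
  infinite set \<open>B\<close>, and there are countably many lengths.\<close>

lemma card_of_lists_ordLeq:
  assumes B: "infinite B" and AB: "|A| \<le>o |B|"
  shows "|lists A| \<le>o |B|"
proof -
  have *: "|{xs \<in> lists A. length xs = n}| \<le>o |B|" for n
  proof (induction n)
    case 0
    have "{xs \<in> lists A. length xs = 0} = {[]}" by auto
    then show ?case
      using B by (metis card_of_singl_ordLeq finite.emptyI)
  next
    case (Suc n)
    have "{xs \<in> lists A. length xs = Suc n} \<subseteq> (\<lambda>(x, xs). x # xs) ` (A \<times> {xs \<in> lists A. length xs = n})"
    proof
      fix xs assume "xs \<in> {xs \<in> lists A. length xs = Suc n}"
      then show "xs \<in> (\<lambda>(x, xs). x # xs) ` (A \<times> {xs \<in> lists A. length xs = n})"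
        by (cases xs) auto
    qed
    then have "|{xs \<in> lists A. length xs = Suc n}| \<le>o |A \<times> {xs \<in> lists A. length xs = n}|"
      using surj_imp_ordLeq by blast
    also have "|A \<times> {xs \<in> lists A. length xs = n}| \<le>o |B|"
      using card_of_Times_ordLeq_infinite_Field[of "|B|"] B AB Suc
      by (simp add: card_of_Card_order Field_card_of)
    finally show ?case .
  qed
  have "lists A = (\<Union>n. {xs \<in> lists A. length xs = n})" by auto
  moreover have "|UNIV :: nat set| \<le>o |B|"
    using B by (simp add: infinite_iff_card_of_nat)
  ultimately show ?thesis
    using card_of_UNION_ordLeq_infinite[OF B] * by (metis (no_types, lifting))
qed

text \<open>A finitely supported family is determined by a list of its nonzero entries together with
  their indices. This bound is what lets homology be coded into \<open>'u\<close>.\<close>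

lemma (in module_family) card_DS:
  assumes B: "infinite B" and "|I| \<le>o |B|" and V: "\<And>x. x \<in> I \<Longrightarrow> |carrier (V x)| \<le>o |B|"
  shows "|carrier DS| \<le>o |B|"
proof -
  let ?S = "SIGMA x:I. carrier (V x)"
  let ?g = "\<lambda>c. (\<lambda>x. (x, c x)) ` {x \<in> I. c x \<noteq> \<zero>\<^bsub>V x\<^esub>}"
  define l where "l c = (SOME xs. set xs = ?g c)" for c
  have l: "set (l c) = ?g c" if "c \<in> carrier DS" for c
  proof -
    have "finite (?g c)" using that by (simp add: carrier_DS)
    then have "\<exists>xs. set xs = ?g c" by (rule finite_list)
    then show ?thesis unfolding l_def by (rule someI_ex)
  qed
  have "inj_on l (carrier DS)"
  proof (rule inj_onI)
    fix c d assume cd: "c \<in> carrier DS" "d \<in> carrier DS" "l c = l d"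
    have g: "?g c = ?g d" using l[OF cd(1)] l[OF cd(2)] cd(3) by simp
    have mem: "(x, v) \<in> ?g e \<longleftrightarrow> x \<in> I \<and> e x \<noteq> \<zero>\<^bsub>V x\<^esub> \<and> v = e x" for x v e
      by auto
    have "c x = d x" if "x \<in> I" for x
      using mem[of x "c x" c] mem[of x "c x" d] mem[of x "d x" d] mem[of x "d x" c] that
      unfolding g by metis
    then show "c = d" using cd by (intro extensionalityI[of _ I]) (auto simp: carrier_DS)
  qed
  moreover have "l ` carrier DS \<subseteq> lists ?S"
    using l by (fastforce simp: carrier_DS)
  ultimately have "|carrier DS| \<le>o |lists ?S|"
    using card_of_ordLeq by blast
  also have "|lists ?S| \<le>o |B|"
    using V by (intro card_of_lists_ordLeq[OF B] card_of_Sigma_ordLeq_infinite[OF B assms(2)]) simp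
  finally show ?thesis .
qed

text \<open>
  Homology in degree 0 is built from two quotients: first by the image \<open>E\<close> of the degenerate chains,
  then by the cosets of \<open>E\<close> in the image \<open>D\<close> of all chains. The image \<open>E\<close> need not vanish, because
  the degenerate chains are not a subcomplex in general; but \<open>E \<subseteq> D\<close>, so the iterated quotient
  is the quotient by \<open>D\<close>.
\<close>

definition add_subgroup :: "('f, 'u) module \<Rightarrow> 'u set \<Rightarrow> bool" where
  "add_subgroup V D \<longleftrightarrow> D \<subseteq> carrier V \<and> \<zero>\<^bsub>V\<^esub> \<in> D \<and> (\<forall>u\<in>D. \<forall>v\<in>D. u \<oplus>\<^bsub>V\<^esub> v \<in> D) \<and> (\<forall>u\<in>D. \<ominus>\<^bsub>V\<^esub> u \<in> D)"

text \<open>The coset of \<open>a\<close> modulo \<open>D\<close>, presented as the set of all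
  cosets of \<open>E\<close> contained in it, since this is the set that the iterated quotient
  literally produces.\<close>

definition coset_class :: "('f, 'u) module \<Rightarrow> 'u set \<Rightarrow> 'u set \<Rightarrow> 'u \<Rightarrow> 'u set set" where
  "coset_class V E D a = (\<lambda>d. E +>\<^bsub>V\<^esub> (d \<oplus>\<^bsub>V\<^esub> a)) ` D"

lemma mem_a_r_coset: "w \<in> E +>\<^bsub>V\<^esub> b \<longleftrightarrow> (\<exists>n\<in>E. w = n \<oplus>\<^bsub>V\<^esub> b)"
  by (auto simp: a_r_coset_def')

lemma mem_set_add: "w \<in> Y <+>\<^bsub>V\<^esub> Z \<longleftrightarrow> (\<exists>y\<in>Y. \<exists>z\<in>Z. w = y \<oplus>\<^bsub>V\<^esub> z)"
  by (auto simp: set_add_def')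

lemma a_r_cosetI: "n \<in> E \<Longrightarrow> n \<oplus>\<^bsub>V\<^esub> b \<in> E +>\<^bsub>V\<^esub> b"
  by (auto simp: a_r_coset_def')

lemma set_addI: "y \<in> Y \<Longrightarrow> z \<in> Z \<Longrightarrow> y \<oplus>\<^bsub>V\<^esub> z \<in> Y <+>\<^bsub>V\<^esub> Z"
  by (auto simp: set_add_def')

context
  fixes F :: "'f ring" and V :: "('f, 'u) module" and E D :: "'u set"
  assumes V: "Module.module F V" and E: "add_subgroup V E" and D: "add_subgroup V D" and ED: "E \<subseteq> D"
begin

interpretation V: Module.module F V by (fact V)

private lemma EV: "n \<in> E \<Longrightarrow> n \<in> carrier V" and DV: "n \<in> D \<Longrightarrow> n \<in> carrier V"
  and E0: "\<zero>\<^bsub>V\<^esub> \<in> E" and D0: "\<zero>\<^bsub>V\<^esub> \<in> D"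
  and E_add: "n \<in> E \<Longrightarrow> m \<in> E \<Longrightarrow> n \<oplus>\<^bsub>V\<^esub> m \<in> E" and D_add: "n \<in> D \<Longrightarrow> m \<in> D \<Longrightarrow> n \<oplus>\<^bsub>V\<^esub> m \<in> D"
  and D_inv: "n \<in> D \<Longrightarrow> \<ominus>\<^bsub>V\<^esub> n \<in> D"
  using E D by (auto simp: add_subgroup_def)

lemma coset_set_add:
  assumes "b \<in> carrier V" "c \<in> carrier V"
  shows "(E +>\<^bsub>V\<^esub> b) <+>\<^bsub>V\<^esub> (E +>\<^bsub>V\<^esub> c) = E +>\<^bsub>V\<^esub> (b \<oplus>\<^bsub>V\<^esub> c)"
proof (intro equalityI subsetI)
  fix w assume "w \<in> (E +>\<^bsub>V\<^esub> b) <+>\<^bsub>V\<^esub> (E +>\<^bsub>V\<^esub> c)"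
  then obtain n m where nm: "n \<in> E" "m \<in> E" "w = (n \<oplus>\<^bsub>V\<^esub> b) \<oplus>\<^bsub>V\<^esub> (m \<oplus>\<^bsub>V\<^esub> c)"
    by (auto simp: mem_set_add mem_a_r_coset)
  then have "w = (n \<oplus>\<^bsub>V\<^esub> m) \<oplus>\<^bsub>V\<^esub> (b \<oplus>\<^bsub>V\<^esub> c)" using assms EV by (simp add: V.a_ac)
  then show "w \<in> E +>\<^bsub>V\<^esub> (b \<oplus>\<^bsub>V\<^esub> c)" using E_add[OF nm(1,2)] by (auto simp: mem_a_r_coset)
next
  fix w assume "w \<in> E +>\<^bsub>V\<^esub> (b \<oplus>\<^bsub>V\<^esub> c)"
  then obtain n where n: "n \<in> E" "w = n \<oplus>\<^bsub>V\<^esub> (b \<oplus>\<^bsub>V\<^esub> c)" by (auto simp: mem_a_r_coset)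
  then have "w = (n \<oplus>\<^bsub>V\<^esub> b) \<oplus>\<^bsub>V\<^esub> (\<zero>\<^bsub>V\<^esub> \<oplus>\<^bsub>V\<^esub> c)" using assms EV by (simp add: V.a_ac)
  then show "w \<in> (E +>\<^bsub>V\<^esub> b) <+>\<^bsub>V\<^esub> (E +>\<^bsub>V\<^esub> c)"
    using n(1) E0 by (auto intro: set_addI a_r_cosetI)
qed

text \<open>\<open>Z\<close> will be the module of cycles, whose addition is addition of subsets of
  \<open>V\<close>.\<close>

lemma coset_class_add:
  assumes "a \<in> carrier V" "b \<in> carrier V" and Z: "\<And>Y Y'. Y \<oplus>\<^bsub>Z\<^esub> Y' = Y <+>\<^bsub>V\<^esub> Y'"
  shows "coset_class V E D a <+>\<^bsub>Z\<^esub> coset_class V E D b = coset_class V E D (a \<oplus>\<^bsub>V\<^esub> b)"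
proof (intro equalityI subsetI)
  fix w assume "w \<in> coset_class V E D a <+>\<^bsub>Z\<^esub> coset_class V E D b"
  then obtain n m where nm: "n \<in> D" "m \<in> D" "w = (E +>\<^bsub>V\<^esub> (n \<oplus>\<^bsub>V\<^esub> a)) <+>\<^bsub>V\<^esub> (E +>\<^bsub>V\<^esub> (m \<oplus>\<^bsub>V\<^esub> b))"
    by (auto simp: mem_set_add coset_class_def Z)
  then have "w = E +>\<^bsub>V\<^esub> ((n \<oplus>\<^bsub>V\<^esub> a) \<oplus>\<^bsub>V\<^esub> (m \<oplus>\<^bsub>V\<^esub> b))" using assms DV by (simp add: coset_set_add)
  moreover have "(n \<oplus>\<^bsub>V\<^esub> a) \<oplus>\<^bsub>V\<^esub> (m \<oplus>\<^bsub>V\<^esub> b) = (n \<oplus>\<^bsub>V\<^esub> m) \<oplus>\<^bsub>V\<^esub> (a \<oplus>\<^bsub>V\<^esub> b)"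
    using assms nm(1,2) DV by (simp add: V.a_ac)
  ultimately show "w \<in> coset_class V E D (a \<oplus>\<^bsub>V\<^esub> b)"
    using D_add[OF nm(1,2)] by (auto simp: coset_class_def)
next
  fix w assume "w \<in> coset_class V E D (a \<oplus>\<^bsub>V\<^esub> b)"
  then obtain n where n: "n \<in> D" "w = E +>\<^bsub>V\<^esub> (n \<oplus>\<^bsub>V\<^esub> (a \<oplus>\<^bsub>V\<^esub> b))" by (auto simp: coset_class_def)
  have "n \<oplus>\<^bsub>V\<^esub> (a \<oplus>\<^bsub>V\<^esub> b) = (n \<oplus>\<^bsub>V\<^esub> a) \<oplus>\<^bsub>V\<^esub> (\<zero>\<^bsub>V\<^esub> \<oplus>\<^bsub>V\<^esub> b)"
    using assms n(1) DV by (simp add: V.a_ac)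
  then have w: "w = (E +>\<^bsub>V\<^esub> (n \<oplus>\<^bsub>V\<^esub> a)) <+>\<^bsub>V\<^esub> (E +>\<^bsub>V\<^esub> (\<zero>\<^bsub>V\<^esub> \<oplus>\<^bsub>V\<^esub> b))"
    using n assms DV by (simp add: coset_set_add)
  have "E +>\<^bsub>V\<^esub> (n \<oplus>\<^bsub>V\<^esub> a) \<in> coset_class V E D a"
    and "E +>\<^bsub>V\<^esub> (\<zero>\<^bsub>V\<^esub> \<oplus>\<^bsub>V\<^esub> b) \<in> coset_class V E D b"
    unfolding coset_class_def using n(1) D0 by (auto intro: imageI)
  from set_addI[of _ _ _ _ Z, unfolded Z, OF this]
  show "w \<in> coset_class V E D a <+>\<^bsub>Z\<^esub> coset_class V E D b"
    unfolding w .
qed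

lemma coset_class_shift:
  assumes "d \<in> D" "a \<in> carrier V"
  shows "coset_class V E D (d \<oplus>\<^bsub>V\<^esub> a) = coset_class V E D a"
proof (intro equalityI subsetI)
  fix w assume "w \<in> coset_class V E D (d \<oplus>\<^bsub>V\<^esub> a)"
  then obtain n where n: "n \<in> D" "w = E +>\<^bsub>V\<^esub> (n \<oplus>\<^bsub>V\<^esub> (d \<oplus>\<^bsub>V\<^esub> a))" by (auto simp: coset_class_def)
  then have "w = E +>\<^bsub>V\<^esub> ((n \<oplus>\<^bsub>V\<^esub> d) \<oplus>\<^bsub>V\<^esub> a)" using assms DV by (simp add: V.a_assoc)
  then show "w \<in> coset_class V E D a" using D_add[OF n(1) assms(1)] by (auto simp: coset_class_def)
next
  fix w assume "w \<in> coset_class V E D a"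
  then obtain n where n: "n \<in> D" "w = E +>\<^bsub>V\<^esub> (n \<oplus>\<^bsub>V\<^esub> a)" by (auto simp: coset_class_def)
  have "n \<oplus>\<^bsub>V\<^esub> a = n \<oplus>\<^bsub>V\<^esub> ((\<ominus>\<^bsub>V\<^esub> d \<oplus>\<^bsub>V\<^esub> d) \<oplus>\<^bsub>V\<^esub> a)"
    using assms n(1) DV by (simp add: V.l_neg)
  also have "\<dots> = (n \<oplus>\<^bsub>V\<^esub> \<ominus>\<^bsub>V\<^esub> d) \<oplus>\<^bsub>V\<^esub> (d \<oplus>\<^bsub>V\<^esub> a)"
    using assms n(1) DV by (simp only: V.a_assoc V.a_inv_closed V.a_closed)
  finally show "w \<in> coset_class V E D (d \<oplus>\<^bsub>V\<^esub> a)"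
    using D_add[OF n(1) D_inv[OF assms(1)]] n(2) by (auto simp: coset_class_def)
qed

text \<open>Equal classes share a coset of \<open>E\<close>; the discrepancy in \<open>E\<close> is
  absorbed by \<open>E \<subseteq> D\<close>.\<close>

lemma coset_class_eqD:
  assumes "a \<in> carrier V" "b \<in> carrier V" "coset_class V E D a = coset_class V E D b"
  shows "\<exists>d\<in>D. a = d \<oplus>\<^bsub>V\<^esub> b"
proof -
  have "E +>\<^bsub>V\<^esub> (\<zero>\<^bsub>V\<^esub> \<oplus>\<^bsub>V\<^esub> a) \<in> coset_class V E D b"
    using D0 assms(3) by (auto simp: coset_class_def)
  then obtain d where d: "d \<in> D" "E +>\<^bsub>V\<^esub> a = E +>\<^bsub>V\<^esub> (d \<oplus>\<^bsub>V\<^esub> b)"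
    using assms(1) by (auto simp: coset_class_def)
  have "a \<in> E +>\<^bsub>V\<^esub> a" using E0 assms(1) by (auto simp: mem_a_r_coset intro!: bexI[of _ "\<zero>\<^bsub>V\<^esub>"])
  then obtain n where "n \<in> E" "a = n \<oplus>\<^bsub>V\<^esub> (d \<oplus>\<^bsub>V\<^esub> b)" using d(2) by (auto simp: mem_a_r_coset)
  then have "a = (n \<oplus>\<^bsub>V\<^esub> d) \<oplus>\<^bsub>V\<^esub> b" "n \<oplus>\<^bsub>V\<^esub> d \<in> D"
    using assms(2) d(1) DV EV ED D_add by (auto simp: V.a_assoc)
  then show ?thesis by blast
qed

text \<open>In degree 0 the inner quotient map adds the zero chain and the outer one adds the
  boundaries; the formula on sets then amounts to applying \<open>f\<close> to a representative.
  Scalar multiplication, the group action and the maps induced by cosheaf maps all have this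
  shape.\<close>

lemma coset_class_push:
  fixes W :: "('f, 'w) module"
  assumes W: "Module.module F W" and a: "a \<in> carrier W"
    and f: "f \<in> carrier W \<rightarrow> carrier V" "\<And>u v. u \<in> carrier W \<Longrightarrow> v \<in> carrier W \<Longrightarrow> f (u \<oplus>\<^bsub>W\<^esub> v) = f u \<oplus>\<^bsub>V\<^esub> f v"
    and E': "add_subgroup W E'" "f ` E' \<subseteq> E" and D': "add_subgroup W D'" "f ` D' \<subseteq> D"
    and Z: "\<And>Y Y'. Y \<oplus>\<^bsub>Z\<^esub> Y' = Y <+>\<^bsub>V\<^esub> Y'"
  shows "coset_class V E D \<zero>\<^bsub>V\<^esub> <+>\<^bsub>Z\<^esub> (\<lambda>Y. {\<zero>\<^bsub>V\<^esub>} <+>\<^bsub>V\<^esub> f ` Y) ` coset_class W E' D' a = coset_class V E D (f a)"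
proof -
  interpret W: Module.module F W by (fact W)
  have E'W: "n \<in> E' \<Longrightarrow> n \<in> carrier W" "\<zero>\<^bsub>W\<^esub> \<in> E'" and D'W: "n \<in> D' \<Longrightarrow> n \<in> carrier W" "\<zero>\<^bsub>W\<^esub> \<in> D'" for n
    using E' D' by (auto simp: add_subgroup_def)
  have fV: "f w \<in> carrier V" if "w \<in> carrier W" for w using f(1) that by auto
  have f0: "f \<zero>\<^bsub>W\<^esub> = \<zero>\<^bsub>V\<^esub>"
    using f(2)[of "\<zero>\<^bsub>W\<^esub>" "\<zero>\<^bsub>W\<^esub>"] fV[of "\<zero>\<^bsub>W\<^esub>"] by simp
  have push: "(E +>\<^bsub>V\<^esub> b) <+>\<^bsub>V\<^esub> ({\<zero>\<^bsub>V\<^esub>} <+>\<^bsub>V\<^esub> f ` (E' +>\<^bsub>W\<^esub> c)) = E +>\<^bsub>V\<^esub> (b \<oplus>\<^bsub>V\<^esub> f c)"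
    if bc: "b \<in> carrier V" "c \<in> carrier W" for b c
  proof (intro equalityI subsetI)
    fix w assume "w \<in> (E +>\<^bsub>V\<^esub> b) <+>\<^bsub>V\<^esub> ({\<zero>\<^bsub>V\<^esub>} <+>\<^bsub>V\<^esub> f ` (E' +>\<^bsub>W\<^esub> c))"
    then obtain n m where nm: "n \<in> E" "m \<in> E'" "w = (n \<oplus>\<^bsub>V\<^esub> b) \<oplus>\<^bsub>V\<^esub> (\<zero>\<^bsub>V\<^esub> \<oplus>\<^bsub>V\<^esub> f (m \<oplus>\<^bsub>W\<^esub> c))"
      by (auto simp: mem_set_add mem_a_r_coset)
    have fm: "f m \<in> E" using nm(2) E' by auto
    have "w = (n \<oplus>\<^bsub>V\<^esub> f m) \<oplus>\<^bsub>V\<^esub> (b \<oplus>\<^bsub>V\<^esub> f c)"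
      using nm bc EV E'W fV by (simp add: f(2) V.a_ac)
    then show "w \<in> E +>\<^bsub>V\<^esub> (b \<oplus>\<^bsub>V\<^esub> f c)"
      using E_add[OF nm(1) fm] by (auto simp: mem_a_r_coset)
  next
    fix w assume "w \<in> E +>\<^bsub>V\<^esub> (b \<oplus>\<^bsub>V\<^esub> f c)"
    then obtain n where n: "n \<in> E" "w = n \<oplus>\<^bsub>V\<^esub> (b \<oplus>\<^bsub>V\<^esub> f c)" by (auto simp: mem_a_r_coset)
    then have "w = (n \<oplus>\<^bsub>V\<^esub> b) \<oplus>\<^bsub>V\<^esub> (\<zero>\<^bsub>V\<^esub> \<oplus>\<^bsub>V\<^esub> f (\<zero>\<^bsub>W\<^esub> \<oplus>\<^bsub>W\<^esub> c))"
      using bc EV fV by (simp add: V.a_assoc)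
    then show "w \<in> (E +>\<^bsub>V\<^esub> b) <+>\<^bsub>V\<^esub> ({\<zero>\<^bsub>V\<^esub>} <+>\<^bsub>V\<^esub> f ` (E' +>\<^bsub>W\<^esub> c))"
      using n(1) E'W(2) by (auto intro!: set_addI a_r_cosetI imageI)
  qed
  show ?thesis
  proof (intro equalityI subsetI)
    fix w assume "w \<in> coset_class V E D \<zero>\<^bsub>V\<^esub> <+>\<^bsub>Z\<^esub> (\<lambda>Y. {\<zero>\<^bsub>V\<^esub>} <+>\<^bsub>V\<^esub> f ` Y) ` coset_class W E' D' a"
    then obtain n m where nm: "n \<in> D" "m \<in> D'"
        "w = (E +>\<^bsub>V\<^esub> (n \<oplus>\<^bsub>V\<^esub> \<zero>\<^bsub>V\<^esub>)) <+>\<^bsub>V\<^esub> ({\<zero>\<^bsub>V\<^esub>} <+>\<^bsub>V\<^esub> f ` (E' +>\<^bsub>W\<^esub> (m \<oplus>\<^bsub>W\<^esub> a)))"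
      by (auto simp: mem_set_add[where V=Z] coset_class_def Z)
    have fm: "f m \<in> D" using nm(2) D' by auto
    have "w = E +>\<^bsub>V\<^esub> ((n \<oplus>\<^bsub>V\<^esub> f m) \<oplus>\<^bsub>V\<^esub> f a)"
      using nm a DV D'W fV by (simp add: push f(2) V.a_assoc)
    then show "w \<in> coset_class V E D (f a)" using D_add[OF nm(1) fm] by (auto simp: coset_class_def)
  next
    fix w assume "w \<in> coset_class V E D (f a)"
    then obtain n where n: "n \<in> D" "w = E +>\<^bsub>V\<^esub> (n \<oplus>\<^bsub>V\<^esub> f a)" by (auto simp: coset_class_def)
    then have w: "w = (E +>\<^bsub>V\<^esub> (n \<oplus>\<^bsub>V\<^esub> \<zero>\<^bsub>V\<^esub>)) <+>\<^bsub>V\<^esub> ({\<zero>\<^bsub>V\<^esub>} <+>\<^bsub>V\<^esub> f ` (E' +>\<^bsub>W\<^esub> (\<zero>\<^bsub>W\<^esub> \<oplus>\<^bsub>W\<^esub> a)))"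
      using a DV fV by (simp add: push)
    have "E +>\<^bsub>V\<^esub> (n \<oplus>\<^bsub>V\<^esub> \<zero>\<^bsub>V\<^esub>) \<in> coset_class V E D \<zero>\<^bsub>V\<^esub>"
      and "E' +>\<^bsub>W\<^esub> (\<zero>\<^bsub>W\<^esub> \<oplus>\<^bsub>W\<^esub> a) \<in> coset_class W E' D' a"
      unfolding coset_class_def using n(1) D'W(2) by (auto intro: imageI)
    from set_addI[of _ _ _ _ Z, unfolded Z, OF this(1) imageI[OF this(2)]]
    show "w \<in> coset_class V E D \<zero>\<^bsub>V\<^esub> <+>\<^bsub>Z\<^esub> (\<lambda>Y. {\<zero>\<^bsub>V\<^esub>} <+>\<^bsub>V\<^esub> f ` Y) ` coset_class W E' D' a"
      unfolding w .
  qed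
qed

end


section \<open>Actions on simplicial sets\<close>

definition vertex_map :: "nat \<Rightarrow> nat \<Rightarrow> nat" where
  "vertex_map i = (\<lambda>j\<in>{..0}. i)"

lemma vertex_map_delta [simp]: "i \<le> n \<Longrightarrow> vertex_map i \<in> delta_maps 0 n"
  by (auto simp: vertex_map_def delta_maps_def mono_on_def)

lemma coface_delta [simp]: "coface n i \<in> delta_maps n (Suc n)"
  by (auto simp: coface_def delta_maps_def mono_on_def)

lemma codegen_delta [simp]: "i \<le> n \<Longrightarrow> codegen n i \<in> delta_maps (Suc n) n"
  by (auto simp: codegen_def delta_maps_def mono_on_def)

lemma coface_vertex_map: "coface 0 0 = vertex_map (Suc 0)" "coface 0 (Suc 0) = vertex_map 0"
  by (auto simp: coface_def vertex_map_def intro!: restrict_ext)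

lemma compose_vertex_map: "compose {0} f (vertex_map i) = vertex_map (f i)"
  by (auto simp: compose_def vertex_map_def intro!: restrict_ext)

text \<open>The argument \<open>univ\<close> ties the type \<open>'u\<close> to the locale, so that
  the size conditions concern the same universe as the cosheaves.\<close>

locale simplicial_action = tdlc G T
  for G :: "'g monoid" (structure) and T :: "'g topology" +
  fixes F :: "'f ring" and Xs :: "('g, 'x) gsset" and univ :: "'u itself"
  assumes field_F: "field F" and sset: "simplicial_set Xs" and action: "sset_action G Xs"
    and continuous: "continuous_action G T Xs"
    and infinite_univ: "infinite (UNIV :: 'u set)" and card_univ: "|splx Xs 0| \<le>o |UNIV :: 'u set|"
begin

lemma cring_F: "cring F"
  using field_F by (rule fieldE(1))

lemma struct_closed [simp]:
  "f \<in> delta_maps m n \<Longrightarrow> x \<in> splx Xs n \<Longrightarrow> struct_map Xs m n f x \<in> splx Xs m"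
  using sset by (auto simp: simplicial_set_def)

lemma struct_comp:
  "h \<in> delta_maps k m \<Longrightarrow> f \<in> delta_maps m n \<Longrightarrow> x \<in> splx Xs n \<Longrightarrow>
     struct_map Xs k m h (struct_map Xs m n f x) = struct_map Xs k n (compose {..k} f h) x"
  using sset unfolding simplicial_set_def by metis

lemma struct_ident: "x \<in> splx Xs n \<Longrightarrow> struct_map Xs n n (\<lambda>i\<in>{..n}. i) x = x"
  using sset by (auto simp: simplicial_set_def)

abbreviation vertex :: "nat \<Rightarrow> nat \<Rightarrow> 'x \<Rightarrow> 'x" where
  "vertex n i \<equiv> struct_map Xs 0 n (vertex_map i)"

lemma vertex_0: "x \<in> splx Xs 0 \<Longrightarrow> vertex 0 0 x = x"
  using struct_ident[of x 0] by (simp add: vertex_map_def restrict_def cong: if_cong)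

lemma vertex_struct:
  "f \<in> delta_maps m n \<Longrightarrow> i \<le> m \<Longrightarrow> x \<in> splx Xs n \<Longrightarrow> vertex m i (struct_map Xs m n f x) = vertex n (f i) x"
  by (simp add: struct_comp compose_vertex_map)

lemma act_group: "group_action G (splx Xs n) (sact Xs n)"
  using action by (simp add: sset_action_def)

lemma act_closed [simp]: "g \<in> carrier G \<Longrightarrow> x \<in> splx Xs n \<Longrightarrow> sact Xs n g x \<in> splx Xs n"
  using group_action.element_image[OF act_group] by blast

lemma act_mult: "g \<in> carrier G \<Longrightarrow> h \<in> carrier G \<Longrightarrow> x \<in> splx Xs n \<Longrightarrow>
    sact Xs n (g \<otimes> h) x = sact Xs n g (sact Xs n h x)"
  using group_action.composition_rule[OF act_group] by blast

lemma act_one: "x \<in> splx Xs n \<Longrightarrow> sact Xs n \<one> x = x"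
  using group_action.id_eq_one[OF act_group] by (metis restrict_apply')

lemma act_inv [simp]:
  assumes "g \<in> carrier G" "x \<in> splx Xs n"
  shows "sact Xs n (inv g) (sact Xs n g x) = x" "sact Xs n g (sact Xs n (inv g) x) = x"
  using act_mult[of "inv g" g x n] act_mult[of g "inv g" x n] assms by (simp_all add: act_one)

lemma stabilizer_open: "x \<in> splx Xs n \<Longrightarrow> openin T (stabilizer G (sact Xs n) x)"
  using continuous by (simp add: continuous_action_def)

lemma stabilizer_subgroup: "x \<in> splx Xs n \<Longrightarrow> subgroup (stabilizer G (sact Xs n) x) G"
  by (rule group_action.stabilizer_subgroup[OF act_group])

lemma perm: "g \<in> carrier G \<Longrightarrow> x \<in> splx Xs n \<Longrightarrow> sperm Xs n g x permutes {..n}"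
  using action by (simp add: sset_action_def)

lemma perm_le: "g \<in> carrier G \<Longrightarrow> x \<in> splx Xs n \<Longrightarrow> i \<le> n \<Longrightarrow> sperm Xs n g x i \<le> n"
  using permutes_in_image[OF perm] by fastforce

lemma perm_0: "g \<in> carrier G \<Longrightarrow> x \<in> splx Xs 0 \<Longrightarrow> sperm Xs 0 g x = id"
  using perm[of g x 0] by simp

lemma act_coface:
  assumes "g \<in> carrier G" "x \<in> splx Xs (Suc n)" "i \<le> Suc n"
  shows "sact Xs n g (struct_map Xs n (Suc n) (coface n i) x)
      = struct_map Xs n (Suc n) (coface n (sperm Xs (Suc n) g x i)) (sact Xs (Suc n) g x)"
    and "j \<le> n \<Longrightarrow> sperm Xs (Suc n) g x (coface n i j)
      = coface n (sperm Xs (Suc n) g x i) (sperm Xs n g (struct_map Xs n (Suc n) (coface n i) x) j)"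
  using action assms unfolding sset_action_def by (simp_all add: Let_def)

lemma act_codegen:
  assumes "g \<in> carrier G" "x \<in> splx Xs n" "i \<le> n"
  shows "sact Xs (Suc n) g (struct_map Xs (Suc n) n (codegen n i) x)
      = struct_map Xs (Suc n) n (codegen n (sperm Xs n g x i)) (sact Xs n g x)"
  using action assms unfolding sset_action_def by (simp add: Let_def)

lemma degenerate_act:
  assumes "degenerate Xs n x" "g \<in> carrier G"
  shows "degenerate Xs n (sact Xs n g x)"
  using assms act_codegen perm_le unfolding degenerate_def by (metis act_closed)

text \<open>The axioms of an action describe faces, so a vertex is followed through a face that
  contains it, down to dimension 0.\<close>

lemma vertex_act:
  "g \<in> carrier G \<Longrightarrow> x \<in> splx Xs n \<Longrightarrow> i \<le> n \<Longrightarrow>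
     sact Xs 0 g (vertex n i x) = vertex n (sperm Xs n g x i) (sact Xs n g x)"
proof (induction n arbitrary: x i)
  case 0
  then show ?case by (simp add: vertex_0 perm_0)
next
  case (Suc n)
  \<comment> \<open>The face opposite to vertex \<open>k\<close> contains vertex \<open>i\<close>,
    because \<open>k\<close> differs from \<open>i\<close>; in that face it has number
    \<open>j\<close>.\<close>
  define k where "k = (if i = 0 then 1 else (0::nat))"
  define j where "j = (if i = 0 then 0 else i - 1)"
  have kj: "k \<le> Suc n" "j \<le> n" "coface n k j = i" using Suc.prems by (auto simp: k_def j_def coface_def)
  let ?y = "struct_map Xs n (Suc n) (coface n k) x"
  have "sact Xs 0 g (vertex (Suc n) i x) = sact Xs 0 g (vertex n j ?y)"
    using vertex_struct[OF coface_delta kj(2) Suc.prems(2), of k] kj(3) by simp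
  also have "\<dots> = vertex n (sperm Xs n g ?y j) (sact Xs n g ?y)"
    using Suc kj by simp
  also have "\<dots> = vertex (Suc n) (sperm Xs (Suc n) g x i) (sact Xs (Suc n) g x)"
    using act_coface(1)[OF Suc.prems(1,2) kj(1)] act_coface(2)[OF Suc.prems(1,2) kj(1,2)] kj(3)
      vertex_struct[OF coface_delta perm_le[OF Suc.prems(1) _ kj(2), of ?y] act_closed[OF Suc.prems(1,2)]]
      Suc.prems by simp
  finally show ?case .
qed

lemma delta_act_vertex:
  assumes "g \<in> carrier G" "x \<in> splx Xs n" "i \<le> n"
  shows "delta_act Xs 0 n g (vertex_map i) x = vertex_map (sperm Xs n g x i)"
proof -
  have "sperm Xs 0 g (vertex n i x) = id" using assms by (simp add: perm_0)
  then show ?thesis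
    unfolding delta_act_def by (auto simp: inv_id vertex_map_def intro!: restrict_ext)
qed

section \<open>Consequences of the cosheaf axioms\<close>

definition is_cosheaf :: "('f, 'u, 'x, 'g) cosheaf \<Rightarrow> bool" where
  "is_cosheaf C \<longleftrightarrow> equivariant_cosheaf F G T Xs C"

context
  fixes C :: "('f, 'u, 'x, 'g) cosheaf"
  assumes C: "is_cosheaf C"
begin

lemma csh_module: "x \<in> splx Xs n \<Longrightarrow> Module.module F (cval C n x)"
  using C by (simp add: is_cosheaf_def equivariant_cosheaf_def)

lemma csh_map_linear: "f \<in> delta_maps m n \<Longrightarrow> x \<in> splx Xs n \<Longrightarrow>
    cmap C m n f x \<in> lin_maps F (cval C n x) (cval C m (struct_map Xs m n f x))"
  using C by (simp add: is_cosheaf_def equivariant_cosheaf_def)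

lemma csh_ident: "x \<in> splx Xs n \<Longrightarrow> v \<in> carrier (cval C n x) \<Longrightarrow> cmap C n n (\<lambda>i\<in>{..n}. i) x v = v"
  using C by (simp add: is_cosheaf_def equivariant_cosheaf_def)

lemma csh_comp: "h \<in> delta_maps k m \<Longrightarrow> f \<in> delta_maps m n \<Longrightarrow> x \<in> splx Xs n \<Longrightarrow> v \<in> carrier (cval C n x) \<Longrightarrow>
    cmap C k m h (struct_map Xs m n f x) (cmap C m n f x v) = cmap C k n (compose {..k} f h) x v"
  using C by (simp add: is_cosheaf_def equivariant_cosheaf_def)

lemma csh_act_linear: "g \<in> carrier G \<Longrightarrow> x \<in> splx Xs n \<Longrightarrow>
    cact C n g x \<in> lin_maps F (cval C n x) (cval C n (sact Xs n g x))"
  using C by (simp add: is_cosheaf_def equivariant_cosheaf_def)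

lemma csh_act_mult: "g \<in> carrier G \<Longrightarrow> h \<in> carrier G \<Longrightarrow> x \<in> splx Xs n \<Longrightarrow> v \<in> carrier (cval C n x) \<Longrightarrow>
    cact C n g (sact Xs n h x) (cact C n h x v) = cact C n (g \<otimes> h) x v"
  using C by (simp add: is_cosheaf_def equivariant_cosheaf_def)

lemma csh_smooth: "x \<in> splx Xs n \<Longrightarrow>
    smooth_rep F (G\<lparr>carrier := stabilizer G (sact Xs n) x\<rparr>) (subtopology T (stabilizer G (sact Xs n) x))
          \<lparr>rspace = cval C n x, ract = (\<lambda>g. cact C n g x)\<rparr>"
  using C by (simp add: is_cosheaf_def equivariant_cosheaf_def Let_def)

lemma csh_equivariant: "g \<in> carrier G \<Longrightarrow> f \<in> delta_maps m n \<Longrightarrow> x \<in> splx Xs n \<Longrightarrow> v \<in> carrier (cval C n x) \<Longrightarrow>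
    cact C m g (struct_map Xs m n f x) (cmap C m n f x v) =
        cmap C m n (delta_act Xs m n g f x) (sact Xs n g x) (cact C n g x v)"
  using C by (simp add: is_cosheaf_def equivariant_cosheaf_def)

text \<open>The identity acts trivially because the value is a representation of the stabiliser; the
  composition law alone would only make it idempotent.\<close>

lemma csh_act_one: "x \<in> splx Xs n \<Longrightarrow> v \<in> carrier (cval C n x) \<Longrightarrow> cact C n \<one> x v = v"
  using csh_smooth by (auto simp: smooth_rep_def)

lemma csh_vertex_comp:
  assumes "f \<in> delta_maps m n" "i \<le> m" "x \<in> splx Xs n" "v \<in> carrier (cval C n x)"
  shows "cmap C 0 m (vertex_map i) (struct_map Xs m n f x) (cmap C m n f x v) = cmap C 0 n (vertex_map (f i)) x v"
  using csh_comp[of "vertex_map i" 0 m f n x v] assms by (simp add: compose_vertex_map)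

lemma csh_vertex_act:
  assumes "g \<in> carrier G" "x \<in> splx Xs n" "i \<le> n" "v \<in> carrier (cval C n x)"
  shows "cact C 0 g (vertex n i x) (cmap C 0 n (vertex_map i) x v)
     = cmap C 0 n (vertex_map (sperm Xs n g x i)) (sact Xs n g x) (cact C n g x v)"
  using csh_equivariant[of g "vertex_map i" 0 n x v] assms by (simp add: delta_act_vertex)

lemma csh_vertex_0: "x \<in> splx Xs 0 \<Longrightarrow> v \<in> carrier (cval C 0 x) \<Longrightarrow> cmap C 0 0 (vertex_map 0) x v = v"
  using csh_ident[of x 0 v] by (simp add: vertex_map_def restrict_def cong: if_cong)

lemma chains_family: "module_family F (splx Xs n) (cval C n)"
  by (rule module_family.intro[OF cring_F csh_module])

end

end


section \<open>Homology in degree 0\<close>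

lemma lin_maps_diff:
  assumes f: "f \<in> lin_maps F V W" and g: "g \<in> lin_maps F V W" and W: "Module.module F W"
  shows "(\<lambda>v. f v \<ominus>\<^bsub>W\<^esub> g v) \<in> lin_maps F V W"
proof -
  interpret W: Module.module F W by (fact W)
  note cl = lin_maps_closed[OF f] lin_maps_closed[OF g]
  show ?thesis
  proof (rule lin_mapsI)
    fix u v assume uv: "u \<in> carrier V" "v \<in> carrier V"
    then show "f (u \<oplus>\<^bsub>V\<^esub> v) \<ominus>\<^bsub>W\<^esub> g (u \<oplus>\<^bsub>V\<^esub> v) = (f u \<ominus>\<^bsub>W\<^esub> g u) \<oplus>\<^bsub>W\<^esub> (f v \<ominus>\<^bsub>W\<^esub> g v)"
      using cl[OF uv(1)] cl[OF uv(2)] by (simp add: lin_maps_add[OF f] lin_maps_add[OF g] a_minus_def W.minus_add W.a_ac)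
  next
    fix k v assume kv: "k \<in> carrier F" "v \<in> carrier V"
    then show "f (k \<odot>\<^bsub>V\<^esub> v) \<ominus>\<^bsub>W\<^esub> g (k \<odot>\<^bsub>V\<^esub> v) = k \<odot>\<^bsub>W\<^esub> (f v \<ominus>\<^bsub>W\<^esub> g v)"
      using cl[OF kv(2)] by (simp add: lin_maps_smult[OF f] lin_maps_smult[OF g] a_minus_def W.smult_r_distr W.smult_r_minus)
  qed (use cl in simp)
qed

context simplicial_action
begin

abbreviation chain :: "('f, 'u, 'x, 'g) cosheaf \<Rightarrow> nat \<Rightarrow> ('f, 'x \<Rightarrow> 'u) module" where
  "chain C n \<equiv> all_chains Xs C n"

definition single :: "('f, 'u, 'x, 'g) cosheaf \<Rightarrow> nat \<Rightarrow> 'x \<Rightarrow> 'u \<Rightarrow> 'x \<Rightarrow> 'u" where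
  "single C n x v = ds_single (splx Xs n) (cval C n) x v"

text \<open>The face that misses 0 is vertex 1, so vertex 1 enters with the positive sign.\<close>

definition edge_boundary :: "('f, 'u, 'x, 'g) cosheaf \<Rightarrow> 'x \<Rightarrow> 'u \<Rightarrow> 'x \<Rightarrow> 'u" where
  "edge_boundary C x v =
     single C 0 (vertex (Suc 0) (Suc 0) x) (cmap C 0 (Suc 0) (vertex_map (Suc 0)) x v) \<ominus>\<^bsub>chain C 0\<^esub>
     single C 0 (vertex (Suc 0) 0 x) (cmap C 0 (Suc 0) (vertex_map 0) x v)"

text \<open>Taking \<open>P\<close> to be degeneracy gives the subgroup \<open>E\<close> of the
  iterated quotient, and the constant condition gives \<open>D\<close>.\<close>

definition bounding :: "('f, 'u, 'x, 'g) cosheaf \<Rightarrow> ('x \<Rightarrow> bool) \<Rightarrow> ('x \<Rightarrow> 'u) set" where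
  "bounding C P = differential Xs C 0 ` {c \<in> carrier (chain C (Suc 0)). \<forall>x\<in>splx Xs (Suc 0). c x \<noteq> \<zero>\<^bsub>cval C (Suc 0) x\<^esub> \<longrightarrow> P x}"

abbreviation bdE :: "('f, 'u, 'x, 'g) cosheaf \<Rightarrow> ('x \<Rightarrow> 'u) set" where
  "bdE C \<equiv> bounding C (degenerate Xs (Suc 0))"

abbreviation bdD :: "('f, 'u, 'x, 'g) cosheaf \<Rightarrow> ('x \<Rightarrow> 'u) set" where
  "bdD C \<equiv> bounding C (\<lambda>x. True)"

context
  fixes C :: "('f, 'u, 'x, 'g) cosheaf"
  assumes C: "is_cosheaf C"
begin

lemma module_chain: "Module.module F (chain C n)"
  unfolding all_chains_def by (rule module_family.module_DS[OF chains_family[OF C]])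

lemma carrier_chain:
  "c \<in> carrier (chain C n) \<longleftrightarrow> c \<in> extensional (splx Xs n) \<and>
     (\<forall>x\<in>splx Xs n. c x \<in> carrier (cval C n x)) \<and> finite {x \<in> splx Xs n. c x \<noteq> \<zero>\<^bsub>cval C n x\<^esub>}"
  unfolding all_chains_def by (rule module_family.carrier_DS[OF chains_family[OF C]])

lemma single_linear: "x \<in> splx Xs n \<Longrightarrow> single C n x \<in> lin_maps F (cval C n x) (chain C n)"
  using module_family.single_linear[OF chains_family[OF C]]
  by (simp add: all_chains_def single_def[abs_def])

lemma single_closed: "x \<in> splx Xs n \<Longrightarrow> v \<in> carrier (cval C n x) \<Longrightarrow> single C n x v \<in> carrier (chain C n)"
  using lin_maps_closed[OF single_linear] .

lemma chain_induct [consumes 1, case_names zero add]: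
  assumes "c \<in> carrier (chain C n)" "Q \<zero>\<^bsub>chain C n\<^esub>"
    and "\<And>d x v. d \<in> carrier (chain C n) \<Longrightarrow> Q d \<Longrightarrow> x \<in> splx Xs n \<Longrightarrow> v \<in> carrier (cval C n x) \<Longrightarrow>
           c x \<noteq> \<zero>\<^bsub>cval C n x\<^esub> \<Longrightarrow> Q (d \<oplus>\<^bsub>chain C n\<^esub> single C n x v)"
  shows "Q c"
  using module_family.DS_induct[OF chains_family[OF C], of c n Q] assms
  by (simp add: all_chains_def single_def)

lemma edge_boundary_linear:
  assumes "x \<in> splx Xs (Suc 0)" shows "edge_boundary C x \<in> lin_maps F (cval C (Suc 0) x) (chain C 0)"
proof -
  have "(\<lambda>v. single C 0 (vertex (Suc 0) i x) (cmap C 0 (Suc 0) (vertex_map i) x v)) \<in> lin_maps F (cval C (Suc 0) x) (chain C 0)"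
    if "i \<le> Suc 0" for i
    using assms that by (intro lin_maps_compose[OF csh_map_linear[OF C] single_linear]) auto
  from lin_maps_diff[OF this[of "Suc 0"] this[of 0] module_chain] show ?thesis
    by (simp add: edge_boundary_def[abs_def])
qed

lemma evaluation_linear: "y \<in> splx Xs n \<Longrightarrow> (\<lambda>c. c y) \<in> lin_maps F (chain C n) (cval C n y)"
  by (auto simp: lin_maps_def all_chains_def direct_sum_def)

text \<open>The definition sums over pairs of an edge and a face index with a prescribed target.
  Regrouped by edges it is the linear extension of \<open>edge_boundary\<close>, so linearity is
  inherited from the direct sum.\<close>

lemma differential_lift:
  assumes c: "c \<in> carrier (chain C (Suc 0))"
  shows "differential Xs C 0 c = ds_lift (splx Xs (Suc 0)) (cval C (Suc 0)) (chain C 0) (edge_boundary C) c"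
    (is "_ = ?r")
proof (rule extensionalityI[of _ "splx Xs 0"])
  interpret fam: module_family F "splx Xs (Suc 0)" "cval C (Suc 0)" by (rule chains_family[OF C])
  let ?s = "{x \<in> splx Xs (Suc 0). c x \<noteq> \<zero>\<^bsub>cval C (Suc 0) x\<^esub>}"
  have c': "finite ?s" "\<And>x. x \<in> splx Xs (Suc 0) \<Longrightarrow> c x \<in> carrier (cval C (Suc 0) x)"
    using c by (auto simp: all_chains_def fam.carrier_DS)
  show "differential Xs C 0 c \<in> extensional (splx Xs 0)"
    by (simp add: differential_def)
  have "?r \<in> carrier (chain C 0)"
    using lin_maps_closed[OF fam.ds_lift_linear[OF module_chain edge_boundary_linear]]
      c[unfolded all_chains_def] by blast
  then show "?r \<in> extensional (splx Xs 0)"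
    using carrier_chain by blast
  fix y assume y: "y \<in> splx Xs 0"
  interpret W: Module.module F "cval C 0 y" by (rule csh_module[OF C y])
  \<comment> \<open>The contribution of vertex \<open>i\<close> of the edge \<open>x\<close> to the
    coefficient at \<open>y\<close>; it is zero when that vertex is not \<open>y\<close>.\<close>
  define t where "t i x = (if vertex (Suc 0) i x = y then cmap C 0 (Suc 0) (vertex_map i) x (c x) else \<zero>\<^bsub>cval C 0 y\<^esub>)" for i x
  have t_closed: "t i x \<in> carrier (cval C 0 y)" if "i \<le> Suc 0" "x \<in> ?s" for i x
    using lin_maps_closed[OF csh_map_linear[OF C, of "vertex_map i" 0 "Suc 0" x]] c'(2) that
    by (auto simp: t_def)
  have "?r y = finsum (cval C 0 y) (\<lambda>x. edge_boundary C x (c x) y) ?s"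
    unfolding ds_lift_def
    using lin_maps_finsum[OF evaluation_linear[OF y] module_chain csh_module[OF C y] _ c'(1)]
      c'(2) lin_maps_closed[OF edge_boundary_linear] by auto
  also have "\<dots> = finsum (cval C 0 y) (\<lambda>x. t (Suc 0) x \<ominus>\<^bsub>cval C 0 y\<^esub> t 0 x) ?s"
  proof (rule W.add.finprod_cong')
    show "(\<lambda>x. t (Suc 0) x \<ominus>\<^bsub>cval C 0 y\<^esub> t 0 x) \<in> ?s \<rightarrow> carrier (cval C 0 y)"
      using t_closed by auto
    fix x assume x: "x \<in> ?s"
    have s: "single C 0 (vertex (Suc 0) i x) (cmap C 0 (Suc 0) (vertex_map i) x (c x)) \<in> carrier (chain C 0)" if "i \<le> Suc 0" for i
      using lin_maps_closed[OF csh_map_linear[OF C, of "vertex_map i" 0 "Suc 0" x]] c'(2) that x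
      by (intro single_closed) auto
    have "single C 0 (vertex (Suc 0) i x) (cmap C 0 (Suc 0) (vertex_map i) x (c x)) y = t i x" for i
      using y by (auto simp: single_def ds_single_def t_def)
    then show "edge_boundary C x (c x) y = t (Suc 0) x \<ominus>\<^bsub>cval C 0 y\<^esub> t 0 x"
      unfolding edge_boundary_def
      using lin_maps_minus[OF evaluation_linear[OF y] module_chain csh_module[OF C y] s s, of "Suc 0" 0] by simp
  qed simp
  also have "\<dots> = finsum (cval C 0 y) (t (Suc 0)) ?s \<oplus>\<^bsub>cval C 0 y\<^esub> finsum (cval C 0 y) (\<lambda>x. \<ominus>\<^bsub>cval C 0 y\<^esub> t 0 x) ?s"
    unfolding a_minus_def using t_closed by (intro W.finsum_addf) auto
  finally have r: "?r y = finsum (cval C 0 y) (t (Suc 0)) ?s \<oplus>\<^bsub>cval C 0 y\<^esub> finsum (cval C 0 y) (\<lambda>x. \<ominus>\<^bsub>cval C 0 y\<^esub> t 0 x) ?s" .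
  define h where "h = (\<lambda>(x, i). add_pow (cval C 0 y) ((-1 :: int) ^ i) (cmap C 0 (Suc 0) (coface 0 i) x (c x)))"
  \<comment> \<open>Here \<open>i\<close> counts faces, and the face missing \<open>i\<close> is the
    vertex \<open>Suc 0 - i\<close>; in \<open>t\<close> the index counts vertices.\<close>
  define A where "A i = {x \<in> ?s. vertex (Suc 0) (Suc 0 - i) x = y}" for i :: nat
  have vm: "coface 0 i = vertex_map (Suc 0 - i)" if "i \<le> Suc 0" for i
    using that coface_vertex_map by (cases "i = 0") (auto simp: le_Suc_eq)
  have finA: "finite (A i)" for i
    unfolding A_def by (rule finite_subset[OF _ c'(1)]) auto
  have v: "cmap C 0 (Suc 0) (coface 0 i) x (c x) \<in> carrier (cval C 0 y)" if "x \<in> A i" "i \<le> Suc 0" for x i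
    using lin_maps_closed[OF csh_map_linear[OF C, of "vertex_map (Suc 0 - i)" 0 "Suc 0" x]] c'(2) that vm[OF that(2)]
    by (auto simp: A_def)
  note add_pow_one = add_pow_int_ge[of 1 "cval C 0 y"] and add_pow_minus_one = add_pow_int_lt[of "-1" "cval C 0 y"]
  have h: "h \<in> (\<lambda>x. (x, 0)) ` A 0 \<rightarrow> carrier (cval C 0 y)" "h \<in> (\<lambda>x. (x, 1)) ` A 1 \<rightarrow> carrier (cval C 0 y)"
    using v by (auto simp: h_def add_pow_one add_pow_minus_one)
  \<comment> \<open>Terms outside \<open>A i\<close> vanish by the default value of
    \<open>t\<close>, so the sum may be extended to the whole support.\<close>
  have reindex: "finsum (cval C 0 y) h ((\<lambda>x. (x, i)) ` A i) = finsum (cval C 0 y) r ?s"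
    if "i \<le> 1" and r: "r \<in> ?s \<rightarrow> carrier (cval C 0 y)" "\<And>x. x \<in> A i \<Longrightarrow> h (x, i) = r x"
      "\<And>x. x \<in> ?s - A i \<Longrightarrow> r x = \<zero>\<^bsub>cval C 0 y\<^esub>" for i r
  proof -
    have "h \<in> (\<lambda>x. (x, i)) ` A i \<rightarrow> carrier (cval C 0 y)"
      using h that(1) by (cases "i = 0") (auto simp: le_Suc_eq)
    then have "finsum (cval C 0 y) h ((\<lambda>x. (x, i)) ` A i) = finsum (cval C 0 y) (\<lambda>x. h (x, i)) (A i)"
      by (rule W.add.finprod_reindex) (auto simp: inj_on_def)
    also have "\<dots> = finsum (cval C 0 y) r ?s"
      using r c'(1) by (intro W.add.finprod_mono_neutral_cong_left) (auto simp: A_def)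
    finally show ?thesis .
  qed
  have h0: "h (x, 0) = t (Suc 0) x" if "x \<in> A 0" for x
    using v[OF that] that vm[of 0] by (simp add: h_def A_def t_def add_pow_one)
  have h1: "h (x, 1) = \<ominus>\<^bsub>cval C 0 y\<^esub> t 0 x" if "x \<in> A 1" for x
    using v[OF that] that vm[of "Suc 0"] by (simp add: h_def A_def t_def add_pow_minus_one)
  have "{(x, i). x \<in> splx Xs (Suc 0) \<and> c x \<noteq> \<zero>\<^bsub>cval C (Suc 0) x\<^esub> \<and> i \<le> Suc 0 \<and> struct_map Xs 0 (Suc 0) (coface 0 i) x = y}
      = (\<lambda>x. (x, 0)) ` A 0 \<union> (\<lambda>x. (x, 1)) ` A 1"
    using vm by (auto simp: A_def image_iff le_Suc_eq)
  then have "differential Xs C 0 c y = finsum (cval C 0 y) h ((\<lambda>x. (x, 0)) ` A 0 \<union> (\<lambda>x. (x, 1)) ` A 1)"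
    using y by (simp add: differential_def h_def)
  also have "\<dots> = finsum (cval C 0 y) h ((\<lambda>x. (x, 0)) ` A 0) \<oplus>\<^bsub>cval C 0 y\<^esub> finsum (cval C 0 y) h ((\<lambda>x. (x, 1)) ` A 1)"
    using h finA by (intro W.finsum_Un_disjoint) auto
  also have "finsum (cval C 0 y) h ((\<lambda>x. (x, 0)) ` A 0) = finsum (cval C 0 y) (t (Suc 0)) ?s"
    by (rule reindex[OF _ _ h0]) (use t_closed in \<open>auto simp: A_def t_def\<close>)
  also have "finsum (cval C 0 y) h ((\<lambda>x. (x, 1)) ` A 1) = finsum (cval C 0 y) (\<lambda>x. \<ominus>\<^bsub>cval C 0 y\<^esub> t 0 x) ?s"
    by (rule reindex[OF _ _ h1]) (use t_closed in \<open>auto simp: A_def t_def\<close>)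
  finally show "differential Xs C 0 c y = ?r y" using r by simp
qed

lemma differential_linear: "differential Xs C 0 \<in> lin_maps F (chain C (Suc 0)) (chain C 0)"
proof (rule lin_maps_cong)
  show "ds_lift (splx Xs (Suc 0)) (cval C (Suc 0)) (chain C 0) (edge_boundary C) \<in> lin_maps F (chain C (Suc 0)) (chain C 0)"
    using module_family.ds_lift_linear[OF chains_family[OF C] module_chain edge_boundary_linear]
    by (simp add: all_chains_def)
qed (simp_all add: differential_lift module_chain)

lemma differential_single:
  assumes "x \<in> splx Xs (Suc 0)" "v \<in> carrier (cval C (Suc 0) x)"
  shows "differential Xs C 0 (single C (Suc 0) x v) = edge_boundary C x v"
  using module_family.ds_lift_single[OF chains_family[OF C] module_chain edge_boundary_linear] assms
  by (simp add: differential_lift single_closed) (simp add: single_def)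

text \<open>Evaluation at a simplex is linear, so sums and negatives of chains supported on
  \<open>P\<close> are again supported on \<open>P\<close>.\<close>

lemma bounding_subgroup: "add_subgroup (chain C 0) (bounding C P)"
proof -
  interpret V1: Module.module F "chain C (Suc 0)" by (rule module_chain)
  let ?N = "{c \<in> carrier (chain C (Suc 0)). \<forall>x\<in>splx Xs (Suc 0). c x \<noteq> \<zero>\<^bsub>cval C (Suc 0) x\<^esub> \<longrightarrow> P x}"
  note ev = evaluation_linear[where n="Suc 0"]
  have N1: "\<zero>\<^bsub>chain C (Suc 0)\<^esub> \<in> ?N"
    using lin_maps_zero[OF ev module_chain csh_module[OF C]] by simp
  have N2: "c \<oplus>\<^bsub>chain C (Suc 0)\<^esub> d \<in> ?N" if "c \<in> ?N" "d \<in> ?N" for c d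
  proof -
    have "P x" if x: "x \<in> splx Xs (Suc 0)" and nz: "(c \<oplus>\<^bsub>chain C (Suc 0)\<^esub> d) x \<noteq> \<zero>\<^bsub>cval C (Suc 0) x\<^esub>" for x
    proof -
      interpret Vx: Module.module F "cval C (Suc 0) x" by (rule csh_module[OF C x])
      have "c x \<noteq> \<zero>\<^bsub>cval C (Suc 0) x\<^esub> \<or> d x \<noteq> \<zero>\<^bsub>cval C (Suc 0) x\<^esub>"
        using nz lin_maps_add[OF ev[OF x], of c d] \<open>c \<in> ?N\<close> \<open>d \<in> ?N\<close> by auto
      then show ?thesis using x \<open>c \<in> ?N\<close> \<open>d \<in> ?N\<close> by auto
    qed
    then show ?thesis using that by auto
  qed
  have N3: "\<ominus>\<^bsub>chain C (Suc 0)\<^esub> c \<in> ?N" if c: "c \<in> ?N" for c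
  proof -
    have "P x" if x: "x \<in> splx Xs (Suc 0)" and nz: "(\<ominus>\<^bsub>chain C (Suc 0)\<^esub> c) x \<noteq> \<zero>\<^bsub>cval C (Suc 0) x\<^esub>" for x
    proof -
      interpret Vx: Module.module F "cval C (Suc 0) x" by (rule csh_module[OF C x])
      have "c x \<noteq> \<zero>\<^bsub>cval C (Suc 0) x\<^esub>"
        using nz lin_maps_uminus[OF ev[OF x] module_chain csh_module[OF C x], of c] c by auto
      then show ?thesis using x c by auto
    qed
    then show ?thesis using c by auto
  qed
  show ?thesis
    unfolding add_subgroup_def bounding_def
  proof (intro conjI ballI subsetI)
    show "\<zero>\<^bsub>chain C 0\<^esub> \<in> differential Xs C 0 ` ?N"
      using imageI[OF N1, of "differential Xs C 0"] lin_maps_zero[OF differential_linear module_chain module_chain]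
      by simp
    fix u assume "u \<in> differential Xs C 0 ` ?N"
    then obtain c where c: "c \<in> ?N" "u = differential Xs C 0 c" by auto
    then have cV: "c \<in> carrier (chain C (Suc 0))" by simp
    show "u \<in> carrier (chain C 0)" using lin_maps_closed[OF differential_linear cV] c by simp
    show "\<ominus>\<^bsub>chain C 0\<^esub> u \<in> differential Xs C 0 ` ?N"
      using imageI[OF N3[OF c(1)], of "differential Xs C 0"]
        lin_maps_uminus[OF differential_linear module_chain module_chain cV] c(2) by simp
    fix w assume "w \<in> differential Xs C 0 ` ?N"
    then obtain d where d: "d \<in> ?N" "w = differential Xs C 0 d" by auto
    then have dV: "d \<in> carrier (chain C (Suc 0))" by simp
    show "u \<oplus>\<^bsub>chain C 0\<^esub> w \<in> differential Xs C 0 ` ?N"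
      using imageI[OF N2[OF c(1) d(1)], of "differential Xs C 0"] lin_maps_add[OF differential_linear cV dV] c(2) d(2)
      by simp
  qed
qed

lemma bdE_subset_bdD: "bdE C \<subseteq> bdD C"
  unfolding bounding_def by auto

lemma edge_boundary_bounding:
  assumes "x \<in> splx Xs (Suc 0)" "v \<in> carrier (cval C (Suc 0) x)" "P x"
  shows "edge_boundary C x v \<in> bounding C P"
  unfolding bounding_def
  by (rule image_eqI[of _ "differential Xs C 0", OF differential_single[OF assms(1,2), symmetric]])
     (use assms single_closed in \<open>auto simp: single_def ds_single_def\<close>)

text \<open>It is enough to test generators of the chains, that is, vectors on single edges.
  Invariance of the boundaries under scalars, the group and cosheaf maps is reduced to edges in this
  way.\<close>

lemma bounding_image:
  assumes W: "Module.module F W" and \<phi>: "\<phi> \<in> lin_maps F (chain C 0) W" and Z: "add_subgroup W Z"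
    and edge: "\<And>x v. x \<in> splx Xs (Suc 0) \<Longrightarrow> P x \<Longrightarrow> v \<in> carrier (cval C (Suc 0) x) \<Longrightarrow> \<phi> (edge_boundary C x v) \<in> Z"
  shows "\<phi> ` bounding C P \<subseteq> Z"
proof -
  have "\<phi> (differential Xs C 0 c) \<in> Z"
    if "c \<in> carrier (chain C (Suc 0))" "\<forall>x\<in>splx Xs (Suc 0). c x \<noteq> \<zero>\<^bsub>cval C (Suc 0) x\<^esub> \<longrightarrow> P x" for c
    using that(1)
  proof (induct rule: chain_induct)
    case zero
    then show ?case
      using lin_maps_zero[OF \<phi> module_chain W] lin_maps_zero[OF differential_linear module_chain module_chain] Z
      by (simp add: add_subgroup_def)
  next
    case (add d x v)
    note s = single_closed[OF add(3,4)]
    have "\<phi> (differential Xs C 0 (d \<oplus>\<^bsub>chain C (Suc 0)\<^esub> single C (Suc 0) x v))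
        = \<phi> (differential Xs C 0 d) \<oplus>\<^bsub>W\<^esub> \<phi> (edge_boundary C x v)"
      using lin_maps_add[OF differential_linear add(1) s] differential_single[OF add(3,4)]
        lin_maps_add[OF \<phi> lin_maps_closed[OF differential_linear add(1)] lin_maps_closed[OF differential_linear s]]
      by simp
    then show ?case
      using add(2) edge[OF add(3) _ add(4)] that(2) add(3,5) Z by (simp add: add_subgroup_def)
  qed
  then show ?thesis by (auto simp: bounding_def)
qed

abbreviation "hclass \<equiv> coset_class (chain C 0) (bdE C) (bdD C)"

lemma degen_chains_0: "degen_chains Xs C 0 = {\<zero>\<^bsub>chain C 0\<^esub>}"
proof -
  have "c = \<zero>\<^bsub>chain C 0\<^esub>" if c: "c \<in> carrier (chain C 0)" "\<And>x. x \<in> splx Xs 0 \<Longrightarrow> c x = \<zero>\<^bsub>cval C 0 x\<^esub>" for c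
  proof (rule extensionalityI[of _ "splx Xs 0"])
    show "c \<in> extensional (splx Xs 0)" "\<zero>\<^bsub>chain C 0\<^esub> \<in> extensional (splx Xs 0)"
      using c(1) carrier_chain by (auto simp: all_chains_def direct_sum_def)
  qed (use c(2) in \<open>simp add: all_chains_def direct_sum_def\<close>)
  moreover have "\<zero>\<^bsub>chain C 0\<^esub> \<in> carrier (chain C 0)"
    using module_abelian[OF module_chain] by (simp add: abelian_group_def abelian_monoid.zero_closed)
  ultimately show ?thesis
    by (auto simp: degen_chains_def degenerate_def) (simp add: all_chains_def direct_sum_def)
qed

text \<open>A class modulo degenerate chains is mapped to a coset of \<open>E\<close> and not to a
  single chain, although zero is the only degenerate chain in degree 0. This is how \<open>E\<close>
  enters the classes.\<close>

lemma boundaries_0: "boundaries Xs C 0 = hclass \<zero>\<^bsub>chain C 0\<^esub>"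
proof -
  interpret V0: Module.module F "chain C 0" by (rule module_chain)
  interpret V1: Module.module F "chain C (Suc 0)" by (rule module_chain)
  let ?d = "differential Xs C 0" and ?N = "degen_chains Xs C (Suc 0)"
  have N: "?N \<subseteq> carrier (chain C (Suc 0))" "?d ` ?N = bdE C"
    by (auto simp: degen_chains_def bounding_def)
  note dc = lin_maps_closed[OF differential_linear]
  have "quot_differential Xs C 0 (?N +>\<^bsub>chain C (Suc 0)\<^esub> c) = bdE C +>\<^bsub>chain C 0\<^esub> (?d c \<oplus>\<^bsub>chain C 0\<^esub> \<zero>\<^bsub>chain C 0\<^esub>)"
    if c: "c \<in> carrier (chain C (Suc 0))" for c
  proof -
    have "quot_differential Xs C 0 (?N +>\<^bsub>chain C (Suc 0)\<^esub> c) = (\<lambda>n. ?d (n \<oplus>\<^bsub>chain C (Suc 0)\<^esub> c)) ` ?N"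
      using N(1) c dc by (auto simp: quot_differential_def quot_map_def degen_chains_0 set_add_def' a_r_coset_def' subset_iff)
    also have "\<dots> = (\<lambda>n. ?d n \<oplus>\<^bsub>chain C 0\<^esub> ?d c) ` ?N"
      using N(1) c lin_maps_add[OF differential_linear] by (intro image_cong) auto
    also have "\<dots> = bdE C +>\<^bsub>chain C 0\<^esub> ?d c"
      unfolding a_r_coset_def' N(2)[symmetric] by auto
    finally show ?thesis using dc[OF c] by simp
  qed
  then have "boundaries Xs C 0 = (\<lambda>c. bdE C +>\<^bsub>chain C 0\<^esub> (?d c \<oplus>\<^bsub>chain C 0\<^esub> \<zero>\<^bsub>chain C 0\<^esub>)) ` carrier (chain C (Suc 0))"
    by (auto simp: boundaries_def chains_def quot_mod_def A_RCOSETS_def' image_iff)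
  also have "\<dots> = hclass \<zero>\<^bsub>chain C 0\<^esub>"
    by (auto simp: coset_class_def bounding_def)
  finally show ?thesis .
qed

lemma cycles_add: "Y \<oplus>\<^bsub>cycles Xs C 0\<^esub> Y' = Y <+>\<^bsub>chain C 0\<^esub> Y'"
  by (simp add: cycles_def chains_def quot_mod_def)

lemmas V0_facts = module_chain[of 0] bounding_subgroup bounding_subgroup bdE_subset_bdD

text \<open>A cycle of degree 0 is the singleton of a chain \<open>a\<close>; adding the boundaries
  to it shifts every coset of \<open>E\<close> in \<open>D\<close> by \<open>a\<close>.\<close>

lemma carrier_homology: "carrier (rspace (homology G Xs C 0)) = hclass ` carrier (chain C 0)"
proof -
  interpret V0: Module.module F "chain C 0" by (rule module_chain)
  have D: "d \<in> carrier (chain C 0)" if "d \<in> bdD C" for d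
    using that bounding_subgroup[unfolded add_subgroup_def] by blast
  have E: "d \<in> carrier (chain C 0)" if "d \<in> bdE C" for d
    using that bounding_subgroup[unfolded add_subgroup_def] by blast
  have cyc: "carrier (cycles Xs C 0) = (\<lambda>a. {a}) ` carrier (chain C 0)"
    by (auto simp: cycles_def chains_def quot_mod_def A_RCOSETS_def' a_r_coset_def' degen_chains_0)
  have "boundaries Xs C 0 +>\<^bsub>cycles Xs C 0\<^esub> {a} = hclass a" if a: "a \<in> carrier (chain C 0)" for a
  proof -
    have "(bdE C +>\<^bsub>chain C 0\<^esub> (d \<oplus>\<^bsub>chain C 0\<^esub> \<zero>\<^bsub>chain C 0\<^esub>)) <+>\<^bsub>chain C 0\<^esub> {a} = bdE C +>\<^bsub>chain C 0\<^esub> (d \<oplus>\<^bsub>chain C 0\<^esub> a)"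
      if "d \<in> bdD C" for d
      using D[OF that] E a by (auto simp: set_add_def' a_r_coset_def' V0.a_assoc)
    then show ?thesis
      unfolding boundaries_0 coset_class_def a_r_coset_def'[of "cycles Xs C 0"] cycles_add
      by (auto simp: image_iff)
  qed
  then show ?thesis
    by (auto simp: homology_def quot_mod_def A_RCOSETS_def' cyc)
qed

lemma homology_simps:
  assumes a: "a \<in> carrier (chain C 0)"
  shows "\<zero>\<^bsub>rspace (homology G Xs C 0)\<^esub> = hclass \<zero>\<^bsub>chain C 0\<^esub>"
    and "b \<in> carrier (chain C 0) \<Longrightarrow>
      hclass a \<oplus>\<^bsub>rspace (homology G Xs C 0)\<^esub> hclass b = hclass (a \<oplus>\<^bsub>chain C 0\<^esub> b)"
    and "k \<in> carrier F \<Longrightarrow> k \<odot>\<^bsub>rspace (homology G Xs C 0)\<^esub> hclass a = hclass (k \<odot>\<^bsub>chain C 0\<^esub> a)"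
proof -
  interpret V0: Module.module F "chain C 0" by (rule module_chain)
  show "\<zero>\<^bsub>rspace (homology G Xs C 0)\<^esub> = hclass \<zero>\<^bsub>chain C 0\<^esub>"
    by (simp add: homology_def quot_mod_def boundaries_0)
  show "hclass a \<oplus>\<^bsub>rspace (homology G Xs C 0)\<^esub> hclass b = hclass (a \<oplus>\<^bsub>chain C 0\<^esub> b)" if "b \<in> carrier (chain C 0)"
    using coset_class_add[OF V0_facts a that cycles_add] by (simp add: homology_def quot_mod_def)
  assume k: "k \<in> carrier F"
  have lin: "(\<lambda>v. k \<odot>\<^bsub>chain C 0\<^esub> v) \<in> lin_maps F (chain C 0) (chain C 0)"
    using k by (intro lin_mapsI) (auto simp: V0.smult_r_distr V0.smult_assoc1[symmetric] V0.R.m_comm)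
  have "(\<lambda>v. k \<odot>\<^bsub>chain C 0\<^esub> v) ` bounding C P \<subseteq> bounding C P" for P
    using k lin_maps_smult[OF edge_boundary_linear, symmetric] Module.module.smult_closed[OF csh_module[OF C]]
    by (intro bounding_image[OF module_chain lin bounding_subgroup]) (auto intro: edge_boundary_bounding)
  then have "hclass \<zero>\<^bsub>chain C 0\<^esub> <+>\<^bsub>cycles Xs C 0\<^esub>
      (\<lambda>Y. {\<zero>\<^bsub>chain C 0\<^esub>} <+>\<^bsub>chain C 0\<^esub> (\<lambda>v. k \<odot>\<^bsub>chain C 0\<^esub> v) ` Y) ` hclass a = hclass (k \<odot>\<^bsub>chain C 0\<^esub> a)"
    using lin by (intro coset_class_push[OF V0_facts module_chain a _ _ bounding_subgroup _ bounding_subgroup _ cycles_add])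
       (auto simp: lin_maps_def)
  then show "k \<odot>\<^bsub>rspace (homology G Xs C 0)\<^esub> hclass a = hclass (k \<odot>\<^bsub>chain C 0\<^esub> a)"
    by (simp add: homology_def quot_mod_def boundaries_0 cycles_def chains_def degen_chains_0)
qed

end

definition HC :: "('f, 'u, 'x, 'g) cosheaf \<Rightarrow> ('f, 'u, 'g) rep" where
  "HC C = transport_rep (homology G Xs C 0)"

text \<open>The quotient map from chains of degree 0 to homology, followed by the coding into
  \<open>'u\<close>.\<close>

definition kap :: "('f, 'u, 'x, 'g) cosheaf \<Rightarrow> ('x \<Rightarrow> 'u) \<Rightarrow> 'u" where
  "kap C a = code (carrier (rspace (homology G Xs C 0))) (coset_class (chain C 0) (bdE C) (bdD C) a)"

text \<open>The map from the value at a vertex to homology. Its images span homology, and later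
  arguments reach homology through it.\<close>

definition inc :: "('f, 'u, 'x, 'g) cosheaf \<Rightarrow> 'x \<Rightarrow> 'u \<Rightarrow> 'u" where
  "inc C x v = kap C (single C 0 x v)"

definition hmap :: "('f, 'u, 'x, 'g) cosheaf \<Rightarrow> (nat \<Rightarrow> 'x \<Rightarrow> 'u \<Rightarrow> 'u) \<Rightarrow> ('f, 'u, 'x, 'g) cosheaf \<Rightarrow> 'u \<Rightarrow> 'u" where
  "hmap C \<psi> D = transport_map (carrier (rspace (homology G Xs C 0))) (carrier (rspace (homology G Xs D 0)))
     (homology_map Xs D 0 \<psi>)"

lemma chain_add: "c \<oplus>\<^bsub>chain C n\<^esub> d = (\<lambda>x\<in>splx Xs n. c x \<oplus>\<^bsub>cval C n x\<^esub> d x)"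
  and chain_smult: "k \<odot>\<^bsub>chain C n\<^esub> c = (\<lambda>x\<in>splx Xs n. k \<odot>\<^bsub>cval C n x\<^esub> c x)"
  by (simp_all add: all_chains_def direct_sum_def)

context
  fixes C :: "('f, 'u, 'x, 'g) cosheaf"
  assumes C: "is_cosheaf C"
begin

text \<open>A permutation of \<open>{..0}\<close> is the identity, so no sign appears in degree
  0.\<close>

lemma chain_act_eq:
  assumes g: "g \<in> carrier G" and c: "c \<in> carrier (chain C 0)"
  shows "chain_act G Xs C 0 g c = (\<lambda>y\<in>splx Xs 0. cact C 0 g (sact Xs 0 (inv g) y) (c (sact Xs 0 (inv g) y)))"
  unfolding chain_act_def Let_def
proof (rule restrict_ext)
  fix y assume y: "y \<in> splx Xs 0"
  let ?x = "sact Xs 0 (inv g) y"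
  interpret Vy: Module.module F "cval C 0 y" by (rule csh_module[OF C y])
  have x: "?x \<in> splx Xs 0" "sact Xs 0 g ?x = y" using g y by auto
  have "c ?x \<in> carrier (cval C 0 ?x)" using c x(1) by (simp add: carrier_chain[OF C])
  then have "cact C 0 g ?x (c ?x) \<in> carrier (cval C 0 y)"
    using lin_maps_closed[OF csh_act_linear[OF C g x(1)]] x(2) by simp
  then show "add_pow (cval C 0 y) (sign (sperm Xs 0 g ?x)) (cact C 0 g ?x (c ?x)) = cact C 0 g ?x (c ?x)"
    using g x(1) by (simp add: perm_0 add_pow_int_ge)
qed

lemma chain_act_linear:
  assumes g: "g \<in> carrier G"
  shows "chain_act G Xs C 0 g \<in> lin_maps F (chain C 0) (chain C 0)"
proof -
  let ?f = "\<lambda>c. \<lambda>y\<in>splx Xs 0. cact C 0 g (sact Xs 0 (inv g) y) (c (sact Xs 0 (inv g) y))"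
  have ig: "inv g \<in> carrier G" using g by simp
  have lin: "cact C 0 g (sact Xs 0 (inv g) y) \<in> lin_maps F (cval C 0 (sact Xs 0 (inv g) y)) (cval C 0 y)"
    if "y \<in> splx Xs 0" for y
    using csh_act_linear[OF C g act_closed[OF ig that]] g that by simp
  have "?f \<in> lin_maps F (chain C 0) (chain C 0)"
  proof (rule lin_mapsI)
    fix c assume c: "c \<in> carrier (chain C 0)"
    have "{y \<in> splx Xs 0. ?f c y \<noteq> \<zero>\<^bsub>cval C 0 y\<^esub>} \<subseteq> sact Xs 0 g ` {x \<in> splx Xs 0. c x \<noteq> \<zero>\<^bsub>cval C 0 x\<^esub>}"
    proof
      fix y assume y: "y \<in> {y \<in> splx Xs 0. ?f c y \<noteq> \<zero>\<^bsub>cval C 0 y\<^esub>}"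
      then have "c (sact Xs 0 (inv g) y) \<noteq> \<zero>\<^bsub>cval C 0 (sact Xs 0 (inv g) y)\<^esub>"
        using lin_maps_zero[OF lin csh_module[OF C] csh_module[OF C], of y] ig by auto
      then show "y \<in> sact Xs 0 g ` {x \<in> splx Xs 0. c x \<noteq> \<zero>\<^bsub>cval C 0 x\<^esub>}"
        using y ig g by (intro image_eqI[of _ _ "sact Xs 0 (inv g) y"]) auto
    qed
    moreover have "finite (sact Xs 0 g ` {x \<in> splx Xs 0. c x \<noteq> \<zero>\<^bsub>cval C 0 x\<^esub>})"
      using c by (simp add: carrier_chain[OF C])
    ultimately have "finite {y \<in> splx Xs 0. ?f c y \<noteq> \<zero>\<^bsub>cval C 0 y\<^esub>}" by (rule finite_subset)
    then show "?f c \<in> carrier (chain C 0)"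
      using c lin_maps_closed[OF lin] ig unfolding carrier_chain[OF C] by auto
  next
    fix c d assume cd: "c \<in> carrier (chain C 0)" "d \<in> carrier (chain C 0)"
    show "?f (c \<oplus>\<^bsub>chain C 0\<^esub> d) = ?f c \<oplus>\<^bsub>chain C 0\<^esub> ?f d"
      using cd[unfolded carrier_chain[OF C]] ig by (auto simp: chain_add intro!: restrict_ext lin_maps_add[OF lin])
  next
    fix k c assume kc: "k \<in> carrier F" "c \<in> carrier (chain C 0)"
    show "?f (k \<odot>\<^bsub>chain C 0\<^esub> c) = k \<odot>\<^bsub>chain C 0\<^esub> ?f c"
      using kc[unfolded carrier_chain[OF C]] ig by (auto simp: chain_smult intro!: restrict_ext lin_maps_smult[OF lin])
  qed
  then show ?thesis
    by (rule lin_maps_cong) (auto simp: chain_act_eq[OF g] module_chain[OF C])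
qed

lemma chain_act_single:
  assumes g: "g \<in> carrier G" and x: "x \<in> splx Xs 0" and v: "v \<in> carrier (cval C 0 x)"
  shows "chain_act G Xs C 0 g (single C 0 x v) = single C 0 (sact Xs 0 g x) (cact C 0 g x v)"
  unfolding chain_act_eq[OF g single_closed[OF C x v]]
  unfolding single_def ds_single_def
proof (rule restrict_ext)
  fix y assume y: "y \<in> splx Xs 0"
  have "sact Xs 0 (inv g) y \<in> splx Xs 0" using g y by simp
  moreover have "cact C 0 g z \<zero>\<^bsub>cval C 0 z\<^esub> = \<zero>\<^bsub>cval C 0 (sact Xs 0 g z)\<^esub>" if "z \<in> splx Xs 0" for z
    using lin_maps_zero[OF csh_act_linear[OF C g that] csh_module[OF C] csh_module[OF C]] that g by simp
  ultimately show "cact C 0 g (sact Xs 0 (inv g) y) ((\<lambda>y\<in>splx Xs 0. if y = x then v else \<zero>\<^bsub>cval C 0 y\<^esub>) (sact Xs 0 (inv g) y))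
      = (if y = sact Xs 0 g x then cact C 0 g x v else \<zero>\<^bsub>cval C 0 y\<^esub>)"
    using g x y by auto
qed

lemma perm_1_cases:
  assumes "g \<in> carrier G" "x \<in> splx Xs (Suc 0)"
  shows "sperm Xs (Suc 0) g x 0 = 0 \<and> sperm Xs (Suc 0) g x (Suc 0) = Suc 0 \<or>
         sperm Xs (Suc 0) g x 0 = Suc 0 \<and> sperm Xs (Suc 0) g x (Suc 0) = 0"
proof -
  have "sperm Xs (Suc 0) g x 0 \<le> Suc 0" "sperm Xs (Suc 0) g x (Suc 0) \<le> Suc 0"
    using perm_le[OF assms] by auto
  moreover have "sperm Xs (Suc 0) g x 0 \<noteq> sperm Xs (Suc 0) g x (Suc 0)"
    using permutes_inj[OF perm[OF assms]] by (auto dest: injD)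
  ultimately show ?thesis by linarith
qed

text \<open>An element of \<open>G\<close> may reverse an edge. The boundary then changes sign,
  which does not lead out of a subgroup.\<close>

lemma chain_act_edge_boundary:
  assumes g: "g \<in> carrier G" and x: "x \<in> splx Xs (Suc 0)" and v: "v \<in> carrier (cval C (Suc 0) x)"
  shows "chain_act G Xs C 0 g (edge_boundary C x v) \<in>
    {edge_boundary C (sact Xs (Suc 0) g x) (cact C (Suc 0) g x v),
     \<ominus>\<^bsub>chain C 0\<^esub> edge_boundary C (sact Xs (Suc 0) g x) (cact C (Suc 0) g x v)}"
proof -
  interpret V0: Module.module F "chain C 0" by (rule module_chain[OF C])
  let ?gx = "sact Xs (Suc 0) g x" and ?gv = "cact C (Suc 0) g x v"
  have vx: "vertex (Suc 0) i x \<in> splx Xs 0" "cmap C 0 (Suc 0) (vertex_map i) x v \<in> carrier (cval C 0 (vertex (Suc 0) i x))"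
    if "i \<le> Suc 0" for i
    using x v that lin_maps_closed[OF csh_map_linear[OF C]] by auto
  have s: "single C 0 (vertex (Suc 0) i x) (cmap C 0 (Suc 0) (vertex_map i) x v) \<in> carrier (chain C 0)" if "i \<le> Suc 0" for i
    using single_closed[OF C vx[OF that]] .
  let ?s = "\<lambda>i. single C 0 (vertex (Suc 0) i ?gx) (cmap C 0 (Suc 0) (vertex_map i) ?gx ?gv)"
  have gv: "?gx \<in> splx Xs (Suc 0)" "?gv \<in> carrier (cval C (Suc 0) ?gx)"
    using g x v lin_maps_closed[OF csh_act_linear[OF C g x]] by auto
  have s': "?s i \<in> carrier (chain C 0)" if "i \<le> Suc 0" for i
    using gv that lin_maps_closed[OF csh_map_linear[OF C]] by (intro single_closed[OF C]) auto
  have "chain_act G Xs C 0 g (single C 0 (vertex (Suc 0) i x) (cmap C 0 (Suc 0) (vertex_map i) x v))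
      = ?s (sperm Xs (Suc 0) g x i)" if "i \<le> Suc 0" for i
    using chain_act_single[OF g vx[OF that]] vertex_act[OF g x that] csh_vertex_act[OF C g x that v] by simp
  then have "chain_act G Xs C 0 g (edge_boundary C x v)
      = ?s (sperm Xs (Suc 0) g x (Suc 0)) \<ominus>\<^bsub>chain C 0\<^esub> ?s (sperm Xs (Suc 0) g x 0)"
    using lin_maps_minus[OF chain_act_linear[OF g] module_chain[OF C] module_chain[OF C] s s, of "Suc 0" 0]
    by (simp add: edge_boundary_def)
  moreover have "\<ominus>\<^bsub>chain C 0\<^esub> edge_boundary C ?gx ?gv = ?s 0 \<ominus>\<^bsub>chain C 0\<^esub> ?s (Suc 0)"
    using s'[of 0] s'[of "Suc 0"] by (simp add: edge_boundary_def a_minus_def V0.minus_add V0.a_comm)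
  moreover have "edge_boundary C ?gx ?gv = ?s (Suc 0) \<ominus>\<^bsub>chain C 0\<^esub> ?s 0"
    by (simp add: edge_boundary_def)
  ultimately show ?thesis
    using perm_1_cases[OF g x] by auto
qed

lemma chain_act_bounding:
  assumes g: "g \<in> carrier G" and P: "\<And>x. x \<in> splx Xs (Suc 0) \<Longrightarrow> P x \<Longrightarrow> P (sact Xs (Suc 0) g x)"
  shows "chain_act G Xs C 0 g ` bounding C P \<subseteq> bounding C P"
proof (rule bounding_image[OF C module_chain[OF C] chain_act_linear[OF g] bounding_subgroup[OF C]])
  fix x v assume x: "x \<in> splx Xs (Suc 0)" "P x" and v: "v \<in> carrier (cval C (Suc 0) x)"
  have "edge_boundary C (sact Xs (Suc 0) g x) (cact C (Suc 0) g x v) \<in> bounding C P"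
    using g x v lin_maps_closed[OF csh_act_linear[OF C g x(1)]] P by (intro edge_boundary_bounding[OF C]) auto
  then show "chain_act G Xs C 0 g (edge_boundary C x v) \<in> bounding C P"
    using chain_act_edge_boundary[OF g x(1) v] bounding_subgroup[OF C, of P, unfolded add_subgroup_def] by auto
qed

text \<open>Homology is an image of the chains of degree 0, and these fit into \<open>'u\<close> by
  the size conditions; so \<open>code\<close> really chooses an injection.\<close>

lemma inj_code: "inj_on (code (carrier (rspace (homology G Xs C 0))) :: _ \<Rightarrow> 'u) (carrier (rspace (homology G Xs C 0)))"
proof -
  have "|carrier (rspace (homology G Xs C 0))| \<le>o |carrier (chain C 0)|"
    unfolding carrier_homology[OF C] by (rule card_of_image)
  also have "|carrier (chain C 0)| \<le>o |UNIV :: 'u set|"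
    unfolding all_chains_def
    by (rule module_family.card_DS[OF chains_family[OF C] infinite_univ card_univ]) (simp add: card_of_mono1)
  finally have "\<exists>e :: _ \<Rightarrow> 'u. inj_on e (carrier (rspace (homology G Xs C 0)))"
    unfolding card_of_ordLeq[symmetric] by blast
  then show ?thesis unfolding code_def by (rule someI_ex)
qed

lemma decode_code: "Y \<in> carrier (rspace (homology G Xs C 0)) \<Longrightarrow>
    decode (carrier (rspace (homology G Xs C 0))) (code (carrier (rspace (homology G Xs C 0))) Y :: 'u) = Y"
  unfolding decode_def by (rule inv_into_f_f[OF inj_code])

lemma decode_kap: "a \<in> carrier (chain C 0) \<Longrightarrow>
    decode (carrier (rspace (homology G Xs C 0))) (kap C a) = coset_class (chain C 0) (bdE C) (bdD C) a"
  unfolding kap_def by (rule decode_code) (simp add: carrier_homology[OF C])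

lemma carrier_HC: "carrier (rspace (HC C)) = kap C ` carrier (chain C 0)"
  by (simp add: HC_def transport_rep_def Let_def carrier_homology[OF C] image_image kap_def)

text \<open>The operations of coded homology decode, act on classes and encode again; on values of
  \<open>kap\<close> they are the operations on chains.\<close>

lemma HC_module: "Module.module F (rspace (HC C))" and kap_linear: "kap C \<in> lin_maps F (chain C 0) (rspace (HC C))"
proof -
  interpret V0: Module.module F "chain C 0" by (rule module_chain[OF C])
  have zero: "\<zero>\<^bsub>rspace (HC C)\<^esub> = kap C \<zero>\<^bsub>chain C 0\<^esub>"
    using homology_simps(1)[OF C V0.zero_closed] by (simp add: HC_def transport_rep_def Let_def kap_def)
  have add: "kap C a \<oplus>\<^bsub>rspace (HC C)\<^esub> kap C b = kap C (a \<oplus>\<^bsub>chain C 0\<^esub> b)"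
    if "a \<in> carrier (chain C 0)" "b \<in> carrier (chain C 0)" for a b
    using homology_simps(2)[OF C that] decode_kap[OF that(1)] decode_kap[OF that(2)]
    by (simp add: HC_def transport_rep_def Let_def kap_def)
  have smult: "k \<odot>\<^bsub>rspace (HC C)\<^esub> kap C a = kap C (k \<odot>\<^bsub>chain C 0\<^esub> a)"
    if "k \<in> carrier F" "a \<in> carrier (chain C 0)" for a k
    using homology_simps(3)[OF C that(2,1)] decode_kap[OF that(2)]
    by (simp add: HC_def transport_rep_def Let_def kap_def)
  note * = module_imageI[where V = "chain C 0" and W = "rspace (HC C)" and \<kappa> = "kap C",
      OF module_chain[OF C] carrier_HC zero add smult]
  show "Module.module F (rspace (HC C))" "kap C \<in> lin_maps F (chain C 0) (rspace (HC C))"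
    using * by blast+
qed

lemma kap_eqD:
  assumes "a \<in> carrier (chain C 0)" "b \<in> carrier (chain C 0)" "kap C a = kap C b"
  shows "\<exists>d\<in>bdD C. a = d \<oplus>\<^bsub>chain C 0\<^esub> b"
proof -
  have "coset_class (chain C 0) (bdE C) (bdD C) a = coset_class (chain C 0) (bdE C) (bdD C) b"
    using decode_kap assms by metis
  then show ?thesis
    by (rule coset_class_eqD[OF V0_facts[OF C] assms(1,2)])
qed

lemma kap_bounding: "d \<in> bdD C \<Longrightarrow> kap C d = \<zero>\<^bsub>rspace (HC C)\<^esub>"
proof -
  interpret V0: Module.module F "chain C 0" by (rule module_chain[OF C])
  assume d: "d \<in> bdD C"
  then have "d \<in> carrier (chain C 0)"
    using bounding_subgroup[OF C, unfolded add_subgroup_def] by blast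
  then have "coset_class (chain C 0) (bdE C) (bdD C) d = coset_class (chain C 0) (bdE C) (bdD C) \<zero>\<^bsub>chain C 0\<^esub>"
    using coset_class_shift[OF V0_facts[OF C] d V0.zero_closed] by simp
  then have "kap C d = kap C \<zero>\<^bsub>chain C 0\<^esub>" by (simp add: kap_def)
  then show ?thesis
    using lin_maps_zero[OF kap_linear module_chain[OF C] HC_module] by simp
qed

lemma ract_kap:
  assumes g: "g \<in> carrier G" and a: "a \<in> carrier (chain C 0)"
  shows "ract (HC C) g (kap C a) = kap C (chain_act G Xs C 0 g a)"
proof -
  have "coset_class (chain C 0) (bdE C) (bdD C) \<zero>\<^bsub>chain C 0\<^esub> <+>\<^bsub>cycles Xs C 0\<^esub>
      (\<lambda>Y. {\<zero>\<^bsub>chain C 0\<^esub>} <+>\<^bsub>chain C 0\<^esub> chain_act G Xs C 0 g ` Y) ` coset_class (chain C 0) (bdE C) (bdD C) a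
      = coset_class (chain C 0) (bdE C) (bdD C) (chain_act G Xs C 0 g a)"
    using chain_act_linear[OF g] chain_act_bounding[OF g] degenerate_act[OF _ g]
    by (intro coset_class_push[OF V0_facts[OF C] module_chain[OF C] a _ _ bounding_subgroup[OF C] _ bounding_subgroup[OF C] _ cycles_add])
       (auto simp: C lin_maps_def)
  then have "ract (homology G Xs C 0) g (coset_class (chain C 0) (bdE C) (bdD C) a)
      = coset_class (chain C 0) (bdE C) (bdD C) (chain_act G Xs C 0 g a)"
    by (simp add: homology_def quot_map_def boundaries_0[OF C] degen_chains_0[OF C])
  then show ?thesis
    using decode_kap[OF a] by (simp add: HC_def transport_rep_def Let_def kap_def)
qed

lemma inc_linear: "x \<in> splx Xs 0 \<Longrightarrow> inc C x \<in> lin_maps F (cval C 0 x) (rspace (HC C))"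
  unfolding inc_def[abs_def] by (rule lin_maps_compose[OF single_linear[OF C] kap_linear])

lemma inc_closed: "x \<in> splx Xs 0 \<Longrightarrow> v \<in> carrier (cval C 0 x) \<Longrightarrow> inc C x v \<in> carrier (rspace (HC C))"
  by (rule lin_maps_closed[OF inc_linear])

text \<open>The boundary of a vector on an edge vanishes in homology, so its images at the two ends
  are identified.\<close>

lemma inc_edge:
  assumes x: "x \<in> splx Xs (Suc 0)" and v: "v \<in> carrier (cval C (Suc 0) x)"
  shows "inc C (vertex (Suc 0) (Suc 0) x) (cmap C 0 (Suc 0) (vertex_map (Suc 0)) x v)
       = inc C (vertex (Suc 0) 0 x) (cmap C 0 (Suc 0) (vertex_map 0) x v)"
    (is "inc C ?x1 ?v1 = inc C ?x0 ?v0")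
proof -
  interpret H: Module.module F "rspace (HC C)" by (rule HC_module)
  have i: "?x1 \<in> splx Xs 0" "?v1 \<in> carrier (cval C 0 ?x1)" "?x0 \<in> splx Xs 0" "?v0 \<in> carrier (cval C 0 ?x0)"
    using x v lin_maps_closed[OF csh_map_linear[OF C]] by auto
  note s = single_closed[OF C i(1,2)] single_closed[OF C i(3,4)]
  have "kap C (edge_boundary C x v) = \<zero>\<^bsub>rspace (HC C)\<^esub>"
    by (rule kap_bounding[OF edge_boundary_bounding[OF C x v]]) simp
  moreover have "kap C (edge_boundary C x v) = inc C ?x1 ?v1 \<ominus>\<^bsub>rspace (HC C)\<^esub> inc C ?x0 ?v0"
    using lin_maps_minus[OF kap_linear module_chain[OF C] HC_module s] by (simp add: edge_boundary_def inc_def)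
  ultimately show ?thesis
    using H.minus_equality[of "inc C ?x1 ?v1" "\<ominus>\<^bsub>rspace (HC C)\<^esub> inc C ?x0 ?v0"]
      inc_closed[OF i(1,2)] inc_closed[OF i(3,4)] by (simp add: a_minus_def)
qed

lemma inc_act:
  assumes g: "g \<in> carrier G" and x: "x \<in> splx Xs 0" and v: "v \<in> carrier (cval C 0 x)"
  shows "ract (HC C) g (inc C x v) = inc C (sact Xs 0 g x) (cact C 0 g x v)"
  unfolding inc_def using ract_kap[OF g single_closed[OF C x v]] chain_act_single[OF g x v] by simp

text \<open>Chains are finite sums of vectors at vertices, so homology is spanned by the images of
  \<open>inc\<close>.\<close>

lemma HC_induct [consumes 1, case_names zero add]:
  assumes w: "w \<in> carrier (rspace (HC C))" and zero: "Q \<zero>\<^bsub>rspace (HC C)\<^esub>"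
    and add: "\<And>w x v. w \<in> carrier (rspace (HC C)) \<Longrightarrow> Q w \<Longrightarrow> x \<in> splx Xs 0 \<Longrightarrow> v \<in> carrier (cval C 0 x) \<Longrightarrow>
      Q (w \<oplus>\<^bsub>rspace (HC C)\<^esub> inc C x v)"
  shows "Q w"
proof -
  obtain a where a: "a \<in> carrier (chain C 0)" "w = kap C a" using w by (auto simp: carrier_HC)
  from a(1) have "Q (kap C a)"
  proof (induct rule: chain_induct[OF C, consumes 1, case_names zero add])
    case zero
    then show ?case using assms(2) lin_maps_zero[OF kap_linear module_chain[OF C] HC_module] by simp
  next
    case (add d x v)
    then show ?case
      using assms(3)[OF lin_maps_closed[OF kap_linear add(1)] add(2-4)]
        lin_maps_add[OF kap_linear add(1) single_closed[OF C add(3,4)]] by (simp add: inc_def)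
  qed
  then show ?thesis using a(2) by simp
qed

text \<open>Existence in the universal property of homology: compatibility along edges makes the
  extension to chains vanish on the boundaries.\<close>

lemma HC_lift:
  assumes W: "Module.module F W" and f: "\<And>x. x \<in> splx Xs 0 \<Longrightarrow> f x \<in> lin_maps F (cval C 0 x) W"
    and edge: "\<And>x v. x \<in> splx Xs (Suc 0) \<Longrightarrow> v \<in> carrier (cval C (Suc 0) x) \<Longrightarrow>
      f (vertex (Suc 0) (Suc 0) x) (cmap C 0 (Suc 0) (vertex_map (Suc 0)) x v)
       = f (vertex (Suc 0) 0 x) (cmap C 0 (Suc 0) (vertex_map 0) x v)"
  obtains h where "h \<in> lin_maps F (rspace (HC C)) W"
    "\<And>x v. x \<in> splx Xs 0 \<Longrightarrow> v \<in> carrier (cval C 0 x) \<Longrightarrow> h (inc C x v) = f x v"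
proof -
  interpret W: Module.module F W by (rule W)
  interpret V0: Module.module F "chain C 0" by (rule module_chain[OF C])
  let ?\<phi> = "ds_lift (splx Xs 0) (cval C 0) W f"
  have \<phi>: "?\<phi> \<in> lin_maps F (chain C 0) W"
    using module_family.ds_lift_linear[OF chains_family[OF C] W f] by (simp add: all_chains_def)
  have \<phi>_single: "?\<phi> (single C 0 x v) = f x v" if "x \<in> splx Xs 0" "v \<in> carrier (cval C 0 x)" for x v
    using module_family.ds_lift_single[OF chains_family[OF C] W f that] by (simp add: single_def)
  have "?\<phi> ` bdD C \<subseteq> {\<zero>\<^bsub>W\<^esub>}"
  proof (rule bounding_image[OF C W \<phi>])
    show "add_subgroup W {\<zero>\<^bsub>W\<^esub>}" by (simp add: add_subgroup_def)
    fix x v assume x: "x \<in> splx Xs (Suc 0)" and v: "v \<in> carrier (cval C (Suc 0) x)"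
    let ?x = "\<lambda>i. vertex (Suc 0) i x" and ?v = "\<lambda>i. cmap C 0 (Suc 0) (vertex_map i) x v"
    have i: "?x i \<in> splx Xs 0" "?v i \<in> carrier (cval C 0 (?x i))" if "i \<le> Suc 0" for i
      using x v lin_maps_closed[OF csh_map_linear[OF C]] that by auto
    note s = single_closed[OF C i]
    have "?\<phi> (edge_boundary C x v) = f (?x (Suc 0)) (?v (Suc 0)) \<ominus>\<^bsub>W\<^esub> f (?x 0) (?v 0)"
      using lin_maps_minus[OF \<phi> module_chain[OF C] W s s, of "Suc 0" 0] \<phi>_single[OF i] by (simp add: edge_boundary_def)
    also have "\<dots> = \<zero>\<^bsub>W\<^esub>"
      using edge[OF x v] lin_maps_closed[OF f[OF i(1)] i(2)] by (simp add: a_minus_def W.r_neg)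
    finally show "?\<phi> (edge_boundary C x v) \<in> {\<zero>\<^bsub>W\<^esub>}" by simp
  qed
  then have eq: "?\<phi> a = ?\<phi> b" if ab: "a \<in> carrier (chain C 0)" "b \<in> carrier (chain C 0)" "kap C a = kap C b" for a b
  proof -
    obtain d where d: "d \<in> bdD C" "a = d \<oplus>\<^bsub>chain C 0\<^esub> b" using kap_eqD[OF ab] by blast
    then have "d \<in> carrier (chain C 0)" using bounding_subgroup[OF C, unfolded add_subgroup_def] by blast
    then show ?thesis
      using \<open>?\<phi> ` bdD C \<subseteq> {\<zero>\<^bsub>W\<^esub>}\<close> d lin_maps_add[OF \<phi> _ ab(2)] lin_maps_closed[OF \<phi> ab(2)] by auto
  qed
  \<comment> \<open>A representing chain is chosen; \<open>eq\<close> shows that the value does not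
    depend on it.\<close>
  define h where "h w = ?\<phi> (SOME a. a \<in> carrier (chain C 0) \<and> kap C a = w)" for w
  have h: "h (kap C a) = ?\<phi> a" if "a \<in> carrier (chain C 0)" for a
  proof -
    have "\<exists>b. b \<in> carrier (chain C 0) \<and> kap C b = kap C a" using that by blast
    from someI_ex[OF this] show ?thesis unfolding h_def using eq that by blast
  qed
  show ?thesis
  proof (rule that)
    show "h \<in> lin_maps F (rspace (HC C)) W"
    proof (rule lin_mapsI)
      fix u w assume "u \<in> carrier (rspace (HC C))" "w \<in> carrier (rspace (HC C))"
      then obtain a b where "a \<in> carrier (chain C 0)" "u = kap C a" "b \<in> carrier (chain C 0)" "w = kap C b"
        by (auto simp: carrier_HC)
      then show "h (u \<oplus>\<^bsub>rspace (HC C)\<^esub> w) = h u \<oplus>\<^bsub>W\<^esub> h w"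
        using lin_maps_add[OF kap_linear, of a b] by (simp add: h lin_maps_add[OF \<phi>] flip: lin_maps_add[OF kap_linear])
    next
      fix k w assume "k \<in> carrier F" "w \<in> carrier (rspace (HC C))"
      then obtain a where "a \<in> carrier (chain C 0)" "w = kap C a" "k \<in> carrier F" by (auto simp: carrier_HC)
      then show "h (k \<odot>\<^bsub>rspace (HC C)\<^esub> w) = k \<odot>\<^bsub>W\<^esub> h w"
        by (simp add: h lin_maps_smult[OF \<phi>] flip: lin_maps_smult[OF kap_linear])
    next
      fix w assume "w \<in> carrier (rspace (HC C))"
      then show "h w \<in> carrier W" using lin_maps_closed[OF \<phi>] by (auto simp: carrier_HC h)
    qed
  qed (simp add: inc_def h single_closed[OF C] \<phi>_single)
qed

end

text \<open>The formula on sets for the induced map is evaluated on representatives here; afterwards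
  the map is known through its values on \<open>inc\<close>.\<close>

lemma hmap_inc:
  assumes C: "is_cosheaf C" and D: "is_cosheaf D" and \<psi>: "\<psi> \<in> cosheaf_maps F G Xs C D"
  shows "hmap C \<psi> D \<in> lin_maps F (rspace (HC C)) (rspace (HC D))"
    and "hmap C \<psi> D \<in> extensional (carrier (rspace (HC C)))"
    and "x \<in> splx Xs 0 \<Longrightarrow> v \<in> carrier (cval C 0 x) \<Longrightarrow> hmap C \<psi> D (inc C x v) = inc D x (\<psi> 0 x v)"
proof -
  have \<psi>_lin: "\<psi> n x \<in> lin_maps F (cval C n x) (cval D n x)" if "x \<in> splx Xs n" for n x
    using \<psi> that by (auto simp: cosheaf_maps_def)
  have \<psi>_map: "\<psi> m (struct_map Xs m n f x) (cmap C m n f x v) = cmap D m n f x (\<psi> n x v)"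
    if "f \<in> delta_maps m n" "x \<in> splx Xs n" "v \<in> carrier (cval C n x)" for m n f x v
    using \<psi> that by (auto simp: cosheaf_maps_def)
  define f where "f c = (\<lambda>x\<in>splx Xs 0. \<psi> 0 x (c x))" for c
  have f: "f \<in> lin_maps F (chain C 0) (chain D 0)"
  proof (rule lin_mapsI)
    fix c assume c: "c \<in> carrier (chain C 0)"
    have "{x \<in> splx Xs 0. f c x \<noteq> \<zero>\<^bsub>cval D 0 x\<^esub>} \<subseteq> {x \<in> splx Xs 0. c x \<noteq> \<zero>\<^bsub>cval C 0 x\<^esub>}"
      using lin_maps_zero[OF \<psi>_lin csh_module[OF C] csh_module[OF D]] by (auto simp: f_def)
    then have "finite {x \<in> splx Xs 0. f c x \<noteq> \<zero>\<^bsub>cval D 0 x\<^esub>}"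
      using c unfolding carrier_chain[OF C] by (blast intro: finite_subset)
    then show "f c \<in> carrier (chain D 0)"
      using c lin_maps_closed[OF \<psi>_lin] unfolding carrier_chain[OF C] carrier_chain[OF D] by (auto simp: f_def)
  next
    fix c d assume "c \<in> carrier (chain C 0)" "d \<in> carrier (chain C 0)"
    then show "f (c \<oplus>\<^bsub>chain C 0\<^esub> d) = f c \<oplus>\<^bsub>chain D 0\<^esub> f d"
      unfolding carrier_chain[OF C] by (auto simp: f_def chain_add lin_maps_add[OF \<psi>_lin] intro!: restrict_ext)
  next
    fix k c assume "k \<in> carrier F" "c \<in> carrier (chain C 0)"
    then show "f (k \<odot>\<^bsub>chain C 0\<^esub> c) = k \<odot>\<^bsub>chain D 0\<^esub> f c"
      unfolding carrier_chain[OF C] by (auto simp: f_def chain_smult lin_maps_smult[OF \<psi>_lin] intro!: restrict_ext)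
  qed
  have f_single: "f (single C 0 x v) = single D 0 x (\<psi> 0 x v)" if "x \<in> splx Xs 0" "v \<in> carrier (cval C 0 x)" for x v
    using lin_maps_zero[OF \<psi>_lin csh_module[OF C] csh_module[OF D]] that
    by (auto simp: f_def single_def ds_single_def intro!: restrict_ext)
  \<comment> \<open>A cosheaf map keeps every vector over its simplex, so any condition
    \<open>P\<close> on edges is respected.\<close>
  have f_bounding: "f ` bounding C P \<subseteq> bounding D P" for P
  proof (rule bounding_image[OF C module_chain[OF D] f bounding_subgroup[OF D]])
    fix x v assume x: "x \<in> splx Xs (Suc 0)" "P x" and v: "v \<in> carrier (cval C (Suc 0) x)"
    let ?x = "\<lambda>i. vertex (Suc 0) i x" and ?v = "\<lambda>i. cmap C 0 (Suc 0) (vertex_map i) x v"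
    have i: "?x i \<in> splx Xs 0" "?v i \<in> carrier (cval C 0 (?x i))" if "i \<le> Suc 0" for i
      using x v lin_maps_closed[OF csh_map_linear[OF C]] that by auto
    note s = single_closed[OF C i]
    have "f (edge_boundary C x v) = edge_boundary D x (\<psi> (Suc 0) x v)"
      using lin_maps_minus[OF f module_chain[OF C] module_chain[OF D] s s, of "Suc 0" 0] f_single[OF i]
        \<psi>_map[OF vertex_map_delta x(1) v] by (simp add: edge_boundary_def)
    then show "f (edge_boundary C x v) \<in> bounding D P"
      using edge_boundary_bounding[OF D x(1) lin_maps_closed[OF \<psi>_lin[OF x(1)] v], of P] x(2) by simp
  qed
  have hk: "hmap C \<psi> D (kap C a) = kap D (f a)" if a: "a \<in> carrier (chain C 0)" for a
  proof -
    have "coset_class (chain D 0) (bdE D) (bdD D) \<zero>\<^bsub>chain D 0\<^esub> <+>\<^bsub>cycles Xs D 0\<^esub>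
        (\<lambda>Y. {\<zero>\<^bsub>chain D 0\<^esub>} <+>\<^bsub>chain D 0\<^esub> f ` Y) ` coset_class (chain C 0) (bdE C) (bdD C) a
        = coset_class (chain D 0) (bdE D) (bdD D) (f a)"
      using f f_bounding
      by (intro coset_class_push[OF V0_facts[OF D] module_chain[OF C] a _ _ bounding_subgroup[OF C] _ bounding_subgroup[OF C] _ cycles_add])
         (auto simp: D lin_maps_def)
    then have "homology_map Xs D 0 \<psi> (coset_class (chain C 0) (bdE C) (bdD C) a) = coset_class (chain D 0) (bdE D) (bdD D) (f a)"
      by (simp add: homology_map_def quot_map_def boundaries_0[OF D] degen_chains_0[OF D] f_def[abs_def])
    moreover have "kap C a \<in> code (carrier (rspace (homology G Xs C 0))) ` carrier (rspace (homology G Xs C 0))"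
      unfolding kap_def using a by (simp add: carrier_homology[OF C])
    ultimately show ?thesis
      using decode_kap[OF C a] by (simp add: hmap_def transport_map_def) (simp add: kap_def)
  qed
  show "hmap C \<psi> D \<in> extensional (carrier (rspace (HC C)))"
    by (simp add: hmap_def transport_map_def HC_def transport_rep_def Let_def)
  show "x \<in> splx Xs 0 \<Longrightarrow> v \<in> carrier (cval C 0 x) \<Longrightarrow> hmap C \<psi> D (inc C x v) = inc D x (\<psi> 0 x v)"
    unfolding inc_def by (simp add: hk single_closed[OF C] f_single)
  interpret V0: Module.module F "chain C 0" by (rule module_chain[OF C])
  show "hmap C \<psi> D \<in> lin_maps F (rspace (HC C)) (rspace (HC D))"
  proof (rule lin_mapsI)
    fix u w assume "u \<in> carrier (rspace (HC C))" "w \<in> carrier (rspace (HC C))"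
    then obtain a b where "a \<in> carrier (chain C 0)" "u = kap C a" "b \<in> carrier (chain C 0)" "w = kap C b"
      by (auto simp: carrier_HC[OF C])
    then show "hmap C \<psi> D (u \<oplus>\<^bsub>rspace (HC C)\<^esub> w) = hmap C \<psi> D u \<oplus>\<^bsub>rspace (HC D)\<^esub> hmap C \<psi> D w"
      using lin_maps_closed[OF f]
      by (simp add: hk lin_maps_add[OF f] lin_maps_add[OF kap_linear[OF D]] flip: lin_maps_add[OF kap_linear[OF C]])
  next
    fix k w assume "k \<in> carrier F" "w \<in> carrier (rspace (HC C))"
    then obtain a where "a \<in> carrier (chain C 0)" "w = kap C a" "k \<in> carrier F" by (auto simp: carrier_HC[OF C])
    then show "hmap C \<psi> D (k \<odot>\<^bsub>rspace (HC C)\<^esub> w) = k \<odot>\<^bsub>rspace (HC D)\<^esub> hmap C \<psi> D w"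
      using lin_maps_closed[OF f]
      by (simp add: hk lin_maps_smult[OF f] lin_maps_smult[OF kap_linear[OF D]] flip: lin_maps_smult[OF kap_linear[OF C]])
  next
    fix w assume "w \<in> carrier (rspace (HC C))"
    then show "hmap C \<psi> D w \<in> carrier (rspace (HC D))"
      using lin_maps_closed[OF f] by (auto simp: carrier_HC[OF C] carrier_HC[OF D] hk)
  qed
qed

end


section \<open>The categories of representations and of cosheaves\<close>

context tdlc
begin

context
  fixes F :: "'f ring"
begin

lemma smooth_module: "smooth_rep F G T V \<Longrightarrow> Module.module F (rspace V)"
  and smooth_linear: "smooth_rep F G T V \<Longrightarrow> g \<in> carrier G \<Longrightarrow> ract V g \<in> lin_maps F (rspace V) (rspace V)"
  and smooth_one: "smooth_rep F G T V \<Longrightarrow> v \<in> carrier (rspace V) \<Longrightarrow> ract V \<one> v = v"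
  and smooth_mult: "smooth_rep F G T V \<Longrightarrow> g \<in> carrier G \<Longrightarrow> h \<in> carrier G \<Longrightarrow> v \<in> carrier (rspace V) \<Longrightarrow>
      ract V (g \<otimes> h) v = ract V g (ract V h v)"
  by (simp_all add: smooth_rep_def)

lemma smooth_closed: "smooth_rep F G T V \<Longrightarrow> g \<in> carrier G \<Longrightarrow> v \<in> carrier (rspace V) \<Longrightarrow> ract V g v \<in> carrier (rspace V)"
  by (rule lin_maps_closed[OF smooth_linear])

abbreviation "Rep \<equiv> SmoothRep F G T"

lemma arrow_Rep:
  "arrow Rep a V W \<longleftrightarrow>
     (\<exists>f. a = (V, f, W) \<and> smooth_rep F G T V \<and> smooth_rep F G T W \<and> f \<in> rep_maps F G V W)"
  by (auto simp: arrow_def SmoothRep_def)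

lemma Rep_simps [simp]:
  "obj Rep = {V. smooth_rep F G T V}"
  "ident Rep V = (V, (\<lambda>v\<in>carrier (rspace V). v), V)"
  "cmp Rep (V', g, W) (U, f, V) = (U, compose (carrier (rspace U)) g f, W)"
  by (simp_all add: SmoothRep_def)

lemma rep_mapsI:
  assumes "f \<in> lin_maps F (rspace V) (rspace W)" "f \<in> extensional (carrier (rspace V))"
    and "\<And>g v. g \<in> carrier G \<Longrightarrow> v \<in> carrier (rspace V) \<Longrightarrow> f (ract V g v) = ract W g (f v)"
  shows "f \<in> rep_maps F G V W"
  using assms by (simp add: rep_maps_def)

lemma rep_mapsD:
  assumes "f \<in> rep_maps F G V W"
  shows "f \<in> lin_maps F (rspace V) (rspace W)" "f \<in> extensional (carrier (rspace V))"
    and "g \<in> carrier G \<Longrightarrow> v \<in> carrier (rspace V) \<Longrightarrow> f (ract V g v) = ract W g (f v)"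
  using assms by (auto simp: rep_maps_def)

lemma rep_maps_compose:
  assumes U: "smooth_rep F G T U" and f: "f \<in> rep_maps F G U V" and g: "g \<in> rep_maps F G V W"
  shows "compose (carrier (rspace U)) g f \<in> rep_maps F G U W"
proof (rule rep_mapsI)
  show "compose (carrier (rspace U)) g f \<in> lin_maps F (rspace U) (rspace W)"
    by (rule lin_maps_cong[OF lin_maps_compose[OF rep_mapsD(1)[OF f] rep_mapsD(1)[OF g]] _ smooth_module[OF U]])
       (simp add: compose_def)
  show "compose (carrier (rspace U)) g f \<in> extensional (carrier (rspace U))"
    by (rule compose_extensional)
  show "compose (carrier (rspace U)) g f (ract U h u) = ract W h (compose (carrier (rspace U)) g f u)"
    if h: "h \<in> carrier G" and u: "u \<in> carrier (rspace U)" for h u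
    using smooth_closed[OF U h u] rep_mapsD(3)[OF f h u] rep_mapsD(3)[OF g h lin_maps_closed[OF rep_mapsD(1)[OF f] u]] u
    by (simp add: compose_def)
qed

lemma category_Rep: "category Rep"
proof (rule categoryI)
  fix V assume "V \<in> obj Rep"
  then have V: "smooth_rep F G T V" by simp
  interpret V: Module.module F "rspace V" by (rule smooth_module[OF V])
  show "arrow Rep (ident Rep V) V V"
    using V smooth_closed[OF V] by (auto simp: arrow_Rep rep_maps_def lin_maps_def)
next
  fix f g U V W assume "arrow Rep f U V" "arrow Rep g V W"
  then show "arrow Rep (cmp Rep g f) U W" by (auto simp: arrow_Rep intro: rep_maps_compose)
next
  fix f V W assume "arrow Rep f V W"
  then obtain f' where f: "f = (V, f', W)" "f' \<in> rep_maps F G V W" by (auto simp: arrow_Rep)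
  note f' = rep_mapsD[OF f(2)]
  have "compose (carrier (rspace V)) f' (\<lambda>v\<in>carrier (rspace V). v) = f'"
    using f'(2) by (intro extensionalityI[of _ "carrier (rspace V)"]) (auto simp: compose_def)
  moreover have "compose (carrier (rspace V)) (\<lambda>w\<in>carrier (rspace W). w) f' = f'"
    using f'(2) lin_maps_closed[OF f'(1)] by (intro extensionalityI[of _ "carrier (rspace V)"]) (auto simp: compose_def)
  ultimately show "cmp Rep f (ident Rep V) = f \<and> cmp Rep (ident Rep W) f = f" by (simp add: f)
next
  fix f g h U V W Z assume "arrow Rep f U V" "arrow Rep g V W" "arrow Rep h W Z"
  then obtain f' g' h' where f: "f = (U, f', V)" "f' \<in> rep_maps F G U V" and "g = (V, g', W)" "h = (W, h', Z)"
    by (auto simp: arrow_Rep)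
  then show "cmp Rep h (cmp Rep g f) = cmp Rep (cmp Rep h g) f"
    using lin_maps_closed[OF rep_mapsD(1)[OF f(2)]] by (auto simp: compose_def intro!: restrict_ext)
qed (auto simp: arrow_Rep)

lemma Rep_eqI:
  assumes "f \<in> rep_maps F G V W" "g \<in> rep_maps F G V W" "\<And>v. v \<in> carrier (rspace V) \<Longrightarrow> f v = g v"
  shows "f = g"
  using extensionalityI[OF rep_mapsD(2)[OF assms(1)] rep_mapsD(2)[OF assms(2)]] assms(3) by blast

lemma iso_RepI:
  assumes a: "arrow Rep (V, f, W) V W" and bij: "bij_betw f (carrier (rspace V)) (carrier (rspace W))"
  shows "iso_arr Rep (V, f, W)"
proof -
  have V: "smooth_rep F G T V" and W: "smooth_rep F G T W" and f: "f \<in> rep_maps F G V W"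
    using a by (auto simp: arrow_Rep)
  interpret V: Module.module F "rspace V" by (rule smooth_module[OF V])
  interpret W: Module.module F "rspace W" by (rule smooth_module[OF W])
  let ?h = "\<lambda>w\<in>carrier (rspace W). inv_into (carrier (rspace V)) f w"
  note f' = rep_mapsD[OF f]
  have h: "?h w \<in> carrier (rspace V)" "f (?h w) = w" if "w \<in> carrier (rspace W)" for w
    using that bij inv_into_into[of w f "carrier (rspace V)"] f_inv_into_f[of w f "carrier (rspace V)"]
    by (auto simp: bij_betw_def)
  have fh: "?h (f v) = v" if "v \<in> carrier (rspace V)" for v
    using that bij lin_maps_closed[OF f'(1) that] by (simp add: bij_betw_def)
  \<comment> \<open>A value of the inverse is recognised by applying \<open>f\<close>; linearity and
    equivariance of the inverse are then read off from those of \<open>f\<close>.\<close>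
  have hI: "?h w = v" if "v \<in> carrier (rspace V)" "f v = w" for v w
    using fh[OF that(1)] that(2) by simp
  have "?h \<in> rep_maps F G W V"
  proof (rule rep_mapsI)
    show "?h \<in> lin_maps F (rspace W) (rspace V)"
    proof (rule lin_mapsI)
      fix u w assume "u \<in> carrier (rspace W)" "w \<in> carrier (rspace W)"
      then show "?h (u \<oplus>\<^bsub>rspace W\<^esub> w) = ?h u \<oplus>\<^bsub>rspace V\<^esub> ?h w"
        using h by (intro hI) (simp_all only: V.a_closed lin_maps_add[OF f'(1)])
    next
      fix k w assume "k \<in> carrier F" "w \<in> carrier (rspace W)"
      then show "?h (k \<odot>\<^bsub>rspace W\<^esub> w) = k \<odot>\<^bsub>rspace V\<^esub> ?h w"
        using h by (intro hI) (simp_all only: V.smult_closed lin_maps_smult[OF f'(1)])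
    qed (rule h)
    fix g w assume "g \<in> carrier G" "w \<in> carrier (rspace W)"
    then show "?h (ract W g w) = ract V g (?h w)"
      using h smooth_closed[OF V] by (intro hI) (simp_all only: f'(3))
  qed simp
  then have h_arrow: "arrow Rep (W, ?h, V) W V" using V W by (auto simp: arrow_Rep)
  have "compose (carrier (rspace V)) ?h f = (\<lambda>v\<in>carrier (rspace V). v)"
    using fh unfolding compose_def by (intro restrict_ext)
  moreover have "compose (carrier (rspace W)) f ?h = (\<lambda>w\<in>carrier (rspace W). w)"
    using h(2) unfolding compose_def by (intro restrict_ext)
  ultimately show ?thesis
    by (intro iso_arrI[OF a h_arrow]) simp_all
qed

end

end

section \<open>The category of cosheaves and the homology functor\<close>

context simplicial_action
begin

abbreviation "CK \<equiv> (Csh F G T Xs :: ('f, 'u, 'x, 'g) csh_cat)"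

lemma arrow_Csh:
  "arrow CK a C D \<longleftrightarrow> (\<exists>\<psi>. a = (C, \<psi>, D) \<and> is_cosheaf C \<and> is_cosheaf D \<and> \<psi> \<in> cosheaf_maps F G Xs C D)"
  by (auto simp: arrow_def Csh_def is_cosheaf_def)

lemma Csh_simps [simp]:
  "obj CK = {C. is_cosheaf C}"
  "ident CK C = (C, (\<lambda>n. \<lambda>x\<in>splx Xs n. \<lambda>v\<in>carrier (cval C n x). v), C)"
  "cmp CK (D', \<phi>, E) (C, \<psi>, D) = (C, (\<lambda>n. \<lambda>x\<in>splx Xs n. compose (carrier (cval C n x)) (\<phi> n x) (\<psi> n x)), E)"
  by (simp_all add: Csh_def is_cosheaf_def)

lemma cosheaf_mapsI:
  assumes "\<And>n. \<psi> n \<in> extensional (splx Xs n)"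
    and "\<And>n x. x \<in> splx Xs n \<Longrightarrow> \<psi> n x \<in> lin_maps F (cval C n x) (cval D n x)"
    and "\<And>n x. x \<in> splx Xs n \<Longrightarrow> \<psi> n x \<in> extensional (carrier (cval C n x))"
    and "\<And>m n f x v. f \<in> delta_maps m n \<Longrightarrow> x \<in> splx Xs n \<Longrightarrow> v \<in> carrier (cval C n x) \<Longrightarrow>
      \<psi> m (struct_map Xs m n f x) (cmap C m n f x v) = cmap D m n f x (\<psi> n x v)"
    and "\<And>n g x v. g \<in> carrier G \<Longrightarrow> x \<in> splx Xs n \<Longrightarrow> v \<in> carrier (cval C n x) \<Longrightarrow>
      \<psi> n (sact Xs n g x) (cact C n g x v) = cact D n g x (\<psi> n x v)"
  shows "\<psi> \<in> cosheaf_maps F G Xs C D"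
  using assms unfolding cosheaf_maps_def by blast

lemma cosheaf_mapsD:
  assumes "\<psi> \<in> cosheaf_maps F G Xs C D"
  shows "\<psi> n \<in> extensional (splx Xs n)"
    and "x \<in> splx Xs n \<Longrightarrow> \<psi> n x \<in> lin_maps F (cval C n x) (cval D n x)"
    and "x \<in> splx Xs n \<Longrightarrow> \<psi> n x \<in> extensional (carrier (cval C n x))"
    and "f \<in> delta_maps m n \<Longrightarrow> x \<in> splx Xs n \<Longrightarrow> v \<in> carrier (cval C n x) \<Longrightarrow>
      \<psi> m (struct_map Xs m n f x) (cmap C m n f x v) = cmap D m n f x (\<psi> n x v)"
    and "g \<in> carrier G \<Longrightarrow> x \<in> splx Xs n \<Longrightarrow> v \<in> carrier (cval C n x) \<Longrightarrow>
      \<psi> n (sact Xs n g x) (cact C n g x v) = cact D n g x (\<psi> n x v)"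
  using assms unfolding cosheaf_maps_def by blast+

lemma cosheaf_map_closed: "\<psi> \<in> cosheaf_maps F G Xs C D \<Longrightarrow> x \<in> splx Xs n \<Longrightarrow> v \<in> carrier (cval C n x) \<Longrightarrow>
    \<psi> n x v \<in> carrier (cval D n x)"
  by (rule lin_maps_closed[OF cosheaf_mapsD(2)])

lemma csh_act_closed: "is_cosheaf C \<Longrightarrow> g \<in> carrier G \<Longrightarrow> x \<in> splx Xs n \<Longrightarrow> v \<in> carrier (cval C n x) \<Longrightarrow>
    cact C n g x v \<in> carrier (cval C n (sact Xs n g x))"
  by (rule lin_maps_closed[OF csh_act_linear])

lemma csh_map_closed: "is_cosheaf C \<Longrightarrow> f \<in> delta_maps m n \<Longrightarrow> x \<in> splx Xs n \<Longrightarrow> v \<in> carrier (cval C n x) \<Longrightarrow>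
    cmap C m n f x v \<in> carrier (cval C m (struct_map Xs m n f x))"
  by (rule lin_maps_closed[OF csh_map_linear])

lemma cosheaf_maps_compose:
  assumes C: "is_cosheaf C" and \<psi>: "\<psi> \<in> cosheaf_maps F G Xs C D" and \<phi>: "\<phi> \<in> cosheaf_maps F G Xs D E"
  shows "(\<lambda>n. \<lambda>x\<in>splx Xs n. compose (carrier (cval C n x)) (\<phi> n x) (\<psi> n x)) \<in> cosheaf_maps F G Xs C E"
proof (rule cosheaf_mapsI)
  fix n x assume x: "x \<in> splx Xs n"
  have "compose (carrier (cval C n x)) (\<phi> n x) (\<psi> n x) \<in> lin_maps F (cval C n x) (cval E n x)"
    by (rule lin_maps_cong[OF lin_maps_compose[OF cosheaf_mapsD(2)[OF \<psi> x] cosheaf_mapsD(2)[OF \<phi> x]] _ csh_module[OF C x]])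
       (simp add: compose_def)
  then show "(\<lambda>x\<in>splx Xs n. compose (carrier (cval C n x)) (\<phi> n x) (\<psi> n x)) x \<in> lin_maps F (cval C n x) (cval E n x)"
    using x by simp
qed (simp_all add: compose_def csh_map_closed[OF C] csh_act_closed[OF C] cosheaf_mapsD(4,5)[OF \<psi>]
      cosheaf_mapsD(4,5)[OF \<phi>] cosheaf_map_closed[OF \<psi>])

lemma category_Csh: "category CK"
proof (rule categoryI)
  fix C assume "C \<in> obj CK"
  then have C: "is_cosheaf C" by simp
  have "(\<lambda>n. \<lambda>x\<in>splx Xs n. \<lambda>v\<in>carrier (cval C n x). v) \<in> cosheaf_maps F G Xs C C"
  proof (rule cosheaf_mapsI)
    fix n x assume x: "x \<in> splx Xs n"
    interpret V: Module.module F "cval C n x" by (rule csh_module[OF C x])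
    show "(\<lambda>x\<in>splx Xs n. \<lambda>v\<in>carrier (cval C n x). v) x \<in> lin_maps F (cval C n x) (cval C n x)"
      using x by (simp add: lin_maps_def)
  qed (simp_all add: csh_map_closed[OF C] csh_act_closed[OF C])
  then show "arrow CK (ident CK C) C C" using C by (simp add: arrow_Csh)
next
  fix f g A B C assume "arrow CK f A B" "arrow CK g B C"
  then show "arrow CK (cmp CK g f) A C" by (auto simp: arrow_Csh intro: cosheaf_maps_compose)
next
  fix f C D assume "arrow CK f C D"
  then obtain \<psi> where f: "f = (C, \<psi>, D)" "is_cosheaf C" "is_cosheaf D" "\<psi> \<in> cosheaf_maps F G Xs C D"
    by (auto simp: arrow_Csh)
  have "(\<lambda>n. \<lambda>x\<in>splx Xs n. compose (carrier (cval C n x)) (\<psi> n x) ((\<lambda>x\<in>splx Xs n. \<lambda>v\<in>carrier (cval C n x). v) x)) = \<psi>"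
    and "(\<lambda>n. \<lambda>x\<in>splx Xs n. compose (carrier (cval C n x)) ((\<lambda>x\<in>splx Xs n. \<lambda>v\<in>carrier (cval D n x). v) x) (\<psi> n x)) = \<psi>"
    using cosheaf_mapsD(1,3)[OF f(4)] cosheaf_map_closed[OF f(4)]
    by (auto simp: fun_eq_iff compose_def extensional_def)
  then show "cmp CK f (ident CK C) = f \<and> cmp CK (ident CK D) f = f" by (simp add: f(1))
next
  fix f g h A B C D assume "arrow CK f A B" "arrow CK g B C" "arrow CK h C D"
  then obtain f' g' h' where f: "f = (A, f', B)" "f' \<in> cosheaf_maps F G Xs A B" and "g = (B, g', C)" "h = (C, h', D)"
    by (auto simp: arrow_Csh)
  then show "cmp CK h (cmp CK g f) = cmp CK (cmp CK h g) f"
    using cosheaf_map_closed[OF f(2)] by (auto simp: compose_def fun_eq_iff)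
qed (auto simp: arrow_Csh)

text \<open>Uniqueness in the universal property: linear maps out of homology are determined by
  their values on vectors from single vertices. Identities between such maps are reduced to
  \<open>inc\<close> by this rule.\<close>

lemma rep_maps_lin_eqI:
  assumes C: "is_cosheaf C" and W: "Module.module F W"
    and f: "f \<in> lin_maps F (rspace (HC C)) W" and g: "g \<in> lin_maps F (rspace (HC C)) W"
    and eq: "\<And>x v. x \<in> splx Xs 0 \<Longrightarrow> v \<in> carrier (cval C 0 x) \<Longrightarrow> f (inc C x v) = g (inc C x v)"
    and w: "w \<in> carrier (rspace (HC C))"
  shows "f w = g w"
  using w
proof (induct rule: HC_induct[OF C, consumes 1, case_names zero add])
  case zero
  then show ?case using lin_maps_zero[OF f HC_module[OF C] W] lin_maps_zero[OF g HC_module[OF C] W] by simp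
next
  case (add w x v)
  then show ?case
    using inc_closed[OF C add(3,4)] eq by (simp add: lin_maps_add[OF f] lin_maps_add[OF g])
qed

lemma ract_HC_linear:
  assumes C: "is_cosheaf C" and g: "g \<in> carrier G"
  shows "ract (HC C) g \<in> lin_maps F (rspace (HC C)) (rspace (HC C))"
proof -
  interpret V0: Module.module F "chain C 0" by (rule module_chain[OF C])
  note l = chain_act_linear[OF C g]
  show ?thesis
  proof (rule lin_mapsI)
    fix u w assume "u \<in> carrier (rspace (HC C))" "w \<in> carrier (rspace (HC C))"
    then obtain a b where "a \<in> carrier (chain C 0)" "u = kap C a" "b \<in> carrier (chain C 0)" "w = kap C b"
      by (auto simp: carrier_HC[OF C])
    then show "ract (HC C) g (u \<oplus>\<^bsub>rspace (HC C)\<^esub> w) = ract (HC C) g u \<oplus>\<^bsub>rspace (HC C)\<^esub> ract (HC C) g w"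
      using lin_maps_closed[OF l]
      by (simp add: ract_kap[OF C g] lin_maps_add[OF l] flip: lin_maps_add[OF kap_linear[OF C]])
  next
    fix k w assume "k \<in> carrier F" "w \<in> carrier (rspace (HC C))"
    then obtain a where "a \<in> carrier (chain C 0)" "w = kap C a" "k \<in> carrier F" by (auto simp: carrier_HC[OF C])
    then show "ract (HC C) g (k \<odot>\<^bsub>rspace (HC C)\<^esub> w) = k \<odot>\<^bsub>rspace (HC C)\<^esub> ract (HC C) g w"
      using lin_maps_closed[OF l]
      by (simp add: ract_kap[OF C g] lin_maps_smult[OF l] flip: lin_maps_smult[OF kap_linear[OF C]])
  next
    fix w assume "w \<in> carrier (rspace (HC C))"
    then show "ract (HC C) g w \<in> carrier (rspace (HC C))"
      using lin_maps_closed[OF l] by (auto simp: carrier_HC[OF C] ract_kap[OF C g])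
  qed
qed

text \<open>Stabilisers are open by continuity of the action, so compact open subgroups of a
  stabiliser are compact open in \<open>G\<close>.\<close>

lemma stabilizer_compact_open:
  assumes x: "x \<in> splx Xs n" and K: "subgroup K (G\<lparr>carrier := stabilizer G (sact Xs n) x\<rparr>)"
    "openin (subtopology T (stabilizer G (sact Xs n) x)) K" "compactin (subtopology T (stabilizer G (sact Xs n) x)) K"
  shows "subgroup K G" "openin T K" "compactin T K" "K \<subseteq> stabilizer G (sact Xs n) x"
  using incl_subgroup[OF stabilizer_subgroup[OF x] K(1)] K(2,3) stabilizer_open[OF x] subgroup.subset[OF K(1)]
  by (auto simp: openin_open_subtopology compactin_subtopology)

text \<open>A vector of homology is a finite sum of vectors from vertices, each fixed by a compact
  open subgroup of the stabiliser of its vertex; the intersection of these subgroups fixes the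
  sum.\<close>

lemma HC_smooth:
  assumes C: "is_cosheaf C" shows "smooth_rep F G T (HC C)"
  unfolding smooth_rep_def
proof (intro conjI ballI)
  interpret H: Module.module F "rspace (HC C)" by (rule HC_module[OF C])
  show "Module.module F (rspace (HC C))" by (rule HC_module[OF C])
  show "ract (HC C) g \<in> lin_maps F (rspace (HC C)) (rspace (HC C))" if "g \<in> carrier G" for g
    by (rule ract_HC_linear[OF C that])
  fix w assume w: "w \<in> carrier (rspace (HC C))"
  have id: "(\<lambda>w. w) \<in> lin_maps F (rspace (HC C)) (rspace (HC C))" by (rule lin_mapsI) auto
  show "ract (HC C) \<one> w = w"
    by (rule rep_maps_lin_eqI[OF C HC_module[OF C] ract_HC_linear[OF C one_closed] id _ w])
       (simp add: inc_act[OF C] act_one csh_act_one[OF C])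
  show "ract (HC C) (g \<otimes> h) w = ract (HC C) g (ract (HC C) h w)" if gh: "g \<in> carrier G" "h \<in> carrier G" for g h
    by (rule rep_maps_lin_eqI[OF C HC_module[OF C] ract_HC_linear[OF C m_closed[OF gh]]
          lin_maps_compose[OF ract_HC_linear[OF C gh(2)] ract_HC_linear[OF C gh(1)]] _ w])
       (simp add: gh inc_act[OF C] act_mult csh_act_mult[OF C] csh_act_closed[OF C])
  from w show "\<exists>K. subgroup K G \<and> openin T K \<and> compactin T K \<and> (\<forall>g\<in>K. ract (HC C) g w = w)"
  proof (induct rule: HC_induct[OF C, consumes 1, case_names zero add])
    case zero
    \<comment> \<open>The zero vector also needs a compact open subgroup, and there may be no vertex
      to supply one.\<close>
    obtain K where K: "subgroup K G" "openin T K" "compactin T K" by (rule compact_open_subgroup)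
    have "ract (HC C) g \<zero>\<^bsub>rspace (HC C)\<^esub> = \<zero>\<^bsub>rspace (HC C)\<^esub>" if "g \<in> K" for g
      using lin_maps_zero[OF ract_HC_linear[OF C] HC_module[OF C] HC_module[OF C]] subgroup.mem_carrier[OF K(1) that] by simp
    then show ?case using K by blast
  next
    case (add w x v)
    then obtain K where K: "subgroup K G" "openin T K" "compactin T K" "\<And>g. g \<in> K \<Longrightarrow> ract (HC C) g w = w" by blast
    obtain L where L: "subgroup L (G\<lparr>carrier := stabilizer G (sact Xs 0) x\<rparr>)"
        "openin (subtopology T (stabilizer G (sact Xs 0) x)) L"
        "compactin (subtopology T (stabilizer G (sact Xs 0) x)) L" "\<And>g. g \<in> L \<Longrightarrow> cact C 0 g x v = v"
      using csh_smooth[OF C add(3)] add(4) unfolding smooth_rep_def by auto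
    note L' = stabilizer_compact_open[OF add(3) L(1-3)]
    have "ract (HC C) g (w \<oplus>\<^bsub>rspace (HC C)\<^esub> inc C x v) = w \<oplus>\<^bsub>rspace (HC C)\<^esub> inc C x v" if g: "g \<in> K \<inter> L" for g
    proof -
      have "g \<in> carrier G" "sact Xs 0 g x = x" using g L'(4) by (auto simp: stabilizer_def)
      then show ?thesis
        using g K(4) L(4) inc_act[OF C _ add(3,4)] inc_closed[OF C add(3,4)] add(1)
        by (simp add: lin_maps_add[OF ract_HC_linear[OF C]])
    qed
    then show ?case using compact_open_Int[OF K(1-3) L'(1,2)] by blast
  qed
qed

abbreviation "RK \<equiv> (SmoothRep F G T :: ('f, 'u, 'g) rep_cat)"
abbreviation "HF \<equiv> (homology_functor G Xs :: (('f, 'u, 'x, 'g) cosheaf, ('f, 'u, 'x, 'g) csh_arr, ('f, 'u, 'g) rep, ('f, 'u, 'g) rep_arr) functr)"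
abbreviation "LF \<equiv> (trivial_functor Xs :: (('f, 'u, 'g) rep, ('f, 'u, 'g) rep_arr, ('f, 'u, 'x, 'g) cosheaf, ('f, 'u, 'x, 'g) csh_arr) functr)"

lemma HF_simps [simp]: "omap HF C = HC C" "amap HF (C, \<psi>, D) = (HC C, hmap C \<psi> D, HC D)"
  by (simp_all add: homology_functor_def HC_def hmap_def)

lemma hmap_rep_map:
  assumes C: "is_cosheaf C" and D: "is_cosheaf D" and \<psi>: "\<psi> \<in> cosheaf_maps F G Xs C D"
  shows "hmap C \<psi> D \<in> rep_maps F G (HC C) (HC D)"
proof (rule rep_mapsI)
  note h = hmap_inc[OF C D \<psi>]
  show "hmap C \<psi> D \<in> lin_maps F (rspace (HC C)) (rspace (HC D))" "hmap C \<psi> D \<in> extensional (carrier (rspace (HC C)))"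
    by (rule h)+
  show "hmap C \<psi> D (ract (HC C) g w) = ract (HC D) g (hmap C \<psi> D w)"
    if g: "g \<in> carrier G" and w: "w \<in> carrier (rspace (HC C))" for g w
    by (rule rep_maps_lin_eqI[OF C HC_module[OF D] lin_maps_compose[OF ract_HC_linear[OF C g] h(1)]
          lin_maps_compose[OF h(1) ract_HC_linear[OF D g]] _ w])
       (simp add: g h(3) inc_act[OF C] inc_act[OF D] csh_act_closed[OF C] cosheaf_map_closed[OF \<psi>] cosheaf_mapsD(5)[OF \<psi>])
qed

lemma functor_HF: "is_functor CK RK HF"
proof (rule is_functorI)
  show "category CK" "category RK" by (rule category_Csh, rule category_Rep)
  show "omap HF C \<in> obj RK" if "C \<in> obj CK" for C using that by (simp add: HC_smooth)
  show "arrow RK (amap HF f) (omap HF C) (omap HF D)" if "arrow CK f C D" for f C D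
    using that by (auto simp: arrow_Csh arrow_Rep HC_smooth hmap_rep_map)
next
  fix C assume "C \<in> obj CK"
  then have C: "is_cosheaf C" by simp
  have \<psi>: "(\<lambda>n. \<lambda>x\<in>splx Xs n. \<lambda>v\<in>carrier (cval C n x). v) \<in> cosheaf_maps F G Xs C C" (is "?\<psi> \<in> _")
    using arrow_ident[OF category_Csh, of C] C by (simp add: arrow_Csh)
  interpret H: Module.module F "rspace (HC C)" by (rule HC_module[OF C])
  have id: "(\<lambda>w. w) \<in> lin_maps F (rspace (HC C)) (rspace (HC C))" by (rule lin_mapsI) auto
  have "hmap C ?\<psi> C = (\<lambda>w\<in>carrier (rspace (HC C)). w)"
  proof (rule extensionalityI[OF hmap_inc(2)[OF C C \<psi>]])
    fix w assume w: "w \<in> carrier (rspace (HC C))"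
    have "hmap C ?\<psi> C w = w"
      by (rule rep_maps_lin_eqI[OF C HC_module[OF C] hmap_inc(1)[OF C C \<psi>] id _ w]) (simp add: hmap_inc(3)[OF C C \<psi>])
    then show "hmap C ?\<psi> C w = (\<lambda>w\<in>carrier (rspace (HC C)). w) w" using w by simp
  qed simp
  then show "amap HF (ident CK C) = ident RK (omap HF C)" by simp
next
  fix f g A B C assume "arrow CK f A B" "arrow CK g B C"
  then obtain \<psi> \<phi> where f: "f = (A, \<psi>, B)" and A: "is_cosheaf A" and B: "is_cosheaf B" and \<psi>: "\<psi> \<in> cosheaf_maps F G Xs A B"
      and g: "g = (B, \<phi>, C)" and C: "is_cosheaf C" and \<phi>: "\<phi> \<in> cosheaf_maps F G Xs B C"
    by (auto simp: arrow_Csh)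
  note c = cosheaf_maps_compose[OF A \<psi> \<phi>]
  have "hmap A (\<lambda>n. \<lambda>x\<in>splx Xs n. compose (carrier (cval A n x)) (\<phi> n x) (\<psi> n x)) C
      = compose (carrier (rspace (HC A))) (hmap B \<phi> C) (hmap A \<psi> B)"
  proof (rule Rep_eqI[OF hmap_rep_map[OF A C c] rep_maps_compose[OF HC_smooth[OF A] hmap_rep_map[OF A B \<psi>] hmap_rep_map[OF B C \<phi>]]])
    fix w assume w: "w \<in> carrier (rspace (HC A))"
    have "hmap A (\<lambda>n. \<lambda>x\<in>splx Xs n. compose (carrier (cval A n x)) (\<phi> n x) (\<psi> n x)) C w = hmap B \<phi> C (hmap A \<psi> B w)"
      by (rule rep_maps_lin_eqI[OF A HC_module[OF C] hmap_inc(1)[OF A C c]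
            lin_maps_compose[OF hmap_inc(1)[OF A B \<psi>] hmap_inc(1)[OF B C \<phi>]] _ w])
         (simp add: hmap_inc(3)[OF A C c] hmap_inc(3)[OF A B \<psi>] hmap_inc(3)[OF B C \<phi>] cosheaf_map_closed[OF \<psi>] compose_eq)
    then show "hmap A (\<lambda>n. \<lambda>x\<in>splx Xs n. compose (carrier (cval A n x)) (\<phi> n x) (\<psi> n x)) C w
        = compose (carrier (rspace (HC A))) (hmap B \<phi> C) (hmap A \<psi> B) w"
      using w by (simp add: compose_def)
  qed
  then show "amap HF (cmp CK g f) = cmp RK (amap HF g) (amap HF f)" by (simp add: f g)
qed

text \<open>Images of maps into a trivial cosheaf are of this kind. Their values are subspaces of
  \<open>V\<close>, so they stay in \<open>'u\<close> without any coding.\<close>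

definition subcosheaf :: "('f, 'u, 'g) rep \<Rightarrow> (nat \<Rightarrow> 'x \<Rightarrow> 'u set) \<Rightarrow> ('f, 'u, 'x, 'g) cosheaf" where
  "subcosheaf V W = \<lparr>cval = (\<lambda>n x. (rspace V)\<lparr>carrier := W n x\<rparr>), cmap = (\<lambda>m n f x v. v), cact = (\<lambda>n g x. ract V g)\<rparr>"

lemma is_cosheaf_subcosheaf:
  assumes V: "smooth_rep F G T V" and W: "\<And>n x. x \<in> splx Xs n \<Longrightarrow> submodule (W n x) F (rspace V)"
    and map: "\<And>m n f x. f \<in> delta_maps m n \<Longrightarrow> x \<in> splx Xs n \<Longrightarrow> W n x \<subseteq> W m (struct_map Xs m n f x)"
    and act: "\<And>n g x v. g \<in> carrier G \<Longrightarrow> x \<in> splx Xs n \<Longrightarrow> v \<in> W n x \<Longrightarrow> ract V g v \<in> W n (sact Xs n g x)"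
  shows "is_cosheaf (subcosheaf V W)"
proof -
  interpret V: Module.module F "rspace V" by (rule smooth_module[OF V])
  have WV: "v \<in> carrier (rspace V)" if "x \<in> splx Xs n" "v \<in> W n x" for n x v
    using V.submoduleE(1)[OF W[OF that(1)]] that(2) by blast
  have mod: "Module.module F ((rspace V)\<lparr>carrier := W n x\<rparr>)" if "x \<in> splx Xs n" for n x
    by (rule submodule.submodule_is_module[OF W[OF that] V.module_axioms])
  have smooth: "smooth_rep F (G\<lparr>carrier := stabilizer G (sact Xs n) x\<rparr>) (subtopology T (stabilizer G (sact Xs n) x))
      \<lparr>rspace = (rspace V)\<lparr>carrier := W n x\<rparr>, ract = (\<lambda>g. ract V g)\<rparr>" if x: "x \<in> splx Xs n" for n x
  proof -
    let ?S = "stabilizer G (sact Xs n) x"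
    have S: "g \<in> carrier G" "sact Xs n g x = x" if "g \<in> ?S" for g using that by (auto simp: stabilizer_def)
    have "\<exists>K. subgroup K (G\<lparr>carrier := ?S\<rparr>) \<and> openin (subtopology T ?S) K \<and> compactin (subtopology T ?S) K \<and>
        (\<forall>g\<in>K. ract V g v = v)" if v: "v \<in> W n x" for v
    proof -
      obtain K where K: "subgroup K G" "openin T K" "compactin T K" "\<forall>g\<in>K. ract V g v = v"
        using V WV[OF x v] unfolding smooth_rep_def by blast
      \<comment> \<open>Cutting with the open stabiliser keeps the subgroup compact and open and
        makes it act on the value at \<open>x\<close>.\<close>
      note * = compact_open_Int[OF K(1-3) stabilizer_subgroup[OF x] stabilizer_open[OF x]]
      have "subgroup (K \<inter> ?S) (G\<lparr>carrier := ?S\<rparr>)"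
        by (rule subgroup_incl[OF *(1) stabilizer_subgroup[OF x]]) simp
      then show ?thesis
        using *(2,3) K(4) stabilizer_open[OF x]
        by (intro exI[of _ "K \<inter> ?S"]) (auto simp: openin_open_subtopology compactin_subtopology)
    qed
    moreover have "ract V g \<in> lin_maps F ((rspace V)\<lparr>carrier := W n x\<rparr>) ((rspace V)\<lparr>carrier := W n x\<rparr>)" if "g \<in> ?S" for g
      using act[OF S(1)[OF that] x] S(2)[OF that] WV[OF x]
        lin_maps_add[OF smooth_linear[OF V S(1)[OF that]]] lin_maps_smult[OF smooth_linear[OF V S(1)[OF that]]]
      by (auto simp: lin_maps_def)
    ultimately show ?thesis
      unfolding smooth_rep_def using mod[OF x] S(1) WV[OF x] smooth_one[OF V] smooth_mult[OF V] by simp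
  qed
  show ?thesis
    unfolding is_cosheaf_def equivariant_cosheaf_def subcosheaf_def
    using mod smooth map act WV smooth_mult[OF V] lin_maps_add[OF smooth_linear[OF V]] lin_maps_smult[OF smooth_linear[OF V]]
    by (auto simp: lin_maps_def Let_def subset_iff)
qed

lemma trivial_subcosheaf: "trivial_cosheaf V = subcosheaf V (\<lambda>n x. carrier (rspace V))"
  by (simp add: trivial_cosheaf_def subcosheaf_def)

lemma is_cosheaf_trivial:
  assumes V: "smooth_rep F G T V" shows "is_cosheaf (trivial_cosheaf V)"
proof -
  interpret V: Module.module F "rspace V" by (rule smooth_module[OF V])
  show ?thesis
    unfolding trivial_subcosheaf
    by (rule is_cosheaf_subcosheaf[OF V V.carrier_is_submodule]) (simp_all add: smooth_closed[OF V])
qed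

lemma trivial_simps [simp]:
  "cval (trivial_cosheaf V) n x = rspace V" "cmap (trivial_cosheaf V) m n f x v = v" "cact (trivial_cosheaf V) n g x = ract V g"
  by (simp_all add: trivial_cosheaf_def)

lemma LF_simps [simp]: "omap LF V = trivial_cosheaf V"
  "amap LF (V, f, W) = (trivial_cosheaf V, (\<lambda>n. \<lambda>x\<in>splx Xs n. f), trivial_cosheaf W)"
  by (simp_all add: trivial_functor_def)

lemma functor_LF: "is_functor RK CK LF"
proof (rule is_functorI)
  show "category CK" "category RK" by (rule category_Csh, rule category_Rep)
  show "omap LF V \<in> obj CK" if "V \<in> obj RK" for V using that by (simp add: is_cosheaf_trivial)
  show "arrow CK (amap LF f) (omap LF V) (omap LF W)" if "arrow RK f V W" for f V W
  proof -
    obtain f' where f: "f = (V, f', W)" "smooth_rep F G T V" "smooth_rep F G T W" "f' \<in> rep_maps F G V W"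
      using \<open>arrow RK f V W\<close> by (auto simp: arrow_Rep)
    have "(\<lambda>n. \<lambda>x\<in>splx Xs n. f') \<in> cosheaf_maps F G Xs (trivial_cosheaf V) (trivial_cosheaf W)"
      by (rule cosheaf_mapsI) (simp_all add: rep_mapsD[OF f(4)])
    then show ?thesis using f by (simp add: arrow_Csh is_cosheaf_trivial)
  qed
qed (auto simp: arrow_Rep restrict_def fun_eq_iff)

end


section \<open>The adjunction of homology and trivial cosheaves\<close>

context simplicial_action
begin

text \<open>The choice of vertex 0 is immaterial, by \<open>inc_vertex\<close>.\<close>

definition eta :: "('f, 'u, 'x, 'g) cosheaf \<Rightarrow> nat \<Rightarrow> 'x \<Rightarrow> 'u \<Rightarrow> 'u" where
  "eta C = (\<lambda>n. \<lambda>x\<in>splx Xs n. \<lambda>v\<in>carrier (cval C n x). inc C (vertex n 0 x) (cmap C 0 n (vertex_map 0) x v))"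

context
  fixes C :: "('f, 'u, 'x, 'g) cosheaf"
  assumes C: "is_cosheaf C"
begin

text \<open>The edge from vertex 0 to vertex \<open>i\<close> of the simplex gives the relation in
  homology. Independence of the vertex makes \<open>eta\<close> compatible with structure maps and
  with elements of \<open>G\<close> that permute vertices.\<close>

lemma inc_vertex:
  assumes x: "x \<in> splx Xs n" and i: "i \<le> n" and v: "v \<in> carrier (cval C n x)"
  shows "inc C (vertex n i x) (cmap C 0 n (vertex_map i) x v) = eta C n x v"
proof -
  \<comment> \<open>Nondecreasing for every \<open>i\<close>, because 0 is the least vertex; hence
    vertex 0 is the one that the others are compared with.\<close>
  define e where "e = (\<lambda>j\<in>{..Suc 0}. if j = 0 then 0 else i)"
  have e: "e \<in> delta_maps (Suc 0) n" "e 0 = 0" "e (Suc 0) = i"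
    using i by (auto simp: e_def delta_maps_def mono_on_def)
  let ?y = "struct_map Xs (Suc 0) n e x" and ?w = "cmap C (Suc 0) n e x v"
  have y: "?y \<in> splx Xs (Suc 0)" "?w \<in> carrier (cval C (Suc 0) ?y)"
    using e(1) x csh_map_closed[OF C e(1) x v] by auto
  have vx: "vertex (Suc 0) j ?y = vertex n (e j) x" "cmap C 0 (Suc 0) (vertex_map j) ?y ?w = cmap C 0 n (vertex_map (e j)) x v"
    if "j \<le> Suc 0" for j
    by (rule vertex_struct[OF e(1) that x], rule csh_vertex_comp[OF C e(1) that x v])
  show ?thesis
    using inc_edge[OF C y] vx[of 0] vx[of "Suc 0"] x v by (simp add: e(2,3) eta_def)
qed

lemma eta_vertex: "x \<in> splx Xs 0 \<Longrightarrow> v \<in> carrier (cval C 0 x) \<Longrightarrow> eta C 0 x v = inc C x v"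
  by (simp add: eta_def vertex_0 csh_vertex_0[OF C])

lemma eta_linear: "x \<in> splx Xs n \<Longrightarrow> eta C n x \<in> lin_maps F (cval C n x) (rspace (HC C))"
  by (rule lin_maps_cong[OF lin_maps_compose[OF csh_map_linear[OF C vertex_map_delta] inc_linear[OF C]] _ csh_module[OF C]])
     (simp_all add: eta_def)

lemma eta_closed: "x \<in> splx Xs n \<Longrightarrow> v \<in> carrier (cval C n x) \<Longrightarrow> eta C n x v \<in> carrier (rspace (HC C))"
  by (rule lin_maps_closed[OF eta_linear])

text \<open>\<open>f\<close> may send 0 to any vertex of the simplex; independence of the chosen
  vertex compensates.\<close>

lemma eta_struct:
  assumes f: "f \<in> delta_maps m n" and x: "x \<in> splx Xs n" and v: "v \<in> carrier (cval C n x)"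
  shows "eta C m (struct_map Xs m n f x) (cmap C m n f x v) = eta C n x v"
proof -
  have "f 0 \<le> n" using f by (auto simp: delta_maps_def)
  then show ?thesis
    using inc_vertex[OF struct_closed[OF f x] _ csh_map_closed[OF C f x v], of 0] inc_vertex[OF x _ v, of "f 0"]
      vertex_struct[OF f _ x, of 0] csh_vertex_comp[OF C f _ x v, of 0] by simp
qed

lemma eta_act:
  assumes g: "g \<in> carrier G" and x: "x \<in> splx Xs n" and v: "v \<in> carrier (cval C n x)"
  shows "eta C n (sact Xs n g x) (cact C n g x v) = ract (HC C) g (eta C n x v)"
proof -
  have v0: "cmap C 0 n (vertex_map 0) x v \<in> carrier (cval C 0 (vertex n 0 x))"
    by (rule csh_map_closed[OF C vertex_map_delta x v]) simp
  have "ract (HC C) g (eta C n x v) = inc C (sact Xs 0 g (vertex n 0 x)) (cact C 0 g (vertex n 0 x) (cmap C 0 n (vertex_map 0) x v))"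
    using inc_act[OF C g _ v0] x v by (simp add: eta_def)
  also have "\<dots> = eta C n (sact Xs n g x) (cact C n g x v)"
    using vertex_act[OF g x, of 0] csh_vertex_act[OF C g x _ v, of 0] perm_le[OF g x, of 0]
      inc_vertex[OF act_closed[OF g x] _ csh_act_closed[OF C g x v]] by simp
  finally show ?thesis by simp
qed

lemma eta_map: "eta C \<in> cosheaf_maps F G Xs C (trivial_cosheaf (HC C))"
proof (rule cosheaf_mapsI)
  show "eta C n \<in> extensional (splx Xs n)" "x \<in> splx Xs n \<Longrightarrow> eta C n x \<in> extensional (carrier (cval C n x))" for n x
    by (simp_all add: eta_def)
qed (simp_all add: eta_linear eta_struct eta_act)

end

lemma eta_natural:
  assumes C: "is_cosheaf C" and D: "is_cosheaf D" and \<psi>: "\<psi> \<in> cosheaf_maps F G Xs C D"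
    and x: "x \<in> splx Xs n" and v: "v \<in> carrier (cval C n x)"
  shows "eta D n x (\<psi> n x v) = hmap C \<psi> D (eta C n x v)"
proof -
  have v0: "cmap C 0 n (vertex_map 0) x v \<in> carrier (cval C 0 (vertex n 0 x))"
    by (rule csh_map_closed[OF C vertex_map_delta x v]) simp
  show ?thesis
    using x v cosheaf_map_closed[OF \<psi> x v] cosheaf_mapsD(4)[OF \<psi> vertex_map_delta x v, of 0] hmap_inc(3)[OF C D \<psi> _ v0]
    by (simp add: eta_def)
qed

text \<open>Determined by being the identity of \<open>V\<close> on the copy at each vertex.
  \<open>HC_lift\<close> gives existence of such a map, hence the choice, and the restriction makes
  it extensional.\<close>

definition eps :: "('f, 'u, 'g) rep \<Rightarrow> 'u \<Rightarrow> 'u" where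
  "eps V = (\<lambda>w\<in>carrier (rspace (HC (trivial_cosheaf V))).
     (SOME h. h \<in> lin_maps F (rspace (HC (trivial_cosheaf V))) (rspace V) \<and>
        (\<forall>x\<in>splx Xs 0. \<forall>v\<in>carrier (rspace V). h (inc (trivial_cosheaf V) x v) = v)) w)"

text \<open>All structure maps are inclusions in \<open>V\<close>, so the inclusions at the vertices
  agree along edges. For the whole of \<open>V\<close> the result is the counit; for an image
  cosheaf it is the left inverse that proves injectivity on homology.\<close>

lemma subcosheaf_eval:
  assumes V: "smooth_rep F G T V" and W: "\<And>n x. x \<in> splx Xs n \<Longrightarrow> W n x \<subseteq> carrier (rspace V)"
    and C: "is_cosheaf (subcosheaf V W)"
  obtains h where "h \<in> lin_maps F (rspace (HC (subcosheaf V W))) (rspace V)"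
    "\<And>x v. x \<in> splx Xs 0 \<Longrightarrow> v \<in> W 0 x \<Longrightarrow> h (inc (subcosheaf V W) x v) = v"
proof -
  have "(\<lambda>v. v) \<in> lin_maps F (cval (subcosheaf V W) 0 x) (rspace V)" if "x \<in> splx Xs 0" for x
    using W[OF that] by (auto simp: lin_maps_def subcosheaf_def)
  from HC_lift[OF C smooth_module[OF V] this] show ?thesis
    using that by (auto simp: subcosheaf_def)
qed

lemma eps_props:
  assumes V: "smooth_rep F G T V"
  shows "eps V \<in> lin_maps F (rspace (HC (trivial_cosheaf V))) (rspace V)"
    and "x \<in> splx Xs 0 \<Longrightarrow> v \<in> carrier (rspace V) \<Longrightarrow> eps V (inc (trivial_cosheaf V) x v) = v"
    and "eps V \<in> rep_maps F G (HC (trivial_cosheaf V)) V"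
proof -
  note LV = is_cosheaf_trivial[OF V]
  obtain h where "h \<in> lin_maps F (rspace (HC (trivial_cosheaf V))) (rspace V)"
    "\<And>x v. x \<in> splx Xs 0 \<Longrightarrow> v \<in> carrier (rspace V) \<Longrightarrow> h (inc (trivial_cosheaf V) x v) = v"
    using subcosheaf_eval[OF V _ LV[unfolded trivial_subcosheaf]] unfolding trivial_subcosheaf by blast
  then have "\<exists>h. h \<in> lin_maps F (rspace (HC (trivial_cosheaf V))) (rspace V) \<and>
        (\<forall>x\<in>splx Xs 0. \<forall>v\<in>carrier (rspace V). h (inc (trivial_cosheaf V) x v) = v)" by blast
  note s = someI_ex[OF this]
  show lin: "eps V \<in> lin_maps F (rspace (HC (trivial_cosheaf V))) (rspace V)"
    by (rule lin_maps_cong[OF conjunct1[OF s] _ HC_module[OF LV]]) (simp add: eps_def)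
  show inc: "eps V (inc (trivial_cosheaf V) x v) = v" if "x \<in> splx Xs 0" "v \<in> carrier (rspace V)" for x v
    using s that inc_closed[OF LV that(1)] by (simp add: eps_def)
  show "eps V \<in> rep_maps F G (HC (trivial_cosheaf V)) V"
  proof (rule rep_mapsI[OF lin])
    show "eps V \<in> extensional (carrier (rspace (HC (trivial_cosheaf V))))" by (simp add: eps_def)
    show "eps V (ract (HC (trivial_cosheaf V)) g w) = ract V g (eps V w)"
      if g: "g \<in> carrier G" and w: "w \<in> carrier (rspace (HC (trivial_cosheaf V)))" for g w
      by (rule rep_maps_lin_eqI[OF LV smooth_module[OF V] lin_maps_compose[OF ract_HC_linear[OF LV g] lin]
            lin_maps_compose[OF lin smooth_linear[OF V g]] _ w])
         (simp add: g inc inc_act[OF LV] smooth_closed[OF V])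
  qed
qed

definition unit_arr :: "('f, 'u, 'x, 'g) cosheaf \<Rightarrow> ('f, 'u, 'x, 'g) csh_arr" where
  "unit_arr C = (C, eta C, trivial_cosheaf (HC C))"

definition counit_arr :: "('f, 'u, 'g) rep \<Rightarrow> ('f, 'u, 'g) rep_arr" where
  "counit_arr V = (HC (trivial_cosheaf V), eps V, V)"

lemma restrict_chain_cong: "(\<And>n x. x \<in> splx Xs n \<Longrightarrow> f n x = g n x) \<Longrightarrow> (\<lambda>n. \<lambda>x\<in>splx Xs n. f n x) = (\<lambda>n. \<lambda>x\<in>splx Xs n. g n x)"
  by (auto simp: fun_eq_iff)

text \<open>Identities between maps out of homology are tested on \<open>inc\<close>, those between
  cosheaf maps pointwise.\<close>

lemma adjunction_HF_LF: "adjunction CK RK HF LF unit_arr counit_arr"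
proof unfold_locales
  show "is_functor CK RK HF" "is_functor RK CK LF" by (rule functor_HF, rule functor_LF)
  show "arrow CK (unit_arr C) C (omap LF (omap HF C))" if "C \<in> obj CK" for C
    using that by (simp add: arrow_Csh unit_arr_def eta_map is_cosheaf_trivial HC_smooth)
  show "arrow RK (counit_arr V) (omap HF (omap LF V)) V" if "V \<in> obj RK" for V
    using that by (simp add: arrow_Rep counit_arr_def eps_props(3) HC_smooth is_cosheaf_trivial)
  show "cmp CK (unit_arr D) f = cmp CK (amap LF (amap HF f)) (unit_arr C)" if "arrow CK f C D" for f C D
  proof -
    obtain \<psi> where f: "f = (C, \<psi>, D)" "is_cosheaf C" "is_cosheaf D" "\<psi> \<in> cosheaf_maps F G Xs C D"
      using \<open>arrow CK f C D\<close> by (auto simp: arrow_Csh)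
    show ?thesis
      by (auto simp: f(1) unit_arr_def compose_def eta_natural[OF f(2-4)] intro!: restrict_chain_cong restrict_ext)
  qed
  show "cmp RK (counit_arr W) (amap HF (amap LF f)) = cmp RK f (counit_arr V)" if "arrow RK f V W" for f V W
  proof -
    obtain f' where f: "f = (V, f', W)" "smooth_rep F G T V" "smooth_rep F G T W" "f' \<in> rep_maps F G V W"
      using \<open>arrow RK f V W\<close> by (auto simp: arrow_Rep)
    note LV = is_cosheaf_trivial[OF f(2)] and LW = is_cosheaf_trivial[OF f(3)] and f' = rep_mapsD(1)[OF f(4)]
    have Lf: "(\<lambda>n. \<lambda>x\<in>splx Xs n. f') \<in> cosheaf_maps F G Xs (trivial_cosheaf V) (trivial_cosheaf W)"
      using functor_arrow[OF functor_LF \<open>arrow RK f V W\<close>] by (simp add: arrow_Csh f(1))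
    have "eps W (hmap (trivial_cosheaf V) (\<lambda>n. \<lambda>x\<in>splx Xs n. f') (trivial_cosheaf W) w) = f' (eps V w)"
      if "w \<in> carrier (rspace (HC (trivial_cosheaf V)))" for w
      by (rule rep_maps_lin_eqI[OF LV smooth_module[OF f(3)] lin_maps_compose[OF hmap_inc(1)[OF LV LW Lf] eps_props(1)[OF f(3)]]
            lin_maps_compose[OF eps_props(1)[OF f(2)] f'] _ that])
         (simp add: hmap_inc(3)[OF LV LW Lf] eps_props(2)[OF f(2)] eps_props(2)[OF f(3)] lin_maps_closed[OF f'])
    then show ?thesis by (auto simp: f(1) counit_arr_def compose_def intro!: restrict_ext)
  qed
  show "cmp RK (counit_arr (omap HF C)) (amap HF (unit_arr C)) = ident RK (omap HF C)" if "C \<in> obj CK" for C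
  proof -
    have C: "is_cosheaf C" using that by simp
    note LH = is_cosheaf_trivial[OF HC_smooth[OF C]] and e = eps_props[OF HC_smooth[OF C]]
    interpret H: Module.module F "rspace (HC C)" by (rule HC_module[OF C])
    have id: "(\<lambda>w. w) \<in> lin_maps F (rspace (HC C)) (rspace (HC C))" by (rule lin_mapsI) auto
    have "eps (HC C) (hmap C (eta C) (trivial_cosheaf (HC C)) w) = w" if "w \<in> carrier (rspace (HC C))" for w
      by (rule rep_maps_lin_eqI[OF C HC_module[OF C] lin_maps_compose[OF hmap_inc(1)[OF C LH eta_map[OF C]] e(1)] id _ that])
         (simp add: hmap_inc(3)[OF C LH eta_map[OF C]] e(2) eta_closed[OF C], simp add: eta_vertex[OF C])
    then show ?thesis by (auto simp: unit_arr_def counit_arr_def compose_def intro!: restrict_ext)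
  qed
  show "cmp CK (amap LF (counit_arr V)) (unit_arr (omap LF V)) = ident CK (omap LF V)" if "V \<in> obj RK" for V
  proof -
    have V: "smooth_rep F G T V" using that by simp
    have "eps V (eta (trivial_cosheaf V) n x v) = v" if "x \<in> splx Xs n" "v \<in> carrier (rspace V)" for n x v
      using that eps_props(2)[OF V, of "vertex n 0 x" v] by (simp add: eta_def)
    then show ?thesis
      by (auto simp: unit_arr_def counit_arr_def compose_def intro!: restrict_chain_cong restrict_ext)
  qed
qed

end


section \<open>Left fractions for cosheaves\<close>

lemma submodule_image:
  assumes V: "Module.module F V" and W: "Module.module F W" and f: "f \<in> lin_maps F V W"
  shows "submodule (f ` carrier V) F W"
proof -
  interpret V: Module.module F V by (rule V)
  interpret W: Module.module F W by (rule W)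
  show ?thesis
  proof (rule W.submoduleI)
    show "f ` carrier V \<subseteq> carrier W" using lin_maps_closed[OF f] by auto
    show "\<zero>\<^bsub>W\<^esub> \<in> f ` carrier V" using lin_maps_zero[OF f V W] V.zero_closed by (metis imageI)
  qed (auto simp flip: lin_maps_uminus[OF f V W] lin_maps_add[OF f] lin_maps_smult[OF f])
qed

lemma submodule_zero: "submodule A F V \<Longrightarrow> \<zero>\<^bsub>V\<^esub> \<in> A"
  using subgroup.one_closed[OF submodule.axioms(1)] by fastforce

lemma submodule_set_add:
  assumes V: "Module.module F V" and A: "submodule A F V" and B: "submodule B F V"
  shows "submodule (A <+>\<^bsub>V\<^esub> B) F V"
proof -
  interpret V: Module.module F V by (rule V)
  note A' = V.submoduleE[OF A] and B' = V.submoduleE[OF B]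
  show ?thesis
  proof (rule V.submoduleI)
    show "A <+>\<^bsub>V\<^esub> B \<subseteq> carrier V" using A'(1) B'(1) by (auto simp: mem_set_add subset_iff)
    show "\<zero>\<^bsub>V\<^esub> \<in> A <+>\<^bsub>V\<^esub> B" using set_addI[OF submodule_zero[OF A] submodule_zero[OF B], where V = V] by simp
  next
    fix u assume "u \<in> A <+>\<^bsub>V\<^esub> B"
    then obtain a b where u: "a \<in> A" "b \<in> B" "u = a \<oplus>\<^bsub>V\<^esub> b" by (auto simp: mem_set_add)
    then have ab: "a \<in> carrier V" "b \<in> carrier V" using A'(1) B'(1) by auto
    show "\<ominus>\<^bsub>V\<^esub> u \<in> A <+>\<^bsub>V\<^esub> B"
      using set_addI[OF A'(3)[OF u(1)] B'(3)[OF u(2)], where V = V] ab by (simp add: u(3) V.minus_add)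
    show "k \<odot>\<^bsub>V\<^esub> u \<in> A <+>\<^bsub>V\<^esub> B" if "k \<in> carrier F" for k
      using set_addI[OF A'(4)[OF that u(1)] B'(4)[OF that u(2)], where V = V] ab that by (simp add: u(3) V.smult_r_distr)
    fix w assume "w \<in> A <+>\<^bsub>V\<^esub> B"
    then obtain c d where w: "c \<in> A" "d \<in> B" "w = c \<oplus>\<^bsub>V\<^esub> d" by (auto simp: mem_set_add)
    then have cd: "c \<in> carrier V" "d \<in> carrier V" using A'(1) B'(1) by auto
    have "(a \<oplus>\<^bsub>V\<^esub> b) \<oplus>\<^bsub>V\<^esub> (c \<oplus>\<^bsub>V\<^esub> d) = (a \<oplus>\<^bsub>V\<^esub> c) \<oplus>\<^bsub>V\<^esub> (b \<oplus>\<^bsub>V\<^esub> d)" using ab cd by (simp add: V.a_ac)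
    then show "u \<oplus>\<^bsub>V\<^esub> w \<in> A <+>\<^bsub>V\<^esub> B"
      using set_addI[OF A'(5)[OF u(1) w(1)] B'(5)[OF u(2) w(2)], where V = V] by (simp add: u(3) w(3))
  qed
qed

context simplicial_action
begin

text \<open>
  The cosheaf \<open>P\<close> is the image in the trivial cosheaf on \<open>HC Z\<close> of the pushout of \<open>Y\<close> and \<open>Z\<close> over \<open>Y'\<close>.
  The map from \<open>HC Z\<close> to \<open>HC P\<close> is injective because evaluation of \<open>P\<close> in \<open>HC Z\<close> is a left inverse,
  and surjective because \<open>Y'\<close> generates \<open>HC Y\<close>.
\<close>

lemma image_of_pushout:
  assumes Y': "is_cosheaf Y'" and Y: "is_cosheaf Y" and Z: "is_cosheaf Z"
    and s: "s \<in> cosheaf_maps F G Xs Y' Y" and u: "u \<in> cosheaf_maps F G Xs Y' Z"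
    and \<phi>: "\<phi> \<in> rep_maps F G (HC Y) (HC Z)"
    and \<phi>_s: "\<And>w. w \<in> carrier (rspace (HC Y')) \<Longrightarrow> \<phi> (hmap Y' s Y w) = hmap Y' u Z w"
    and s_surj: "carrier (rspace (HC Y)) \<subseteq> hmap Y' s Y ` carrier (rspace (HC Y'))"
  obtains P u' where "is_cosheaf P" "eta Z \<in> cosheaf_maps F G Xs Z P" "u' \<in> cosheaf_maps F G Xs Y P"
    "\<And>n x v. x \<in> splx Xs n \<Longrightarrow> v \<in> carrier (cval Y' n x) \<Longrightarrow> u' n x (s n x v) = eta Z n x (u n x v)"
    "bij_betw (hmap Z (eta Z) P) (carrier (rspace (HC Z))) (carrier (rspace (HC P)))"
proof -
  interpret H: Module.module F "rspace (HC Z)" by (rule HC_module[OF Z])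
  define A where "A n x = eta Z n x ` carrier (cval Z n x)" for n x
  define D where "D n x = (\<lambda>y. \<phi> (eta Y n x y)) ` carrier (cval Y n x)" for n x
  \<comment> \<open>A pushout is a quotient of the direct sum of \<open>Y\<close> and
    \<open>Z\<close>, so its image is the sum of the images of the two; the quotient itself is never
    formed.\<close>
  define W where "W n x = A n x <+>\<^bsub>rspace (HC Z)\<^esub> D n x" for n x
  define P where "P = subcosheaf (HC Z) W"
  define u' where "u' = (\<lambda>n. \<lambda>x\<in>splx Xs n. \<lambda>y\<in>carrier (cval Y n x). \<phi> (eta Y n x y))"
  note \<phi>_lin = rep_mapsD(1)[OF \<phi>]
  have linY: "(\<lambda>y. \<phi> (eta Y n x y)) \<in> lin_maps F (cval Y n x) (rspace (HC Z))" if "x \<in> splx Xs n" for n x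
    by (rule lin_maps_compose[OF eta_linear[OF Y that] \<phi>_lin])
  have A_sub: "submodule (A n x) F (rspace (HC Z))" and D_sub: "submodule (D n x) F (rspace (HC Z))" if "x \<in> splx Xs n" for n x
    unfolding A_def D_def
    using submodule_image[OF csh_module[OF Z that] HC_module[OF Z] eta_linear[OF Z that]]
      submodule_image[OF csh_module[OF Y that] HC_module[OF Z] linY[OF that]] by auto
  have W_sub: "submodule (W n x) F (rspace (HC Z))" if "x \<in> splx Xs n" for n x
    unfolding W_def by (rule submodule_set_add[OF HC_module[OF Z] A_sub[OF that] D_sub[OF that]])
  note WH = H.submoduleE(1)[OF W_sub]
  note AH = H.submoduleE(1)[OF A_sub] and DH = H.submoduleE(1)[OF D_sub]
  have A_W: "a \<in> W n x" if x: "x \<in> splx Xs n" and "a \<in> A n x" for n x a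
    using set_addI[OF that(2) submodule_zero[OF D_sub[OF x]], where V = "rspace (HC Z)"] AH[OF x] that(2)
    by (auto simp: W_def)
  have D_W: "a \<in> W n x" if x: "x \<in> splx Xs n" and "a \<in> D n x" for n x a
    using set_addI[OF submodule_zero[OF A_sub[OF x]] that(2), where V = "rspace (HC Z)"] DH[OF x] that(2)
    by (auto simp: W_def)
  have eta_W: "eta Z n x z \<in> W n x" if "x \<in> splx Xs n" "z \<in> carrier (cval Z n x)" for n x z
    using A_W[OF that(1)] that(2) by (simp add: A_def)
  have u_W: "\<phi> (eta Y n x y) \<in> W n x" if "x \<in> splx Xs n" "y \<in> carrier (cval Y n x)" for n x y
    using D_W[OF that(1)] that(2) by (simp add: D_def)
  have P: "is_cosheaf P"
    unfolding P_def
  proof (rule is_cosheaf_subcosheaf[OF HC_smooth[OF Z] W_sub])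
    fix m n f x assume f: "f \<in> delta_maps m n" and x: "x \<in> splx Xs n"
    have "A n x \<subseteq> A m (struct_map Xs m n f x)"
    proof
      fix a assume "a \<in> A n x"
      then obtain z where z: "z \<in> carrier (cval Z n x)" "a = eta Z n x z" by (auto simp: A_def)
      then show "a \<in> A m (struct_map Xs m n f x)"
        using imageI[OF csh_map_closed[OF Z f x z(1)], of "eta Z m (struct_map Xs m n f x)"] eta_struct[OF Z f x z(1)]
        by (simp add: A_def)
    qed
    moreover have "D n x \<subseteq> D m (struct_map Xs m n f x)"
    proof
      fix a assume "a \<in> D n x"
      then obtain y where y: "y \<in> carrier (cval Y n x)" "a = \<phi> (eta Y n x y)" by (auto simp: D_def)
      then show "a \<in> D m (struct_map Xs m n f x)"
        using imageI[OF csh_map_closed[OF Y f x y(1)], of "\<lambda>y. \<phi> (eta Y m (struct_map Xs m n f x) y)"] eta_struct[OF Y f x y(1)]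
        by (simp add: D_def)
    qed
    ultimately show "W n x \<subseteq> W m (struct_map Xs m n f x)"
      unfolding W_def set_add_def' by blast
  next
    fix n g x v assume g: "g \<in> carrier G" and x: "x \<in> splx Xs n" and v: "v \<in> W n x"
    then obtain z y where z: "z \<in> carrier (cval Z n x)" and y: "y \<in> carrier (cval Y n x)"
        and v: "v = eta Z n x z \<oplus>\<^bsub>rspace (HC Z)\<^esub> \<phi> (eta Y n x y)"
      by (auto simp: W_def A_def D_def mem_set_add)
    have "ract (HC Z) g v = ract (HC Z) g (eta Z n x z) \<oplus>\<^bsub>rspace (HC Z)\<^esub> ract (HC Z) g (\<phi> (eta Y n x y))"
      unfolding v by (rule lin_maps_add[OF ract_HC_linear[OF Z g] eta_closed[OF Z x z] lin_maps_closed[OF linY[OF x] y]])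
    also have "\<dots> = eta Z n (sact Xs n g x) (cact Z n g x z) \<oplus>\<^bsub>rspace (HC Z)\<^esub> \<phi> (eta Y n (sact Xs n g x) (cact Y n g x y))"
      using eta_act[OF Z g x z] eta_act[OF Y g x y] rep_mapsD(3)[OF \<phi> g eta_closed[OF Y x y]] by simp
    also have "\<dots> \<in> W n (sact Xs n g x)"
      unfolding W_def A_def D_def using csh_act_closed[OF Z g x z] csh_act_closed[OF Y g x y] by (intro set_addI) auto
    finally show "ract (HC Z) g v \<in> W n (sact Xs n g x)" .
  qed
  have P_simps: "carrier (cval P n x) = W n x" "\<And>u v. u \<oplus>\<^bsub>cval P n x\<^esub> v = u \<oplus>\<^bsub>rspace (HC Z)\<^esub> v"
    "\<And>k v. k \<odot>\<^bsub>cval P n x\<^esub> v = k \<odot>\<^bsub>rspace (HC Z)\<^esub> v" "cmap P m n f x v = v" "cact P n g x = ract (HC Z) g" for m n x f v g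
    by (simp_all add: P_def subcosheaf_def)
  have eta_P: "eta Z \<in> cosheaf_maps F G Xs Z P"
  proof (rule cosheaf_mapsI)
    fix n x assume x: "x \<in> splx Xs n"
    show "eta Z n x \<in> lin_maps F (cval Z n x) (cval P n x)"
      using x by (intro lin_mapsI) (simp_all add: P_simps eta_W lin_maps_add[OF eta_linear[OF Z]] lin_maps_smult[OF eta_linear[OF Z]])
  qed (simp_all add: cosheaf_mapsD(1,3)[OF eta_map[OF Z]] P_simps eta_struct[OF Z] eta_act[OF Z])
  have u'_P: "u' \<in> cosheaf_maps F G Xs Y P"
  proof (rule cosheaf_mapsI)
    fix n x assume x: "x \<in> splx Xs n"
    have "(\<lambda>y. \<phi> (eta Y n x y)) \<in> lin_maps F (cval Y n x) (cval P n x)"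
      using x by (intro lin_mapsI) (simp_all add: P_simps u_W lin_maps_add[OF linY] lin_maps_smult[OF linY])
    then show "u' n x \<in> lin_maps F (cval Y n x) (cval P n x)"
      by (rule lin_maps_cong) (simp_all add: u'_def x csh_module[OF Y])
  qed (simp_all add: u'_def P_simps csh_map_closed[OF Y] csh_act_closed[OF Y] eta_struct[OF Y] eta_act[OF Y]
        rep_mapsD(3)[OF \<phi>] eta_closed[OF Y])
  have comm: "u' n x (s n x v) = eta Z n x (u n x v)" if x: "x \<in> splx Xs n" and v: "v \<in> carrier (cval Y' n x)" for n x v
    using x cosheaf_map_closed[OF s x v] eta_natural[OF Y' Y s x v] eta_natural[OF Y' Z u x v] \<phi>_s[OF eta_closed[OF Y' x v]]
    by (simp add: u'_def)
  note h\<eta> = hmap_inc[OF Z P eta_P] and hu' = hmap_inc[OF Y P u'_P]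
  note h_s = hmap_inc[OF Y' Y s] and h_u = hmap_inc[OF Y' Z u]
  have "hmap Y u' P (hmap Y' s Y w) = hmap Z (eta Z) P (hmap Y' u Z w)" if "w \<in> carrier (rspace (HC Y'))" for w
    by (rule rep_maps_lin_eqI[OF Y' HC_module[OF P] lin_maps_compose[OF h_s(1) hu'(1)] lin_maps_compose[OF h_u(1) h\<eta>(1)] _ that])
       (simp add: h_s(3) h_u(3) hu'(3) h\<eta>(3) cosheaf_map_closed[OF s] cosheaf_map_closed[OF u] comm)
  \<comment> \<open>Every vector of \<open>HC Y\<close> comes from \<open>HC Y'\<close>, where the
    two ways into \<open>HC P\<close> agree.\<close>
  then have u'_image: "hmap Y u' P w \<in> hmap Z (eta Z) P ` carrier (rspace (HC Z))" if "w \<in> carrier (rspace (HC Y))" for w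
    using s_surj that lin_maps_closed[OF h_u(1)] by fastforce
  have "w \<in> hmap Z (eta Z) P ` carrier (rspace (HC Z))" if "w \<in> carrier (rspace (HC P))" for w
    using that
  proof (induct rule: HC_induct[OF P, consumes 1, case_names zero add])
    case zero
    then show ?case by (rule submodule_zero[OF submodule_image[OF HC_module[OF Z] HC_module[OF P] h\<eta>(1)]])
  next
    case (add w x v)
    interpret HP: Module.module F "rspace (HC P)" by (rule HC_module[OF P])
    note sub = HP.submoduleE(5)[OF submodule_image[OF HC_module[OF Z] HC_module[OF P] h\<eta>(1)]]
    obtain z y where z: "z \<in> carrier (cval Z 0 x)" and y: "y \<in> carrier (cval Y 0 x)"
        and v: "v = eta Z 0 x z \<oplus>\<^bsub>cval P 0 x\<^esub> u' 0 x y"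
      using add(3,4) by (auto simp: P_simps W_def A_def D_def mem_set_add u'_def)
    have "inc P x v = inc P x (eta Z 0 x z) \<oplus>\<^bsub>rspace (HC P)\<^esub> inc P x (u' 0 x y)"
      unfolding v by (rule lin_maps_add[OF inc_linear[OF P add(3)] cosheaf_map_closed[OF eta_P add(3) z] cosheaf_map_closed[OF u'_P add(3) y]])
    also have "\<dots> = hmap Z (eta Z) P (inc Z x z) \<oplus>\<^bsub>rspace (HC P)\<^esub> hmap Y u' P (inc Y x y)"
      using h\<eta>(3)[OF add(3) z] hu'(3)[OF add(3) y] by simp
    also have "\<dots> \<in> hmap Z (eta Z) P ` carrier (rspace (HC Z))"
      by (rule sub[OF imageI[OF inc_closed[OF Z add(3) z]] u'_image[OF inc_closed[OF Y add(3) y]]])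
    finally show ?case by (rule sub[OF add(2)])
  qed
  then have surj: "hmap Z (eta Z) P ` carrier (rspace (HC Z)) = carrier (rspace (HC P))"
    using lin_maps_closed[OF h\<eta>(1)] by blast
  obtain e where e: "e \<in> lin_maps F (rspace (HC P)) (rspace (HC Z))" "\<And>x v. x \<in> splx Xs 0 \<Longrightarrow> v \<in> W 0 x \<Longrightarrow> e (inc P x v) = v"
    using subcosheaf_eval[OF HC_smooth[OF Z] WH P[unfolded P_def]] unfolding P_def by blast
  have id: "(\<lambda>w. w) \<in> lin_maps F (rspace (HC Z)) (rspace (HC Z))" by (rule lin_mapsI) auto
  have "e (hmap Z (eta Z) P w) = w" if "w \<in> carrier (rspace (HC Z))" for w
    by (rule rep_maps_lin_eqI[OF Z HC_module[OF Z] lin_maps_compose[OF h\<eta>(1) e(1)] id _ that])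
       (simp add: h\<eta>(3) e(2) eta_W, simp add: eta_vertex[OF Z])
  then have "inj_on (hmap Z (eta Z) P) (carrier (rspace (HC Z)))"
    by (rule inj_on_inverseI)
  then show ?thesis
    using that[OF P eta_P u'_P comm] surj by (simp add: bij_betw_def)
qed

text \<open>Both conditions are instances of \<open>image_of_pushout\<close>: the given span for the
  first, a span of two identities for the second.\<close>

lemma left_fractions_HF: "left_fractions CK RK HF"
proof -
  interpret adjunction CK RK HF LF unit_arr counit_arr by (rule adjunction_HF_LF)
  show ?thesis
  proof unfold_locales
    fix s x y u z assume sS: "s \<in> S" and s: "arrow CK s x y" and u: "arrow CK u x z"
    obtain s' where s': "s = (x, s', y)" "is_cosheaf x" "is_cosheaf y" "s' \<in> cosheaf_maps F G Xs x y"
      using s by (auto simp: arrow_Csh)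
    obtain u' where u': "u = (x, u', z)" "is_cosheaf z" "u' \<in> cosheaf_maps F G Xs x z"
      using u by (auto simp: arrow_Csh)
    have Hs: "arrow RK (HC x, hmap x s' y, HC y) (HC x) (HC y)" and iso: "iso_arr RK (HC x, hmap x s' y, HC y)"
      using functor_arrow[OF func s] inverts[OF sS] by (simp_all add: s'(1))
    obtain i where i: "inv_arr RK (HC x, hmap x s' y, HC y) = (HC y, i, HC x)" "i \<in> rep_maps F G (HC y) (HC x)"
      using inv_arr(1)[OF iso Hs] by (auto simp: arrow_Rep)
    have "compose (carrier (rspace (HC x))) i (hmap x s' y) = (\<lambda>v\<in>carrier (rspace (HC x)). v)"
      and "compose (carrier (rspace (HC y))) (hmap x s' y) i = (\<lambda>v\<in>carrier (rspace (HC y)). v)"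
      using inv_arr(2,3)[OF iso Hs] by (simp_all add: i(1))
    then have i_s: "\<And>w. w \<in> carrier (rspace (HC x)) \<Longrightarrow> i (hmap x s' y w) = w"
      and s_i: "\<And>w. w \<in> carrier (rspace (HC y)) \<Longrightarrow> hmap x s' y (i w) = w"
      by (metis compose_eq restrict_apply')+
    note ic = lin_maps_closed[OF rep_mapsD(1)[OF i(2)]]
    \<comment> \<open>\<open>H u\<close> after the inverse of \<open>H s\<close>: the map that a
      completed square forces on homology, once \<open>HC z\<close> is identified with the homology
      of the new corner.\<close>
    define \<phi> where "\<phi> = compose (carrier (rspace (HC y))) (hmap x u' z) i"
    have "\<phi> \<in> rep_maps F G (HC y) (HC z)"
      unfolding \<phi>_def by (rule rep_maps_compose[OF HC_smooth[OF s'(3)] i(2) hmap_rep_map[OF s'(2) u'(2,3)]])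
    moreover have "\<phi> (hmap x s' y w) = hmap x u' z w" if "w \<in> carrier (rspace (HC x))" for w
      using i_s[OF that] lin_maps_closed[OF hmap_inc(1)[OF s'(2-4)] that] by (simp add: \<phi>_def compose_eq)
    moreover have "carrier (rspace (HC y)) \<subseteq> hmap x s' y ` carrier (rspace (HC x))"
      using s_i ic by (metis image_eqI subsetI)
    ultimately obtain P q where P: "is_cosheaf P" "eta z \<in> cosheaf_maps F G Xs z P" "q \<in> cosheaf_maps F G Xs y P"
        "\<And>n a v. a \<in> splx Xs n \<Longrightarrow> v \<in> carrier (cval x n a) \<Longrightarrow> q n a (s' n a v) = eta z n a (u' n a v)"
        "bij_betw (hmap z (eta z) P) (carrier (rspace (HC z))) (carrier (rspace (HC P)))"
      using image_of_pushout[OF s'(2,3) u'(2) s'(4) u'(3)] by metis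
    have a: "arrow CK (z, eta z, P) z P" "arrow CK (y, q, P) y P"
      using P u'(2) s'(3) by (auto simp: arrow_Csh)
    have "(z, eta z, P) \<in> S"
      using iso_RepI[OF _ P(5)] functor_arrow[OF func a(1)] by (simp add: S_iff[OF a(1)])
    moreover have "cmp CK (y, q, P) s = cmp CK (z, eta z, P) u"
      using P(4) by (auto simp: s'(1) u'(1) compose_def intro!: restrict_chain_cong restrict_ext)
    ultimately show "\<exists>w s' u'. s' \<in> S \<and> arrow CK s' z w \<and> arrow CK u' y w \<and> cmp CK u' s = cmp CK s' u"
      using a by blast
  next
    fix f x y g assume f: "arrow CK f x y" and g: "arrow CK g x y" and eq: "amap HF f = amap HF g"
    obtain f' where f': "f = (x, f', y)" "is_cosheaf x" "is_cosheaf y" "f' \<in> cosheaf_maps F G Xs x y"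
      using f by (auto simp: arrow_Csh)
    obtain g' where g': "g = (x, g', y)" "g' \<in> cosheaf_maps F G Xs x y"
      using g by (auto simp: arrow_Csh)
    let ?i = "\<lambda>n. \<lambda>a\<in>splx Xs n. \<lambda>v\<in>carrier (cval y n a). v"
    have i: "?i \<in> cosheaf_maps F G Xs y y"
      using arrow_ident[OF category_Csh, of y] f'(3) by (simp add: arrow_Csh)
    have hi: "hmap y ?i y = (\<lambda>w\<in>carrier (rspace (HC y)). w)"
      using functor_ident[OF func, of y] f'(3) by simp
    have ir: "hmap y ?i y \<in> rep_maps F G (HC y) (HC y)" by (rule hmap_rep_map[OF f'(3,3) i])
    have i1: "hmap y ?i y (hmap y ?i y w) = hmap y ?i y w" if "w \<in> carrier (rspace (HC y))" for w
      using that by (simp add: hi)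
    have i2: "carrier (rspace (HC y)) \<subseteq> hmap y ?i y ` carrier (rspace (HC y))"
      by (auto simp: hi)
    \<comment> \<open>With identity legs \<open>P\<close> is the image of the unit of
      \<open>y\<close>. By naturality the unit after a cosheaf map depends on the induced map on
      homology alone, so \<open>eta y\<close> equalizes \<open>f\<close> and
      \<open>g\<close>.\<close>
    obtain P q where P: "is_cosheaf P" "eta y \<in> cosheaf_maps F G Xs y P" "q \<in> cosheaf_maps F G Xs y P"
        "\<And>n a v. a \<in> splx Xs n \<Longrightarrow> v \<in> carrier (cval y n a) \<Longrightarrow> q n a (?i n a v) = eta y n a (?i n a v)"
        "bij_betw (hmap y (eta y) P) (carrier (rspace (HC y))) (carrier (rspace (HC P)))"
      by (rule image_of_pushout[OF f'(3,3,3) i i ir _ i2]) (erule i1, rule that)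
    have a: "arrow CK (y, eta y, P) y P" using P f'(3) by (auto simp: arrow_Csh)
    have "(y, eta y, P) \<in> S"
      using iso_RepI[OF _ P(5)] functor_arrow[OF func a] by (simp add: S_iff[OF a])
    moreover have "hmap x f' y = hmap x g' y" using eq by (simp add: f'(1) g'(1))
    then have "cmp CK (y, eta y, P) f = cmp CK (y, eta y, P) g"
      by (auto simp: f'(1) g'(1) compose_def eta_natural[OF f'(2-4)] eta_natural[OF f'(2,3) g'(2)]
          intro!: restrict_chain_cong restrict_ext)
    ultimately show "\<exists>w t. t \<in> S \<and> arrow CK t y w \<and> cmp CK t f = cmp CK t g"
      using a by blast
  qed
qed

end


section \<open>Connected realisations\<close>

lemma openin_quotient_space:
  "openin (quotient_space T q) U \<longleftrightarrow> U \<subseteq> q ` topspace T \<and> openin T {p \<in> topspace T. q p \<in> U}"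
proof -
  have "istopology (\<lambda>U. U \<subseteq> q ` topspace T \<and> openin T {p \<in> topspace T. q p \<in> U})"
    unfolding istopology_def
  proof (intro conjI allI impI)
    fix U V assume UV: "U \<subseteq> q ` topspace T \<and> openin T {p \<in> topspace T. q p \<in> U}"
      "V \<subseteq> q ` topspace T \<and> openin T {p \<in> topspace T. q p \<in> V}"
    have "{p \<in> topspace T. q p \<in> U \<inter> V} = {p \<in> topspace T. q p \<in> U} \<inter> {p \<in> topspace T. q p \<in> V}" by auto
    then show "openin T {p \<in> topspace T. q p \<in> U \<inter> V}" using UV by (simp add: openin_Int)
    show "U \<inter> V \<subseteq> q ` topspace T" using UV by auto
  next
    fix K assume K: "\<forall>U\<in>K. U \<subseteq> q ` topspace T \<and> openin T {p \<in> topspace T. q p \<in> U}"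
    have "{p \<in> topspace T. q p \<in> \<Union>K} = (\<Union>U\<in>K. {p \<in> topspace T. q p \<in> U})" by auto
    then show "openin T {p \<in> topspace T. q p \<in> \<Union>K}" using K by auto
    show "\<Union>K \<subseteq> q ` topspace T" using K by auto
  qed
  then show ?thesis by (simp add: quotient_space_def topology_inverse')
qed

lemma topspace_quotient_space: "topspace (quotient_space T q) = q ` topspace T"
proof
  show "topspace (quotient_space T q) \<subseteq> q ` topspace T"
    using openin_topspace[of "quotient_space T q"] unfolding openin_quotient_space by blast
  have "{p \<in> topspace T. q p \<in> q ` topspace T} = topspace T" by auto
  then have "openin (quotient_space T q) (q ` topspace T)"
    by (simp add: openin_quotient_space)
  then show "q ` topspace T \<subseteq> topspace (quotient_space T q)" by (rule openin_subset)
qed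

context simplicial_action
begin

definition edge :: "'x \<Rightarrow> 'x \<Rightarrow> bool" where
  "edge x y \<longleftrightarrow> (\<exists>e\<in>splx Xs (Suc 0). vertex (Suc 0) 0 e = x \<and> vertex (Suc 0) (Suc 0) e = y)"

text \<open>The edge used is the one that proves \<open>inc_vertex\<close>.\<close>

lemma vertices_edge_related:
  assumes x: "x \<in> splx Xs n" and i: "i \<le> n"
  shows "edge (vertex n 0 x) (vertex n i x)"
proof -
  define e where "e = (\<lambda>j\<in>{..Suc 0}. if j = 0 then 0 else i)"
  have e: "e \<in> delta_maps (Suc 0) n" "e 0 = 0" "e (Suc 0) = i"
    using i by (auto simp: e_def delta_maps_def mono_on_def)
  show ?thesis
    unfolding edge_def
    using vertex_struct[OF e(1) _ x, of 0] vertex_struct[OF e(1) _ x, of "Suc 0"] struct_closed[OF e(1) x]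
    by (intro bexI[of _ "struct_map Xs (Suc 0) n e x"]) (simp_all add: e(2,3))
qed

text \<open>When points are glued, the vertex 0 of the simplex that carries them changes only along
  an edge. So being joined to \<open>a\<close> by edges is well defined on the realisation and
  splits it into two open sets.\<close>

lemma connected_vertices:
  assumes conn: "connected_realization Xs"
  shows "splx Xs 0 \<noteq> {}" and "a \<in> splx Xs 0 \<Longrightarrow> b \<in> splx Xs 0 \<Longrightarrow> equivclp edge a b"
proof -
  define simplex_top where "simplex_top = (\<lambda>(n :: nat, x :: 'x). subtopology (powertop_real UNIV) (standard_simplex n))"
  define ST where "ST = sum_topology simplex_top (SIGMA n:UNIV. splx Xs n)"
  define q where "q p = {r. equivclp (glue Xs) p r}" for p
  have real: "realization Xs = quotient_space ST q"
    by (simp add: realization_def ST_def simplex_top_def q_def[abs_def])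
  have top_ST: "((n, x), t) \<in> topspace ST \<longleftrightarrow> x \<in> splx Xs n \<and> t \<in> standard_simplex n" for n x t
    by (simp add: ST_def simplex_top_def)
  show ne: "splx Xs 0 \<noteq> {}"
  proof -
    obtain p where "p \<in> topspace ST"
      using conn unfolding connected_realization_def real topspace_quotient_space by blast
    then obtain n x where "x \<in> splx Xs n" by (metis surj_pair top_ST)
    then have "vertex n 0 x \<in> splx Xs 0" by simp
    then show ?thesis by blast
  qed
  assume a: "a \<in> splx Xs 0" and b: "b \<in> splx Xs 0"
  \<comment> \<open>Whether the simplex that carries the point is joined to \<open>a\<close>; the
    coordinates \<open>t\<close> do not enter, which gives openness.\<close>
  define c where "c = (\<lambda>((n, x), t :: nat \<Rightarrow> real). equivclp edge a (vertex n 0 x))"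
  have glue: "c p = c r" if "glue Xs p r" for p r
    using that
  proof cases
    case (1 x n f m t)
    have "f 0 \<le> n" using 1(4) by (auto simp: delta_maps_def)
    then have "equivclp edge (vertex n 0 x) (vertex m 0 (struct_map Xs m n f x))"
      using vertices_edge_related[OF 1(3)] vertex_struct[OF 1(4) _ 1(3), of 0] by (simp add: r_into_equivclp)
    then show ?thesis
      unfolding 1(1,2) c_def by (auto intro: equivclp_trans equivclp_sym)
  qed
  have c_equiv: "c p = c r" if "equivclp (glue Xs) p r" for p r
    using that by (induction rule: equivclp_induct) (auto dest: glue)
  have c_q: "c p = c r" if "q p = q r" for p r
  proof -
    have "r \<in> q p" using that by (simp add: q_def)
    then show ?thesis using c_equiv by (simp add: q_def)
  qed
  \<comment> \<open>Before gluing the space is a disjoint union of simplices, so any condition on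
    the simplex alone is open.\<close>
  have slice: "openin ST {p \<in> topspace ST. P (fst p)}" for P
    unfolding ST_def openin_sum_topology
  proof (intro conjI ballI)
    fix i assume i: "i \<in> (SIGMA n:UNIV. splx Xs n)"
    show "openin (simplex_top i) {t. (i, t) \<in> {p \<in> topspace (sum_topology simplex_top (SIGMA n:UNIV. splx Xs n)). P (fst p)}}"
    proof (cases "P i")
      case True
      then have "{t. (i, t) \<in> {p \<in> topspace (sum_topology simplex_top (SIGMA n:UNIV. splx Xs n)). P (fst p)}} = topspace (simplex_top i)"
        using i by auto
      then show ?thesis by simp
    qed simp
  qed auto
  define U where "U P = q ` {p \<in> topspace ST. c p = P}" for P
  have U_iff: "q p \<in> U P \<longleftrightarrow> c p = P" if p: "p \<in> topspace ST" for p P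
  proof
    assume "q p \<in> U P"
    then obtain r where "q p = q r" "c r = P" unfolding U_def by blast
    then show "c p = P" using c_q by metis
  next
    assume "c p = P"
    then show "q p \<in> U P" unfolding U_def using p by blast
  qed
  have U_open: "openin (realization Xs) (U P)" for P
  proof -
    have "{p \<in> topspace ST. q p \<in> U P} = {p \<in> topspace ST. (\<lambda>(n, x). equivclp edge a (vertex n 0 x)) (fst p) = P}"
      by (rule Collect_cong) (use U_iff in \<open>simp add: c_def case_prod_unfold cong: conj_cong\<close>)
    then have "openin ST {p \<in> topspace ST. q p \<in> U P}" using slice by simp
    moreover have "U P \<subseteq> q ` topspace ST" unfolding U_def by blast
    ultimately show ?thesis unfolding real openin_quotient_space by blast
  qed
  have disjoint: "U True \<inter> U False = {}"
  proof (rule ccontr)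
    assume "U True \<inter> U False \<noteq> {}"
    then obtain p where "p \<in> topspace ST" "q p \<in> U True" "q p \<in> U False" unfolding U_def by blast
    then show False using U_iff by simp
  qed
  have cover: "topspace (realization Xs) \<subseteq> U True \<union> U False"
    unfolding real topspace_quotient_space U_def by auto
  have "connected_space (realization Xs)" using conn by (simp add: connected_realization_def)
  note nsep = this[unfolded connected_space_def]
  have "U True = {} \<or> U False = {}"
  proof (rule ccontr)
    assume "\<not> (U True = {} \<or> U False = {})"
    then have "openin (realization Xs) (U True) \<and> openin (realization Xs) (U False) \<and>
        topspace (realization Xs) \<subseteq> U True \<union> U False \<and> U True \<inter> U False = {} \<and> U True \<noteq> {} \<and> U False \<noteq> {}"
      using U_open disjoint cover by simp
    from nsep[THEN notE, OF exI, OF exI, OF this] show False .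
  qed
  moreover obtain t where t: "t \<in> standard_simplex 0"
    using nonempty_standard_simplex[of 0] by blast
  then have "q ((0, a), t) \<in> U True"
    using a top_ST[of 0 a t] by (simp add: U_iff c_def vertex_0)
  moreover have "q ((0, b), t) \<in> U (c ((0, b), t))"
    using b t top_ST[of 0 b t] by (simp add: U_iff)
  ultimately have "c ((0, b), t)" by (metis (full_types) empty_iff)
  then show "equivclp edge a b" using b by (simp add: c_def vertex_0)
qed

text \<open>\<open>inc\<close> at a fixed vertex \<open>a\<close> is inverse to
  \<open>eps V\<close>. It is onto because, by connectedness, \<open>inc\<close> takes the same
  values at every vertex.\<close>

lemma counit_iso:
  assumes conn: "connected_realization Xs" and V: "smooth_rep F G T V"
  shows "iso_arr RK (counit_arr V)"
proof -
  note LV = is_cosheaf_trivial[OF V]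
  interpret V: Module.module F "rspace V" by (rule smooth_module[OF V])
  obtain a where a: "a \<in> splx Xs 0" using connected_vertices(1)[OF conn] by blast
  have edge: "inc (trivial_cosheaf V) x v = inc (trivial_cosheaf V) y v" if "edge x y" "v \<in> carrier (rspace V)" for x y v
    using that inc_edge[OF LV] by (auto simp: edge_def)
  have inc: "inc (trivial_cosheaf V) b v = inc (trivial_cosheaf V) a v" if b: "b \<in> splx Xs 0" and v: "v \<in> carrier (rspace V)" for b v
    using connected_vertices(2)[OF conn a b] by (induction rule: equivclp_induct) (auto dest: edge[OF _ v])
  have onto: "\<exists>v\<in>carrier (rspace V). w = inc (trivial_cosheaf V) a v" if "w \<in> carrier (rspace (HC (trivial_cosheaf V)))" for w
    using that
  proof (induct rule: HC_induct[OF LV, consumes 1, case_names zero add])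
    case zero
    then show ?case
      using lin_maps_zero[OF inc_linear[OF LV a] csh_module[OF LV a] HC_module[OF LV]]
      by (intro bexI[of _ "\<zero>\<^bsub>rspace V\<^esub>"]) simp_all
  next
    case (add w x v)
    then obtain u where "u \<in> carrier (rspace V)" "w = inc (trivial_cosheaf V) a u" by blast
    then show ?case
      using lin_maps_add[OF inc_linear[OF LV a], of u v] inc[OF add(3)] add(4) by (intro bexI[of _ "u \<oplus>\<^bsub>rspace V\<^esub> v"]) simp_all
  qed
  have inv: "inc (trivial_cosheaf V) a (eps V w) = w" if "w \<in> carrier (rspace (HC (trivial_cosheaf V)))" for w
    using onto[OF that] eps_props(2)[OF V a] by auto
  have "bij_betw (eps V) (carrier (rspace (HC (trivial_cosheaf V)))) (carrier (rspace V))"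
    by (rule bij_betw_byWitness[of _ "inc (trivial_cosheaf V) a"])
       (use inv eps_props(2)[OF V a] inc_closed[OF LV a] lin_maps_closed[OF eps_props(1)[OF V]] in auto)
  then show ?thesis
    unfolding counit_arr_def using V eps_props(3)[OF V] HC_smooth[OF LV] by (intro iso_RepI) (auto simp: arrow_Rep)
qed

end


section \<open>Semisimplicity\<close>

lemma submodule_as_module: "Module.module F V \<Longrightarrow> submodule W F V \<Longrightarrow> Module.module F (V\<lparr>carrier := W\<rparr>)"
  by (rule submodule.submodule_is_module)

text \<open>In terms of this map from the external direct sum, an internal direct sum is a bijection
  and an independent family an injection.\<close>

definition sum_map :: "('f, 'u) module \<Rightarrow> 'u set set \<Rightarrow> ('u set \<Rightarrow> 'u) \<Rightarrow> 'u" where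
  "sum_map V \<W> = ds_lift \<W> (\<lambda>W. V\<lparr>carrier := W\<rparr>) V (\<lambda>W w. w)"

lemma sum_map_eq: "sum_map V \<W> c = finsum V c {W\<in>\<W>. c W \<noteq> \<zero>\<^bsub>V\<^esub>}"
  by (simp add: sum_map_def ds_lift_def)

definition indep_family :: "('f, 'u) module \<Rightarrow> 'u set set \<Rightarrow> bool" where
  "indep_family V \<W> \<longleftrightarrow> (\<forall>c\<in>carrier (direct_sum \<W> (\<lambda>W. V\<lparr>carrier := W\<rparr>)).
     sum_map V \<W> c = \<zero>\<^bsub>V\<^esub> \<longrightarrow> (\<forall>W\<in>\<W>. c W = \<zero>\<^bsub>V\<^esub>))"

context
  fixes F :: "'f ring" and V :: "('f, 'u) module" and \<W> :: "'u set set"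
  assumes V: "Module.module F V" and sub: "\<And>W. W \<in> \<W> \<Longrightarrow> submodule W F V"
begin

interpretation V: Module.module F V by (rule V)

lemma submodule_family: "module_family F \<W> (\<lambda>W. V\<lparr>carrier := W\<rparr>)"
  by (rule module_family.intro[OF V.R.is_cring submodule_as_module[OF V sub]])

interpretation fam: module_family F \<W> "\<lambda>W. V\<lparr>carrier := W\<rparr>" by (rule submodule_family)

lemma incl_linear: "W \<in> \<W> \<Longrightarrow> (\<lambda>w. w) \<in> lin_maps F (V\<lparr>carrier := W\<rparr>) V"
  using V.submoduleE(1)[OF sub] by (auto simp: lin_maps_def)

lemma sum_map_linear: "sum_map V \<W> \<in> lin_maps F fam.DS V"
  unfolding sum_map_def by (rule fam.ds_lift_linear[OF V incl_linear])

lemma internal_direct_sum_iff: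
  "internal_direct_sum V \<W> \<longleftrightarrow> (\<forall>v\<in>carrier V. \<exists>!c. c \<in> carrier fam.DS \<and> v = sum_map V \<W> c)"
  unfolding internal_direct_sum_def sum_map_eq by (simp add: direct_sum_def conj_assoc)

lemma indep_family_direct_sum:
  assumes indep: "indep_family V \<W>" and onto: "carrier V \<subseteq> sum_map V \<W> ` carrier fam.DS"
  shows "internal_direct_sum V \<W>"
  unfolding internal_direct_sum_iff
proof
  interpret DS: Module.module F fam.DS by (rule fam.module_DS)
  fix v assume "v \<in> carrier V"
  then obtain c where c: "c \<in> carrier fam.DS" "v = sum_map V \<W> c" using onto by auto
  show "\<exists>!c. c \<in> carrier fam.DS \<and> v = sum_map V \<W> c"
  proof (rule ex1I[of _ c])
    fix d assume d: "d \<in> carrier fam.DS \<and> v = sum_map V \<W> d"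
    let ?e = "d \<ominus>\<^bsub>fam.DS\<^esub> c"
    have e: "?e \<in> carrier fam.DS" using d c by simp
    have "sum_map V \<W> ?e = v \<ominus>\<^bsub>V\<^esub> v"
      using lin_maps_minus[OF sum_map_linear fam.module_DS V] d c by simp
    also have "\<dots> = \<zero>\<^bsub>V\<^esub>" using \<open>v \<in> carrier V\<close> by (simp add: a_minus_def V.r_neg)
    finally have "?e W = \<zero>\<^bsub>V\<^esub>" if "W \<in> \<W>" for W
      using indep e that unfolding indep_family_def by blast
    then have "?e = \<zero>\<^bsub>fam.DS\<^esub>"
      using e by (intro extensionalityI[of _ \<W>]) (auto simp: fam.carrier_DS fam.DS_simps)
    then show "d = c"
      using DS.minus_equality[of d "\<ominus>\<^bsub>fam.DS\<^esub> c"] d c(1) by (simp add: a_minus_def)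
  qed (use c in simp)
qed

end

text \<open>A relation involves finitely many submodules, and these lie in one member of the chain,
  where the relation is trivial.\<close>

lemma indep_family_Union_chain:
  fixes F :: "'f ring"
  assumes V: "Module.module F V" and chain: "subset.chain {\<W>. \<W> \<subseteq> \<W>0 \<and> indep_family V \<W>} \<C>" and ne: "\<C> \<noteq> {}"
    and sub: "\<And>W. W \<in> \<W>0 \<Longrightarrow> submodule W F V"
  shows "indep_family V (\<Union>\<C>)"
  unfolding indep_family_def
proof (intro ballI impI)
  have \<C>: "\<And>\<W>. \<W> \<in> \<C> \<Longrightarrow> \<W> \<subseteq> \<W>0 \<and> indep_family V \<W>" and lin: "\<And>\<W> \<W>'. \<W> \<in> \<C> \<Longrightarrow> \<W>' \<in> \<C> \<Longrightarrow> \<W> \<subseteq> \<W>' \<or> \<W>' \<subseteq> \<W>"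
    using chain unfolding subset_chain_def by blast+
  have fam: "module_family F \<W> (\<lambda>W. V\<lparr>carrier := W\<rparr>)" if "\<W> \<subseteq> \<W>0" for \<W>
    by (rule submodule_family[OF V sub]) (use that in blast)
  have U: "\<Union>\<C> \<subseteq> \<W>0" using \<C> by blast
  fix c W assume c: "c \<in> carrier (direct_sum (\<Union>\<C>) (\<lambda>W. V\<lparr>carrier := W\<rparr>))" and zero: "sum_map V (\<Union>\<C>) c = \<zero>\<^bsub>V\<^esub>"
    and W: "W \<in> \<Union>\<C>"
  note c' = c[unfolded module_family.carrier_DS[OF fam[OF U]]]
  let ?s = "{W \<in> \<Union>\<C>. c W \<noteq> \<zero>\<^bsub>V\<^esub>}"
  \<comment> \<open>\<open>W\<close> is added to the support so that the member found below contains
    it also when the coefficient at \<open>W\<close> is zero.\<close>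
  have fin: "finite (insert W ?s)" using c' by simp
  have "\<exists>\<W>\<in>\<C>. A \<subseteq> \<W>" if "finite A" "A \<subseteq> \<Union>\<C>" for A
    using that
  proof induction
    case empty
    then show ?case using ne by blast
  next
    case (insert a A)
    then obtain \<W> where \<W>: "\<W> \<in> \<C>" "A \<subseteq> \<W>" by auto
    obtain \<W>' where \<W>': "\<W>' \<in> \<C>" "a \<in> \<W>'" using insert.prems by auto
    from lin[OF \<W>(1) \<W>'(1)] show ?case
    proof
      assume "\<W> \<subseteq> \<W>'"
      then show ?thesis using \<W> \<W>' by (intro bexI[of _ \<W>']) auto
    next
      assume "\<W>' \<subseteq> \<W>"
      then show ?thesis using \<W> \<W>' by (intro bexI[of _ \<W>]) auto
    qed
  qed
  moreover have "insert W ?s \<subseteq> \<Union>\<C>" using W by auto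
  ultimately obtain \<W> where \<W>: "\<W> \<in> \<C>" "insert W ?s \<subseteq> \<W>" using fin by meson
  let ?d = "restrict c \<W>"
  have s: "{W \<in> \<W>. ?d W \<noteq> \<zero>\<^bsub>V\<^esub>} = ?s" using \<W> by auto
  have \<W>0: "\<W> \<subseteq> \<W>0" using \<C>[OF \<W>(1)] by blast
  have d: "?d \<in> carrier (direct_sum \<W> (\<lambda>W. V\<lparr>carrier := W\<rparr>))"
    unfolding module_family.carrier_DS[OF fam[OF \<W>0]] using c' s \<W>(1) by auto
  have cong: "finsum V ?d ?s = finsum V c ?s"
  proof -
    interpret V: Module.module F V by (rule V)
    have "c W \<in> carrier V" if "W \<in> \<Union>\<C>" for W
      using c' that U V.submoduleE(1)[OF sub] by fastforce
    then show ?thesis using \<W>(2) by (intro V.add.finprod_cong') auto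
  qed
  have "sum_map V \<W> ?d = \<zero>\<^bsub>V\<^esub>"
    using zero unfolding sum_map_eq s cong .
  with d have "?d W = \<zero>\<^bsub>V\<^esub>"
    using \<C>[OF \<W>(1)] \<W>(2) unfolding indep_family_def by blast
  then show "c W = \<zero>\<^bsub>V\<^esub>" using \<W>(2) by simp
qed

text \<open>In a relation the coefficient in \<open>A\<close> is the negative of a sum over
  \<open>\<W>\<close>, hence lies in the trivial intersection.\<close>

lemma indep_family_insert:
  fixes F :: "'f ring"
  assumes V: "Module.module F V" and sub: "\<And>W. W \<in> insert A \<W> \<Longrightarrow> submodule W F V" and indep: "indep_family V \<W>"
    and A: "A \<notin> \<W>" "A \<inter> sum_map V \<W> ` carrier (direct_sum \<W> (\<lambda>W. V\<lparr>carrier := W\<rparr>)) \<subseteq> {\<zero>\<^bsub>V\<^esub>}"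
  shows "indep_family V (insert A \<W>)"
  unfolding indep_family_def
proof (intro ballI impI)
  interpret V: Module.module F V by (rule V)
  have sub': "\<And>W. W \<in> \<W> \<Longrightarrow> submodule W F V" using sub by blast
  interpret fam: module_family F \<W> "\<lambda>W. V\<lparr>carrier := W\<rparr>" by (rule submodule_family[OF V sub'])
  interpret fam': module_family F "insert A \<W>" "\<lambda>W. V\<lparr>carrier := W\<rparr>" by (rule submodule_family[OF V sub])
  fix c W assume c: "c \<in> carrier fam'.DS" and zero: "sum_map V (insert A \<W>) c = \<zero>\<^bsub>V\<^esub>" and W: "W \<in> insert A \<W>"
  note c' = c[unfolded fam'.carrier_DS]
  let ?d = "restrict c \<W>"
  have cV: "c W \<in> carrier V" if "W \<in> insert A \<W>" for W
    using c' that V.submoduleE(1)[OF sub[OF that]] by auto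
  have fin: "finite {W \<in> \<W>. c W \<noteq> \<zero>\<^bsub>V\<^esub>}"
    by (rule finite_subset[of _ "{W \<in> insert A \<W>. c W \<noteq> \<zero>\<^bsub>V\<^esub>}"]) (use c' in auto)
  have s: "{W \<in> \<W>. ?d W \<noteq> \<zero>\<^bsub>V\<^esub>} = {W \<in> \<W>. c W \<noteq> \<zero>\<^bsub>V\<^esub>}" by auto
  have d: "?d \<in> carrier fam.DS"
    unfolding fam.carrier_DS using c' fin by (auto simp: s cong: conj_cong)
  have Ac: "c A \<in> A" using c' by auto
  have sd: "sum_map V \<W> ?d = finsum V c {W \<in> \<W>. c W \<noteq> \<zero>\<^bsub>V\<^esub>}"
    unfolding sum_map_eq s using cV by (intro V.add.finprod_cong') auto
  have sdV: "sum_map V \<W> ?d \<in> carrier V"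
    by (rule lin_maps_closed[OF sum_map_linear[OF V sub'] d])
  have "sum_map V (insert A \<W>) c = finsum V c (insert A {W \<in> \<W>. c W \<noteq> \<zero>\<^bsub>V\<^esub>})"
  proof -
    have "finsum V c {W \<in> insert A \<W>. c W \<noteq> \<zero>\<^bsub>V\<^esub>} = finsum V c (insert A {W \<in> \<W>. c W \<noteq> \<zero>\<^bsub>V\<^esub>})"
      using fin cV by (intro V.add.finprod_mono_neutral_cong_left) auto
    then show ?thesis unfolding sum_map_eq .
  qed
  also have "\<dots> = c A \<oplus>\<^bsub>V\<^esub> sum_map V \<W> ?d"
    unfolding sd using fin A(1) cV by (subst V.finsum_insert) auto
  finally have eq: "c A \<oplus>\<^bsub>V\<^esub> sum_map V \<W> ?d = \<zero>\<^bsub>V\<^esub>" using zero by simp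
  then have "\<ominus>\<^bsub>V\<^esub> sum_map V \<W> ?d = c A"
    using V.minus_equality sdV cV by blast
  moreover have "\<ominus>\<^bsub>V\<^esub> sum_map V \<W> ?d \<in> sum_map V \<W> ` carrier fam.DS"
    by (rule V.submoduleE(3)[OF submodule_image[OF fam.module_DS V sum_map_linear[OF V sub']] imageI[OF d]])
  ultimately have cA: "c A = \<zero>\<^bsub>V\<^esub>" using Ac A(2) by auto
  then have "sum_map V \<W> ?d = \<zero>\<^bsub>V\<^esub>" using eq sdV by simp
  then have "c W = \<zero>\<^bsub>V\<^esub>" if "W \<in> \<W>" for W
    using indep d that unfolding indep_family_def by force
  then show "c W = \<zero>\<^bsub>V\<^esub>" using W cA by auto
qed

text \<open>By Zorn there is a maximal independent subfamily. Its sum is stable, so a simple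
  submodule outside it meets it in zero and could be added. That the family spans is expressed by
  testing submodules, which spares a second notion of sum.\<close>

theorem sum_of_simples_direct:
  fixes F :: "'f ring"
  assumes V: "Module.module F V" and \<rho>: "\<And>a. a \<in> A \<Longrightarrow> \<rho> a \<in> lin_maps F V V"
    and simple: "\<And>W. W \<in> \<W>0 \<Longrightarrow> simple_submod F A V \<rho> W"
    and span: "\<And>U. submodule U F V \<Longrightarrow> (\<And>W. W \<in> \<W>0 \<Longrightarrow> W \<subseteq> U) \<Longrightarrow> carrier V \<subseteq> U"
  shows "\<exists>\<W>\<subseteq>\<W>0. internal_direct_sum V \<W>"
proof -
  interpret V: Module.module F V by (rule V)
  have sub: "submodule W F V" if "W \<in> \<W>0" for W
    using simple[OF that] by (simp add: simple_submod_def stable_submod_def)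
  let ?A = "{\<W>. \<W> \<subseteq> \<W>0 \<and> indep_family V \<W>}"
  have empty: "{} \<in> ?A" by (simp add: indep_family_def)
  have "\<exists>M\<in>?A. \<forall>N\<in>?A. M \<subseteq> N \<longrightarrow> N = M"
  proof (rule subset_Zorn_nonempty)
    show "?A \<noteq> {}" using empty by (rule ex_in_conv[THEN iffD1, OF exI])
    fix \<C> assume \<C>: "\<C> \<noteq> {}" "subset.chain ?A \<C>"
    then have "\<Union>\<C> \<subseteq> \<W>0" unfolding subset_chain_def by blast
    then show "\<Union>\<C> \<in> ?A" using indep_family_Union_chain[OF V \<C>(2,1) sub] by simp
  qed
  then obtain \<W> where M: "\<W> \<in> ?A" "\<forall>N\<in>?A. \<W> \<subseteq> N \<longrightarrow> N = \<W>"
    by (rule bexE)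
  have \<W>: "\<W> \<subseteq> \<W>0" "indep_family V \<W>" using M(1) by simp_all
  have max: "N = \<W>" if "N \<subseteq> \<W>0" "indep_family V N" "\<W> \<subseteq> N" for N
    using bspec[OF M(2), of N] that by simp
  have sub': "submodule W F V" if "W \<in> \<W>" for W using sub \<W>(1) that by blast
  interpret fam: module_family F \<W> "\<lambda>W. V\<lparr>carrier := W\<rparr>" by (rule submodule_family[OF V sub'])
  let ?U = "sum_map V \<W> ` carrier fam.DS"
  note lin = sum_map_linear[OF V sub']
  note U = submodule_image[OF fam.module_DS V lin]
  note UE = V.submoduleE[OF U]
  have W_U: "W \<subseteq> ?U" if W: "W \<in> \<W>" for W
  proof
    fix w assume w: "w \<in> W"
    then have eq: "sum_map V \<W> (ds_single \<W> (\<lambda>W. V\<lparr>carrier := W\<rparr>) W w) = w"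
      unfolding sum_map_def using fam.ds_lift_single[OF V incl_linear[OF V sub'] W] by simp
    have "ds_single \<W> (\<lambda>W. V\<lparr>carrier := W\<rparr>) W w \<in> carrier fam.DS"
      using w by (intro fam.single_closed[OF W]) simp
    from imageI[OF this, of "sum_map V \<W>"] show "w \<in> ?U" unfolding eq .
  qed
  \<comment> \<open>The sum is stable because each summand is. Its intersection with a simple
    \<open>W\<close> is then stable too, so simplicity of \<open>W\<close> applies to it.\<close>
  have stable: "\<rho> a v \<in> ?U" if a: "a \<in> A" and v: "v \<in> ?U" for a v
  proof -
    obtain c where c: "c \<in> carrier fam.DS" "v = sum_map V \<W> c" using v by auto
    from c(1) have "\<rho> a (sum_map V \<W> c) \<in> ?U"
    proof (induct rule: fam.DS_induct)
      case zero
      then show ?case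
        using lin_maps_zero[OF lin fam.module_DS V] lin_maps_zero[OF \<rho>[OF a] V V] submodule_zero[OF U] by simp
    next
      case (add d W w)
      have w: "w \<in> W" using add(4) by simp
      have s: "ds_single \<W> (\<lambda>W. V\<lparr>carrier := W\<rparr>) W w \<in> carrier fam.DS" using fam.single_closed[OF add(3,4)] .
      have "\<rho> a w \<in> W" using simple[of W] add(3) \<W>(1) a w unfolding simple_submod_def stable_submod_def by blast
      then have "\<rho> a w \<in> ?U" using W_U[OF add(3)] by blast
      moreover have "sum_map V \<W> (ds_single \<W> (\<lambda>W. V\<lparr>carrier := W\<rparr>) W w) = w"
        unfolding sum_map_def using fam.ds_lift_single[OF V incl_linear[OF V sub'] add(3)] w by simp
      moreover have "w \<in> carrier V" using V.submoduleE(1)[OF sub'[OF add(3)]] w by blast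
      ultimately show ?case
        using add(2) lin_maps_add[OF lin add(1) s] lin_maps_add[OF \<rho>[OF a] lin_maps_closed[OF lin add(1)]] UE(5) by simp
    qed
    then show ?thesis using c(2) by simp
  qed
  have onto: "carrier V \<subseteq> ?U"
  proof (rule span[OF U])
    fix W assume W: "W \<in> \<W>0"
    have \<rho>W: "\<rho> a w \<in> W" if "a \<in> A" "w \<in> W" for a w
      using simple[OF W] that by (simp add: simple_submod_def stable_submod_def)
    have minimal: "W' = {\<zero>\<^bsub>V\<^esub>} \<or> W' = W" if "stable_submod F A V \<rho> W'" "W' \<subseteq> W" for W'
      using simple[OF W] that by (simp add: simple_submod_def)
    have inter: "submodule (W \<inter> ?U) F V"
      using V.submoduleE[OF sub[OF W]] UE submodule_zero[OF U] submodule_zero[OF sub[OF W]]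
      by (intro V.submoduleI) auto
    have "stable_submod F A V \<rho> (W \<inter> ?U)"
      unfolding stable_submod_def
    proof (rule conjI[OF inter], intro ballI)
      fix a w assume a: "a \<in> A" and w: "w \<in> W \<inter> ?U"
      show "\<rho> a w \<in> W \<inter> ?U" by (rule IntI[OF \<rho>W[OF a IntD1[OF w]] stable[OF a IntD2[OF w]]])
    qed
    then have cases: "W \<inter> ?U = {\<zero>\<^bsub>V\<^esub>} \<or> W \<inter> ?U = W"
      using minimal by simp
    show "W \<subseteq> ?U"
    proof (rule ccontr)
      assume n: "\<not> W \<subseteq> ?U"
      then have i: "W \<inter> ?U \<subseteq> {\<zero>\<^bsub>V\<^esub>}" using cases by auto
      have nW: "W \<notin> \<W>" using W_U n by (rule contrapos_nn[rotated])
      have "indep_family V (insert W \<W>)"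
        by (rule indep_family_insert[OF V _ \<W>(2) nW i]) (use sub' sub[OF W] in auto)
      then have "insert W \<W> = \<W>" using max[of "insert W \<W>"] W \<W>(1) subset_insertI[of \<W> W] by simp
      then show False using nW by (metis insertI1)
    qed
  qed
  have "internal_direct_sum V \<W>"
    by (rule indep_family_direct_sum[OF V _ \<W>(2) onto]) (rule sub')
  then show ?thesis using \<W>(1) by blast
qed

section \<open>Images of stable and simple submodules\<close>

lemma stable_submodI:
  "submodule W F V \<Longrightarrow> (\<And>a w. a \<in> A \<Longrightarrow> w \<in> W \<Longrightarrow> \<rho> a w \<in> W) \<Longrightarrow> stable_submod F A V \<rho> W"
  by (simp add: stable_submod_def)

lemma stable_submodD:
  assumes "stable_submod F A V \<rho> W"
  shows "submodule W F V" "a \<in> A \<Longrightarrow> w \<in> W \<Longrightarrow> \<rho> a w \<in> W"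
  using assms by (simp_all add: stable_submod_def)

text \<open>Serves for kernels, for pulling back submodules of an image and, with \<open>A\<close>
  empty, for submodules without an action.\<close>

lemma stable_submod_preimage:
  assumes V: "Module.module F V" and W: "Module.module F W" and f: "f \<in> lin_maps F V W"
    and U: "stable_submod F A V \<rho> U" and U': "stable_submod F A W \<tau> U'"
    and eq: "\<And>a u. a \<in> A \<Longrightarrow> u \<in> U \<Longrightarrow> f (\<rho> a u) = \<tau> a (f u)"
  shows "stable_submod F A V \<rho> {u\<in>U. f u \<in> U'}"
proof (rule stable_submodI)
  interpret V: Module.module F V by (rule V)
  interpret W: Module.module F W by (rule W)
  note UE = V.submoduleE[OF stable_submodD(1)[OF U]] and UE' = W.submoduleE[OF stable_submodD(1)[OF U']]
  have c: "u \<in> carrier V" if "u \<in> U" for u using UE(1) that by blast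
  show "submodule {u\<in>U. f u \<in> U'} F V"
  proof (rule V.submoduleI)
    show "\<zero>\<^bsub>V\<^esub> \<in> {u\<in>U. f u \<in> U'}"
      using submodule_zero[OF stable_submodD(1)[OF U]] submodule_zero[OF stable_submodD(1)[OF U']]
        lin_maps_zero[OF f V W] by simp
  qed (use UE(1) in \<open>auto simp: c UE(3-5) UE'(3-5) lin_maps_uminus[OF f V W] lin_maps_add[OF f] lin_maps_smult[OF f]\<close>)
  show "\<rho> a w \<in> {u\<in>U. f u \<in> U'}" if "a \<in> A" "w \<in> {u\<in>U. f u \<in> U'}" for a w
    using that stable_submodD(2)[OF U] stable_submodD(2)[OF U'] eq by simp
qed

text \<open>Schur's lemma: the kernel on \<open>U\<close> is stable and not all of \<open>U\<close>,
  hence zero, and a stable submodule of the image is the image of its preimage.\<close>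

lemma simple_submod_image:
  assumes V: "Module.module F V" and W: "Module.module F W" and f: "f \<in> lin_maps F V W"
    and U: "simple_submod F A V \<rho> U" and \<tau>: "\<And>a. a \<in> A \<Longrightarrow> \<tau> a \<in> lin_maps F W W"
    and eq: "\<And>a u. a \<in> A \<Longrightarrow> u \<in> U \<Longrightarrow> f (\<rho> a u) = \<tau> a (f u)" and nonzero: "f ` U \<noteq> {\<zero>\<^bsub>W\<^esub>}"
  shows "inj_on f U" "simple_submod F A W \<tau> (f ` U)"
proof -
  interpret V: Module.module F V by (rule V)
  interpret W: Module.module F W by (rule W)
  have stU: "stable_submod F A V \<rho> U"
    and minimal: "\<And>U'. stable_submod F A V \<rho> U' \<Longrightarrow> U' \<subseteq> U \<Longrightarrow> U' = {\<zero>\<^bsub>V\<^esub>} \<or> U' = U"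
    using U by (simp_all add: simple_submod_def)
  note sU = stable_submodD(1)[OF stU] and UE = V.submoduleE[OF stable_submodD(1)[OF stU]]
  have zU: "\<zero>\<^bsub>V\<^esub> \<in> U" and f0: "f \<zero>\<^bsub>V\<^esub> = \<zero>\<^bsub>W\<^esub>"
    by (rule submodule_zero[OF sU], rule lin_maps_zero[OF f V W])
  have c: "u \<in> carrier V" if "u \<in> U" for u using UE(1) that by blast
  have z: "stable_submod F A W \<tau> {\<zero>\<^bsub>W\<^esub>}"
  proof (rule stable_submodI)
    show "submodule {\<zero>\<^bsub>W\<^esub>} F W" by (rule W.submoduleI) simp_all
    show "\<tau> a w \<in> {\<zero>\<^bsub>W\<^esub>}" if "a \<in> A" "w \<in> {\<zero>\<^bsub>W\<^esub>}" for a w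
      using lin_maps_zero[OF \<tau>[OF that(1)] W W] that(2) by simp
  qed
  have "stable_submod F A V \<rho> {u\<in>U. f u \<in> {\<zero>\<^bsub>W\<^esub>}}"
    by (rule stable_submod_preimage[where \<tau> = \<tau> and \<rho> = \<rho>, OF V W f stU z]) (rule eq)
  from minimal[OF this] have "{u\<in>U. f u \<in> {\<zero>\<^bsub>W\<^esub>}} = {\<zero>\<^bsub>V\<^esub>} \<or> {u\<in>U. f u \<in> {\<zero>\<^bsub>W\<^esub>}} = U" by simp
  moreover have "{u\<in>U. f u \<in> {\<zero>\<^bsub>W\<^esub>}} \<noteq> U"
  proof
    assume e: "{u\<in>U. f u \<in> {\<zero>\<^bsub>W\<^esub>}} = U"
    have "f u = \<zero>\<^bsub>W\<^esub>" if "u \<in> U" for u using subsetD[OF equalityD2[OF e] that] by simp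
    then have "f ` U = {\<zero>\<^bsub>W\<^esub>}" using zU by force
    then show False using nonzero by simp
  qed
  ultimately have ker: "{u\<in>U. f u \<in> {\<zero>\<^bsub>W\<^esub>}} = {\<zero>\<^bsub>V\<^esub>}" by simp
  show "inj_on f U"
  proof (rule inj_onI)
    fix u v assume u: "u \<in> U" and v: "v \<in> U" and e: "f u = f v"
    have "f (u \<ominus>\<^bsub>V\<^esub> v) = \<zero>\<^bsub>W\<^esub>"
      using lin_maps_minus[OF f V W c[OF u] c[OF v]] e lin_maps_closed[OF f c[OF v]] by (simp add: a_minus_def W.r_neg)
    moreover have "u \<ominus>\<^bsub>V\<^esub> v \<in> U" using UE(3)[OF v] UE(5)[OF u] by (simp add: a_minus_def)
    ultimately have "u \<ominus>\<^bsub>V\<^esub> v = \<zero>\<^bsub>V\<^esub>" using ker by blast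
    then show "u = v" using V.minus_equality[of u "\<ominus>\<^bsub>V\<^esub> v"] c[OF u] c[OF v] by (simp add: a_minus_def)
  qed
  have sub: "submodule (f ` U) F W"
  proof (rule W.submoduleI)
    show "f ` U \<subseteq> carrier W" using lin_maps_closed[OF f c] by auto
    show "\<zero>\<^bsub>W\<^esub> \<in> f ` U" using zU f0 by (metis imageI)
  qed (auto simp: c UE(3-5) simp flip: lin_maps_uminus[OF f V W c] lin_maps_add[OF f c c] lin_maps_smult[OF f _ c])
  have st: "stable_submod F A W \<tau> (f ` U)"
  proof (rule stable_submodI[OF sub])
    fix a w assume a: "a \<in> A" and "w \<in> f ` U"
    then obtain u where u: "u \<in> U" "w = f u" by blast
    then show "\<tau> a w \<in> f ` U" using eq[OF a u(1)] stable_submodD(2)[OF stU a u(1)] by (metis imageI)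
  qed
  show "simple_submod F A W \<tau> (f ` U)"
    unfolding simple_submod_def
  proof (intro conjI st nonzero allI impI)
    fix U' assume U': "stable_submod F A W \<tau> U'" "U' \<subseteq> f ` U"
    let ?P = "{u\<in>U. f u \<in> U'}"
    have im: "f ` ?P = U'" using U'(2) by auto
    have "stable_submod F A V \<rho> ?P" by (rule stable_submod_preimage[where \<tau> = \<tau> and \<rho> = \<rho>, OF V W f stU U'(1)]) (rule eq)
    from minimal[OF this] have "?P = {\<zero>\<^bsub>V\<^esub>} \<or> ?P = U" by simp
    then show "U' = {\<zero>\<^bsub>W\<^esub>} \<or> U' = f ` U"
    proof
      assume "?P = {\<zero>\<^bsub>V\<^esub>}"
      then show ?thesis using im f0 by (metis image_empty image_insert)
    next
      assume "?P = U"
      then show ?thesis using im by metis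
    qed
  qed
qed

text \<open>\<open>\<theta>\<close> is an isomorphism onto \<open>W\<close> from the simple module
  given by \<open>chi\<close>. The conditions are those inside
  \<open>A_semisimple_with_character\<close>, named so that they can be transported.\<close>

definition character_line ::
    "'f ring \<Rightarrow> 'g set \<Rightarrow> 'e ring \<Rightarrow> ('f \<Rightarrow> 'e) \<Rightarrow> ('g \<Rightarrow> 'e) \<Rightarrow>
     ('f, 'u) module \<Rightarrow> ('g \<Rightarrow> 'u \<Rightarrow> 'u) \<Rightarrow> 'u set \<Rightarrow> ('e \<Rightarrow> 'u) \<Rightarrow> bool" where
  "character_line F A E \<iota> chi V \<rho> W \<theta> \<longleftrightarrow> bij_betw \<theta> (carrier E) W \<and>
     (\<forall>x\<in>carrier E. \<forall>y\<in>carrier E. \<theta> (x \<oplus>\<^bsub>E\<^esub> y) = \<theta> x \<oplus>\<^bsub>V\<^esub> \<theta> y) \<and>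
     (\<forall>k\<in>carrier F. \<forall>x\<in>carrier E. \<theta> (\<iota> k \<otimes>\<^bsub>E\<^esub> x) = k \<odot>\<^bsub>V\<^esub> \<theta> x) \<and>
     (\<forall>a\<in>A. \<forall>x\<in>carrier E. \<theta> (chi a \<otimes>\<^bsub>E\<^esub> x) = \<rho> a (\<theta> x))"

lemma A_semisimple_with_character_iff:
  "A_semisimple_with_character F A E \<iota> chi V \<rho> \<longleftrightarrow> (\<exists>\<W>. internal_direct_sum V \<W> \<and>
     (\<forall>W\<in>\<W>. stable_submod F A V \<rho> W \<and> (\<exists>\<theta>. character_line F A E \<iota> chi V \<rho> W \<theta>)))"
  by (simp add: A_semisimple_with_character_def character_line_def)

text \<open>The scalars of \<open>E\<close> that preserve a stable subspace form a subring containing the generators.\<close>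

lemma character_line_simple:
  assumes chi: "irr_character F G A E \<iota> chi" and V: "Module.module F V"
    and stW: "stable_submod F A V \<rho> W" and line: "character_line F A E \<iota> chi V \<rho> W \<theta>"
  shows "simple_submod F A V \<rho> W"
proof -
  interpret V: Module.module F V by (rule V)
  interpret E: field E using chi by (simp add: irr_character_def)
  have bij: "bij_betw \<theta> (carrier E) W"
    and add: "\<And>x y. x \<in> carrier E \<Longrightarrow> y \<in> carrier E \<Longrightarrow> \<theta> (x \<oplus>\<^bsub>E\<^esub> y) = \<theta> x \<oplus>\<^bsub>V\<^esub> \<theta> y"
    and smult: "\<And>k x. k \<in> carrier F \<Longrightarrow> x \<in> carrier E \<Longrightarrow> \<theta> (\<iota> k \<otimes>\<^bsub>E\<^esub> x) = k \<odot>\<^bsub>V\<^esub> \<theta> x"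
    and act: "\<And>a x. a \<in> A \<Longrightarrow> x \<in> carrier E \<Longrightarrow> \<theta> (chi a \<otimes>\<^bsub>E\<^esub> x) = \<rho> a (\<theta> x)"
    using line by (simp_all add: character_line_def)
  have \<theta>W: "\<theta> x \<in> W" if "x \<in> carrier E" for x using bij_betwE[OF bij] that by blast
  have \<theta>V: "\<theta> x \<in> carrier V" if "x \<in> carrier E" for x
    using V.submoduleE(1)[OF stable_submodD(1)[OF stW]] \<theta>W[OF that] by blast
  have \<theta>0: "\<theta> \<zero>\<^bsub>E\<^esub> = \<zero>\<^bsub>V\<^esub>"
    using add[OF E.zero_closed E.zero_closed] \<theta>V[OF E.zero_closed] by (simp add: V.add.r_cancel_one')
  have \<theta>m: "\<theta> (\<ominus>\<^bsub>E\<^esub> x) = \<ominus>\<^bsub>V\<^esub> \<theta> x" if x: "x \<in> carrier E" for x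
  proof -
    have "\<theta> (\<ominus>\<^bsub>E\<^esub> x) \<oplus>\<^bsub>V\<^esub> \<theta> x = \<zero>\<^bsub>V\<^esub>" using add[of "\<ominus>\<^bsub>E\<^esub> x" x] x \<theta>0 by (simp add: E.l_neg)
    from V.minus_equality[OF this] show ?thesis using \<theta>V x by simp
  qed
  have "chi a \<in> carrier E" if "a \<in> A" for a
    using chi that by (auto simp: irr_character_def hom_def units_of_def Pi_iff)
  then have gen: "\<iota> ` carrier F \<union> chi ` A \<subseteq> carrier E" "generate_ring E (\<iota> ` carrier F \<union> chi ` A) = carrier E"
    using chi ring_hom_closed[of \<iota> F E] by (auto simp: irr_character_def)
  show ?thesis
    unfolding simple_submod_def
  proof (intro conjI stW allI impI)
    show "W \<noteq> {\<zero>\<^bsub>V\<^esub>}"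
    proof
      assume "W = {\<zero>\<^bsub>V\<^esub>}"
      then have "\<theta> \<one>\<^bsub>E\<^esub> = \<theta> \<zero>\<^bsub>E\<^esub>" using \<theta>W[of "\<one>\<^bsub>E\<^esub>"] \<theta>0 by simp
      then show False using bij_betw_imp_inj_on[OF bij] by (simp add: inj_on_eq_iff)
    qed
    fix W' assume W': "stable_submod F A V \<rho> W'" "W' \<subseteq> W"
    note WE' = V.submoduleE[OF stable_submodD(1)[OF W'(1)]]
    show "W' = {\<zero>\<^bsub>V\<^esub>} \<or> W' = W"
    proof (cases "W' \<subseteq> {\<zero>\<^bsub>V\<^esub>}")
      case True
      then show ?thesis using submodule_zero[OF stable_submodD(1)[OF W'(1)]] by blast
    next
      case False
      then obtain w where w: "w \<in> W'" "w \<noteq> \<zero>\<^bsub>V\<^esub>" by blast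
      then obtain e where e: "e \<in> carrier E" "w = \<theta> e"
        using W'(2) bij_betw_imp_surj_on[OF bij] by blast
      then have unit: "e \<in> Units E" using w(2) \<theta>0 by (auto simp: E.field_Units)
      let ?R = "{r\<in>carrier E. \<forall>x\<in>carrier E. \<theta> x \<in> W' \<longrightarrow> \<theta> (r \<otimes>\<^bsub>E\<^esub> x) \<in> W'}"
      have sub: "subring ?R E"
        by (rule E.subringI)
           (auto simp: E.l_minus \<theta>m WE'(3) E.m_assoc E.l_distr add WE'(5))
      have gen_R: "\<iota> ` carrier F \<union> chi ` A \<subseteq> ?R"
        using gen(1) stable_submodD(2)[OF W'(1)] by (auto simp: smult act WE'(4))
      have R: "carrier E \<subseteq> ?R"
        using E.generate_ring_min_subring1[OF gen(1) sub gen_R] unfolding gen(2) .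
      have "W \<subseteq> W'"
      proof
        fix v assume "v \<in> W"
        then obtain y where y: "y \<in> carrier E" "v = \<theta> y" using bij_betw_imp_surj_on[OF bij] by blast
        \<comment> \<open>\<open>E\<close> is a field, so \<open>y\<close> is a multiple of
          \<open>e\<close>, and every scalar preserves \<open>W'\<close>.\<close>
        have y_eq: "y = (y \<otimes>\<^bsub>E\<^esub> inv\<^bsub>E\<^esub> e) \<otimes>\<^bsub>E\<^esub> e" using y(1) unit e(1) by (simp add: E.m_assoc)
        have "\<theta> ((y \<otimes>\<^bsub>E\<^esub> inv\<^bsub>E\<^esub> e) \<otimes>\<^bsub>E\<^esub> e) \<in> W'"
          using subsetD[OF R E.m_closed[OF y(1) E.Units_inv_closed[OF unit]]] e w(1) by simp
        then show "v \<in> W'" unfolding y(2) y_eq[symmetric] .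
      qed
      then show ?thesis using W'(2) by blast
    qed
  qed
qed

lemma character_line_image:
  assumes f: "f \<in> lin_maps F V W" and U: "U \<subseteq> carrier V" and inj: "inj_on f U"
    and eq: "\<And>a u. a \<in> A \<Longrightarrow> u \<in> U \<Longrightarrow> f (\<rho> a u) = \<tau> a (f u)"
    and line: "character_line F A E \<iota> chi V \<rho> U \<theta>"
  shows "character_line F A E \<iota> chi W \<tau> (f ` U) (f \<circ> \<theta>)"
proof -
  have bij: "bij_betw \<theta> (carrier E) U" using line by (simp add: character_line_def)
  have "\<theta> x \<in> U" "\<theta> x \<in> carrier V" if "x \<in> carrier E" for x using bij_betwE[OF bij] U that by auto
  moreover have "bij_betw (f \<circ> \<theta>) (carrier E) (f ` U)"
    by (rule bij_betw_trans[OF bij]) (simp add: bij_betw_imageI inj)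
  ultimately show ?thesis
    using line by (simp add: character_line_def lin_maps_add[OF f] lin_maps_smult[OF f] eq)
qed

lemma internal_direct_sum_subset:
  assumes V: "Module.module F V" and sum: "internal_direct_sum V \<W>" and U: "submodule U F V"
    and sub: "\<And>W. W \<in> \<W> \<Longrightarrow> W \<subseteq> U"
  shows "carrier V \<subseteq> U"
proof
  interpret V: Module.module F V by (rule V)
  note UE = V.submoduleE[OF U]
  fix v assume "v \<in> carrier V"
  then obtain c where c: "c \<in> (\<Pi>\<^sub>E W\<in>\<W>. W)" "finite {W\<in>\<W>. c W \<noteq> \<zero>\<^bsub>V\<^esub>}" "v = finsum V c {W\<in>\<W>. c W \<noteq> \<zero>\<^bsub>V\<^esub>}"
    using sum unfolding internal_direct_sum_def by blast
  have cU: "c W \<in> U" if "W \<in> \<W>" for W using c(1) sub that by (auto simp: PiE_iff)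
  have "finsum V c S \<in> U" if "finite S" "S \<subseteq> \<W>" for S
    using that
  proof (induct S)
    case empty
    then show ?case using submodule_zero[OF U] by simp
  next
    case (insert W S)
    then have "c W \<in> U" "c \<in> S \<rightarrow> carrier V" "c W \<in> carrier V" using cU UE(1) by auto
    then show ?case using insert UE(5) by simp
  qed
  then show "v \<in> U" using c(2,3) by simp
qed

section \<open>Semisimplicity of homology\<close>

context simplicial_action
begin

text \<open>The images in homology of the simple summands at the vertices are simple or zero, and
  together they span. The conclusion records from which summand each new one comes, so that a
  character can be carried along.\<close>

lemma HC_semisimple:
  assumes C: "is_cosheaf C" and A: "A \<subseteq> carrier G" "acts_trivially A Xs"
    and sum: "\<And>x. x \<in> splx Xs 0 \<Longrightarrow> internal_direct_sum (cval C 0 x) (\<W> x)"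
    and simple: "\<And>x W. x \<in> splx Xs 0 \<Longrightarrow> W \<in> \<W> x \<Longrightarrow> simple_submod F A (cval C 0 x) (\<lambda>a. cact C 0 a x) W"
  obtains \<W>' where "internal_direct_sum (rspace (HC C)) \<W>'"
    "\<And>W'. W' \<in> \<W>' \<Longrightarrow> \<exists>x\<in>splx Xs 0. \<exists>W\<in>\<W> x. W' = inc C x ` W \<and> inj_on (inc C x) W \<and>
       simple_submod F A (rspace (HC C)) (ract (HC C)) W'"
proof -
  note H = HC_module[OF C]
  interpret H: Module.module F "rspace (HC C)" by (rule H)
  have \<tau>: "ract (HC C) a \<in> lin_maps F (rspace (HC C)) (rspace (HC C))" if "a \<in> A" for a
    using ract_HC_linear[OF C] A(1) that by blast
  \<comment> \<open>Zero images are discarded, since the zero module is not simple.\<close>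
  let ?\<W> = "{W'. \<exists>x\<in>splx Xs 0. \<exists>W\<in>\<W> x. W' = inc C x ` W \<and> W' \<noteq> {\<zero>\<^bsub>rspace (HC C)\<^esub>}}"
  have image: "inj_on (inc C x) W" "simple_submod F A (rspace (HC C)) (ract (HC C)) (inc C x ` W)"
    if x: "x \<in> splx Xs 0" and W: "W \<in> \<W> x" and n: "inc C x ` W \<noteq> {\<zero>\<^bsub>rspace (HC C)\<^esub>}" for x W
  proof -
    interpret Cx: Module.module F "cval C 0 x" by (rule csh_module[OF C x])
    have "W \<subseteq> carrier (cval C 0 x)"
      using Cx.submoduleE(1) simple[OF x W] by (simp add: simple_submod_def stable_submod_def)
    \<comment> \<open>\<open>A\<close> fixes the vertices, so each \<open>a\<close> acts inside the
      value at \<open>x\<close>.\<close>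
    then have eq: "inc C x (cact C 0 a x w) = ract (HC C) a (inc C x w)" if "a \<in> A" "w \<in> W" for a w
      using inc_act[OF C subsetD[OF A(1) that(1)] x, of w] x A(2) that by (auto simp: acts_trivially_def)
    show "inj_on (inc C x) W" "simple_submod F A (rspace (HC C)) (ract (HC C)) (inc C x ` W)"
      by (rule simple_submod_image[where \<rho> = "\<lambda>a. cact C 0 a x" and f = "inc C x" and \<tau> = "ract (HC C)",
            OF csh_module[OF C x] H inc_linear[OF C x] simple[OF x W] \<tau> eq n]; assumption)+
  qed
  have "\<exists>\<W>'\<subseteq>?\<W>. internal_direct_sum (rspace (HC C)) \<W>'"
  proof (rule sum_of_simples_direct[where \<rho> = "ract (HC C)", OF H \<tau>])
    show "simple_submod F A (rspace (HC C)) (ract (HC C)) W" if "W \<in> ?\<W>" for W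
      using that image(2) by blast
    fix U assume U: "submodule U F (rspace (HC C))" and sub: "\<And>W. W \<in> ?\<W> \<Longrightarrow> W \<subseteq> U"
    note UE = H.submoduleE[OF U]
    have incU: "inc C x v \<in> U" if x: "x \<in> splx Xs 0" and v: "v \<in> carrier (cval C 0 x)" for x v
    proof -
      interpret Cx: Module.module F "cval C 0 x" by (rule csh_module[OF C x])
      \<comment> \<open>With the empty set of operators a stable submodule is just a
        submodule.\<close>
      have U': "submodule {v\<in>carrier (cval C 0 x). inc C x v \<in> U} F (cval C 0 x)"
        using stable_submodD(1)[OF stable_submod_preimage[where A = "{}", OF csh_module[OF C x] H inc_linear[OF C x]
          stable_submodI[OF Cx.carrier_is_submodule] stable_submodI[OF U]]] by simp
      have "carrier (cval C 0 x) \<subseteq> {v\<in>carrier (cval C 0 x). inc C x v \<in> U}"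
      proof (rule internal_direct_sum_subset[OF csh_module[OF C x] sum[OF x] U'])
        fix W assume W: "W \<in> \<W> x"
        have "W \<subseteq> carrier (cval C 0 x)"
          using Cx.submoduleE(1) simple[OF x W] by (simp add: simple_submod_def stable_submod_def)
        moreover have "inc C x ` W \<subseteq> U"
        proof (cases "inc C x ` W = {\<zero>\<^bsub>rspace (HC C)\<^esub>}")
          case True
          then show ?thesis using submodule_zero[OF U] by simp
        next
          case False
          then show ?thesis using sub x W by blast
        qed
        ultimately show "W \<subseteq> {v\<in>carrier (cval C 0 x). inc C x v \<in> U}" by blast
      qed
      then show ?thesis using v by blast
    qed
    show "carrier (rspace (HC C)) \<subseteq> U"
    proof
      fix w assume "w \<in> carrier (rspace (HC C))"
      then show "w \<in> U"
        by (induct rule: HC_induct[OF C, consumes 1, case_names zero add])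
           (auto intro: submodule_zero[OF U] UE(5) incU)
    qed
  qed
  then obtain \<W>' where \<W>': "\<W>' \<subseteq> ?\<W>" "internal_direct_sum (rspace (HC C)) \<W>'" by blast
  show thesis
  proof (rule that[OF \<W>'(2)])
    fix W' assume "W' \<in> \<W>'"
    then have "W' \<in> ?\<W>" by (rule subsetD[OF \<W>'(1)])
    then obtain x W where x: "x \<in> splx Xs 0" "W \<in> \<W> x" and W': "W' = inc C x ` W" "W' \<noteq> {\<zero>\<^bsub>rspace (HC C)\<^esub>}"
      by (elim CollectE bexE conjE) (rule that)
    show "\<exists>x\<in>splx Xs 0. \<exists>W\<in>\<W> x. W' = inc C x ` W \<and> inj_on (inc C x) W \<and>
       simple_submod F A (rspace (HC C)) (ract (HC C)) W'"
      using image[OF x W'(2)[unfolded W'(1)]] unfolding W'(1)[symmetric] by (intro bexI[OF _ x(1)] bexI[OF _ x(2)] conjI W'(1))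
  qed
qed

lemma HC_A_semisimple:
  assumes C: "is_cosheaf C" and A: "A \<subseteq> carrier G" "acts_trivially A Xs"
    and C': "valuewise Xs (A_semisimple F A) C"
  shows "A_semisimple F A (rspace (HC C)) (ract (HC C))"
proof -
  have "\<forall>x\<in>splx Xs 0. \<exists>\<W>. (\<forall>W\<in>\<W>. simple_submod F A (cval C 0 x) (\<lambda>a. cact C 0 a x) W) \<and>
      internal_direct_sum (cval C 0 x) \<W>"
    using C' by (simp add: valuewise_def A_semisimple_def)
  from bchoice[OF this] obtain \<W> where
    \<W>: "\<forall>x\<in>splx Xs 0. (\<forall>W\<in>\<W> x. simple_submod F A (cval C 0 x) (\<lambda>a. cact C 0 a x) W) \<and>
      internal_direct_sum (cval C 0 x) (\<W> x)" ..
  obtain \<W>' where "internal_direct_sum (rspace (HC C)) \<W>'"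
    "\<And>W'. W' \<in> \<W>' \<Longrightarrow> \<exists>x\<in>splx Xs 0. \<exists>W\<in>\<W> x. W' = inc C x ` W \<and> inj_on (inc C x) W \<and>
       simple_submod F A (rspace (HC C)) (ract (HC C)) W'"
    by (rule HC_semisimple[OF C A, of \<W>]) (use \<W> in auto)
  then show ?thesis unfolding A_semisimple_def by metis
qed

text \<open>The summands in the values are simple by \<open>character_line_simple\<close>; each
  summand of homology is an injective image of one of them and inherits its character.\<close>

lemma HC_A_semisimple_with_character:
  assumes C: "is_cosheaf C" and A: "A \<subseteq> carrier G" "acts_trivially A Xs"
    and chi: "irr_character F G A E \<iota> chi"
    and C': "valuewise Xs (A_semisimple_with_character F A E \<iota> chi) C"
  shows "A_semisimple_with_character F A E \<iota> chi (rspace (HC C)) (ract (HC C))"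
proof -
  let ?P = "\<lambda>x W. stable_submod F A (cval C 0 x) (\<lambda>a. cact C 0 a x) W \<and>
      (\<exists>\<theta>. character_line F A E \<iota> chi (cval C 0 x) (\<lambda>a. cact C 0 a x) W \<theta>)"
  have "\<forall>x\<in>splx Xs 0. \<exists>\<W>. internal_direct_sum (cval C 0 x) \<W> \<and> (\<forall>W\<in>\<W>. ?P x W)"
    using C' by (simp add: valuewise_def A_semisimple_with_character_iff)
  from bchoice[OF this] obtain \<W> where
    \<W>: "\<forall>x\<in>splx Xs 0. internal_direct_sum (cval C 0 x) (\<W> x) \<and> (\<forall>W\<in>\<W> x. ?P x W)" ..
  have simple: "simple_submod F A (cval C 0 x) (\<lambda>a. cact C 0 a x) W" if "x \<in> splx Xs 0" "W \<in> \<W> x" for x W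
    using character_line_simple[OF chi csh_module[OF C]] \<W> that by metis
  obtain \<W>' where \<W>': "internal_direct_sum (rspace (HC C)) \<W>'"
    "\<And>W'. W' \<in> \<W>' \<Longrightarrow> \<exists>x\<in>splx Xs 0. \<exists>W\<in>\<W> x. W' = inc C x ` W \<and> inj_on (inc C x) W \<and>
       simple_submod F A (rspace (HC C)) (ract (HC C)) W'"
    by (rule HC_semisimple[OF C A, of \<W>]) (use \<W> simple in auto)
  have "stable_submod F A (rspace (HC C)) (ract (HC C)) W' \<and>
      (\<exists>\<theta>. character_line F A E \<iota> chi (rspace (HC C)) (ract (HC C)) W' \<theta>)" if W': "W' \<in> \<W>'" for W'
  proof -
    obtain x W where x: "x \<in> splx Xs 0" "W \<in> \<W> x" "W' = inc C x ` W" "inj_on (inc C x) W"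
      "simple_submod F A (rspace (HC C)) (ract (HC C)) W'"
      using \<W>'(2)[OF W'] by blast
    interpret Cx: Module.module F "cval C 0 x" by (rule csh_module[OF C x(1)])
    obtain \<theta> where \<theta>: "character_line F A E \<iota> chi (cval C 0 x) (\<lambda>a. cact C 0 a x) W \<theta>"
      using \<W> x(1,2) by blast
    have W: "W \<subseteq> carrier (cval C 0 x)"
      using Cx.submoduleE(1) simple[OF x(1,2)] by (simp add: simple_submod_def stable_submod_def)
    then have "inc C x (cact C 0 a x w) = ract (HC C) a (inc C x w)" if "a \<in> A" "w \<in> W" for a w
      using inc_act[OF C subsetD[OF A(1) that(1)] x(1), of w] x(1) A(2) that by (auto simp: acts_trivially_def)
    from character_line_image[where f = "inc C x" and \<rho> = "\<lambda>a. cact C 0 a x" and \<tau> = "ract (HC C)", OF inc_linear[OF C x(1)] W x(4) this \<theta>]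
    show ?thesis using x(3,5) by (auto simp: simple_submod_def)
  qed
  then show ?thesis unfolding A_semisimple_with_character_iff using \<W>'(1) by blast
qed

end

theorem theorem4p7:
  fixes F :: "'f ring" and G :: "'g monoid" and T :: "'g topology" and A :: "'g set"
    and Xs :: "('g, 'x) gsset"
    and C :: "('f, 'u, 'x, 'g) csh_cat" and M :: "('f, 'u, 'g) rep_cat"
  assumes "field F"
    and "tdlc_group G T"
    and "subgroup A G" and "closedin T A"
    and "\<forall>a\<in>A. \<forall>g\<in>carrier G. a \<otimes>\<^bsub>G\<^esub> g = g \<otimes>\<^bsub>G\<^esub> a"
    and "simplicial_set Xs" and "sset_action G Xs" and "continuous_action G T Xs"
    and "acts_trivially A Xs"
    and "infinite (UNIV :: 'u set)" and "|splx Xs 0| \<le>o |UNIV :: 'u set|"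
    and "C = Csh F G T Xs" and "M = SmoothRep F G T"
  shows
    "let H = homology_functor G Xs; L = trivial_functor Xs;
         S = inverted_arrows C M H; Q = frac_functor C S; H' = frac_induced M H
     in
       left_calculus_of_fractions C S \<and>
       conservative (fractions C S) M H' \<and>
       (\<forall>(J :: ('j, 'k) cat) D c t. colimit (fractions C S) J D c t \<longrightarrow>
          colimit M J (H' \<circ>\<^sub>F D) (omap H' c) (\<lambda>j. amap H' (t j))) \<and>
       faithful (fractions C S) M H' \<and>
       (connected_realization Xs \<longrightarrow>
          equivalence_of_categories (fractions C S) M H' \<and>
          quasi_inverse (fractions C S) M H' (Q \<circ>\<^sub>F L) \<and>
          equivalence_restricts C S M H L
            (valuewise Xs (A_semisimple F A))
            (\<lambda>V. A_semisimple F A (rspace V) (ract V)) \<and>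
          (\<forall>(E :: 'e ring) \<iota> chi. irr_character F G A E \<iota> chi \<longrightarrow>
             equivalence_restricts C S M H L
               (valuewise Xs (A_semisimple_with_character F A E \<iota> chi))
               (\<lambda>V. A_semisimple_with_character F A E \<iota> chi (rspace V) (ract V))))"
proof -
  interpret simplicial_action G T F Xs "TYPE('u)"
    by (intro simplicial_action.intro tdlc.intro simplicial_action_axioms.intro assms)
  interpret adjunction CK RK HF LF unit_arr counit_arr by (rule adjunction_HF_LF)
  interpret left_fractions CK RK HF by (rule left_fractions_HF)
  have A: "A \<subseteq> carrier G" using assms(3) by (rule subgroup.subset)
  have obj: "obj CK = {Y. is_cosheaf Y}" "obj RK = {V. smooth_rep F G T V}"
    by (auto simp: Csh_def SmoothRep_def is_cosheaf_def)
  \<comment> \<open>A trivial cosheaf has the same value and the same action at every simplex, so a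
    condition on them passes from \<open>V\<close> to the cosheaf.\<close>
  have value_trivial: "valuewise Xs P (trivial_cosheaf V)" if "P (rspace V) (ract V)"
    for P and V :: "('f, 'u, 'g) rep"
    using that by (simp add: valuewise_def)
  have "equivalence_of_categories B RK HB \<and> quasi_inverse B RK HB (Q \<circ>\<^sub>F LF) \<and>
      equivalence_restricts CK S RK HF LF (valuewise Xs (A_semisimple F A)) (\<lambda>V. A_semisimple F A (rspace V) (ract V)) \<and>
      (\<forall>(E :: 'e ring) \<iota> chi. irr_character F G A E \<iota> chi \<longrightarrow>
         equivalence_restricts CK S RK HF LF (valuewise Xs (A_semisimple_with_character F A E \<iota> chi))
           (\<lambda>V. A_semisimple_with_character F A E \<iota> chi (rspace V) (ract V)))"
    if conn: "connected_realization Xs"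
  proof (intro conjI allI impI)
    have iso: "iso_arr RK (counit_arr V)" if "V \<in> obj RK" for V
      using counit_iso[OF conn] that by (simp add: obj)
    show "quasi_inverse B RK HB (Q \<circ>\<^sub>F LF)" by (rule quasi_inverse_induced[OF iso])
    then show "equivalence_of_categories B RK HB" unfolding equivalence_of_categories_def by (rule exI)
    show "equivalence_restricts CK S RK HF LF (valuewise Xs (A_semisimple F A)) (\<lambda>V. A_semisimple F A (rspace V) (ract V))"
      by (rule equivalence_restricts_full[OF iso])
         (simp_all add: obj HC_A_semisimple[OF _ A assms(9)] value_trivial)
    show "equivalence_restricts CK S RK HF LF (valuewise Xs (A_semisimple_with_character F A E \<iota> chi))
        (\<lambda>V. A_semisimple_with_character F A E \<iota> chi (rspace V) (ract V))"
      if chi: "irr_character F G A E \<iota> chi" for E :: "'e ring" and \<iota> chi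
      by (rule equivalence_restricts_full[OF iso])
         (simp_all add: obj HC_A_semisimple_with_character[OF _ A assms(9) chi] value_trivial)
  qed
  then show ?thesis
    unfolding assms(12,13) Let_def
    using left_calculus conservative_induced faithful_induced induced_preserves_colimits by blast
qed

end
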